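(* Let $G$ be a finite group and let $\omega\in H^3(G,k^\times)$. There is an exact sequence of groups $$Z(G)\xrightarrow{\;\beta\;}H^2(G,k^\times)\xrightarrow{\;\mathsf{ind}\;}I(G,\omega)\to\mathsf{OutStab}(\omega)\to 0 .$$
   Context: $k$ is an algebraically closed field of characteristic $0$. $\mathcal{C}(G,\omega)$ is the fusion category of finite dimensional $G$-graded $k$-vector spaces with associativity constraint given by (a 3-cocycle representing) $\omega$. $Z(G)$ is the center of $G$. For $a\in Z(G)$ put $\beta_a(x,y)=\dfrac{\omega(a,x,y)\,\omega(x,y,a)}{\omega(x,a,y)}$, $x,y\in G$; this is a 2-cocycle, and $\beta:Z(G)\to H^2(G,k^\times)$, $a\mapsto\beta_a$, is a group homomorphism. $\mathsf{Stab}(\omega)\subset\mathsf{Aut}(G)$ is the subgroup of automorphisms $a$ such that $\omega\circ(a\times a\times a)$ is cohomologous to $\omega$; it contains the group $\mathsf{Inn}(G)$ of inner automorphisms, and $\mathsf{OutStab}(\omega)=\mathsf{Stab}(\omega)/\mathsf{Inn}(G)$. $\mathsf{Aut}(\mathcal{A})$ is the group of isomorphism classes of tensor autoequivalences of a fusion category $\mathcal{A}$; $\mathsf{Aut}^{br}$ is the analogous group of braided tensor autoequivalences. Every tensor autoequivalence of $\mathcal{C}(G,\omega)$ is isomorphic to one of the form $F_{a,\mu}$, acting on simple objects by $a\in\mathsf{Stab}(\omega)$ with tensor structure given by a 2-cochain $\mu$ with $d\mu=\omega\circ(a\times a\times a)/\omega$; thus $H^2(G,k^\times)$ embeds in $\mathsf{Aut}(\mathcal{C}(G,\omega))$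 as $\mu\mapsto F_{\mathrm{id},\mu}$, with quotient $\mathsf{Stab}(\omega)$. $I(G,\omega)$ is the image of the induction homomorphism $\mathsf{ind}:\mathsf{Aut}(\mathcal{C}(G,\omega))\to\mathsf{Aut}^{br}(\mathcal{Z}(\mathcal{C}(G,\omega)))$, where for a fusion category $\mathcal{A}$ and $\alpha\in\mathsf{Aut}(\mathcal{A})$ with tensor structure $J_{X,Y}:\alpha(X)\otimes\alpha(Y)\xrightarrow{\sim}\alpha(X\otimes Y)$ one sets $\mathsf{ind}(\alpha)(Z,\gamma)=(\alpha(Z),\gamma^\alpha)$ on the Drinfeld center $\mathcal{Z}(\mathcal{A})$ (with half-braidings $\gamma_X:X\otimes Z\to Z\otimes X$), $\gamma^\alpha_X$ being the composition $X\otimes\alpha(Z)\cong\alpha(\alpha^{-1}(X))\otimes\alpha(Z)\xrightarrow{J}\alpha(\alpha^{-1}(X)\otimes Z)\xrightarrow{\alpha(\gamma_{\alpha^{-1}(X)})}\alpha(Z\otimes\alpha^{-1}(X))\xrightarrow{J^{-1}}\alpha(Z)\otimes\alpha(\alpha^{-1}(X))\cong\alpha(Z)\otimes X$. In the sequence, the second map is $\mu\mapsto\mathsf{ind}(F_{\mathrm{id},\mu})$ and the third is induced by $F_{a,\mu}\mapsto a\,\mathsf{Inn}(G)$. *)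

theory Defs
  imports
    "HOL-Algebra.Coset"
    "HOL-Algebra.Bij"
    "HOL-Computational_Algebra.Polynomial"
    "HOL-Library.Function_Algebras"
    "HOL-Library.Nat_Bijection"
begin

section \<open>Linear monoidal categories\<close>

text \<open>
  The associator is directed as \<open>X \<boxtimes> (Y \<boxtimes> Z) \<rightarrow> (X \<boxtimes> Y) \<boxtimes> Z\<close>. \<open>Plus\<close> is only meaningful on
  parallel arrows. The records carry the data; all predicates below relativise to \<open>Obj\<close> and \<open>Arr\<close>.
\<close>

record ('o, 'm, 'k) lin_moncat =
  Obj :: "'o set"
  Arr :: "'m set"
  Dom :: "'m \<Rightarrow> 'o"
  Cod :: "'m \<Rightarrow> 'o"
  Id :: "'o \<Rightarrow> 'm"
  Comp :: "'m \<Rightarrow> 'm \<Rightarrow> 'm" (infixl \<open>\<cdot>\<index>\<close> 60)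
  Plus :: "'m \<Rightarrow> 'm \<Rightarrow> 'm"
  Scale :: "'k \<Rightarrow> 'm \<Rightarrow> 'm"
  TenO :: "'o \<Rightarrow> 'o \<Rightarrow> 'o" (infixl \<open>\<boxtimes>\<index>\<close> 70)
  TenA :: "'m \<Rightarrow> 'm \<Rightarrow> 'm" (infixl \<open>\<boxdot>\<index>\<close> 70)
  UnitO :: "'o"
  Assoc :: "'o \<Rightarrow> 'o \<Rightarrow> 'o \<Rightarrow> 'm"
  LUnit :: "'o \<Rightarrow> 'm"
  RUnit :: "'o \<Rightarrow> 'm"

record ('o, 'm, 'k) lin_brcat = "('o, 'm, 'k) lin_moncat" +
  Braid :: "'o \<Rightarrow> 'o \<Rightarrow> 'm"

definition Hom :: "('o, 'm, 'k, 'z) lin_moncat_scheme \<Rightarrow> 'o \<Rightarrow> 'o \<Rightarrow> 'm set" where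
  "Hom C X Y = {f \<in> Arr C. Dom C f = X \<and> Cod C f = Y}"

definition is_inverse :: "('o, 'm, 'k, 'z) lin_moncat_scheme \<Rightarrow> 'm \<Rightarrow> 'm \<Rightarrow> bool" where
  "is_inverse C f g \<longleftrightarrow> f \<in> Arr C \<and> g \<in> Hom C (Cod C f) (Dom C f) \<and>
     g \<cdot>\<^bsub>C\<^esub> f = Id C (Dom C f) \<and> f \<cdot>\<^bsub>C\<^esub> g = Id C (Cod C f)"

definition is_iso :: "('o, 'm, 'k, 'z) lin_moncat_scheme \<Rightarrow> 'm \<Rightarrow> bool" where
  "is_iso C f \<longleftrightarrow> (\<exists>g. is_inverse C f g)"

definition Inv :: "('o, 'm, 'k, 'z) lin_moncat_scheme \<Rightarrow> 'm \<Rightarrow> 'm" where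
  "Inv C f = (THE g. is_inverse C f g)"

definition isomorphic :: "('o, 'm, 'k, 'z) lin_moncat_scheme \<Rightarrow> 'o \<Rightarrow> 'o \<Rightarrow> bool" where
  "isomorphic C X Y \<longleftrightarrow> (\<exists>f \<in> Hom C X Y. is_iso C f)"


section \<open>Functors, tensor functors and their isomorphisms\<close>

record ('o, 'm, 'p, 'n) fctr =
  FO :: "'o \<Rightarrow> 'p"
  FA :: "'m \<Rightarrow> 'n"

text \<open>\<open>FJ F X Y\<close> is the tensor structure \<open>F X \<boxtimes> F Y \<rightarrow> F (X \<boxtimes> Y)\<close>.\<close>

record ('o, 'm, 'p, 'n) tfctr = "('o, 'm, 'p, 'n) fctr" +
  FJ :: "'o \<Rightarrow> 'o \<Rightarrow> 'n"

definition is_functor ::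
  "('o, 'm, 'k, 'y) lin_moncat_scheme \<Rightarrow> ('p, 'n, 'k, 'z) lin_moncat_scheme \<Rightarrow>
   ('o, 'm, 'p, 'n, 'w) fctr_scheme \<Rightarrow> bool" where
  "is_functor C D F \<longleftrightarrow>
     (\<forall>X \<in> Obj C. FO F X \<in> Obj D) \<and>
     (\<forall>X \<in> Obj C. FA F (Id C X) = Id D (FO F X)) \<and>
     (\<forall>X \<in> Obj C. \<forall>Y \<in> Obj C. \<forall>f \<in> Hom C X Y. FA F f \<in> Hom D (FO F X) (FO F Y)) \<and>
     (\<forall>X \<in> Obj C. \<forall>Y \<in> Obj C. \<forall>Z \<in> Obj C. \<forall>f \<in> Hom C X Y. \<forall>g \<in> Hom C Y Z.
        FA F (g \<cdot>\<^bsub>C\<^esub> f) = FA F g \<cdot>\<^bsub>D\<^esub> FA F f)"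

definition is_linear_functor ::
  "('o, 'm, 'k, 'y) lin_moncat_scheme \<Rightarrow> ('p, 'n, 'k, 'z) lin_moncat_scheme \<Rightarrow>
   ('o, 'm, 'p, 'n, 'w) fctr_scheme \<Rightarrow> bool" where
  "is_linear_functor C D F \<longleftrightarrow> is_functor C D F \<and>
     (\<forall>X \<in> Obj C. \<forall>Y \<in> Obj C. \<forall>f \<in> Hom C X Y. \<forall>g \<in> Hom C X Y.
        FA F (Plus C f g) = Plus D (FA F f) (FA F g)) \<and>
     (\<forall>X \<in> Obj C. \<forall>Y \<in> Obj C. \<forall>f \<in> Hom C X Y. \<forall>c. FA F (Scale C c f) = Scale D c (FA F f))"

definition is_nat_iso ::
  "('o, 'm, 'k, 'y) lin_moncat_scheme \<Rightarrow> ('p, 'n, 'k, 'z) lin_moncat_scheme \<Rightarrow>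
   ('o, 'm, 'p, 'n, 'v) fctr_scheme \<Rightarrow> ('o, 'm, 'p, 'n, 'w) fctr_scheme \<Rightarrow> ('o \<Rightarrow> 'n) \<Rightarrow> bool" where
  "is_nat_iso C D F H \<eta> \<longleftrightarrow>
     (\<forall>X \<in> Obj C. \<eta> X \<in> Hom D (FO F X) (FO H X) \<and> is_iso D (\<eta> X)) \<and>
     (\<forall>X \<in> Obj C. \<forall>Y \<in> Obj C. \<forall>f \<in> Hom C X Y. \<eta> Y \<cdot>\<^bsub>D\<^esub> FA F f = FA H f \<cdot>\<^bsub>D\<^esub> \<eta> X)"

definition id_functor :: "('o, 'm, 'o, 'm) fctr" where
  "id_functor = \<lparr>FO = (\<lambda>X. X), FA = (\<lambda>f. f)\<rparr>"

definition comp_functor ::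
  "('p, 'n, 'q, 'l, 'v) fctr_scheme \<Rightarrow> ('o, 'm, 'p, 'n, 'w) fctr_scheme \<Rightarrow> ('o, 'm, 'q, 'l) fctr" where
  "comp_functor F H = \<lparr>FO = (\<lambda>X. FO F (FO H X)), FA = (\<lambda>f. FA F (FA H f))\<rparr>"

definition is_equivalence ::
  "('o, 'm, 'k, 'y) lin_moncat_scheme \<Rightarrow> ('p, 'n, 'k, 'z) lin_moncat_scheme \<Rightarrow>
   ('o, 'm, 'p, 'n, 'w) fctr_scheme \<Rightarrow> bool" where
  "is_equivalence C D F \<longleftrightarrow> is_functor C D F \<and>
     (\<exists>(K :: ('p, 'n, 'o, 'm) fctr) \<epsilon> \<eta>. is_functor D C K \<and>
        is_nat_iso D D (comp_functor F K) id_functor \<epsilon> \<and>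
        is_nat_iso C C (comp_functor K F) id_functor \<eta>)"

text \<open>
  A tensor functor is a pair of a linear functor and a tensor structure such that the unit object is
  preserved up to isomorphism; the unit constraint is then determined and is not part of the data.
\<close>

definition is_tensor_functor ::
  "('o, 'm, 'k, 'y) lin_moncat_scheme \<Rightarrow> ('p, 'n, 'k, 'z) lin_moncat_scheme \<Rightarrow>
   ('o, 'm, 'p, 'n, 'w) tfctr_scheme \<Rightarrow> bool" where
  "is_tensor_functor C D F \<longleftrightarrow> is_linear_functor C D F \<and>
     isomorphic D (FO F (UnitO C)) (UnitO D) \<and>
     (\<forall>X \<in> Obj C. \<forall>Y \<in> Obj C.
        FJ F X Y \<in> Hom D (FO F X \<boxtimes>\<^bsub>D\<^esub> FO F Y) (FO F (X \<boxtimes>\<^bsub>C\<^esub> Y)) \<and> is_iso D (FJ F X Y)) \<and>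
     (\<forall>X \<in> Obj C. \<forall>Y \<in> Obj C. \<forall>X' \<in> Obj C. \<forall>Y' \<in> Obj C. \<forall>f \<in> Hom C X X'. \<forall>g \<in> Hom C Y Y'.
        FJ F X' Y' \<cdot>\<^bsub>D\<^esub> (FA F f \<boxdot>\<^bsub>D\<^esub> FA F g) = FA F (f \<boxdot>\<^bsub>C\<^esub> g) \<cdot>\<^bsub>D\<^esub> FJ F X Y) \<and>
     (\<forall>X \<in> Obj C. \<forall>Y \<in> Obj C. \<forall>Z \<in> Obj C.
        FJ F (X \<boxtimes>\<^bsub>C\<^esub> Y) Z \<cdot>\<^bsub>D\<^esub> (FJ F X Y \<boxdot>\<^bsub>D\<^esub> Id D (FO F Z)) \<cdot>\<^bsub>D\<^esub> Assoc D (FO F X) (FO F Y) (FO F Z) =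
        FA F (Assoc C X Y Z) \<cdot>\<^bsub>D\<^esub> FJ F X (Y \<boxtimes>\<^bsub>C\<^esub> Z) \<cdot>\<^bsub>D\<^esub> (Id D (FO F X) \<boxdot>\<^bsub>D\<^esub> FJ F Y Z))"

definition tensor_functor_iso ::
  "('o, 'm, 'k, 'y) lin_moncat_scheme \<Rightarrow> ('p, 'n, 'k, 'z) lin_moncat_scheme \<Rightarrow>
   ('o, 'm, 'p, 'n, 'v) tfctr_scheme \<Rightarrow> ('o, 'm, 'p, 'n, 'w) tfctr_scheme \<Rightarrow> bool" where
  "tensor_functor_iso C D F H \<longleftrightarrow> (\<exists>\<eta>. is_nat_iso C D F H \<eta> \<and>
     (\<forall>X \<in> Obj C. \<forall>Y \<in> Obj C.
        \<eta> (X \<boxtimes>\<^bsub>C\<^esub> Y) \<cdot>\<^bsub>D\<^esub> FJ F X Y = FJ H X Y \<cdot>\<^bsub>D\<^esub> (\<eta> X \<boxdot>\<^bsub>D\<^esub> \<eta> Y)))"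

definition is_braided_functor ::
  "('o, 'm, 'k, 'y) lin_brcat_scheme \<Rightarrow> ('p, 'n, 'k, 'z) lin_brcat_scheme \<Rightarrow>
   ('o, 'm, 'p, 'n, 'w) tfctr_scheme \<Rightarrow> bool" where
  "is_braided_functor C D F \<longleftrightarrow> is_tensor_functor C D F \<and>
     (\<forall>X \<in> Obj C. \<forall>Y \<in> Obj C.
        FA F (Braid C X Y) \<cdot>\<^bsub>D\<^esub> FJ F X Y = FJ F Y X \<cdot>\<^bsub>D\<^esub> Braid D (FO F X) (FO F Y))"

definition id_tensor_functor :: "('o, 'm, 'k, 'z) lin_moncat_scheme \<Rightarrow> ('o, 'm, 'o, 'm) tfctr" where
  "id_tensor_functor C = \<lparr>FO = (\<lambda>X. X), FA = (\<lambda>f. f), FJ = (\<lambda>X Y. Id C (X \<boxtimes>\<^bsub>C\<^esub> Y))\<rparr>"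

definition comp_tensor_functor ::
  "('q, 'l, 'k, 'z) lin_moncat_scheme \<Rightarrow> ('p, 'n, 'q, 'l) tfctr \<Rightarrow> ('o, 'm, 'p, 'n) tfctr \<Rightarrow>
   ('o, 'm, 'q, 'l) tfctr" where
  "comp_tensor_functor E F H =
     \<lparr>FO = (\<lambda>X. FO F (FO H X)), FA = (\<lambda>f. FA F (FA H f)),
      FJ = (\<lambda>X Y. FA F (FJ H X Y) \<cdot>\<^bsub>E\<^esub> FJ F (FO H X) (FO H Y))\<rparr>"


section \<open>Groups of isomorphism classes of autoequivalences\<close>

definition quotient_group :: "'f set \<Rightarrow> ('f \<times> 'f) set \<Rightarrow> ('f \<Rightarrow> 'f \<Rightarrow> 'f) \<Rightarrow> 'f \<Rightarrow> 'f set monoid" where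
  "quotient_group S R f e =
     \<lparr>carrier = S // R, monoid.mult = (\<lambda>A B. \<Union>F\<in>A. \<Union>H\<in>B. R `` {f F H}), one = R `` {e}\<rparr>"

definition tensor_autoeqs :: "('o, 'm, 'k, 'z) lin_moncat_scheme \<Rightarrow> ('o, 'm, 'o, 'm) tfctr set" where
  "tensor_autoeqs C = {F. is_tensor_functor C C F \<and> is_equivalence C C F}"

definition braided_autoeqs :: "('o, 'm, 'k, 'z) lin_brcat_scheme \<Rightarrow> ('o, 'm, 'o, 'm) tfctr set" where
  "braided_autoeqs C = {F. is_braided_functor C C F \<and> is_equivalence C C F}"

definition tensor_iso_rel ::
  "('o, 'm, 'k, 'z) lin_moncat_scheme \<Rightarrow> (('o, 'm, 'o, 'm) tfctr \<times> ('o, 'm, 'o, 'm) tfctr) set" where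
  "tensor_iso_rel C = {(F, H). F \<in> tensor_autoeqs C \<and> H \<in> tensor_autoeqs C \<and> tensor_functor_iso C C F H}"

definition braided_iso_rel ::
  "('o, 'm, 'k, 'z) lin_brcat_scheme \<Rightarrow> (('o, 'm, 'o, 'm) tfctr \<times> ('o, 'm, 'o, 'm) tfctr) set" where
  "braided_iso_rel C = {(F, H). F \<in> braided_autoeqs C \<and> H \<in> braided_autoeqs C \<and> tensor_functor_iso C C F H}"

definition Aut_tensor :: "('o, 'm, 'k, 'z) lin_moncat_scheme \<Rightarrow> ('o, 'm, 'o, 'm) tfctr set monoid" where
  "Aut_tensor C =
     quotient_group (tensor_autoeqs C) (tensor_iso_rel C) (comp_tensor_functor C) (id_tensor_functor C)"

definition Aut_braided :: "('o, 'm, 'k, 'z) lin_brcat_scheme \<Rightarrow> ('o, 'm, 'o, 'm) tfctr set monoid" where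
  "Aut_braided C =
     quotient_group (braided_autoeqs C) (braided_iso_rel C) (comp_tensor_functor C) (id_tensor_functor C)"


section \<open>The Drinfeld center\<close>

text \<open>
  \<open>\<gamma> X : X \<boxtimes> Z \<rightarrow> Z \<boxtimes> X\<close>. Half-braidings are extensional functions on the objects.
\<close>

definition is_half_braiding :: "('o, 'm, 'k, 'z) lin_moncat_scheme \<Rightarrow> 'o \<Rightarrow> ('o \<Rightarrow> 'm) \<Rightarrow> bool" where
  "is_half_braiding C Z \<gamma> \<longleftrightarrow> \<gamma> \<in> extensional (Obj C) \<and>
     (\<forall>X \<in> Obj C. \<gamma> X \<in> Hom C (X \<boxtimes>\<^bsub>C\<^esub> Z) (Z \<boxtimes>\<^bsub>C\<^esub> X) \<and> is_iso C (\<gamma> X)) \<and>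
     (\<forall>X \<in> Obj C. \<forall>Y \<in> Obj C. \<forall>f \<in> Hom C X Y.
        \<gamma> Y \<cdot>\<^bsub>C\<^esub> (f \<boxdot>\<^bsub>C\<^esub> Id C Z) = (Id C Z \<boxdot>\<^bsub>C\<^esub> f) \<cdot>\<^bsub>C\<^esub> \<gamma> X) \<and>
     (\<forall>X \<in> Obj C. \<forall>Y \<in> Obj C.
        \<gamma> (X \<boxtimes>\<^bsub>C\<^esub> Y) =
          Inv C (Assoc C Z X Y) \<cdot>\<^bsub>C\<^esub> (\<gamma> X \<boxdot>\<^bsub>C\<^esub> Id C Y) \<cdot>\<^bsub>C\<^esub> Assoc C X Z Y \<cdot>\<^bsub>C\<^esub>
          (Id C X \<boxdot>\<^bsub>C\<^esub> \<gamma> Y) \<cdot>\<^bsub>C\<^esub> Inv C (Assoc C X Y Z))"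

type_synonym ('o, 'm) center_obj = "'o \<times> ('o \<Rightarrow> 'm)"
type_synonym ('o, 'm) center_arr = "('o, 'm) center_obj \<times> 'm \<times> ('o, 'm) center_obj"

definition center_objs :: "('o, 'm, 'k, 'z) lin_moncat_scheme \<Rightarrow> ('o, 'm) center_obj set" where
  "center_objs C = {(Z, \<gamma>). Z \<in> Obj C \<and> is_half_braiding C Z \<gamma>}"

text \<open>The arrows are recorded together with their source and target.\<close>

definition center_arrs :: "('o, 'm, 'k, 'z) lin_moncat_scheme \<Rightarrow> ('o, 'm) center_arr set" where
  "center_arrs C = {(P, f, Q). P \<in> center_objs C \<and> Q \<in> center_objs C \<and> f \<in> Hom C (fst P) (fst Q) \<and>
     (\<forall>X \<in> Obj C. (f \<boxdot>\<^bsub>C\<^esub> Id C X) \<cdot>\<^bsub>C\<^esub> snd P X = snd Q X \<cdot>\<^bsub>C\<^esub> (Id C X \<boxdot>\<^bsub>C\<^esub> f))}"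

definition center_ten ::
  "('o, 'm, 'k, 'z) lin_moncat_scheme \<Rightarrow> ('o, 'm) center_obj \<Rightarrow> ('o, 'm) center_obj \<Rightarrow> ('o, 'm) center_obj" where
  "center_ten C P Q = (fst P \<boxtimes>\<^bsub>C\<^esub> fst Q,
     (\<lambda>X \<in> Obj C. Assoc C (fst P) (fst Q) X \<cdot>\<^bsub>C\<^esub> (Id C (fst P) \<boxdot>\<^bsub>C\<^esub> snd Q X) \<cdot>\<^bsub>C\<^esub>
        Inv C (Assoc C (fst P) X (fst Q)) \<cdot>\<^bsub>C\<^esub> (snd P X \<boxdot>\<^bsub>C\<^esub> Id C (fst Q)) \<cdot>\<^bsub>C\<^esub> Assoc C X (fst P) (fst Q)))"

definition center_unit :: "('o, 'm, 'k, 'z) lin_moncat_scheme \<Rightarrow> ('o, 'm) center_obj" where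
  "center_unit C = (UnitO C, (\<lambda>X \<in> Obj C. Inv C (LUnit C X) \<cdot>\<^bsub>C\<^esub> RUnit C X))"

definition drinfeld_center ::
  "('o, 'm, 'k, 'z) lin_moncat_scheme \<Rightarrow> (('o, 'm) center_obj, ('o, 'm) center_arr, 'k) lin_brcat" where
  "drinfeld_center C =
     \<lparr>Obj = center_objs C,
      Arr = center_arrs C,
      Dom = (\<lambda>(P, f, Q). P),
      Cod = (\<lambda>(P, f, Q). Q),
      Id = (\<lambda>P. (P, Id C (fst P), P)),
      Comp = (\<lambda>(P', g, Q') (P, f, Q). (P, g \<cdot>\<^bsub>C\<^esub> f, Q')),
      Plus = (\<lambda>(P, f, Q) (P', g, Q'). (P, Plus C f g, Q)),
      Scale = (\<lambda>c (P, f, Q). (P, Scale C c f, Q)),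
      TenO = center_ten C,
      TenA = (\<lambda>(P, f, Q) (P', g, Q'). (center_ten C P P', f \<boxdot>\<^bsub>C\<^esub> g, center_ten C Q Q')),
      UnitO = center_unit C,
      Assoc = (\<lambda>P Q R. (center_ten C P (center_ten C Q R), Assoc C (fst P) (fst Q) (fst R),
                         center_ten C (center_ten C P Q) R)),
      LUnit = (\<lambda>P. (center_ten C (center_unit C) P, LUnit C (fst P), P)),
      RUnit = (\<lambda>P. (center_ten C P (center_unit C), RUnit C (fst P), P)),
      Braid = (\<lambda>P Q. (center_ten C P Q, snd Q (fst P), center_ten C Q P))\<rparr>"


section \<open>The induction homomorphism\<close>

text \<open>
  A choice of \<open>\<alpha>\<^sup>-\<^sup>1\<close> with \<open>\<epsilon> X : \<alpha> (\<alpha>\<^sup>-\<^sup>1 X) \<rightarrow> X\<close>; by naturality of \<open>\<gamma>\<close> the half-braiding defined from it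
  does not depend on the choice.
\<close>

definition quasi_inverse ::
  "('o, 'm, 'k, 'z) lin_moncat_scheme \<Rightarrow> ('o, 'm, 'o, 'm, 'w) fctr_scheme \<Rightarrow>
   ('o, 'm, 'o, 'm) fctr \<times> ('o \<Rightarrow> 'm)" where
  "quasi_inverse C \<alpha> =
     (SOME (K, \<epsilon>). is_functor C C K \<and> is_nat_iso C C (comp_functor \<alpha> K) id_functor \<epsilon>)"

definition ind_obj ::
  "('o, 'm, 'k, 'z) lin_moncat_scheme \<Rightarrow> ('o, 'm, 'o, 'm) tfctr \<Rightarrow> ('o, 'm) center_obj \<Rightarrow> ('o, 'm) center_obj" where
  "ind_obj C \<alpha> P = (case quasi_inverse C \<alpha> of (K, \<epsilon>) \<Rightarrow> case P of (Z, \<gamma>) \<Rightarrow>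
     (FO \<alpha> Z,
      (\<lambda>X \<in> Obj C. (Id C (FO \<alpha> Z) \<boxdot>\<^bsub>C\<^esub> \<epsilon> X) \<cdot>\<^bsub>C\<^esub> Inv C (FJ \<alpha> Z (FO K X)) \<cdot>\<^bsub>C\<^esub>
         FA \<alpha> (\<gamma> (FO K X)) \<cdot>\<^bsub>C\<^esub> FJ \<alpha> (FO K X) Z \<cdot>\<^bsub>C\<^esub> (Inv C (\<epsilon> X) \<boxdot>\<^bsub>C\<^esub> Id C (FO \<alpha> Z)))))"

definition ind ::
  "('o, 'm, 'k, 'z) lin_moncat_scheme \<Rightarrow> ('o, 'm, 'o, 'm) tfctr \<Rightarrow>
   (('o, 'm) center_obj, ('o, 'm) center_arr, ('o, 'm) center_obj, ('o, 'm) center_arr) tfctr" where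
  "ind C \<alpha> =
     \<lparr>FO = ind_obj C \<alpha>,
      FA = (\<lambda>(P, f, Q). (ind_obj C \<alpha> P, FA \<alpha> f, ind_obj C \<alpha> Q)),
      FJ = (\<lambda>P Q. (center_ten C (ind_obj C \<alpha> P) (ind_obj C \<alpha> Q), FJ \<alpha> (fst P) (fst Q),
                    ind_obj C \<alpha> (center_ten C P Q)))\<rparr>"

definition ind_class ::
  "('o, 'm, 'k, 'z) lin_moncat_scheme \<Rightarrow> ('o, 'm, 'o, 'm) tfctr set \<Rightarrow>
   (('o, 'm) center_obj, ('o, 'm) center_arr, ('o, 'm) center_obj, ('o, 'm) center_arr) tfctr set" where
  "ind_class C \<xi> = braided_iso_rel (drinfeld_center C) `` (ind C ` \<xi>)"

definition ind_image ::
  "('o, 'm, 'k, 'z) lin_moncat_scheme \<Rightarrow>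
   (('o, 'm) center_obj, ('o, 'm) center_arr, ('o, 'm) center_obj, ('o, 'm) center_arr) tfctr set monoid" where
  "ind_image C = (Aut_braided (drinfeld_center C))\<lparr>carrier := ind_class C ` carrier (Aut_tensor C)\<rparr>"


section \<open>Group cohomology with trivial coefficients in the multiplicative group of a field\<close>

definition is_cocycle3 :: "('g, 'b) monoid_scheme \<Rightarrow> ('g \<Rightarrow> 'g \<Rightarrow> 'g \<Rightarrow> 'k::field) \<Rightarrow> bool" where
  "is_cocycle3 G \<omega> \<longleftrightarrow>
     (\<forall>x \<in> carrier G. \<forall>y \<in> carrier G. \<forall>z \<in> carrier G. \<omega> x y z \<noteq> 0) \<and>
     (\<forall>x \<in> carrier G. \<forall>y \<in> carrier G. \<forall>z \<in> carrier G. \<forall>w \<in> carrier G.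
        \<omega> y z w * \<omega> x (y \<otimes>\<^bsub>G\<^esub> z) w * \<omega> x y z = \<omega> (x \<otimes>\<^bsub>G\<^esub> y) z w * \<omega> x y (z \<otimes>\<^bsub>G\<^esub> w))"

definition coboundary1 :: "('g, 'b) monoid_scheme \<Rightarrow> ('g \<Rightarrow> 'k::field) \<Rightarrow> 'g \<Rightarrow> 'g \<Rightarrow> 'k" where
  "coboundary1 G \<nu> x y = \<nu> y * \<nu> x / \<nu> (x \<otimes>\<^bsub>G\<^esub> y)"

definition coboundary2 :: "('g, 'b) monoid_scheme \<Rightarrow> ('g \<Rightarrow> 'g \<Rightarrow> 'k::field) \<Rightarrow> 'g \<Rightarrow> 'g \<Rightarrow> 'g \<Rightarrow> 'k" where
  "coboundary2 G \<mu> x y z = \<mu> y z * \<mu> x (y \<otimes>\<^bsub>G\<^esub> z) / (\<mu> (x \<otimes>\<^bsub>G\<^esub> y) z * \<mu> x y)"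

text \<open>2-cochains take the value 1 outside the carrier, so that they are determined by their values on it.\<close>

definition cochains2 :: "('g, 'b) monoid_scheme \<Rightarrow> ('g \<Rightarrow> 'g \<Rightarrow> 'k::field) set" where
  "cochains2 G = {\<mu>. (\<forall>x \<in> carrier G. \<forall>y \<in> carrier G. \<mu> x y \<noteq> 0) \<and>
     (\<forall>x y. \<not> (x \<in> carrier G \<and> y \<in> carrier G) \<longrightarrow> \<mu> x y = 1)}"

definition Z2 :: "('g, 'b) monoid_scheme \<Rightarrow> ('g \<Rightarrow> 'g \<Rightarrow> 'k::field) monoid" where
  "Z2 G =
     \<lparr>carrier = {\<mu> \<in> cochains2 G.
        \<forall>x \<in> carrier G. \<forall>y \<in> carrier G. \<forall>z \<in> carrier G. coboundary2 G \<mu> x y z = 1},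
      monoid.mult = (\<lambda>\<mu> \<nu> x y. \<mu> x y * \<nu> x y), one = (\<lambda>x y. 1)\<rparr>"

definition B2 :: "('g, 'b) monoid_scheme \<Rightarrow> ('g \<Rightarrow> 'g \<Rightarrow> 'k::field) set" where
  "B2 G = {\<mu> \<in> cochains2 G. \<exists>\<nu>. (\<forall>x \<in> carrier G. \<nu> x \<noteq> 0) \<and>
     (\<forall>x \<in> carrier G. \<forall>y \<in> carrier G. \<mu> x y = coboundary1 G \<nu> x y)}"

definition H2 :: "('g, 'b) monoid_scheme \<Rightarrow> ('g \<Rightarrow> 'g \<Rightarrow> 'k::field) set monoid" where
  "H2 G = Z2 G Mod B2 G"

definition group_center :: "('g, 'b) monoid_scheme \<Rightarrow> ('g, 'b) monoid_scheme" where
  "group_center G = G\<lparr>carrier := {z \<in> carrier G. \<forall>x \<in> carrier G. z \<otimes>\<^bsub>G\<^esub> x = x \<otimes>\<^bsub>G\<^esub> z}\<rparr>"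

definition beta_cocycle ::
  "('g, 'b) monoid_scheme \<Rightarrow> ('g \<Rightarrow> 'g \<Rightarrow> 'g \<Rightarrow> 'k::field) \<Rightarrow> 'g \<Rightarrow> 'g \<Rightarrow> 'g \<Rightarrow> 'k" where
  "beta_cocycle G \<omega> a x y =
     (if x \<in> carrier G \<and> y \<in> carrier G then \<omega> a x y * \<omega> x y a / \<omega> x a y else 1)"

definition beta ::
  "('g, 'b) monoid_scheme \<Rightarrow> ('g \<Rightarrow> 'g \<Rightarrow> 'g \<Rightarrow> 'k::field) \<Rightarrow> 'g \<Rightarrow> ('g \<Rightarrow> 'g \<Rightarrow> 'k) set" where
  "beta G \<omega> a = B2 G #>\<^bsub>Z2 G\<^esub> beta_cocycle G \<omega> a"

text \<open>The cochains \<open>\<mu>\<close> with \<open>d\<mu> = \<omega> \<circ> (a \<times> a \<times> a) / \<omega>\<close>.\<close>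

definition stab_cochains ::
  "('g, 'b) monoid_scheme \<Rightarrow> ('g \<Rightarrow> 'g \<Rightarrow> 'g \<Rightarrow> 'k::field) \<Rightarrow> ('g \<Rightarrow> 'g) \<Rightarrow> ('g \<Rightarrow> 'g \<Rightarrow> 'k) set" where
  "stab_cochains G \<omega> a = {\<mu> \<in> cochains2 G.
     \<forall>x \<in> carrier G. \<forall>y \<in> carrier G. \<forall>z \<in> carrier G.
       coboundary2 G \<mu> x y z = \<omega> (a x) (a y) (a z) / \<omega> x y z}"

definition Stab :: "('g, 'b) monoid_scheme \<Rightarrow> ('g \<Rightarrow> 'g \<Rightarrow> 'g \<Rightarrow> 'k::field) \<Rightarrow> ('g \<Rightarrow> 'g) monoid" where
  "Stab G \<omega> = (AutoGroup G)\<lparr>carrier := {a \<in> auto G. stab_cochains G \<omega> a \<noteq> {}}\<rparr>"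

definition Inn :: "('g, 'b) monoid_scheme \<Rightarrow> ('g \<Rightarrow> 'g) set" where
  "Inn G = {(\<lambda>x \<in> carrier G. g \<otimes>\<^bsub>G\<^esub> x \<otimes>\<^bsub>G\<^esub> inv\<^bsub>G\<^esub> g) | g. g \<in> carrier G}"

definition OutStab :: "('g, 'b) monoid_scheme \<Rightarrow> ('g \<Rightarrow> 'g \<Rightarrow> 'g \<Rightarrow> 'k::field) \<Rightarrow> ('g \<Rightarrow> 'g) set monoid" where
  "OutStab G \<omega> = Stab G \<omega> Mod Inn G"


section \<open>Finite-dimensional graded vector spaces\<close>

text \<open>
  To have a set of objects, the graded vector spaces are taken inside the sequence space \<open>nat \<Rightarrow> 'k\<close>,
  which contains a copy of every finite-dimensional vector space. The tensor product of two subspaces is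
  realised in it by \<open>v \<otimes> w = (\<lambda>(i, j). v i * w j)\<close>, with \<open>nat \<times> nat\<close> identified with \<open>nat\<close>; the bilinear map
  \<open>vec_ten\<close> induces an injection of the algebraic tensor square of the sequence space into it.
\<close>

type_synonym 'k vec = "nat \<Rightarrow> 'k"

definition vec_scale :: "'k::field \<Rightarrow> 'k vec \<Rightarrow> 'k vec" where
  "vec_scale c v = (\<lambda>n. c * v n)"

interpretation seqvec: vector_space vec_scale
  by unfold_locales (auto simp: vec_scale_def fun_eq_iff algebra_simps)

definition vec_ten :: "'k::field vec \<Rightarrow> 'k vec \<Rightarrow> 'k vec" where
  "vec_ten v w = (\<lambda>n. case prod_decode n of (i, j) \<Rightarrow> v i * w j)"

definition vec_unit :: "'k::field vec" where
  "vec_unit = (\<lambda>n. if n = 0 then 1 else 0)"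

text \<open>
  A graded space is given by its homogeneous components; the underlying space \<open>total G V\<close> is their
  internal direct sum.
\<close>

type_synonym ('g, 'k) grspace = "'g \<Rightarrow> 'k vec set"
type_synonym ('g, 'k) grmap = "('g, 'k) grspace \<times> ('k vec \<Rightarrow> 'k vec) \<times> ('g, 'k) grspace"

definition total :: "('g, 'b) monoid_scheme \<Rightarrow> ('g, 'k::field) grspace \<Rightarrow> 'k vec set" where
  "total G V = {(\<Sum>g \<in> carrier G. u g) | u. \<forall>g \<in> carrier G. u g \<in> V g}"

definition graded_spaces :: "('g, 'b) monoid_scheme \<Rightarrow> ('g, 'k::field) grspace set" where
  "graded_spaces G = {V.
     (\<forall>g \<in> carrier G. seqvec.subspace (V g) \<and> (\<exists>B. finite B \<and> V g = seqvec.span B)) \<and>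
     (\<forall>u. (\<forall>g \<in> carrier G. u g \<in> V g) \<and> (\<Sum>g \<in> carrier G. u g) = 0 \<longrightarrow> (\<forall>g \<in> carrier G. u g = 0)) \<and>
     (\<forall>g. g \<notin> carrier G \<longrightarrow> V g = {0})}"

definition linear_on :: "'k::field vec set \<Rightarrow> ('k vec \<Rightarrow> 'k vec) \<Rightarrow> bool" where
  "linear_on S f \<longleftrightarrow> (\<forall>u \<in> S. \<forall>v \<in> S. f (u + v) = f u + f v) \<and>
     (\<forall>c. \<forall>v \<in> S. f (vec_scale c v) = vec_scale c (f v))"

definition graded_maps :: "('g, 'b) monoid_scheme \<Rightarrow> ('g, 'k::field) grmap set" where
  "graded_maps G = {(V, f, W). V \<in> graded_spaces G \<and> W \<in> graded_spaces G \<and>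
     f \<in> extensional (total G V) \<and> linear_on (total G V) f \<and>
     (\<forall>g \<in> carrier G. \<forall>v \<in> V g. f v \<in> W g)}"

text \<open>The linear map on \<open>S\<close> that is determined by the property \<open>P\<close> (its values on a spanning set).\<close>

definition the_linear :: "'k::field vec set \<Rightarrow> (('k vec \<Rightarrow> 'k vec) \<Rightarrow> bool) \<Rightarrow> 'k vec \<Rightarrow> 'k vec" where
  "the_linear S P = (THE f. f \<in> extensional S \<and> linear_on S f \<and> P f)"

definition gr_ten ::
  "('g, 'b) monoid_scheme \<Rightarrow> ('g, 'k::field) grspace \<Rightarrow> ('g, 'k) grspace \<Rightarrow> ('g, 'k) grspace" where
  "gr_ten G V W = (\<lambda>g. seqvec.span
     {vec_ten v w | v w x y. x \<in> carrier G \<and> y \<in> carrier G \<and> x \<otimes>\<^bsub>G\<^esub> y = g \<and> v \<in> V x \<and> w \<in> W y})"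

definition gr_unit :: "('g, 'b) monoid_scheme \<Rightarrow> ('g, 'k::field) grspace" where
  "gr_unit G = (\<lambda>g. if g = \<one>\<^bsub>G\<^esub> then seqvec.span {vec_unit} else {0})"

text \<open>
  The associator multiplies homogeneous vectors by \<open>\<omega>\<close>. Since \<open>\<omega>\<close> need not be normalised, the unit
  constraints carry the scalars forced by the triangle axiom
  \<open>(RUnit X \<boxdot> Id Y) \<cdot> Assoc X 1 Y = Id X \<boxdot> LUnit Y\<close>, using \<open>\<omega> x 1 y = \<omega> x 1 1 * \<omega> 1 1 y\<close>.
\<close>

definition graded_vect ::
  "('g, 'b) monoid_scheme \<Rightarrow> ('g \<Rightarrow> 'g \<Rightarrow> 'g \<Rightarrow> 'k::field) \<Rightarrow>
   (('g, 'k) grspace, ('g, 'k) grmap, 'k) lin_moncat" where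
  "graded_vect G \<omega> =
     \<lparr>Obj = graded_spaces G,
      Arr = graded_maps G,
      Dom = (\<lambda>(V, f, W). V),
      Cod = (\<lambda>(V, f, W). W),
      Id = (\<lambda>V. (V, (\<lambda>v \<in> total G V. v), V)),
      Comp = (\<lambda>(V', g, W') (V, f, W). (V, compose (total G V) g f, W')),
      Plus = (\<lambda>(V, f, W) (V', g, W'). (V, (\<lambda>v \<in> total G V. f v + g v), W)),
      Scale = (\<lambda>c (V, f, W). (V, (\<lambda>v \<in> total G V. vec_scale c (f v)), W)),
      TenO = gr_ten G,
      TenA = (\<lambda>(V, f, V') (W, h, W'). (gr_ten G V W,
         the_linear (total G (gr_ten G V W)) (\<lambda>\<phi>.
           \<forall>v \<in> total G V. \<forall>w \<in> total G W. \<phi> (vec_ten v w) = vec_ten (f v) (h w)),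
         gr_ten G V' W')),
      UnitO = gr_unit G,
      Assoc = (\<lambda>U V W. (gr_ten G U (gr_ten G V W),
         the_linear (total G (gr_ten G U (gr_ten G V W))) (\<lambda>\<phi>.
           \<forall>x \<in> carrier G. \<forall>y \<in> carrier G. \<forall>z \<in> carrier G. \<forall>u \<in> U x. \<forall>v \<in> V y. \<forall>w \<in> W z.
             \<phi> (vec_ten u (vec_ten v w)) = vec_scale (\<omega> x y z) (vec_ten (vec_ten u v) w)),
         gr_ten G (gr_ten G U V) W)),
      LUnit = (\<lambda>V. (gr_ten G (gr_unit G) V,
         the_linear (total G (gr_ten G (gr_unit G) V)) (\<lambda>\<phi>.
           \<forall>x \<in> carrier G. \<forall>v \<in> V x. \<phi> (vec_ten vec_unit v) = vec_scale (\<omega> \<one>\<^bsub>G\<^esub> \<one>\<^bsub>G\<^esub> x) v),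
         V)),
      RUnit = (\<lambda>V. (gr_ten G V (gr_unit G),
         the_linear (total G (gr_ten G V (gr_unit G))) (\<lambda>\<phi>.
           \<forall>x \<in> carrier G. \<forall>v \<in> V x. \<phi> (vec_ten v vec_unit) = vec_scale (1 / \<omega> x \<one>\<^bsub>G\<^esub> \<one>\<^bsub>G\<^esub>) v),
         V))\<rparr>"

text \<open>
  \<open>F\<^sub>a\<^sub>,\<^sub>\<mu>\<close> moves the component of degree \<open>g\<close> to degree \<open>a g\<close> and leaves the underlying spaces and maps
  unchanged.
\<close>

definition regrade :: "('g, 'b) monoid_scheme \<Rightarrow> ('g \<Rightarrow> 'g) \<Rightarrow> ('g, 'k::field) grspace \<Rightarrow> ('g, 'k) grspace" where
  "regrade G a V = (\<lambda>g. if g \<in> carrier G then V (inv_into (carrier G) a g) else {0})"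

definition F_functor ::
  "('g, 'b) monoid_scheme \<Rightarrow> ('g \<Rightarrow> 'g) \<Rightarrow> ('g \<Rightarrow> 'g \<Rightarrow> 'k::field) \<Rightarrow>
   (('g, 'k) grspace, ('g, 'k) grmap, ('g, 'k) grspace, ('g, 'k) grmap) tfctr" where
  "F_functor G a \<mu> =
     \<lparr>FO = regrade G a,
      FA = (\<lambda>(V, f, W). (regrade G a V, f, regrade G a W)),
      FJ = (\<lambda>V W. (gr_ten G (regrade G a V) (regrade G a W),
         the_linear (total G (gr_ten G (regrade G a V) (regrade G a W))) (\<lambda>\<phi>.
           \<forall>x \<in> carrier G. \<forall>y \<in> carrier G. \<forall>v \<in> V x. \<forall>w \<in> W y.
             \<phi> (vec_ten v w) = vec_scale (\<mu> x y) (vec_ten v w)),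
         regrade G a (gr_ten G V W)))\<rparr>"


section \<open>The maps of the sequence\<close>

abbreviation I_group where
  "I_group G \<omega> \<equiv> ind_image (graded_vect G \<omega>)"

definition F_class ::
  "('g, 'b) monoid_scheme \<Rightarrow> ('g \<Rightarrow> 'g \<Rightarrow> 'g \<Rightarrow> 'k::field) \<Rightarrow> ('g \<Rightarrow> 'g) \<Rightarrow> ('g \<Rightarrow> 'g \<Rightarrow> 'k) \<Rightarrow>
   (('g, 'k) grspace, ('g, 'k) grmap, ('g, 'k) grspace, ('g, 'k) grmap) tfctr set" where
  "F_class G \<omega> a \<mu> = tensor_iso_rel (graded_vect G \<omega>) `` {F_functor G a \<mu>}"

text \<open>
  The next two maps are defined as unions over all representatives. Distinct classes (of functors, or cosets)
  being disjoint and nonempty, such a union is a single class precisely if there is a representative and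
  the result does not depend on it; that the maps take values in the carriers of their
  target groups thus expresses that they are well defined.
\<close>

definition H2_to_I where
  "H2_to_I G \<omega> M =
     (\<Union>\<mu> \<in> M. ind_class (graded_vect G \<omega>) (F_class G \<omega> (\<lambda>x \<in> carrier G. x) \<mu>))"

definition I_to_OutStab where
  "I_to_OutStab G \<omega> \<xi> =
     \<Union>{Inn G #>\<^bsub>Stab G \<omega>\<^esub> a | a \<mu>. a \<in> carrier (Stab G \<omega>) \<and> \<mu> \<in> stab_cochains G \<omega> a \<and>
         ind_class (graded_vect G \<omega>) (F_class G \<omega> a \<mu>) = \<xi>}"

end

theory Submission
  imports Defs
begin

text \<open>
  A half-braiding on a graded space \<open>Z\<close> amounts to operators \<open>\<rho>\<^sub>g\<close> that map the component of degree \<open>d\<close>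
  to that of degree \<open>g d g\<^sup>-\<^sup>1\<close> and are multiplicative up to scalars determined by \<open>\<omega>\<close>. The functor
  \<open>ind F\<^sub>a\<^sub>,\<^sub>\<mu>\<close> regrades \<open>Z\<close> by \<open>a\<close> and multiplies \<open>\<rho>\<^sub>g\<close> by \<open>\<mu>(g, d) / \<mu>(g d g\<^sup>-\<^sup>1, g)\<close>. If \<open>a\<close> is conjugation
  by \<open>s\<close> and \<open>\<mu> = d\<nu> / \<kappa>\<^sub>s\<close>, where \<open>\<kappa>\<^sub>s\<close> extends the formula for \<open>\<beta>\<^sub>s\<close> to non-central \<open>s\<close>, then the operators \<open>\<rho>\<^sub>s\<close>
  themselves, rescaled by \<open>\<nu>\<close>, form a tensor isomorphism from \<open>ind F\<^sub>a\<^sub>,\<^sub>\<mu>\<close> to the identity. Conversely,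
  the components of such an isomorphism at the objects \<open>I(x)\<close> induced from one-dimensional spaces are compatible with
  multiplications \<open>I(x) \<otimes> I(y) \<rightarrow> I(x y)\<close>, and their coefficients yield \<open>s\<close> and \<open>\<nu>\<close>. Since every tensor
  autoequivalence is isomorphic to some \<open>F\<^sub>a\<^sub>,\<^sub>\<mu>\<close>, which is seen on one-dimensional spaces, the exact sequence follows.
\<close>

section \<open>Categories with a bifunctor\<close>

text \<open>A morphism out of a tensor product is fixed by its values on homogeneous tensors, and by
  naturality a half-braiding is fixed by its values at the lines \<open>delta g\<close>. Diagrams
  thus become identities of scalars in \<open>theta\<close> and \<open>kappa\<close>, which are, up
  to inversion and relabelling, the structure constants of the twisted Drinfeld double of Dijkgraaf,
  Pasquier and Roche. The obstacle in the converse is to find \<open>s\<close>. The object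
  \<open>I(x)\<close> represents the functor that takes the component of degree \<open>x\<close>, so
  a natural map out of this component is a sum of multiples \<open>c x k\<close> of the operators
  \<open>\<rho>\<^sub>k\<close>. For fixed \<open>k\<close>, compatibility with the products makes
  \<open>c\<close> multiplicative in \<open>x\<close> up to nonzero scalars. Hence
  \<open>c \<one> k \<noteq> 0\<close> implies \<open>c x k \<noteq> 0\<close> for all
  \<open>x\<close>, and any such \<open>k\<close> can serve as \<open>s\<close>. As \<omega> is not
  normalised, \<open>\<rho>\<close> at the unit of the group need not be the identity, and
  \<open>kappa \<one>\<close> is only a coboundary; \<open>unit_scalar\<close> is the resulting
  correction to \<open>\<nu>\<close>. The calculus of isomorphisms and tensor functors is used both
  for graded spaces and for their center, whence the locale.\<close>

locale tensor_precategory =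
  fixes C :: "('o, 'm, 'k, 'z) lin_moncat_scheme" (structure)
  assumes dom_obj: "f \<in> Arr C \<Longrightarrow> Dom C f \<in> Obj C"
    and cod_obj: "f \<in> Arr C \<Longrightarrow> Cod C f \<in> Obj C"
    and id_hom: "X \<in> Obj C \<Longrightarrow> Id C X \<in> Hom C X X"
    and comp_hom: "\<lbrakk>f \<in> Hom C X Y; g \<in> Hom C Y Z\<rbrakk> \<Longrightarrow> g \<cdot> f \<in> Hom C X Z"
    and comp_assoc: "\<lbrakk>f \<in> Hom C W X; g \<in> Hom C X Y; h \<in> Hom C Y Z\<rbrakk> \<Longrightarrow> h \<cdot> g \<cdot> f = h \<cdot> (g \<cdot> f)"
    and id_left: "f \<in> Hom C X Y \<Longrightarrow> Id C Y \<cdot> f = f"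
    and id_right: "f \<in> Hom C X Y \<Longrightarrow> f \<cdot> Id C X = f"
    and ten_obj: "\<lbrakk>X \<in> Obj C; Y \<in> Obj C\<rbrakk> \<Longrightarrow> X \<boxtimes> Y \<in> Obj C"
    and ten_hom: "\<lbrakk>f \<in> Hom C X X'; g \<in> Hom C Y Y'\<rbrakk> \<Longrightarrow> f \<boxdot> g \<in> Hom C (X \<boxtimes> Y) (X' \<boxtimes> Y')"
    and ten_comp: "\<lbrakk>f \<in> Hom C X X'; f' \<in> Hom C X' X''; g \<in> Hom C Y Y'; g' \<in> Hom C Y' Y''\<rbrakk> \<Longrightarrow>
      (f' \<boxdot> g') \<cdot> (f \<boxdot> g) = (f' \<cdot> f) \<boxdot> (g' \<cdot> g)"
    and ten_id: "\<lbrakk>X \<in> Obj C; Y \<in> Obj C\<rbrakk> \<Longrightarrow> Id C X \<boxdot> Id C Y = Id C (X \<boxtimes> Y)"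
    and unit_obj: "UnitO C \<in> Obj C"
    and assoc_hom: "\<lbrakk>X \<in> Obj C; Y \<in> Obj C; Z \<in> Obj C\<rbrakk> \<Longrightarrow>
      Assoc C X Y Z \<in> Hom C (X \<boxtimes> (Y \<boxtimes> Z)) (X \<boxtimes> Y \<boxtimes> Z)"
    and plus_hom: "\<lbrakk>f \<in> Hom C X Y; g \<in> Hom C X Y\<rbrakk> \<Longrightarrow> Plus C f g \<in> Hom C X Y"
    and scale_hom: "f \<in> Hom C X Y \<Longrightarrow> Scale C c f \<in> Hom C X Y"
begin

lemma hom_arr: "f \<in> Arr C \<Longrightarrow> f \<in> Hom C (Dom C f) (Cod C f)"
  by (simp add: Hom_def)

lemma Hom_iff: "f \<in> Hom C X Y \<longleftrightarrow> f \<in> Arr C \<and> Dom C f = X \<and> Cod C f = Y"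
  by (simp add: Hom_def)

lemma hom_obj: "f \<in> Hom C X Y \<Longrightarrow> X \<in> Obj C" "f \<in> Hom C X Y \<Longrightarrow> Y \<in> Obj C"
  using dom_obj cod_obj by (auto simp: Hom_def)

text \<open>Typing in terms of \<open>Arr\<close>, \<open>Dom\<close> and \<open>Cod\<close> leaves
  no intermediate object to guess, so that the simplifier can discharge it; hence \<open>Hom\<close>
  is unfolded in most calculations below.\<close>

lemma comp_simps [simp]:
  assumes "f \<in> Arr C" "g \<in> Arr C" "Dom C g = Cod C f"
  shows "g \<cdot> f \<in> Arr C" "Dom C (g \<cdot> f) = Dom C f" "Cod C (g \<cdot> f) = Cod C g"
  using comp_hom[of f "Dom C f" "Cod C f" g "Cod C g"] assms by (simp_all add: Hom_def)

lemma comp_assoc' [simp]: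
  assumes "f \<in> Arr C" "g \<in> Arr C" "h \<in> Arr C" "Dom C g = Cod C f" "Dom C h = Cod C g"
  shows "h \<cdot> g \<cdot> f = h \<cdot> (g \<cdot> f)"
  using comp_assoc[of f "Dom C f" "Cod C f" g "Cod C g" h "Cod C h"] assms by (simp_all add: Hom_def)

lemma id_simps [simp]:
  assumes "X \<in> Obj C"
  shows "Id C X \<in> Arr C" "Dom C (Id C X) = X" "Cod C (Id C X) = X"
  using id_hom[OF assms] by (simp_all add: Hom_def)

lemma id_comp [simp]:
  assumes "f \<in> Arr C"
  shows "Cod C f = Y \<Longrightarrow> Id C Y \<cdot> f = f" "Dom C f = X \<Longrightarrow> f \<cdot> Id C X = f"
  using id_left[OF hom_arr[OF assms]] id_right[OF hom_arr[OF assms]] by auto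

lemma ten_simps [simp]:
  assumes "f \<in> Arr C" "g \<in> Arr C"
  shows "f \<boxdot> g \<in> Arr C" "Dom C (f \<boxdot> g) = Dom C f \<boxtimes> Dom C g" "Cod C (f \<boxdot> g) = Cod C f \<boxtimes> Cod C g"
  using ten_hom[OF hom_arr[OF assms(1)] hom_arr[OF assms(2)]] by (simp_all add: Hom_def)

lemma ten_comp' :
  assumes "f \<in> Arr C" "g \<in> Arr C" "f' \<in> Arr C" "g' \<in> Arr C" "Dom C f' = Cod C f" "Dom C g' = Cod C g"
  shows "(f' \<boxdot> g') \<cdot> (f \<boxdot> g) = (f' \<cdot> f) \<boxdot> (g' \<cdot> g)"
  using assms by (intro ten_comp) (simp_all add: Hom_def)

text \<open>Composites are normalised to nest to the right, so the interchange law must also apply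
  when a further factor \<open>h\<close> follows.\<close>

lemma ten_comp_reassoc:
  assumes "f \<in> Arr C" "g \<in> Arr C" "f' \<in> Arr C" "g' \<in> Arr C" "Dom C f' = Cod C f" "Dom C g' = Cod C g"
    "h \<in> Arr C" "Cod C h = Dom C f \<boxtimes> Dom C g"
  shows "(f' \<boxdot> g') \<cdot> ((f \<boxdot> g) \<cdot> h) = ((f' \<cdot> f) \<boxdot> (g' \<cdot> g)) \<cdot> h"
proof -
  have "(f' \<boxdot> g') \<cdot> ((f \<boxdot> g) \<cdot> h) = (f' \<boxdot> g') \<cdot> (f \<boxdot> g) \<cdot> h"
    using assms by simp
  then show ?thesis
    using assms by (simp add: ten_comp')
qed

declare dom_obj [simp] cod_obj [simp] ten_obj [simp] ten_id [simp] unit_obj [simp]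

lemma is_inverse_unique:
  assumes "is_inverse C f g" "is_inverse C f h"
  shows "g = h"
proof -
  have "g = g \<cdot> (f \<cdot> h)"
    using assms by (simp_all add: is_inverse_def Hom_def)
  also have "\<dots> = g \<cdot> f \<cdot> h"
    using assms by (subst comp_assoc') (simp_all add: is_inverse_def Hom_def)
  also have "\<dots> = h"
    using assms by (simp_all add: is_inverse_def Hom_def)
  finally show ?thesis .
qed

lemma Inv_eq: "is_inverse C f g \<Longrightarrow> Inv C f = g"
  unfolding Inv_def using is_inverse_unique by blast

lemma is_isoI: "is_inverse C f g \<Longrightarrow> is_iso C f"
  unfolding is_iso_def by blast

lemma Inv_is_inverse: "is_iso C f \<Longrightarrow> is_inverse C f (Inv C f)"
  by (metis Inv_eq is_iso_def)

lemma Inv_simps [simp]: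
  assumes "is_iso C f"
  shows "f \<in> Arr C" "Inv C f \<in> Arr C" "Dom C (Inv C f) = Cod C f" "Cod C (Inv C f) = Dom C f"
    "Inv C f \<cdot> f = Id C (Dom C f)" "f \<cdot> Inv C f = Id C (Cod C f)"
  using Inv_is_inverse[OF assms] by (simp_all add: is_inverse_def Hom_def)

lemma Inv_cancel [simp]:
  assumes "is_iso C f" "g \<in> Arr C"
  shows "Cod C g = Dom C f \<Longrightarrow> Inv C f \<cdot> (f \<cdot> g) = g" "Cod C g = Cod C f \<Longrightarrow> f \<cdot> (Inv C f \<cdot> g) = g"
proof -
  show "Inv C f \<cdot> (f \<cdot> g) = g" if "Cod C g = Dom C f"
    using assms comp_assoc'[of g f "Inv C f"] that by (simp del: comp_assoc')
  show "f \<cdot> (Inv C f \<cdot> g) = g" if "Cod C g = Cod C f"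
    using assms comp_assoc'[of g "Inv C f" f] that by (simp del: comp_assoc')
qed

lemma Inv_hom: "is_iso C f \<Longrightarrow> f \<in> Hom C X Y \<Longrightarrow> Inv C f \<in> Hom C Y X"
  using Inv_simps by (simp_all add: Hom_def)

lemma is_inverseI:
  assumes "f \<in> Hom C X Y" "g \<in> Hom C Y X" "g \<cdot> f = Id C X" "f \<cdot> g = Id C Y"
  shows "is_inverse C f g"
  using assms by (simp_all add: is_inverse_def Hom_def)

lemma is_iso_Inv: "is_iso C f \<Longrightarrow> is_iso C (Inv C f)"
  unfolding is_iso_def[of C "Inv C f"]
  by (rule exI[of _ f], rule is_inverseI[of _ "Cod C f" "Dom C f"]) (simp_all add: Hom_def)

lemma is_iso_comp:
  assumes "is_iso C f" "is_iso C g" "Dom C g = Cod C f"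
  shows "is_iso C (g \<cdot> f)" "Inv C (g \<cdot> f) = Inv C f \<cdot> Inv C g"
proof -
  have "is_inverse C (g \<cdot> f) (Inv C f \<cdot> Inv C g)"
    by (rule is_inverseI[of _ "Dom C f" "Cod C g"]) (use assms in \<open>simp_all add: Hom_def\<close>)
  then show "is_iso C (g \<cdot> f)" "Inv C (g \<cdot> f) = Inv C f \<cdot> Inv C g"
    by (fact is_isoI, fact Inv_eq)
qed

lemma is_iso_ten:
  assumes "is_iso C f" "is_iso C g"
  shows "is_iso C (f \<boxdot> g)" "Inv C (f \<boxdot> g) = Inv C f \<boxdot> Inv C g"
proof -
  have "is_inverse C (f \<boxdot> g) (Inv C f \<boxdot> Inv C g)"
    by (rule is_inverseI[of _ "Dom C f \<boxtimes> Dom C g" "Cod C f \<boxtimes> Cod C g"])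
      (use assms in \<open>simp_all add: Hom_def ten_comp'\<close>)
  then show "is_iso C (f \<boxdot> g)" "Inv C (f \<boxdot> g) = Inv C f \<boxdot> Inv C g"
    by (fact is_isoI, fact Inv_eq)
qed

lemma is_iso_id:
  assumes "X \<in> Obj C"
  shows "is_iso C (Id C X)" "Inv C (Id C X) = Id C X"
proof -
  have "is_inverse C (Id C X) (Id C X)"
    by (rule is_inverseI[of _ X X]) (use assms in \<open>simp_all add: Hom_def\<close>)
  then show "is_iso C (Id C X)" "Inv C (Id C X) = Id C X"
    by (fact is_isoI, fact Inv_eq)
qed

text \<open>Conjugation of the square by the two inverses. In this way naturality of tensor
  structures and compatibility with half-braidings pass to inverses.\<close>

lemma Inv_swap:
  assumes a: "is_iso C a" and b: "is_iso C b" and p: "p \<in> Hom C X Y" and q: "q \<in> Hom C X' Y'"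
    and eq: "a \<cdot> p = q \<cdot> b" and d: "Dom C a = Y" "Dom C b = X" "Cod C a = Y'" "Cod C b = X'"
  shows "Inv C a \<cdot> q = p \<cdot> Inv C b"
proof -
  have "Inv C a \<cdot> q = Inv C a \<cdot> (q \<cdot> b \<cdot> Inv C b)"
    using a b q d by (simp add: Hom_def)
  also have "\<dots> = Inv C a \<cdot> (a \<cdot> p \<cdot> Inv C b)"
    by (simp only: eq)
  also have "\<dots> = p \<cdot> Inv C b"
    using a b p d by (simp add: Hom_def)
  finally show ?thesis .
qed

lemma comp_cancel_left:
  assumes "is_iso C h" "f \<in> Hom C X (Dom C h)" "g \<in> Hom C X (Dom C h)" "h \<cdot> f = h \<cdot> g"
  shows "f = g"
proof -
  have "f = Inv C h \<cdot> (h \<cdot> f)"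
    using assms(1,2) by (simp add: Hom_def)
  also have "\<dots> = g"
    unfolding assms(4) using assms(1,3) by (simp add: Hom_def)
  finally show ?thesis .
qed

lemma comp_cancel_right:
  assumes "is_iso C h" "f \<in> Hom C (Cod C h) X" "g \<in> Hom C (Cod C h) X" "f \<cdot> h = g \<cdot> h"
  shows "f = g"
proof -
  have "f = f \<cdot> h \<cdot> Inv C h"
    using assms(1,2) by (simp add: Hom_def)
  also have "\<dots> = g"
    unfolding assms(4) using assms(1,3) by (simp add: Hom_def)
  finally show ?thesis .
qed

subsection \<open>Isomorphisms of tensor functors\<close>

lemma tensor_functorD:
  assumes "is_tensor_functor C C F"
  shows "is_functor C C F"
    and "\<And>X. X \<in> Obj C \<Longrightarrow> FO F X \<in> Obj C"
    and "\<And>X. X \<in> Obj C \<Longrightarrow> FA F (Id C X) = Id C (FO F X)"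
    and "\<And>X Y f. f \<in> Hom C X Y \<Longrightarrow> FA F f \<in> Hom C (FO F X) (FO F Y)"
    and "\<And>X Y Z f g. f \<in> Hom C X Y \<Longrightarrow> g \<in> Hom C Y Z \<Longrightarrow> FA F (g \<cdot> f) = FA F g \<cdot> FA F f"
    and "\<And>X Y. X \<in> Obj C \<Longrightarrow> Y \<in> Obj C \<Longrightarrow> FJ F X Y \<in> Hom C (FO F X \<boxtimes> FO F Y) (FO F (X \<boxtimes> Y))"
    and "\<And>X Y. X \<in> Obj C \<Longrightarrow> Y \<in> Obj C \<Longrightarrow> is_iso C (FJ F X Y)"
    and "\<And>X Y X' Y' f g. f \<in> Hom C X X' \<Longrightarrow> g \<in> Hom C Y Y' \<Longrightarrow>
        FJ F X' Y' \<cdot> (FA F f \<boxdot> FA F g) = FA F (f \<boxdot> g) \<cdot> FJ F X Y"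
    and "\<And>X Y f g. f \<in> Hom C X Y \<Longrightarrow> g \<in> Hom C X Y \<Longrightarrow> FA F (Plus C f g) = Plus C (FA F f) (FA F g)"
    and "\<And>X Y f c. f \<in> Hom C X Y \<Longrightarrow> FA F (Scale C c f) = Scale C c (FA F f)"
proof -
  note F = assms[unfolded is_tensor_functor_def is_linear_functor_def is_functor_def]
  show "is_functor C C F"
    using assms unfolding is_tensor_functor_def is_linear_functor_def by simp
  show "\<And>X. X \<in> Obj C \<Longrightarrow> FO F X \<in> Obj C"
    "\<And>X. X \<in> Obj C \<Longrightarrow> FA F (Id C X) = Id C (FO F X)"
    "\<And>X Y. X \<in> Obj C \<Longrightarrow> Y \<in> Obj C \<Longrightarrow> FJ F X Y \<in> Hom C (FO F X \<boxtimes> FO F Y) (FO F (X \<boxtimes> Y))"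
    "\<And>X Y. X \<in> Obj C \<Longrightarrow> Y \<in> Obj C \<Longrightarrow> is_iso C (FJ F X Y)"
    using F by simp_all
  show "FA F f \<in> Hom C (FO F X) (FO F Y)" "FA F (Scale C c f) = Scale C c (FA F f)"
    if "f \<in> Hom C X Y" for X Y f c
    using F that hom_obj[OF that] by simp_all
  show "FA F (g \<cdot> f) = FA F g \<cdot> FA F f" if "f \<in> Hom C X Y" "g \<in> Hom C Y Z" for X Y Z f g
    using F that hom_obj[OF that(1)] hom_obj[OF that(2)] by simp
  show "FA F (Plus C f g) = Plus C (FA F f) (FA F g)" if "f \<in> Hom C X Y" "g \<in> Hom C X Y" for X Y f g
    using F that hom_obj[OF that(1)] by simp
  show "FJ F X' Y' \<cdot> (FA F f \<boxdot> FA F g) = FA F (f \<boxdot> g) \<cdot> FJ F X Y"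
    if "f \<in> Hom C X X'" "g \<in> Hom C Y Y'" for X Y X' Y' f g
    using F that hom_obj[OF that(1)] hom_obj[OF that(2)] by simp
qed

text \<open>Names the witness hidden in \<open>tensor_functor_iso\<close>, so that one destruction
  rule provides its typing, invertibility, naturality and compatibility with the tensor
  structures.\<close>

definition tensor_nat_iso where
  "tensor_nat_iso F H \<eta> \<longleftrightarrow> is_nat_iso C C F H \<eta> \<and>
     (\<forall>X\<in>Obj C. \<forall>Y\<in>Obj C. \<eta> (X \<boxtimes> Y) \<cdot> FJ F X Y = FJ H X Y \<cdot> (\<eta> X \<boxdot> \<eta> Y))"

lemma tensor_functor_iso_iff: "tensor_functor_iso C C F H \<longleftrightarrow> (\<exists>\<eta>. tensor_nat_iso F H \<eta>)"
  by (simp add: tensor_functor_iso_def tensor_nat_iso_def)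

lemma tensor_nat_isoD:
  assumes "tensor_nat_iso F H \<eta>"
  shows "X \<in> Obj C \<Longrightarrow> \<eta> X \<in> Hom C (FO F X) (FO H X)" "X \<in> Obj C \<Longrightarrow> is_iso C (\<eta> X)"
    "\<lbrakk>X \<in> Obj C; Y \<in> Obj C; f \<in> Hom C X Y\<rbrakk> \<Longrightarrow> \<eta> Y \<cdot> FA F f = FA H f \<cdot> \<eta> X"
    "X \<in> Obj C \<Longrightarrow> Y \<in> Obj C \<Longrightarrow> \<eta> (X \<boxtimes> Y) \<cdot> FJ F X Y = FJ H X Y \<cdot> (\<eta> X \<boxdot> \<eta> Y)"
  using assms unfolding tensor_nat_iso_def is_nat_iso_def by simp_all

lemma tensor_functor_iso_refl:
  assumes F: "is_tensor_functor C C F"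
  shows "tensor_functor_iso C C F F"
proof -
  note [simp] = tensor_functorD(2)[OF F]
    and Ff = tensor_functorD(4)[OF F] and FJ = tensor_functorD(6)[OF F]
  show ?thesis
    unfolding tensor_functor_iso_def is_nat_iso_def
    by (rule exI[of _ "\<lambda>X. Id C (FO F X)"], use Ff FJ in \<open>simp_all add: is_iso_id Hom_def\<close>)
qed

lemma tensor_functor_iso_sym:
  assumes F: "is_tensor_functor C C F" and H: "is_tensor_functor C C H" and "tensor_functor_iso C C F H"
  shows "tensor_functor_iso C C H F"
proof -
  obtain \<eta> where "tensor_nat_iso F H \<eta>"
    using assms(3) unfolding tensor_functor_iso_iff by blast
  note eta = tensor_nat_isoD(1)[OF this] and iso [simp] = tensor_nat_isoD(2)[OF this] and nat = tensor_nat_isoD(3)[OF this] and ten = tensor_nat_isoD(4)[OF this]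
  note Ff = tensor_functorD(4)[OF F] and FJ = tensor_functorD(6)[OF F]
  note Hf = tensor_functorD(4)[OF H] and HJ = tensor_functorD(6)[OF H]
  have e [simp]: "\<And>X. X \<in> Obj C \<Longrightarrow> Dom C (\<eta> X) = FO F X" "\<And>X. X \<in> Obj C \<Longrightarrow> Cod C (\<eta> X) = FO H X"
    using eta by (simp_all add: Hom_def)
  show ?thesis
    unfolding tensor_functor_iso_def is_nat_iso_def
  proof (rule exI[of _ "\<lambda>X. Inv C (\<eta> X)"], intro conjI ballI)
    fix X Y f assume *: "X \<in> Obj C" "Y \<in> Obj C" "f \<in> Hom C X Y"
    show "Inv C (\<eta> Y) \<cdot> FA H f = FA F f \<cdot> Inv C (\<eta> X)"
      by (rule Inv_swap[OF _ _ Ff[OF *(3)] Hf[OF *(3)] nat[OF *]]) (use * in simp_all)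
  next
    fix X Y assume *: "X \<in> Obj C" "Y \<in> Obj C"
    have "Inv C (\<eta> (X \<boxtimes> Y)) \<cdot> FJ H X Y = FJ F X Y \<cdot> Inv C (\<eta> X \<boxdot> \<eta> Y)"
      by (rule Inv_swap[OF _ _ FJ[OF *] HJ[OF *] ten[OF *]]) (use * in \<open>simp_all add: is_iso_ten\<close>)
    then show "Inv C (\<eta> (X \<boxtimes> Y)) \<cdot> FJ H X Y = FJ F X Y \<cdot> (Inv C (\<eta> X) \<boxdot> Inv C (\<eta> Y))"
      using * by (simp add: is_iso_ten)
  qed (use eta Inv_hom is_iso_Inv in auto)
qed

lemma tensor_functor_iso_trans:
  assumes F: "is_tensor_functor C C F" and H: "is_tensor_functor C C H" and K: "is_tensor_functor C C K"
    and FH: "tensor_functor_iso C C F H" and HK: "tensor_functor_iso C C H K"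
  shows "tensor_functor_iso C C F K"
proof -
  obtain \<eta> where "tensor_nat_iso F H \<eta>"
    using FH unfolding tensor_functor_iso_iff by blast
  note eta = tensor_nat_isoD(1)[OF this] and iso [simp] = tensor_nat_isoD(2)[OF this] and nat = tensor_nat_isoD(3)[OF this] and ten = tensor_nat_isoD(4)[OF this]
  obtain \<theta> where "tensor_nat_iso H K \<theta>"
    using HK unfolding tensor_functor_iso_iff by blast
  note eta' = tensor_nat_isoD(1)[OF this] and iso' [simp] = tensor_nat_isoD(2)[OF this] and nat' = tensor_nat_isoD(3)[OF this] and ten' = tensor_nat_isoD(4)[OF this]
  note Ff = tensor_functorD(4)[OF F] and FJ = tensor_functorD(6)[OF F]
  note Hf = tensor_functorD(4)[OF H] and HJ = tensor_functorD(6)[OF H]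
  note Kf = tensor_functorD(4)[OF K] and KJ = tensor_functorD(6)[OF K]
  have e [simp]: "\<And>X. X \<in> Obj C \<Longrightarrow> Dom C (\<eta> X) = FO F X" "\<And>X. X \<in> Obj C \<Longrightarrow> Cod C (\<eta> X) = FO H X"
    "\<And>X. X \<in> Obj C \<Longrightarrow> Dom C (\<theta> X) = FO H X" "\<And>X. X \<in> Obj C \<Longrightarrow> Cod C (\<theta> X) = FO K X"
    using eta eta' by (simp_all add: Hom_def)
  show ?thesis
    unfolding tensor_functor_iso_def is_nat_iso_def
  proof (rule exI[of _ "\<lambda>X. \<theta> X \<cdot> \<eta> X"], intro conjI ballI)
    fix X Y f assume *: "X \<in> Obj C" "Y \<in> Obj C" "f \<in> Hom C X Y"
    have "\<theta> Y \<cdot> \<eta> Y \<cdot> FA F f = \<theta> Y \<cdot> FA H f \<cdot> \<eta> X"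
      using Ff[OF *(3)] Hf[OF *(3)] * nat[OF *] by (simp add: Hom_def)
    also have "\<dots> = FA K f \<cdot> (\<theta> X \<cdot> \<eta> X)"
      using Kf[OF *(3)] * by (simp add: nat'[OF *] Hom_def)
    finally show "\<theta> Y \<cdot> \<eta> Y \<cdot> FA F f = FA K f \<cdot> (\<theta> X \<cdot> \<eta> X)" .
  next
    fix X Y assume *: "X \<in> Obj C" "Y \<in> Obj C"
    have "\<theta> (X \<boxtimes> Y) \<cdot> \<eta> (X \<boxtimes> Y) \<cdot> FJ F X Y = \<theta> (X \<boxtimes> Y) \<cdot> FJ H X Y \<cdot> (\<eta> X \<boxdot> \<eta> Y)"
      using FJ[OF *] HJ[OF *] * ten[OF *] by (simp add: Hom_def)
    also have "\<dots> = FJ K X Y \<cdot> ((\<theta> X \<cdot> \<eta> X) \<boxdot> (\<theta> Y \<cdot> \<eta> Y))"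
      using KJ[OF *] * by (simp add: ten'[OF *] ten_comp' Hom_def)
    finally show "\<theta> (X \<boxtimes> Y) \<cdot> \<eta> (X \<boxtimes> Y) \<cdot> FJ F X Y = FJ K X Y \<cdot> ((\<theta> X \<cdot> \<eta> X) \<boxdot> (\<theta> Y \<cdot> \<eta> Y))" .
  qed (use eta eta' in \<open>auto simp: Hom_def intro: is_iso_comp\<close>)
qed

lemma functor_iso:
  assumes F: "is_functor C C F" and f: "is_iso C f"
  shows "is_iso C (FA F f)" "Inv C (FA F f) = FA F (Inv C f)"
proof -
  have fh: "f \<in> Hom C (Dom C f) (Cod C f)"
    using f by (simp add: Hom_def)
  note o = hom_obj[OF fh]
  have a: "FA F (Inv C f \<cdot> f) = FA F (Inv C f) \<cdot> FA F f" "FA F (f \<cdot> Inv C f) = FA F f \<cdot> FA F (Inv C f)"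
    using F o fh Inv_hom[OF f fh] unfolding is_functor_def by blast+
  have "is_inverse C (FA F f) (FA F (Inv C f))"
    by (rule is_inverseI[of _ "FO F (Dom C f)" "FO F (Cod C f)"])
      (use F o fh Inv_hom[OF f fh] a f in \<open>auto simp: is_functor_def\<close>)
  then show "is_iso C (FA F f)" "Inv C (FA F f) = FA F (Inv C f)"
    by (fact is_isoI, fact Inv_eq)
qed

text \<open>Horizontal composition of natural isomorphisms; it makes the product of isomorphism
  classes independent of the representatives.\<close>

lemma tensor_functor_iso_comp:
  assumes F: "is_tensor_functor C C F" and H: "is_tensor_functor C C H"
    and F': "is_tensor_functor C C F'" and H': "is_tensor_functor C C H'"
    and FF: "tensor_functor_iso C C F F'" and HH: "tensor_functor_iso C C H H'"
  shows "tensor_functor_iso C C (comp_tensor_functor C F H) (comp_tensor_functor C F' H')"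
proof -
  obtain \<eta> where "tensor_nat_iso F F' \<eta>"
    using FF unfolding tensor_functor_iso_iff by blast
  note eta = tensor_nat_isoD(1)[OF this] and iso [simp] = tensor_nat_isoD(2)[OF this] and nat = tensor_nat_isoD(3)[OF this] and ten = tensor_nat_isoD(4)[OF this]
  obtain \<theta> where "tensor_nat_iso H H' \<theta>"
    using HH unfolding tensor_functor_iso_iff by blast
  note eta' = tensor_nat_isoD(1)[OF this] and iso' [simp] = tensor_nat_isoD(2)[OF this] and nat' = tensor_nat_isoD(3)[OF this] and ten' = tensor_nat_isoD(4)[OF this]
  note Fo [simp] = tensor_functorD(2)[OF F]
    and Ff = tensor_functorD(4)[OF F] and Fc = tensor_functorD(5)[OF F] and FJ = tensor_functorD(6)[OF F] and FJn = tensor_functorD(8)[OF F] and fF = tensor_functorD(1)[OF F]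
  note Fo' [simp] = tensor_functorD(2)[OF F']
    and Ff' = tensor_functorD(4)[OF F'] and Fc' = tensor_functorD(5)[OF F'] and FJ' = tensor_functorD(6)[OF F']
  note Ho [simp] = tensor_functorD(2)[OF H]
    and Hf = tensor_functorD(4)[OF H] and HJ = tensor_functorD(6)[OF H]
  note Ho' [simp] = tensor_functorD(2)[OF H']
    and Hf' = tensor_functorD(4)[OF H'] and HJ' = tensor_functorD(6)[OF H']
  have e [simp]: "\<And>X. X \<in> Obj C \<Longrightarrow> Dom C (\<eta> X) = FO F X" "\<And>X. X \<in> Obj C \<Longrightarrow> Cod C (\<eta> X) = FO F' X"
    "\<And>X. X \<in> Obj C \<Longrightarrow> Dom C (\<theta> X) = FO H X" "\<And>X. X \<in> Obj C \<Longrightarrow> Cod C (\<theta> X) = FO H' X"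
    using eta eta' by (simp_all add: Hom_def)
  have Ft [simp]: "FA F (\<theta> X) \<in> Arr C" "Dom C (FA F (\<theta> X)) = FO F (FO H X)" "Cod C (FA F (\<theta> X)) = FO F (FO H' X)"
    if "X \<in> Obj C" for X
    using Ff[OF eta'[OF that]] by (simp_all add: Hom_def)
  have Ft_iso: "is_iso C (FA F (\<theta> X))" if "X \<in> Obj C" for X
    using functor_iso[OF fF] that by simp
  show ?thesis
    unfolding tensor_functor_iso_def is_nat_iso_def comp_tensor_functor_def fctr.simps tfctr.simps
  \<comment> \<open>Of the two equal forms of the horizontal composite, the one that first applies
    \<open>F\<close> to \<open>\<theta>\<close> is taken.\<close>
  proof (rule exI[of _ "\<lambda>X. \<eta> (FO H' X) \<cdot> FA F (\<theta> X)"], intro conjI ballI)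
    fix X Y f assume *: "X \<in> Obj C" "Y \<in> Obj C" "f \<in> Hom C X Y"
    note [simp] = Ff[OF Hf[OF *(3)], unfolded Hom_iff] Ff[OF Hf'[OF *(3)], unfolded Hom_iff] Ff'[OF Hf'[OF *(3)], unfolded Hom_iff]
    have "\<eta> (FO H' Y) \<cdot> FA F (\<theta> Y) \<cdot> FA F (FA H f) = \<eta> (FO H' Y) \<cdot> FA F (\<theta> Y \<cdot> FA H f)"
      using * by (simp add: Fc[OF Hf[OF *(3)] eta'])
    also have "\<dots> = \<eta> (FO H' Y) \<cdot> FA F (FA H' f) \<cdot> FA F (\<theta> X)"
      using * by (simp add: nat'[OF *] Fc[OF eta' Hf'[OF *(3)]])
    also have "\<dots> = FA F' (FA H' f) \<cdot> (\<eta> (FO H' X) \<cdot> FA F (\<theta> X))"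
      using * by (simp only: nat[OF Ho' Ho' Hf']) simp
    finally show "\<eta> (FO H' Y) \<cdot> FA F (\<theta> Y) \<cdot> FA F (FA H f) = FA F' (FA H' f) \<cdot> (\<eta> (FO H' X) \<cdot> FA F (\<theta> X))" .
  next
    fix X Y assume *: "X \<in> Obj C" "Y \<in> Obj C"
    note [simp] = Ff[OF HJ[OF *], unfolded Hom_iff] Ff[OF HJ'[OF *], unfolded Hom_iff] Ff'[OF HJ'[OF *], unfolded Hom_iff]
      FJ[OF Ho[OF *(1)] Ho[OF *(2)], unfolded Hom_iff] FJ[OF Ho'[OF *(1)] Ho'[OF *(2)], unfolded Hom_iff]
      FJ'[OF Ho'[OF *(1)] Ho'[OF *(2)], unfolded Hom_iff]
    have ee: "\<theta> X \<boxdot> \<theta> Y \<in> Hom C (FO H X \<boxtimes> FO H Y) (FO H' X \<boxtimes> FO H' Y)"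
      using * by (simp add: Hom_def)
    note [simp] = Ff[OF ee, unfolded Hom_iff]
    have "\<eta> (FO H' (X \<boxtimes> Y)) \<cdot> FA F (\<theta> (X \<boxtimes> Y)) \<cdot> (FA F (FJ H X Y) \<cdot> FJ F (FO H X) (FO H Y)) =
        \<eta> (FO H' (X \<boxtimes> Y)) \<cdot> (FA F (\<theta> (X \<boxtimes> Y) \<cdot> FJ H X Y) \<cdot> FJ F (FO H X) (FO H Y))"
      using * by (simp add: Fc[OF HJ eta'])
    also have "\<dots> = \<eta> (FO H' (X \<boxtimes> Y)) \<cdot> FA F (FJ H' X Y) \<cdot> (FA F (\<theta> X \<boxdot> \<theta> Y) \<cdot> FJ F (FO H X) (FO H Y))"
      using * by (simp add: ten'[OF *] Fc[OF ee HJ'])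
    also have "\<dots> = FA F' (FJ H' X Y) \<cdot> \<eta> (FO H' X \<boxtimes> FO H' Y) \<cdot> (FJ F (FO H' X) (FO H' Y) \<cdot> (FA F (\<theta> X) \<boxdot> FA F (\<theta> Y)))"
      using * by (simp only: FJn[OF eta' eta'] nat[OF ten_obj[OF Ho' Ho'] Ho'[OF ten_obj] HJ'])
    also have "\<dots> = FA F' (FJ H' X Y) \<cdot> (\<eta> (FO H' X \<boxtimes> FO H' Y) \<cdot> FJ F (FO H' X) (FO H' Y) \<cdot> (FA F (\<theta> X) \<boxdot> FA F (\<theta> Y)))"
      using * by simp
    also have "\<dots> = FA F' (FJ H' X Y) \<cdot> FJ F' (FO H' X) (FO H' Y) \<cdot>
         ((\<eta> (FO H' X) \<cdot> FA F (\<theta> X)) \<boxdot> (\<eta> (FO H' Y) \<cdot> FA F (\<theta> Y)))"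
      using * by (simp only: ten[OF Ho' Ho']) (simp add: ten_comp')
    finally show "\<eta> (FO H' (X \<boxtimes> Y)) \<cdot> FA F (\<theta> (X \<boxtimes> Y)) \<cdot> (FA F (FJ H X Y) \<cdot> FJ F (FO H X) (FO H Y)) =
       FA F' (FJ H' X Y) \<cdot> FJ F' (FO H' X) (FO H' Y) \<cdot>
         ((\<eta> (FO H' X) \<cdot> FA F (\<theta> X)) \<boxdot> (\<eta> (FO H' Y) \<cdot> FA F (\<theta> Y)))" .
  qed (use eta eta' Ft_iso in \<open>auto simp: Hom_def intro: is_iso_comp\<close>)
qed

subsection \<open>Equivalences\<close>

lemma functorD:
  assumes "is_functor C C F"
  shows "\<And>X. X \<in> Obj C \<Longrightarrow> FO F X \<in> Obj C"
    and "\<And>X. X \<in> Obj C \<Longrightarrow> FA F (Id C X) = Id C (FO F X)"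
    and "\<And>X Y f. f \<in> Hom C X Y \<Longrightarrow> FA F f \<in> Hom C (FO F X) (FO F Y)"
    and "\<And>X Y Z f g. f \<in> Hom C X Y \<Longrightarrow> g \<in> Hom C Y Z \<Longrightarrow> FA F (g \<cdot> f) = FA F g \<cdot> FA F f"
proof -
  note F = assms[unfolded is_functor_def]
  show "\<And>X. X \<in> Obj C \<Longrightarrow> FO F X \<in> Obj C" "\<And>X. X \<in> Obj C \<Longrightarrow> FA F (Id C X) = Id C (FO F X)"
    using F by simp_all
  show "FA F f \<in> Hom C (FO F X) (FO F Y)" if "f \<in> Hom C X Y" for X Y f
    using F that hom_obj[OF that] by simp
  show "FA F (g \<cdot> f) = FA F g \<cdot> FA F f" if "f \<in> Hom C X Y" "g \<in> Hom C Y Z" for X Y Z f g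
    using F that hom_obj[OF that(1)] hom_obj[OF that(2)] by simp
qed

text \<open>By naturality \<open>f \<cdot> \<eta> X\<close> depends only on \<open>FA F f\<close>,
  and \<open>\<eta> X\<close> can be cancelled. Only one of the two natural isomorphisms of an
  equivalence is assumed, so that the lemma applies to the quasi-inverse as well.\<close>

lemma faithful_if_left_inverse:
  assumes F: "is_functor C C F" and K: "is_functor C C K"
    and nat: "is_nat_iso C C (comp_functor K F) id_functor \<eta>"
    and f: "f \<in> Hom C X Y" and g: "g \<in> Hom C X Y" and eq: "FA F f = FA F g"
  shows "f = g"
proof -
  note o = hom_obj[OF f]
  have iso: "is_iso C (\<eta> X)" and e: "\<eta> X \<in> Hom C (FO K (FO F X)) X"
    using nat o unfolding is_nat_iso_def by (simp_all add: comp_functor_def id_functor_def)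
  have "f \<cdot> \<eta> X = g \<cdot> \<eta> X"
    using nat o f g eq unfolding is_nat_iso_def by (metis comp_functor_def fctr.simps(2) id_functor_def)
  then show ?thesis
    using comp_cancel_right[OF iso, of f Y g] f g e by (simp add: Hom_def)
qed

text \<open>The preimage is the image of \<open>h\<close> under the quasi-inverse \<open>K\<close>,
  conjugated by \<open>\<eta>\<close>. That \<open>F\<close> sends it to \<open>h\<close> is seen
  after applying \<open>K\<close>, which is faithful because of \<open>\<epsilon>\<close>.\<close>

lemma equivalence_full:
  assumes F: "is_equivalence C C F" and X: "X \<in> Obj C" and Y: "Y \<in> Obj C"
    and h: "h \<in> Hom C (FO F X) (FO F Y)"
  shows "\<exists>f\<in>Hom C X Y. FA F f = h"
proof -
  have fF: "is_functor C C F" using F by (simp add: is_equivalence_def)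
  obtain K :: "('o, 'm, 'o, 'm) fctr" and \<epsilon> \<eta> where K: "is_functor C C K"
    and eps: "is_nat_iso C C (comp_functor F K) id_functor \<epsilon>"
    and eta: "is_nat_iso C C (comp_functor K F) id_functor \<eta>"
    using F unfolding is_equivalence_def by blast
  have iso: "is_iso C (\<eta> X)" "is_iso C (\<eta> Y)" and e: "\<eta> X \<in> Hom C (FO K (FO F X)) X" "\<eta> Y \<in> Hom C (FO K (FO F Y)) Y"
    using eta X Y unfolding is_nat_iso_def by (simp_all add: comp_functor_def id_functor_def)
  define f where "f = \<eta> Y \<cdot> (FA K h \<cdot> Inv C (\<eta> X))"
  note Kh = functorD(3)[OF K h]
  have f: "f \<in> Hom C X Y"
    unfolding f_def using comp_hom[OF comp_hom[OF Inv_hom[OF iso(1) e(1)] Kh] e(2)] .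
  note Ff = functorD(3)[OF fF f]
  note KF = functorD(3)[OF K Ff]
  have "\<eta> Y \<cdot> FA K (FA F f) = f \<cdot> \<eta> X"
    using eta X Y f unfolding is_nat_iso_def by (simp add: comp_functor_def id_functor_def)
  also have "\<dots> = \<eta> Y \<cdot> FA K h"
    unfolding f_def using e iso Kh by (simp add: Hom_def)
  finally have "FA K (FA F f) = FA K h"
    using comp_cancel_left[OF iso(2), of "FA K (FA F f)" "FO K (FO F X)" "FA K h"] KF Kh e by (simp add: Hom_def)
  then have "FA F f = h"
    using faithful_if_left_inverse[OF K fF eps Ff h] by simp
  then show ?thesis
    using f by blast
qed

lemma equivalence_faithful:
  assumes F: "is_equivalence C C F" and "f \<in> Hom C X Y" "g \<in> Hom C X Y" "FA F f = FA F g"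
  shows "f = g"
  using F faithful_if_left_inverse[of F _ _ f X Y g] assms(2-) unfolding is_equivalence_def by blast

text \<open>With a strict inverse on objects and arrows, identities serve as both natural
  isomorphisms.\<close>

lemma is_equivalence_if_inverse:
  fixes F :: "('o, 'm, 'o, 'm, 'w) fctr_scheme" and K :: "('o, 'm, 'o, 'm, 'v) fctr_scheme"
  assumes F: "is_functor C C F" and K: "is_functor C C K"
    and o: "\<And>X. X \<in> Obj C \<Longrightarrow> FO F (FO K X) = X" "\<And>X. X \<in> Obj C \<Longrightarrow> FO K (FO F X) = X"
    and a: "\<And>f. f \<in> Arr C \<Longrightarrow> FA F (FA K f) = f" "\<And>f. f \<in> Arr C \<Longrightarrow> FA K (FA F f) = f"
  shows "is_equivalence C C F"
proof -
  let ?K = "\<lparr>FO = FO K, FA = FA K\<rparr>"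
  have "is_functor C C ?K"
    using K unfolding is_functor_def by simp
  moreover have "is_nat_iso C C (comp_functor F ?K) id_functor (Id C)"
    "is_nat_iso C C (comp_functor ?K F) id_functor (Id C)"
    unfolding is_nat_iso_def comp_functor_def id_functor_def
    by (simp_all add: o a is_iso_id id_hom) (simp_all add: Hom_def a)
  ultimately show ?thesis
    unfolding is_equivalence_def using F by blast
qed

text \<open>The choice in \<open>quasi_inverse\<close> has a witness because an equivalence supplies
  a functor and \<open>\<epsilon>\<close>; beyond these properties nothing is known about the chosen
  pair.\<close>

lemma quasi_inverse_props:
  assumes "is_equivalence C C \<alpha>" and "quasi_inverse C \<alpha> = (K, \<epsilon>)"
  shows "is_functor C C K" "\<And>X. X \<in> Obj C \<Longrightarrow> \<epsilon> X \<in> Hom C (FO \<alpha> (FO K X)) X"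
    "\<And>X. X \<in> Obj C \<Longrightarrow> is_iso C (\<epsilon> X)"
proof -
  let ?P = "\<lambda>(K :: ('o, 'm, 'o, 'm) fctr, \<epsilon>). is_functor C C K \<and> is_nat_iso C C (comp_functor \<alpha> K) id_functor \<epsilon>"
  obtain K' :: "('o, 'm, 'o, 'm) fctr" and \<epsilon>' where "is_functor C C K'" "is_nat_iso C C (comp_functor \<alpha> K') id_functor \<epsilon>'"
    using assms(1) unfolding is_equivalence_def by blast
  then have "\<exists>x. ?P x"
    by (intro exI[of _ "(K', \<epsilon>')"]) simp
  then have "?P (quasi_inverse C \<alpha>)"
    unfolding quasi_inverse_def by (rule someI_ex)
  then show "is_functor C C K" "\<And>X. X \<in> Obj C \<Longrightarrow> \<epsilon> X \<in> Hom C (FO \<alpha> (FO K X)) X"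
    "\<And>X. X \<in> Obj C \<Longrightarrow> is_iso C (\<epsilon> X)"
    using assms(2) unfolding is_nat_iso_def by (simp_all add: comp_functor_def id_functor_def)
qed

subsection \<open>Functors that agree on a category\<close>

text \<open>Functors are records of total functions with arbitrary values off the category.
  Composites can therefore not be expected to be equal as records, only to agree on objects and
  arrows.\<close>

definition agree :: "('o, 'm, 'o, 'm) tfctr \<Rightarrow> ('o, 'm, 'o, 'm) tfctr \<Rightarrow> bool" where
  "agree F H \<longleftrightarrow> (\<forall>X\<in>Obj C. FO F X = FO H X) \<and> (\<forall>f\<in>Arr C. FA F f = FA H f) \<and>
     (\<forall>X\<in>Obj C. \<forall>Y\<in>Obj C. FJ F X Y = FJ H X Y)"

lemma agreeD:
  assumes "agree F H"
  shows "X \<in> Obj C \<Longrightarrow> FO H X = FO F X" "f \<in> Arr C \<Longrightarrow> FA H f = FA F f"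
    "X \<in> Obj C \<Longrightarrow> Y \<in> Obj C \<Longrightarrow> FJ H X Y = FJ F X Y" "f \<in> Hom C X Y \<Longrightarrow> FA H f = FA F f"
  using assms by (simp_all add: agree_def Hom_def)

lemma agree_functor:
  assumes a: "agree F H" and F: "is_functor C C F"
  shows "is_functor C C H"
  unfolding is_functor_def
proof (intro conjI ballI)
  fix X Y Z f g assume *: "f \<in> Hom C X Y" "g \<in> Hom C Y Z"
  show "FA H (g \<cdot> f) = FA H g \<cdot> FA H f"
    by (simp only: agreeD(4)[OF a *(1)] agreeD(4)[OF a *(2)] agreeD(4)[OF a comp_hom[OF *]] functorD(4)[OF F *])
qed (use functorD[OF F] agreeD[OF a] in simp_all)

lemma agree_tensor_functor:
  assumes a: "agree F H" and F: "is_tensor_functor C C F"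
  shows "is_tensor_functor C C H"
  unfolding is_tensor_functor_def is_linear_functor_def
proof (intro conjI ballI allI)
  note a' = agreeD[OF a] and F' = tensor_functorD[OF F]
  show "is_functor C C H"
    by (rule agree_functor[OF a F'(1)])
  show "isomorphic C (FO H (UnitO C)) (UnitO C)"
    using F unfolding is_tensor_functor_def by (simp add: a')
  fix X Y assume o: "X \<in> Obj C" "Y \<in> Obj C"
  show "FJ H X Y \<in> Hom C (FO H X \<boxtimes> FO H Y) (FO H (X \<boxtimes> Y))" "is_iso C (FJ H X Y)"
    using o F' by (simp_all add: a'(1,3))
  {
    fix f g assume f: "f \<in> Hom C X Y" "g \<in> Hom C X Y"
    show "FA H (Plus C f g) = Plus C (FA H f) (FA H g)"
      by (simp only: a'(4)[OF f(1)] a'(4)[OF f(2)] a'(4)[OF plus_hom[OF f]] F'(9)[OF f])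
  }
  {
    fix f c assume f: "f \<in> Hom C X Y"
    show "FA H (Scale C c f) = Scale C c (FA H f)"
      by (simp only: a'(4)[OF f] a'(4)[OF scale_hom[OF f]] F'(10)[OF f])
  }
  {
    fix X' Y' f g assume o': "X' \<in> Obj C" "Y' \<in> Obj C" and f: "f \<in> Hom C X X'" "g \<in> Hom C Y Y'"
    show "FJ H X' Y' \<cdot> (FA H f \<boxdot> FA H g) = FA H (f \<boxdot> g) \<cdot> FJ H X Y"
      by (simp only: a'(4)[OF f(1)] a'(4)[OF f(2)] a'(4)[OF ten_hom[OF f]] a'(3)[OF o] a'(3)[OF o'] F'(8)[OF f])
  }
  fix Z assume Z: "Z \<in> Obj C"
  show "FJ H (X \<boxtimes> Y) Z \<cdot> (FJ H X Y \<boxdot> Id C (FO H Z)) \<cdot> Assoc C (FO H X) (FO H Y) (FO H Z) =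
        FA H (Assoc C X Y Z) \<cdot> FJ H X (Y \<boxtimes> Z) \<cdot> (Id C (FO H X) \<boxdot> FJ H Y Z)"
    using F o Z unfolding is_tensor_functor_def
    by (simp only: a'(1,3) a'(4)[OF assoc_hom] ten_obj)
qed

lemma agree_equivalence:
  assumes a: "agree F H" and F: "is_equivalence C C F"
  shows "is_equivalence C C H"
proof -
  obtain K :: "('o, 'm, 'o, 'm) fctr" and \<epsilon> \<eta> where K: "is_functor C C K"
    and eps: "is_nat_iso C C (comp_functor F K) id_functor \<epsilon>"
    and eta: "is_nat_iso C C (comp_functor K F) id_functor \<eta>"
    using F unfolding is_equivalence_def by blast
  note K' = functorD[OF K]
  have K'': "\<lbrakk>X \<in> Obj C; Y \<in> Obj C; f \<in> Hom C X Y\<rbrakk> \<Longrightarrow> FA K f \<in> Arr C" for X Y f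
    using K'(3)[of f X Y] by (simp add: Hom_def)
  have "is_nat_iso C C (comp_functor H K) id_functor \<epsilon>"
    using eps K'' unfolding is_nat_iso_def by (simp add: comp_functor_def agreeD(1,2)[OF a] K'(1))
  moreover have "is_nat_iso C C (comp_functor K H) id_functor \<eta>"
    using eta unfolding is_nat_iso_def by (simp add: comp_functor_def agreeD(1,4)[OF a])
  ultimately show ?thesis
    using K agree_functor[OF a] F unfolding is_equivalence_def by blast
qed

lemma tensor_functor_iso_if_agree:
  assumes a: "agree F H" and F: "is_tensor_functor C C F"
  shows "tensor_functor_iso C C F H"
  using tensor_functor_iso_refl[OF F] unfolding tensor_functor_iso_def is_nat_iso_def
  by (simp add: agreeD(1,3,4)[OF a])

subsection \<open>The induction homomorphism\<close>

lemma center_objsD: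
  assumes "P \<in> center_objs C"
  shows "fst P \<in> Obj C" "snd P \<in> extensional (Obj C)"
    "\<And>X. X \<in> Obj C \<Longrightarrow> snd P X \<in> Hom C (X \<boxtimes> fst P) (fst P \<boxtimes> X)"
    "\<And>X. X \<in> Obj C \<Longrightarrow> is_iso C (snd P X)"
    "\<And>X Y f. f \<in> Hom C X Y \<Longrightarrow> snd P Y \<cdot> (f \<boxdot> Id C (fst P)) = (Id C (fst P) \<boxdot> f) \<cdot> snd P X"
    "\<And>X Y. X \<in> Obj C \<Longrightarrow> Y \<in> Obj C \<Longrightarrow> snd P (X \<boxtimes> Y) =
          Inv C (Assoc C (fst P) X Y) \<cdot> (snd P X \<boxdot> Id C Y) \<cdot> Assoc C X (fst P) Y \<cdot>
          (Id C X \<boxdot> snd P Y) \<cdot> Inv C (Assoc C X Y (fst P))"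
proof -
  have hb: "fst P \<in> Obj C" "is_half_braiding C (fst P) (snd P)"
    using assms by (auto simp: center_objs_def)
  note hb' = hb(2)[unfolded is_half_braiding_def]
  show "fst P \<in> Obj C" "snd P \<in> extensional (Obj C)"
    "\<And>X. X \<in> Obj C \<Longrightarrow> snd P X \<in> Hom C (X \<boxtimes> fst P) (fst P \<boxtimes> X)"
    "\<And>X. X \<in> Obj C \<Longrightarrow> is_iso C (snd P X)"
    "\<And>X Y. X \<in> Obj C \<Longrightarrow> Y \<in> Obj C \<Longrightarrow> snd P (X \<boxtimes> Y) =
          Inv C (Assoc C (fst P) X Y) \<cdot> (snd P X \<boxdot> Id C Y) \<cdot> Assoc C X (fst P) Y \<cdot>
          (Id C X \<boxdot> snd P Y) \<cdot> Inv C (Assoc C X Y (fst P))"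
    using hb(1) hb' by blast+
  show "snd P Y \<cdot> (f \<boxdot> Id C (fst P)) = (Id C (fst P) \<boxdot> f) \<cdot> snd P X" if "f \<in> Hom C X Y" for X Y f
    using hb' that hom_obj[OF that] by blast
qed

lemma ind_obj_fst: "fst (ind_obj C \<alpha> P) = FO \<alpha> (fst P)"
  unfolding ind_obj_def by (simp add: split_def)

lemma ind_obj_extensional: "snd (ind_obj C \<alpha> P) \<in> extensional (Obj C)"
  unfolding ind_obj_def by (simp add: split_def)

text \<open>The induced half-braiding does not depend on the quasi-inverse: any isomorphism
  \<open>\<zeta> : \<alpha> X' \<rightarrow> X\<close> may be used to compute its component at \<open>X\<close>.\<close>

lemma ind_half_braiding:
  assumes \<alpha>: "is_tensor_functor C C \<alpha>" "is_equivalence C C \<alpha>" and P: "P \<in> center_objs C"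
    and X': "X' \<in> Obj C" and z: "\<zeta> \<in> Hom C (FO \<alpha> X') X" and zi: "is_iso C \<zeta>"
  shows "snd (ind_obj C \<alpha> P) X = (Id C (FO \<alpha> (fst P)) \<boxdot> \<zeta>) \<cdot> (Inv C (FJ \<alpha> (fst P) X') \<cdot>
      (FA \<alpha> (snd P X') \<cdot> (FJ \<alpha> X' (fst P) \<cdot> (Inv C \<zeta> \<boxdot> Id C (FO \<alpha> (fst P))))))" (is "?L = ?R")
    and "snd (ind_obj C \<alpha> P) X \<in> Hom C (X \<boxtimes> FO \<alpha> (fst P)) (FO \<alpha> (fst P) \<boxtimes> X)"
    and "is_iso C (snd (ind_obj C \<alpha> P) X)"
proof -
  obtain K \<epsilon> where KE: "quasi_inverse C \<alpha> = (K, \<epsilon>)"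
    by force
  define Z \<gamma> where "Z = fst P" and "\<gamma> = snd P"
  note Pz = center_objsD[OF P, folded Z_def \<gamma>_def]
  note q = quasi_inverse_props[OF \<alpha>(2) KE] and A = tensor_functorD[OF \<alpha>(1)]
  have X: "X \<in> Obj C" using hom_obj(2)[OF z] .
  define Y where "Y = FO K X"
  have Y: "Y \<in> Obj C" unfolding Y_def using functorD(1)[OF q(1) X] .
  note e = q(2)[OF X, folded Y_def] and ei = q(3)[OF X]
  have aZ [simp]: "FO \<alpha> Z \<in> Obj C" using A(2) Pz(1) by simp
  have [simp]: "FO \<alpha> X' \<in> Obj C" "FO \<alpha> Y \<in> Obj C" using A(2) X' Y by simp_all
  note JZX = A(6)[OF Pz(1) X'] A(7)[OF Pz(1) X'] and JZY = A(6)[OF Pz(1) Y] A(7)[OF Pz(1) Y]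
    and JXZ = A(6)[OF X' Pz(1)] A(7)[OF X' Pz(1)] and JYZ = A(6)[OF Y Pz(1)] A(7)[OF Y Pz(1)]
  note gX = A(4)[OF Pz(3)[OF X']] functor_iso[OF A(1) Pz(4)[OF X']]
    and gY = A(4)[OF Pz(3)[OF Y]] functor_iso[OF A(1) Pz(4)[OF Y]]
  have L: "?L = (Id C (FO \<alpha> Z) \<boxdot> \<epsilon> X) \<cdot> (Inv C (FJ \<alpha> Z Y) \<cdot>
      (FA \<alpha> (\<gamma> Y) \<cdot> (FJ \<alpha> Y Z \<cdot> (Inv C (\<epsilon> X) \<boxdot> Id C (FO \<alpha> Z)))))"
    unfolding ind_obj_def KE Y_def[symmetric] Z_def[symmetric]
    using X Y Pz(1) e ei JZY JYZ gY by (simp add: split_def Z_def[symmetric] \<gamma>_def[symmetric] Y_def[symmetric] Hom_def)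
  have Lh: "?L \<in> Hom C (X \<boxtimes> FO \<alpha> Z) (FO \<alpha> Z \<boxtimes> X)"
    unfolding L using X Y Pz(1) e ei JZY JYZ gY by (simp add: Hom_def)
  show "?L \<in> Hom C (X \<boxtimes> FO \<alpha> (fst P)) (FO \<alpha> (fst P) \<boxtimes> X)"
    using Lh by (simp add: Z_def)
  show "is_iso C ?L"
    unfolding L using X Y Pz(1) e ei JZY JYZ gY
    by (intro is_iso_comp is_iso_ten is_iso_id is_iso_Inv) (simp_all add: Hom_def)
  \<comment> \<open>Fullness lifts the comparison of the two presentations of \<open>X\<close> to an
    arrow \<open>\<theta>\<close> from \<open>Y\<close> to \<open>X'\<close>. Naturality of the
    half-braiding along \<open>\<theta>\<close> then carries one formula into the other.\<close>
  obtain \<theta> where th: "\<theta> \<in> Hom C Y X'" and t: "FA \<alpha> \<theta> = Inv C \<zeta> \<cdot> \<epsilon> X"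
    using equivalence_full[OF \<alpha>(2) Y X' comp_hom[OF e Inv_hom[OF zi z]]] by blast
  note th' = A(4)[OF th]
  have zt: "\<zeta> \<cdot> FA \<alpha> \<theta> = \<epsilon> X"
    unfolding t using e zi z by (simp add: Hom_def)
  have idZ: "FA \<alpha> (Id C Z) = Id C (FO \<alpha> Z)" "Id C Z \<in> Hom C Z Z"
    using A(3) Pz(1) id_hom by simp_all
  have n1: "FJ \<alpha> X' Z \<cdot> (FA \<alpha> \<theta> \<boxdot> Id C (FO \<alpha> Z)) = FA \<alpha> (\<theta> \<boxdot> Id C Z) \<cdot> FJ \<alpha> Y Z"
    using A(8)[OF th idZ(2)] by (simp add: idZ)
  have n2: "FJ \<alpha> Z X' \<cdot> (Id C (FO \<alpha> Z) \<boxdot> FA \<alpha> \<theta>) = FA \<alpha> (Id C Z \<boxdot> \<theta>) \<cdot> FJ \<alpha> Z Y"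
    using A(8)[OF idZ(2) th] by (simp add: idZ)
  note h1 = A(4)[OF ten_hom[OF th idZ(2)]] and h2 = A(4)[OF ten_hom[OF idZ(2) th]]
  have n3: "Inv C (FJ \<alpha> Z X') \<cdot> FA \<alpha> (Id C Z \<boxdot> \<theta>) = (Id C (FO \<alpha> Z) \<boxdot> FA \<alpha> \<theta>) \<cdot> Inv C (FJ \<alpha> Z Y)"
    by (rule Inv_swap[OF JZX(2) JZY(2) _ h2 n2, of "FO \<alpha> Z \<boxtimes> FO \<alpha> Y" "FO \<alpha> Z \<boxtimes> FO \<alpha> X'"])
      (use JZX JZY th' in \<open>simp_all add: Hom_def\<close>)
  have n4: "FA \<alpha> (\<gamma> X') \<cdot> FA \<alpha> (\<theta> \<boxdot> Id C Z) = FA \<alpha> (Id C Z \<boxdot> \<theta>) \<cdot> FA \<alpha> (\<gamma> Y)"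
    unfolding A(5)[OF ten_hom[OF th idZ(2)] Pz(3)[OF X'], symmetric]
      A(5)[OF Pz(3)[OF Y] ten_hom[OF idZ(2) th], symmetric] Pz(5)[OF th] ..
  \<comment> \<open>Both sides are compared after composition with an isomorphism, which removes the
    inverse of \<open>\<epsilon> X\<close>.\<close>
  have "?R \<cdot> (\<epsilon> X \<boxdot> Id C (FO \<alpha> Z)) = (Id C (FO \<alpha> Z) \<boxdot> \<zeta>) \<cdot> (Inv C (FJ \<alpha> Z X') \<cdot>
      (FA \<alpha> (\<gamma> X') \<cdot> (FJ \<alpha> X' Z \<cdot> (FA \<alpha> \<theta> \<boxdot> Id C (FO \<alpha> Z)))))"
    unfolding Z_def[symmetric] \<gamma>_def[symmetric] t
    using X X' z zi e ei JZX JXZ gX by (simp add: Hom_def ten_comp')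
  also have "\<dots> = (Id C (FO \<alpha> Z) \<boxdot> \<zeta>) \<cdot> (Inv C (FJ \<alpha> Z X') \<cdot>
      (FA \<alpha> (\<gamma> X') \<cdot> FA \<alpha> (\<theta> \<boxdot> Id C Z) \<cdot> FJ \<alpha> Y Z))"
    unfolding n1 using z zi JZX JYZ gX h1 by (simp add: Hom_def)
  also have "\<dots> = (Id C (FO \<alpha> Z) \<boxdot> \<zeta>) \<cdot> (Inv C (FJ \<alpha> Z X') \<cdot> FA \<alpha> (Id C Z \<boxdot> \<theta>) \<cdot>
      (FA \<alpha> (\<gamma> Y) \<cdot> FJ \<alpha> Y Z))"
    unfolding n4 using z zi JZX JYZ gX gY h2 by (simp add: Hom_def)
  also have "\<dots> = (Id C (FO \<alpha> Z) \<boxdot> (\<zeta> \<cdot> FA \<alpha> \<theta>)) \<cdot> (Inv C (FJ \<alpha> Z Y) \<cdot> (FA \<alpha> (\<gamma> Y) \<cdot> FJ \<alpha> Y Z))"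
    unfolding n3 using z zi JZX JZY JYZ gX gY th' by (simp add: Hom_def ten_comp_reassoc)
  also have "\<dots> = ?L \<cdot> (\<epsilon> X \<boxdot> Id C (FO \<alpha> Z))"
    unfolding zt L using X Y e ei JZY JYZ gY by (simp add: Hom_def ten_comp')
  finally have eq: "?L \<cdot> (\<epsilon> X \<boxdot> Id C (FO \<alpha> Z)) = ?R \<cdot> (\<epsilon> X \<boxdot> Id C (FO \<alpha> Z))" ..
  have Rh: "?R \<in> Hom C (X \<boxtimes> FO \<alpha> Z) (FO \<alpha> Z \<boxtimes> X)"
    unfolding Z_def[symmetric] \<gamma>_def[symmetric] using X X' z zi JZX JXZ gX by (simp add: Hom_def)
  have ti: "is_iso C (\<epsilon> X \<boxdot> Id C (FO \<alpha> Z))"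
    using ei by (simp add: is_iso_ten is_iso_id)
  show "?L = ?R"
    by (rule comp_cancel_right[OF ti _ _ eq]) (use Lh Rh e in \<open>simp_all add: Hom_def\<close>)
qed

text \<open>This says that \<open>\<eta> (fst P)\<close> is an arrow of the center between the two
  induced objects, which is the reason why isomorphic tensor functors induce isomorphic
  functors.\<close>

lemma ind_natural:
  assumes F: "is_tensor_functor C C F" "is_equivalence C C F"
    and H: "is_tensor_functor C C H" "is_equivalence C C H"
    and eta: "\<And>X. X \<in> Obj C \<Longrightarrow> \<eta> X \<in> Hom C (FO F X) (FO H X)"
    and iso: "\<And>X. X \<in> Obj C \<Longrightarrow> is_iso C (\<eta> X)"
    and nat: "\<And>X Y f. \<lbrakk>X \<in> Obj C; Y \<in> Obj C; f \<in> Hom C X Y\<rbrakk> \<Longrightarrow> \<eta> Y \<cdot> FA F f = FA H f \<cdot> \<eta> X"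
    and ten: "\<And>X Y. X \<in> Obj C \<Longrightarrow> Y \<in> Obj C \<Longrightarrow> \<eta> (X \<boxtimes> Y) \<cdot> FJ F X Y = FJ H X Y \<cdot> (\<eta> X \<boxdot> \<eta> Y)"
    and P: "P \<in> center_objs C" and X: "X \<in> Obj C"
  shows "(\<eta> (fst P) \<boxdot> Id C X) \<cdot> snd (ind_obj C F P) X = snd (ind_obj C H P) X \<cdot> (Id C X \<boxdot> \<eta> (fst P))"
proof -
  obtain K \<epsilon> where KE: "quasi_inverse C H = (K, \<epsilon>)"
    by force
  define Z \<gamma> where "Z = fst P" and "\<gamma> = snd P"
  note Pz = center_objsD[OF P, folded Z_def \<gamma>_def]
  note q = quasi_inverse_props[OF H(2) KE] and A = tensor_functorD[OF F(1)] and B = tensor_functorD[OF H(1)]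
  define Y where "Y = FO K X"
  have Y: "Y \<in> Obj C" unfolding Y_def using functorD(1)[OF q(1) X] .
  note e = q(2)[OF X, folded Y_def] and ei = q(3)[OF X]
  have [simp]: "FO F Z \<in> Obj C" "FO H Z \<in> Obj C" "FO F Y \<in> Obj C" "FO H Y \<in> Obj C"
    using A(2) B(2) Pz(1) Y by simp_all
  note yh = eta[OF Y] and yi = iso[OF Y] and zh = eta[OF Pz(1)] and zi = iso[OF Pz(1)]
  \<comment> \<open>The same object \<open>Y\<close> presents \<open>X\<close> through
    \<open>H\<close> by \<open>\<epsilon> X\<close> and through \<open>F\<close> by
    \<open>?z\<close>, so both induced half-braidings are expressed by one and the same
    \<open>\<gamma> Y\<close>.\<close>
  let ?z = "\<epsilon> X \<cdot> \<eta> Y"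
  have z: "?z \<in> Hom C (FO F Y) X" "is_iso C ?z"
    using comp_hom[OF yh e] is_iso_comp[OF yi ei] yh e by (simp_all add: Hom_def)
  note iF = ind_half_braiding[OF F P Y z, folded Z_def \<gamma>_def]
    and iH = ind_half_braiding[OF H P Y e ei, folded Z_def \<gamma>_def]
  note JF = A(6)[OF Pz(1) Y] A(7)[OF Pz(1) Y] A(6)[OF Y Pz(1)] A(7)[OF Y Pz(1)]
    and JH = B(6)[OF Pz(1) Y] B(7)[OF Pz(1) Y] B(6)[OF Y Pz(1)] B(7)[OF Y Pz(1)]
  note gF = A(4)[OF Pz(3)[OF Y]] and gH = B(4)[OF Pz(3)[OF Y]]
  note oZY = ten_obj[OF Pz(1) Y] and oYZ = ten_obj[OF Y Pz(1)]
  have n1: "(\<eta> Z \<boxdot> \<eta> Y) \<cdot> Inv C (FJ F Z Y) = Inv C (FJ H Z Y) \<cdot> \<eta> (Z \<boxtimes> Y)"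
    by (rule sym, rule Inv_swap[OF JH(2) JF(2) _ eta[OF oZY] ten[OF Pz(1) Y, symmetric], of "FO F Z \<boxtimes> FO F Y" "FO H Z \<boxtimes> FO H Y"])
      (use JH JF zh yh in \<open>simp_all add: Hom_def\<close>)
  have "(\<eta> Z \<boxdot> Id C X) \<cdot> snd (ind_obj C F P) X \<cdot> (?z \<boxdot> Id C (FO F Z)) =
     (Id C (FO H Z) \<boxdot> \<epsilon> X) \<cdot> ((\<eta> Z \<boxdot> \<eta> Y) \<cdot> Inv C (FJ F Z Y) \<cdot> (FA F (\<gamma> Y) \<cdot> FJ F Y Z))"
    unfolding iF(1) using X Y z JF gF zh yh e by (simp add: Hom_def ten_comp' ten_comp_reassoc)
  also have "\<dots> = (Id C (FO H Z) \<boxdot> \<epsilon> X) \<cdot> (Inv C (FJ H Z Y) \<cdot> (\<eta> (Z \<boxtimes> Y) \<cdot> FA F (\<gamma> Y) \<cdot> FJ F Y Z))"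
    unfolding n1 using X Y JF JH gF zh yh e eta[OF oZY] by (simp add: Hom_def)
  also have "\<dots> = (Id C (FO H Z) \<boxdot> \<epsilon> X) \<cdot> (Inv C (FJ H Z Y) \<cdot> (FA H (\<gamma> Y) \<cdot> (\<eta> (Y \<boxtimes> Z) \<cdot> FJ F Y Z)))"
    unfolding nat[OF oYZ oZY Pz(3)[OF Y]] using X Y JF JH gF gH zh yh e eta[OF oYZ] by (simp add: Hom_def)
  also have "\<dots> = (Id C (FO H Z) \<boxdot> \<epsilon> X) \<cdot> (Inv C (FJ H Z Y) \<cdot> (FA H (\<gamma> Y) \<cdot> (FJ H Y Z \<cdot> (\<eta> Y \<boxdot> \<eta> Z))))"
    unfolding ten[OF Y Pz(1)] ..
  also have "\<dots> = snd (ind_obj C H P) X \<cdot> (Id C X \<boxdot> \<eta> Z) \<cdot> (?z \<boxdot> Id C (FO F Z))"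
    unfolding iH(1) using X Y JH gH zh yh e ei by (simp add: Hom_def ten_comp' ten_comp_reassoc)
  finally have eq: "(\<eta> Z \<boxdot> Id C X) \<cdot> snd (ind_obj C F P) X \<cdot> (?z \<boxdot> Id C (FO F Z)) =
    snd (ind_obj C H P) X \<cdot> (Id C X \<boxdot> \<eta> Z) \<cdot> (?z \<boxdot> Id C (FO F Z))" .
  have ti: "is_iso C (?z \<boxdot> Id C (FO F Z))"
    using z by (simp add: is_iso_ten is_iso_id)
  show ?thesis
    unfolding Z_def[symmetric]
    by (rule comp_cancel_right[OF ti _ _ eq, of "FO H Z \<boxtimes> X"])
      (use iF(2) iH(2) e yh zh X in \<open>simp_all add: Hom_def\<close>)
qed

lemma drinfeld_center_simps [simp]:
  "Obj (drinfeld_center C) = center_objs C"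
  "Arr (drinfeld_center C) = center_arrs C"
  "Dom (drinfeld_center C) (P, f, Q) = P"
  "Cod (drinfeld_center C) (P, f, Q) = Q"
  "Id (drinfeld_center C) P = (P, Id C (fst P), P)"
  "Comp (drinfeld_center C) (P', g, Q') (P, f, Q) = (P, g \<cdot> f, Q')"
  "Plus (drinfeld_center C) (P, f, Q) (P', g, Q') = (P, Plus C f g, Q)"
  "Scale (drinfeld_center C) c (P, f, Q) = (P, Scale C c f, Q)"
  "TenO (drinfeld_center C) = center_ten C"
  "TenA (drinfeld_center C) (P, f, Q) (P', g, Q') = (center_ten C P P', f \<boxdot> g, center_ten C Q Q')"
  "UnitO (drinfeld_center C) = center_unit C"
  "Assoc (drinfeld_center C) P Q R = (center_ten C P (center_ten C Q R), Assoc C (fst P) (fst Q) (fst R),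
     center_ten C (center_ten C P Q) R)"
  "Braid (drinfeld_center C) P Q = (center_ten C P Q, snd Q (fst P), center_ten C Q P)"
  by (simp_all add: drinfeld_center_def)

lemma center_hom_iff:
  "x \<in> Hom (drinfeld_center C) P Q \<longleftrightarrow> (\<exists>f. x = (P, f, Q) \<and> (P, f, Q) \<in> center_arrs C)"
  unfolding Hom_def by (cases x) auto

lemma center_arrsD:
  assumes "(P, f, Q) \<in> center_arrs C"
  shows "P \<in> center_objs C" "Q \<in> center_objs C" "f \<in> Hom C (fst P) (fst Q)"
    "\<And>X. X \<in> Obj C \<Longrightarrow> (f \<boxdot> Id C X) \<cdot> snd P X = snd Q X \<cdot> (Id C X \<boxdot> f)"
  using assms by (simp_all add: center_arrs_def)

text \<open>Compatibility with the half-braidings is a commutative square for each \<open>X\<close>,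
  hence is inherited by the inverse; isomorphisms of the center can be tested on the underlying
  arrows.\<close>

lemma center_Inv:
  assumes a: "(P, f, Q) \<in> center_arrs C" and i: "is_iso C f"
  shows "is_inverse (drinfeld_center C) (P, f, Q) (Q, Inv C f, P)"
    and "is_iso (drinfeld_center C) (P, f, Q)"
proof -
  note a' = center_arrsD[OF a]
  have "(Inv C f \<boxdot> Id C X) \<cdot> snd Q X = snd P X \<cdot> (Id C X \<boxdot> Inv C f)" if X: "X \<in> Obj C" for X
  proof -
    have "Inv C (f \<boxdot> Id C X) \<cdot> snd Q X = snd P X \<cdot> Inv C (Id C X \<boxdot> f)"
      by (rule Inv_swap[OF _ _ center_objsD(3)[OF a'(1) X] center_objsD(3)[OF a'(2) X] a'(4)[OF X]])
        (use a' X i in \<open>simp_all add: Hom_def is_iso_ten is_iso_id\<close>)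
    then show ?thesis
      using X i by (simp add: is_iso_ten is_iso_id)
  qed
  then have "(Q, Inv C f, P) \<in> center_arrs C"
    using a' Inv_hom[OF i a'(3)] by (simp add: center_arrs_def)
  then show "is_inverse (drinfeld_center C) (P, f, Q) (Q, Inv C f, P)"
    unfolding is_inverse_def using a a' i by (simp add: center_hom_iff Hom_def)
  then show "is_iso (drinfeld_center C) (P, f, Q)"
    unfolding is_iso_def by blast
qed

text \<open>The components of \<open>\<eta>\<close> at the underlying objects are those of the
  induced isomorphism. That induced objects and tensor products lie in the center is assumed here
  and proved where the half-braidings are explicit.\<close>

lemma tensor_functor_iso_ind:
  assumes F: "is_tensor_functor C C F" "is_equivalence C C F"
    and H: "is_tensor_functor C C H" "is_equivalence C C H"
    and FH: "tensor_functor_iso C C F H"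
    and obF: "\<And>P. P \<in> center_objs C \<Longrightarrow> ind_obj C F P \<in> center_objs C"
    and obH: "\<And>P. P \<in> center_objs C \<Longrightarrow> ind_obj C H P \<in> center_objs C"
    and tenc: "\<And>P Q. P \<in> center_objs C \<Longrightarrow> Q \<in> center_objs C \<Longrightarrow> center_ten C P Q \<in> center_objs C"
  shows "tensor_functor_iso (drinfeld_center C) (drinfeld_center C) (ind C F) (ind C H)"
proof -
  obtain \<eta> where "tensor_nat_iso F H \<eta>"
    using FH unfolding tensor_functor_iso_iff by blast
  note eta = tensor_nat_isoD(1)[OF this] and iso = tensor_nat_isoD(2)[OF this] and nat = tensor_nat_isoD(3)[OF this] and ten = tensor_nat_isoD(4)[OF this]
  define \<theta> where "\<theta> P = (ind_obj C F P, \<eta> (fst P), ind_obj C H P)" for P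
  have arr: "\<theta> P \<in> center_arrs C" if P: "P \<in> center_objs C" for P
    unfolding \<theta>_def center_arrs_def
    using obF[OF P] obH[OF P] center_objsD(1)[OF P] eta ind_natural[OF F H eta iso nat ten P]
    by (simp add: ind_obj_fst)
  have fctr: "FO (ind C A) = ind_obj C A" "FA (ind C A) (P, f, Q) = (ind_obj C A P, FA A f, ind_obj C A Q)"
    "FJ (ind C A) P Q = (center_ten C (ind_obj C A P) (ind_obj C A Q), FJ A (fst P) (fst Q),
        ind_obj C A (center_ten C P Q))" for A P f Q
    by (simp_all add: ind_def)
  have fst_ten: "fst (center_ten C P Q) = fst P \<boxtimes> fst Q" for P Q
    by (simp add: center_ten_def)
  show ?thesis
    unfolding tensor_functor_iso_def is_nat_iso_def fctr drinfeld_center_simps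
  proof (rule exI[of _ \<theta>], intro conjI ballI)
    fix P assume P: "P \<in> center_objs C"
    show "\<theta> P \<in> Hom (drinfeld_center C) (ind_obj C F P) (ind_obj C H P)"
      using arr[OF P] unfolding center_hom_iff \<theta>_def by blast
    show "is_iso (drinfeld_center C) (\<theta> P)"
      using center_Inv(2) arr[OF P] iso[OF center_objsD(1)[OF P]] unfolding \<theta>_def by blast
  next
    fix P Q f assume *: "P \<in> center_objs C" "Q \<in> center_objs C" "f \<in> Hom (drinfeld_center C) P Q"
    obtain g where g: "f = (P, g, Q)" "(P, g, Q) \<in> center_arrs C"
      using *(3) by (auto simp: center_hom_iff)
    show "\<theta> Q \<cdot>\<^bsub>drinfeld_center C\<^esub> FA (ind C F) f = FA (ind C H) f \<cdot>\<^bsub>drinfeld_center C\<^esub> \<theta> P"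
      unfolding g \<theta>_def using nat[OF _ _ center_arrsD(3)[OF g(2)]] *(1,2)
      by (simp add: fctr center_objsD(1))
  next
    fix P Q assume *: "P \<in> center_objs C" "Q \<in> center_objs C"
    show "\<theta> (center_ten C P Q) \<cdot>\<^bsub>drinfeld_center C\<^esub>
        (center_ten C (ind_obj C F P) (ind_obj C F Q), FJ F (fst P) (fst Q), ind_obj C F (center_ten C P Q)) =
        (center_ten C (ind_obj C H P) (ind_obj C H Q), FJ H (fst P) (fst Q), ind_obj C H (center_ten C P Q))
        \<cdot>\<^bsub>drinfeld_center C\<^esub> (\<theta> P \<boxdot>\<^bsub>drinfeld_center C\<^esub> \<theta> Q)"
      unfolding \<theta>_def using ten * by (simp add: fst_ten center_objsD(1))
  qed
qed

end

subsection \<open>Classes of braided autoequivalences\<close>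

locale braided_precategory = tensor_precategory C
  for C :: "('o, 'm, 'k, 'z) lin_brcat_scheme" (structure) +
  assumes braid_hom: "\<lbrakk>X \<in> Obj C; Y \<in> Obj C\<rbrakk> \<Longrightarrow> Braid C X Y \<in> Hom C (X \<boxtimes> Y) (Y \<boxtimes> X)"
begin

lemma agree_braided_autoeqs:
  assumes a: "agree F H" and F: "F \<in> braided_autoeqs C"
  shows "H \<in> braided_autoeqs C"
  using F agree_tensor_functor[OF a] agree_equivalence[OF a]
  unfolding braided_autoeqs_def is_braided_functor_def
  by (simp add: agreeD(1,3)[OF a] agreeD(4)[OF a braid_hom])

lemma braided_autoeqs_tensor: "F \<in> braided_autoeqs C \<Longrightarrow> is_tensor_functor C C F"
  unfolding braided_autoeqs_def is_braided_functor_def by simp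

lemma equiv_braided_iso_rel: "equiv (braided_autoeqs C) (braided_iso_rel C)"
proof (rule equivI)
  show "sym (braided_iso_rel C)"
    unfolding sym_def braided_iso_rel_def using tensor_functor_iso_sym braided_autoeqs_tensor by blast
  show "trans (braided_iso_rel C)"
    unfolding trans_def braided_iso_rel_def using tensor_functor_iso_trans braided_autoeqs_tensor by blast
  show "refl_on (braided_autoeqs C) (braided_iso_rel C)"
    unfolding refl_on_def braided_iso_rel_def using tensor_functor_iso_refl braided_autoeqs_tensor by blast
qed (auto simp: braided_iso_rel_def)

lemma braided_class_eq_iff:
  assumes "F \<in> braided_autoeqs C" "H \<in> braided_autoeqs C"
  shows "braided_iso_rel C `` {F} = braided_iso_rel C `` {H} \<longleftrightarrow> tensor_functor_iso C C F H"
  using eq_equiv_class_iff[OF equiv_braided_iso_rel assms] assms by (auto simp: braided_iso_rel_def)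

lemma agree_braided_class:
  assumes "agree F H" "F \<in> braided_autoeqs C"
  shows "braided_iso_rel C `` {H} = braided_iso_rel C `` {F}"
  using braided_class_eq_iff[OF assms(2) agree_braided_autoeqs[OF assms]]
    tensor_functor_iso_if_agree[OF assms(1) braided_autoeqs_tensor[OF assms(2)]] by simp

lemma Aut_braided_mult:
  assumes F: "F \<in> braided_autoeqs C" and H: "H \<in> braided_autoeqs C"
    and FH: "comp_tensor_functor C F H \<in> braided_autoeqs C"
  shows "braided_iso_rel C `` {F} \<otimes>\<^bsub>Aut_braided C\<^esub> braided_iso_rel C `` {H} =
    braided_iso_rel C `` {comp_tensor_functor C F H}"
proof -
  let ?R = "braided_iso_rel C"
  have "?R `` {comp_tensor_functor C F' H'} \<subseteq> ?R `` {comp_tensor_functor C F H}"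
    if "F' \<in> ?R `` {F}" "H' \<in> ?R `` {H}" for F' H'
  \<comment> \<open>The product of two classes is a union over all pairs of representatives. A
    composite that is a braided autoequivalence contributes the class of the composite of
    \<open>F\<close> and \<open>H\<close>, any other one the empty set.\<close>
  proof (cases "comp_tensor_functor C F' H' \<in> braided_autoeqs C")
    case True
    have "tensor_functor_iso C C (comp_tensor_functor C F H) (comp_tensor_functor C F' H')"
      using that F H by (intro tensor_functor_iso_comp braided_autoeqs_tensor) (auto simp: braided_iso_rel_def)
    then show ?thesis
      using braided_class_eq_iff[OF FH True] by simp
  next
    case False
    then show ?thesis
      by (auto simp: braided_iso_rel_def)
  qed
  moreover have "F \<in> ?R `` {F}" "H \<in> ?R `` {H}"
    using equiv_class_self[OF equiv_braided_iso_rel] F H by auto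
  ultimately show ?thesis
    unfolding Aut_braided_def quotient_group_def by auto
qed

end

section \<open>Linear maps of sequence spaces and their tensor products\<close>

interpretation seqpair: vector_space_pair "vec_scale :: 'k::field \<Rightarrow> _" "vec_scale :: 'k \<Rightarrow> _"
  by unfold_locales

lemma vec_scale_apply [simp]: "vec_scale c v n = c * v n"
  by (simp add: vec_scale_def)

lemma vec_scale_vec_scale [simp]: "vec_scale a (vec_scale b v) = vec_scale (a * b) v"
  by (simp add: fun_eq_iff)

lemma vec_ten_apply [simp]: "vec_ten v w (prod_encode (i, j)) = v i * w j"
  by (simp add: vec_ten_def)

lemma vec_eqI: "(\<And>i j. t (prod_encode (i, j)) = s (prod_encode (i, j))) \<Longrightarrow> t = s"
  by (rule ext) (metis prod.collapse prod_decode_inverse)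

lemma vec_ten_simps:
  "vec_ten (u + v) w = vec_ten u w + vec_ten v w"
  "vec_ten u (v + w) = vec_ten u v + vec_ten u w"
  "vec_ten 0 v = 0" "vec_ten u 0 = 0"
  by (rule vec_eqI, simp add: algebra_simps)+

lemma vec_ten_scale [simp]:
  "vec_ten (vec_scale c u) v = vec_scale c (vec_ten u v)"
  "vec_ten u (vec_scale c v) = vec_scale c (vec_ten u v)"
  by (rule vec_eqI, simp)+

lemma vec_ten_eq_0_iff [simp]: "vec_ten v w = 0 \<longleftrightarrow> v = 0 \<or> w = 0"
proof
  assume z: "vec_ten v w = 0"
  show "v = 0 \<or> w = 0"
  proof (rule ccontr)
    assume "\<not> (v = 0 \<or> w = 0)"
    then obtain i j where "v i \<noteq> 0" "w j \<noteq> 0"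
      by (auto simp: fun_eq_iff)
    then show False
      using fun_cong[OF z, of "prod_encode (i, j)"] by simp
  qed
qed (auto simp: vec_ten_simps)

lemma vec_ten_cancel_right: "vec_ten v w = vec_ten v' w \<Longrightarrow> w \<noteq> 0 \<Longrightarrow> v = v'"
proof -
  assume e: "vec_ten v w = vec_ten v' w" and "w \<noteq> 0"
  then obtain j where "w j \<noteq> 0"
    by (auto simp: fun_eq_iff)
  then show ?thesis
    using fun_cong[OF e, of "prod_encode (_, j)"] by (auto simp: fun_eq_iff)
qed

lemma vec_unit_nonzero [simp]: "vec_unit \<noteq> (0 :: 'k::field vec)"
  by (auto simp: fun_eq_iff vec_unit_def)

lemma vec_scale_eq_0_iff [simp]: "vec_scale c v = 0 \<longleftrightarrow> c = 0 \<or> v = 0"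
  by (auto simp: fun_eq_iff)

lemma vec_scale_cancel: "vec_scale c v = vec_scale d v \<Longrightarrow> v \<noteq> 0 \<Longrightarrow> c = d"
  by (auto simp: fun_eq_iff)

lemma vec_ten_unit_unit: "vec_ten vec_unit vec_unit = (vec_unit :: 'k::field vec)"
proof (rule vec_eqI)
  fix i j
  have "prod_encode (i, j) = 0 \<longleftrightarrow> i = 0 \<and> j = 0"
    using prod_encode_eq[of "(i, j)" "(0, 0)"] by (simp add: prod_encode_def)
  then show "vec_ten vec_unit vec_unit (prod_encode (i, j)) = (vec_unit (prod_encode (i, j)) :: 'k)"
    by (simp add: vec_unit_def)
qed

lemma linear_onD:
  assumes "linear_on S f"
  shows "u \<in> S \<Longrightarrow> v \<in> S \<Longrightarrow> f (u + v) = f u + f v" "v \<in> S \<Longrightarrow> f (vec_scale c v) = vec_scale c (f v)"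
  using assms by (simp_all add: linear_on_def)

lemma vec_ten_linear: "linear_on S (\<lambda>v. vec_ten v w)" "linear_on S (\<lambda>w. vec_ten v w)"
  by (simp_all add: linear_on_def vec_ten_simps)

lemma linear_on_subset: "linear_on T f \<Longrightarrow> S \<subseteq> T \<Longrightarrow> linear_on S f"
  by (simp add: linear_on_def subset_iff)

lemma linear_on_restrict: "linear_on S (restrict f S) \<longleftrightarrow> linear_on S f" if "seqvec.subspace S"
  using that by (simp add: linear_on_def seqvec.subspace_add seqvec.subspace_scale)

lemma linear_on_zero:
  assumes "linear_on S f" "seqvec.subspace S"
  shows "f 0 = 0"
  using linear_onD(2)[OF assms(1) seqvec.subspace_0[OF assms(2)], of 0] by (simp only: seqvec.scale_zero_left)

lemma subspace_vimage:
  assumes f: "linear_on UNIV f" and T: "seqvec.subspace T"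
  shows "seqvec.subspace {v. f v \<in> T}"
  by (rule seqvec.subspaceI)
    (simp_all add: linear_onD[OF f] linear_on_zero[OF f] seqvec.subspace_0[OF T] seqvec.subspace_add[OF T]
      seqvec.subspace_scale[OF T] seqvec.subspace_UNIV)

text \<open>The vectors of \<open>S\<close> on which two linear maps agree form a subspace.\<close>

lemma linear_on_eq:
  assumes S: "linear_on S f" "linear_on S g" "seqvec.subspace S" and "v \<in> seqvec.span B" "B \<subseteq> S"
    and "\<And>b. b \<in> B \<Longrightarrow> f b = g b"
  shows "f v = g v"
proof -
  have "seqvec.subspace {v \<in> S. f v = g v}"
    using linear_on_zero[OF S(1,3)] linear_on_zero[OF S(2,3)] linear_onD[OF S(1)] linear_onD[OF S(2)] S(3)
    by (intro seqvec.subspaceI)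
      (simp_all add: seqvec.subspace_0[OF S(3)] seqvec.subspace_add[OF S(3)] seqvec.subspace_scale[OF S(3)])
  moreover have "B \<subseteq> {v \<in> S. f v = g v}"
    using assms(5,6) by auto
  ultimately show ?thesis
    using seqvec.span_minimal[of B] assms(4) by blast
qed

text \<open>Maps on subspaces are traded for maps on the whole sequence space, where composition and
  \<open>tens\<close> carry no domain conditions. The bound on the image lets the degree projections
  keep their range.\<close>

lemma linear_on_extend:
  assumes f: "linear_on S f" and S: "seqvec.subspace S"
  obtains F where "linear_on UNIV F" "\<And>v. v \<in> S \<Longrightarrow> F v = f v" "\<And>v. F v \<in> seqvec.span (f ` S)"
proof -
  obtain B where B: "B \<subseteq> S" "seqvec.independent B" "S \<subseteq> seqvec.span B"
    by (rule seqvec.maximal_independent_subset)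
  let ?F = "seqpair.construct B f"
  have lin: "linear_on UNIV ?F"
    using seqpair.linear_construct[OF B(2), of f] by (simp add: Vector_Spaces.linear_iff linear_on_def)
  moreover have "?F v = f v" if "v \<in> S" for v
  proof (rule linear_on_eq[OF linear_on_subset[OF lin subset_UNIV] f S])
    show "v \<in> seqvec.span B" using that B(3) by blast
  qed (use B seqpair.construct_basis in auto)
  moreover have "?F v \<in> seqvec.span (f ` S)" for v
    using seqpair.construct_in_span[OF B(2), of f v] seqvec.span_mono[OF image_mono[OF B(1)], of f] by blast
  ultimately show ?thesis
    using that by blast
qed

lemma linear_on_sum:
  assumes "linear_on UNIV f"
  shows "f (\<Sum>a\<in>A. u a) = (\<Sum>a\<in>A. f (u a))"
proof -
  have "f 0 = 0"
    by (rule linear_on_zero[OF assms seqvec.subspace_UNIV])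
  then show ?thesis
    by (induction A rule: infinite_finite_induct) (simp_all add: linear_onD[OF assms])
qed

text \<open>The tensor product of two maps in terms of infinite matrices: \<open>h\<close> is
  applied to every row, then \<open>f\<close> to every column. No decomposition into pure tensors is
  involved, so the map is defined on the whole sequence space.\<close>

definition tens :: "('k::field vec \<Rightarrow> 'k vec) \<Rightarrow> ('k vec \<Rightarrow> 'k vec) \<Rightarrow> 'k vec \<Rightarrow> 'k vec" where
  "tens f h t = (\<lambda>n. case prod_decode n of (i, j) \<Rightarrow> f (\<lambda>k. h (\<lambda>l. t (prod_encode (k, l))) j) i)"

lemma tens_linear:
  assumes f: "linear_on UNIV f" and h: "linear_on UNIV h"
  shows "linear_on UNIV (tens f h)"
  unfolding linear_on_def
proof (intro conjI ballI allI)
  fix t s :: "'a vec" and c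
  let ?r = "\<lambda>t k. (\<lambda>l. t (prod_encode (k, l)))"
  have row: "?r (t + s) k = ?r t k + ?r s k" "?r (vec_scale c t) k = vec_scale c (?r t k)" for k
    by (simp_all add: fun_eq_iff)
  have col: "(\<lambda>k. h (?r (t + s) k) j) = (\<lambda>k. h (?r t k) j) + (\<lambda>k. h (?r s k) j)"
    "(\<lambda>k. h (?r (vec_scale c t) k) j) = vec_scale c (\<lambda>k. h (?r t k) j)" for j
    unfolding row by (simp_all only: linear_onD[OF h] UNIV_I) (simp_all only: fun_eq_iff plus_fun_apply vec_scale_apply simp_thms)
  have e: "tens f h t (prod_encode (i, j)) = f (\<lambda>k. h (?r t k) j) i" for t i j
    by (simp only: tens_def prod_encode_inverse prod.case)
  show "tens f h (t + s) = tens f h t + tens f h s"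
    by (rule vec_eqI) (simp only: e col linear_onD(1)[OF f] UNIV_I, simp only: e plus_fun_apply)
  show "tens f h (vec_scale c t) = vec_scale c (tens f h t)"
    by (rule vec_eqI) (simp only: e col linear_onD(2)[OF f] UNIV_I, simp only: e vec_scale_apply)
qed

lemma tens_vec_ten:
  assumes f: "linear_on UNIV f" and h: "linear_on UNIV h"
  shows "tens f h (vec_ten v w) = vec_ten (f v) (h w)"
proof (rule vec_eqI)
  fix i j
  have 1: "(\<lambda>l. v k * w l) = vec_scale (v k) w" for k
    by (simp add: fun_eq_iff)
  have 2: "(\<lambda>k. h (vec_scale (v k) w) j) = vec_scale (h w j) v"
    by (simp add: fun_eq_iff linear_onD[OF h] mult.commute)
  show "tens f h (vec_ten v w) (prod_encode (i, j)) = vec_ten (f v) (h w) (prod_encode (i, j))"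
    by (simp add: tens_def 1 2 linear_onD[OF f] mult.commute)
qed

definition vswap :: "'k vec \<Rightarrow> 'k vec" where
  "vswap t = (\<lambda>n. case prod_decode n of (i, j) \<Rightarrow> t (prod_encode (j, i)))"

definition vassoc :: "'k vec \<Rightarrow> 'k vec" where
  "vassoc t = (\<lambda>n. case prod_decode n of (p, k) \<Rightarrow> case prod_decode p of (i, j) \<Rightarrow>
     t (prod_encode (i, prod_encode (j, k))))"

definition vassoc' :: "'k vec \<Rightarrow> 'k vec" where
  "vassoc' t = (\<lambda>n. case prod_decode n of (i, p) \<Rightarrow> case prod_decode p of (j, k) \<Rightarrow>
     t (prod_encode (prod_encode (i, j), k)))"

text \<open>Contraction with the first coordinate functional; it undoes tensoring with
  \<open>vec_unit\<close> on the left.\<close>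

definition lcut :: "'k vec \<Rightarrow> 'k vec" where
  "lcut t = (\<lambda>n. t (prod_encode (0, n)))"

definition rcut :: "'k vec \<Rightarrow> 'k vec" where
  "rcut t = (\<lambda>n. t (prod_encode (n, 0)))"

lemma maps_linear:
  "linear_on UNIV vswap" "linear_on UNIV vassoc" "linear_on UNIV vassoc'"
  "linear_on UNIV lcut" "linear_on UNIV rcut"
  by (auto simp: linear_on_def vswap_def vassoc_def vassoc'_def lcut_def rcut_def fun_eq_iff split: prod.splits)

lemma vec_maps_ten [simp]:
  "vswap (vec_ten v w) = vec_ten w v"
  "vassoc (vec_ten u (vec_ten v w)) = vec_ten (vec_ten u v) w"
  "vassoc' (vec_ten (vec_ten u v) w) = vec_ten u (vec_ten v w)"
  "lcut (vec_ten vec_unit v) = v" "rcut (vec_ten v vec_unit) = v"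
  by (auto simp: vswap_def vassoc_def vassoc'_def lcut_def rcut_def vec_ten_def vec_unit_def fun_eq_iff
      mult_ac split: prod.splits)

lemma linear_on_compose: "linear_on UNIV f \<Longrightarrow> linear_on UNIV g \<Longrightarrow> linear_on UNIV (\<lambda>v. f (g v))"
  by (simp add: linear_on_def)

lemma linear_on_scale: "linear_on UNIV f \<Longrightarrow> linear_on UNIV (\<lambda>v. vec_scale c (f v))"
  by (simp add: linear_on_def seqvec.scale_right_distrib mult.commute)

lemma linear_on_sums: "(\<And>a. a \<in> A \<Longrightarrow> linear_on UNIV (f a)) \<Longrightarrow> linear_on UNIV (\<lambda>v. \<Sum>a\<in>A. f a v)"
  by (simp add: linear_on_def sum.distrib seqvec.scale_sum_right)

lemma sum_if_eq:
  assumes "finite A" "a \<in> A" "\<And>b. b \<in> A \<Longrightarrow> b \<noteq> a \<Longrightarrow> f b = 0"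
  shows "(\<Sum>b\<in>A. f b) = f a"
  using sum.remove[OF assms(1,2), of f] sum.neutral[of "A - {a}" f] assms(3) by auto

section \<open>Graded vector spaces\<close>

locale finite_group = group G for G (structure) +
  assumes finite_carrier: "finite (carrier G)"
begin

abbreviation "\<G> \<equiv> carrier G"

abbreviation tot :: "('a, 'k::field) grspace \<Rightarrow> 'k vec set" where "tot \<equiv> total G"

abbreviation gten :: "('a, 'k::field) grspace \<Rightarrow> ('a, 'k) grspace \<Rightarrow> ('a, 'k) grspace" where "gten \<equiv> gr_ten G"

abbreviation shift :: "('a \<Rightarrow> 'a) \<Rightarrow> ('a, 'k::field) grspace \<Rightarrow> ('a, 'k) grspace" where "shift \<equiv> regrade G"

lemma total_iff: "v \<in> tot V \<longleftrightarrow> (\<exists>u. (\<forall>g\<in>\<G>. u g \<in> V g) \<and> v = (\<Sum>g\<in>\<G>. u g))"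
  unfolding total_def by auto

lemma totalE:
  assumes "v \<in> tot V"
  obtains u where "\<forall>g\<in>\<G>. u g \<in> V g" "v = (\<Sum>g\<in>\<G>. u g)"
  using assms unfolding total_iff by (elim exE conjE)

lemma gradedD:
  assumes "V \<in> graded_spaces G"
  shows "g \<in> \<G> \<Longrightarrow> seqvec.subspace (V g)"
    and "g \<in> \<G> \<Longrightarrow> \<exists>B. finite B \<and> V g = seqvec.span B"
    and "\<lbrakk>\<And>g. g \<in> \<G> \<Longrightarrow> u g \<in> V g; (\<Sum>g\<in>\<G>. u g) = 0; g \<in> \<G>\<rbrakk> \<Longrightarrow> u g = 0"
    and "g \<notin> \<G> \<Longrightarrow> V g = {0}"
    and "0 \<in> V g"
proof -
  note V = assms[unfolded graded_spaces_def mem_Collect_eq]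
  note V = V[THEN conjunct1] V[THEN conjunct2, THEN conjunct1] V[THEN conjunct2, THEN conjunct2]
  show "g \<in> \<G> \<Longrightarrow> seqvec.subspace (V g)" "g \<in> \<G> \<Longrightarrow> \<exists>B. finite B \<and> V g = seqvec.span B"
    using V(1) by blast+
  show "\<lbrakk>\<And>g. g \<in> \<G> \<Longrightarrow> u g \<in> V g; (\<Sum>g\<in>\<G>. u g) = 0; g \<in> \<G>\<rbrakk> \<Longrightarrow> u g = 0"
    using V(2) by blast
  show "g \<notin> \<G> \<Longrightarrow> V g = {0}"
    using V(3) by blast
  show "0 \<in> V g"
    using V(1,3) seqvec.subspace_0 by (cases "g \<in> \<G>") auto
qed

lemma gr_scale:
  assumes V: "V \<in> graded_spaces G"
  shows "v \<in> V g \<Longrightarrow> vec_scale c v \<in> V g"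
    and "v \<in> V g \<Longrightarrow> w \<in> V g \<Longrightarrow> v + w \<in> V g"
proof -
  have "seqvec.subspace (V g)"
    using gradedD(1,4)[OF V, of g] by (cases "g \<in> \<G>") simp_all
  from seqvec.subspace_scale[OF this] seqvec.subspace_add[OF this]
  show "v \<in> V g \<Longrightarrow> vec_scale c v \<in> V g" "v \<in> V g \<Longrightarrow> w \<in> V g \<Longrightarrow> v + w \<in> V g"
    by blast+
qed

lemma total_subspace:
  assumes V: "V \<in> graded_spaces G"
  shows "seqvec.subspace (tot V)"
proof (rule seqvec.subspaceI)
  show "0 \<in> tot V"
    unfolding total_iff using gradedD(5)[OF V] by (intro exI[of _ "\<lambda>_. 0"]) simp
  fix x y c assume "x \<in> tot V"
  then obtain u where u: "\<forall>g\<in>\<G>. u g \<in> V g" "x = (\<Sum>g\<in>\<G>. u g)"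
    unfolding total_iff by blast
  show "vec_scale c x \<in> tot V"
    unfolding total_iff u using u(1) gr_scale(1)[OF V]
    by (intro exI[of _ "\<lambda>g. vec_scale c (u g)"]) (simp add: seqvec.scale_sum_right)
  assume "y \<in> tot V"
  then obtain u' where u': "\<forall>g\<in>\<G>. u' g \<in> V g" "y = (\<Sum>g\<in>\<G>. u' g)"
    unfolding total_iff by blast
  show "x + y \<in> tot V"
    unfolding total_iff u u' using u(1) u'(1) gr_scale(2)[OF V]
    by (intro exI[of _ "\<lambda>g. u g + u' g"]) (simp add: sum.distrib)
qed

lemma hom_total:
  assumes V: "V \<in> graded_spaces G" and g: "g \<in> \<G>" and v: "v \<in> V g"
  shows "v \<in> tot V"
proof -
  have "(\<Sum>h\<in>\<G>. if h = g then v else 0) = v"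
    using g finite_carrier by simp
  then show ?thesis
    unfolding total_iff using v gradedD(5)[OF V]
    by (intro exI[of _ "\<lambda>h. if h = g then v else 0"]) simp
qed

lemma decomposition_unique:
  assumes V: "V \<in> graded_spaces G" and u: "\<And>g. g \<in> \<G> \<Longrightarrow> u g \<in> V g" "\<And>g. g \<in> \<G> \<Longrightarrow> u' g \<in> V g"
    and eq: "(\<Sum>g\<in>\<G>. u g) = (\<Sum>g\<in>\<G>. u' g)" and g: "g \<in> \<G>"
  shows "u g = u' g"
proof -
  have "u h + vec_scale (-1) (u' h) \<in> V h" if "h \<in> \<G>" for h
    by (rule gr_scale(2)[OF V u(1)[OF that] gr_scale(1)[OF V u(2)[OF that]]])
  moreover have "(\<Sum>g\<in>\<G>. u g + vec_scale (-1) (u' g)) =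
      (\<Sum>g\<in>\<G>. u g) + vec_scale (-1) (\<Sum>g\<in>\<G>. u' g)"
    by (simp only: sum.distrib seqvec.scale_sum_right)
  then have "(\<Sum>g\<in>\<G>. u g + vec_scale (-1) (u' g)) = 0"
    unfolding eq by (simp only: fun_eq_iff plus_fun_apply vec_scale_apply zero_fun_apply) simp
  ultimately have "u g + vec_scale (-1) (u' g) = 0"
    by (rule gradedD(3)[OF V _ _ g])
  then show ?thesis
    by (simp add: fun_eq_iff)
qed

text \<open>Uniqueness of the decomposition makes its component in degree \<open>g\<close> linear on
  the total space. Extended to all sequences, it becomes a map with values in \<open>V g\<close>
  that can be applied without membership hypotheses.\<close>

lemma projections_exist:
  assumes V: "V \<in> graded_spaces G"
  shows "\<exists>P. \<forall>g\<in>\<G>. linear_on UNIV (P g) \<and> (\<forall>v. P g v \<in> V g) \<and>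
    (\<forall>h\<in>\<G>. \<forall>v\<in>V h. P g v = (if g = h then v else 0))"
proof -
  define d where "d v = (SOME u. (\<forall>g\<in>\<G>. u g \<in> V g) \<and> v = (\<Sum>g\<in>\<G>. u g))" for v
  have d: "(\<forall>g\<in>\<G>. d v g \<in> V g) \<and> v = (\<Sum>g\<in>\<G>. d v g)" if "v \<in> tot V" for v
    using that unfolding total_iff d_def by (rule someI_ex)
  have dI: "d v g = u g" if "\<And>g. g \<in> \<G> \<Longrightarrow> u g \<in> V g" "v = (\<Sum>g\<in>\<G>. u g)" "g \<in> \<G>" for v u g
  proof -
    have "v \<in> tot V" unfolding total_iff using that by blast
    then show ?thesis
      using decomposition_unique[OF V, of "d v" u g] d that by metis
  qed
  have "\<exists>F. linear_on UNIV F \<and> (\<forall>v. F v \<in> V g) \<and> (\<forall>h\<in>\<G>. \<forall>v\<in>V h. F v = (if g = h then v else 0))"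
    if g: "g \<in> \<G>" for g
  proof -
    have "linear_on (tot V) (\<lambda>v. d v g)"
      unfolding linear_on_def
    proof (intro conjI ballI allI)
      fix v w c assume v: "v \<in> tot V"
      show "d (vec_scale c v) g = vec_scale c (d v g)"
      proof (rule dI[of "\<lambda>g. vec_scale c (d v g)", OF _ _ g])
        show "vec_scale c (d v h) \<in> V h" if "h \<in> \<G>" for h
          using d[OF v] that gr_scale(1)[OF V] by blast
        show "vec_scale c v = (\<Sum>g\<in>\<G>. vec_scale c (d v g))"
          unfolding seqvec.scale_sum_right[symmetric] using d[OF v] by (rule arg_cong[OF conjunct2])
      qed
      assume w: "w \<in> tot V"
      show "d (v + w) g = d v g + d w g"
      proof (rule dI[of "\<lambda>g. d v g + d w g", OF _ _ g])
        show "d v h + d w h \<in> V h" if "h \<in> \<G>" for h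
          using d[OF v] d[OF w] that gr_scale(2)[OF V] by blast
        show "v + w = (\<Sum>g\<in>\<G>. d v g + d w g)"
          unfolding sum.distrib using d[OF v] d[OF w] by (rule arg_cong2[OF conjunct2 conjunct2])
      qed
    qed
    then obtain F where F: "linear_on UNIV F" "\<And>v. v \<in> tot V \<Longrightarrow> F v = d v g"
      "\<And>v. F v \<in> seqvec.span ((\<lambda>v. d v g) ` tot V)"
      by (rule linear_on_extend) (use total_subspace[OF V] in blast)+
    have "seqvec.span ((\<lambda>v. d v g) ` tot V) \<subseteq> V g"
      using d g by (intro seqvec.span_minimal gradedD(1)[OF V]) auto
    moreover have "F v = (if g = h then v else 0)" if h: "h \<in> \<G>" and v: "v \<in> V h" for h v
    proof -
      have "(\<Sum>k\<in>\<G>. if k = h then v else 0) = v"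
        using h finite_carrier by simp
      then have "d v g = (if g = h then v else 0)"
        using dI[of "\<lambda>k. if k = h then v else 0" v g] v g gradedD(5)[OF V] by auto
      then show ?thesis
        using F(2)[OF hom_total[OF V h v]] by simp
    qed
    ultimately show ?thesis
      using F by blast
  qed
  then show ?thesis
    by metis
qed

definition proj :: "('a, 'k::field) grspace \<Rightarrow> 'a \<Rightarrow> 'k vec \<Rightarrow> 'k vec" where
  "proj V = (SOME P. \<forall>g\<in>\<G>. linear_on UNIV (P g) \<and> (\<forall>v. P g v \<in> V g) \<and>
    (\<forall>h\<in>\<G>. \<forall>v\<in>V h. P g v = (if g = h then v else 0)))"

lemma proj:
  assumes V: "V \<in> graded_spaces G" and g: "g \<in> \<G>"
  shows "linear_on UNIV (proj V g)" "proj V g v \<in> V g"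
    "h \<in> \<G> \<Longrightarrow> w \<in> V h \<Longrightarrow> proj V g w = (if g = h then w else 0)"
  using someI_ex[OF projections_exist[OF V], folded proj_def] g by auto

text \<open>The point is independence of the components. It is seen from an operator that fixes one
  component and kills the others, built from the degree projections of the factors.\<close>

lemma ten_closed:
  fixes V W :: "('a, 'k::field) grspace"
  assumes V: "V \<in> graded_spaces G" and W: "W \<in> graded_spaces G"
  shows "gten V W \<in> graded_spaces G"
proof -
  have sub: "seqvec.subspace (gten V W g)" for g
    by (simp add: gr_ten_def)
  have "\<exists>B. finite B \<and> gten V W g = seqvec.span B" if g: "g \<in> \<G>" for g
  proof -
    obtain B where B: "\<And>x. x \<in> \<G> \<Longrightarrow> finite (B x) \<and> V x = seqvec.span (B x)"
      using gradedD(2)[OF V] by metis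
    obtain D where D: "\<And>x. x \<in> \<G> \<Longrightarrow> finite (D x) \<and> W x = seqvec.span (D x)"
      using gradedD(2)[OF W] by metis
    \<comment> \<open>In degree \<open>g\<close> the degree of the second factor is determined by
      that of the first, so finitely many products of spanning vectors suffice.\<close>
    define E where "E = (\<Union>x\<in>\<G>. (\<lambda>(b, c). vec_ten b c) ` (B x \<times> D (inv x \<otimes> g)))"
    have fin: "finite E"
      unfolding E_def using B D g finite_carrier by auto
    have E1: "vec_ten v w \<in> seqvec.span E" if x: "x \<in> \<G>" and y: "y = inv x \<otimes> g"
      and v: "v \<in> seqvec.span (B x)" and w: "w \<in> seqvec.span (D y)" for v w x y
    proof -
      have 1: "vec_ten b c \<in> seqvec.span E" if "b \<in> B x" "c \<in> D y" for b c
        unfolding E_def using that x y by (intro seqvec.span_base) auto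
      have 2: "vec_ten b w \<in> seqvec.span E" if "b \<in> B x" for b
        using seqvec.span_minimal[OF _ subspace_vimage[OF vec_ten_linear(2) seqvec.subspace_span[of E]], of "D y" b] w 1 that
        by blast
      show ?thesis
        using seqvec.span_minimal[OF _ subspace_vimage[OF vec_ten_linear(1) seqvec.subspace_span[of E]], of "B x" w] v 2
        by blast
    qed
    have "gten V W g = seqvec.span E"
      unfolding gr_ten_def
    proof (rule antisym; rule seqvec.span_minimal; (rule seqvec.subspace_span)?; rule subsetI)
      fix t assume "t \<in> {vec_ten v w | v w x y. x \<in> \<G> \<and> y \<in> \<G> \<and> x \<otimes> y = g \<and> v \<in> V x \<and> w \<in> W y}"
      then obtain v w x y where *: "t = vec_ten v w" "x \<in> \<G>" "y \<in> \<G>" "x \<otimes> y = g" "v \<in> V x" "w \<in> W y"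
        by blast
      have "y = inv x \<otimes> g"
        using * by (metis inv_solve_left m_closed)
      then show "t \<in> seqvec.span E"
        using E1[OF *(2)] * B D by blast
    next
      fix t assume "t \<in> E"
      then obtain x b c where *: "x \<in> \<G>" "b \<in> B x" "c \<in> D (inv x \<otimes> g)" "t = vec_ten b c"
        unfolding E_def by auto
      have "x \<otimes> (inv x \<otimes> g) = g" "inv x \<otimes> g \<in> \<G>"
        using * g by (simp_all add: m_assoc[symmetric])
      moreover have "b \<in> V x" "c \<in> W (inv x \<otimes> g)"
        using * B D calculation by (auto simp: seqvec.span_base)
      ultimately show "t \<in> seqvec.span {vec_ten v w | v w x y. x \<in> \<G> \<and> y \<in> \<G> \<and> x \<otimes> y = g \<and> v \<in> V x \<and> w \<in> W y}"
        using * by (intro seqvec.span_base) blast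
    qed
    then show ?thesis using fin by blast
  qed
  moreover have "u h = 0" if u: "\<forall>g\<in>\<G>. u g \<in> gten V W g" "(\<Sum>g\<in>\<G>. u g) = 0" and h: "h \<in> \<G>"
    for u h
  proof -
    \<comment> \<open>The projection onto degree \<open>h\<close>, as the sum of the projections
      onto the pairs of degrees with product \<open>h\<close>.\<close>
    define Q where "Q t = (\<Sum>x\<in>\<G>. tens (proj V x) (proj W (inv x \<otimes> h)) t)" for t
    have lin: "linear_on UNIV Q"
      unfolding Q_def using h by (intro linear_on_sums tens_linear proj V W) auto
    have Q0: "Q t = (if k = h then t else 0)" if k: "k \<in> \<G>" and t: "t \<in> gten V W k" for k t
    proof (rule linear_on_eq[OF lin _ _ t[unfolded gr_ten_def]])
      show "linear_on UNIV (\<lambda>t :: 'k vec. if k = h then t else 0)"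
        by (simp add: linear_on_def)
      fix b assume "b \<in> {vec_ten v w | v w x y. x \<in> \<G> \<and> y \<in> \<G> \<and> x \<otimes> y = k \<and> v \<in> V x \<and> w \<in> W y}"
      then obtain v w x y where b: "b = vec_ten v w" "x \<in> \<G>" "y \<in> \<G>" "x \<otimes> y = k" "v \<in> V x" "w \<in> W y"
        by blast
      have "Q b = (\<Sum>z\<in>\<G>. vec_ten (proj V z v) (proj W (inv z \<otimes> h) w))"
        unfolding Q_def b using h by (intro sum.cong tens_vec_ten proj V W) auto
      also have "\<dots> = vec_ten (proj V x v) (proj W (inv x \<otimes> h) w)"
        by (rule sum_if_eq[OF finite_carrier b(2)]) (use proj(3)[OF V _ b(2,5)] in \<open>auto simp: vec_ten_simps\<close>)
      also have "\<dots> = (if k = h then b else 0)"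
      proof -
        have "inv x \<otimes> h = y \<longleftrightarrow> k = h"
          using b h by (metis inv_solve_left m_closed inv_closed)
        then show ?thesis
          using proj(3)[OF V b(2) b(2,5)] proj(3)[OF W _ b(3,6), of "inv x \<otimes> h"] b h by (simp add: vec_ten_simps)
      qed
      finally show "Q b = (if k = h then b else 0)" .
    qed auto
    have "0 = Q (\<Sum>g\<in>\<G>. u g)"
      using u linear_on_zero[OF lin seqvec.subspace_UNIV] by simp
    also have "\<dots> = (\<Sum>g\<in>\<G>. Q (u g))"
      by (rule linear_on_sum[OF lin])
    also have "\<dots> = (\<Sum>g\<in>\<G>. if g = h then u h else 0)"
      by (rule sum.cong) (use Q0 u in auto)
    finally show ?thesis
      using h finite_carrier by simp
  qed
  moreover have "gten V W g = {0}" if "g \<notin> \<G>" for g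
  proof -
    have "{vec_ten v w | v w x y. x \<in> \<G> \<and> y \<in> \<G> \<and> x \<otimes> y = g \<and> v \<in> V x \<and> w \<in> W y} = {}"
      using that by auto
    then show ?thesis
      unfolding gr_ten_def by (simp only: seqvec.span_empty)
  qed
  ultimately show ?thesis
    unfolding graded_spaces_def using sub by blast
qed

lemma gr_ten_mem:
  assumes "x \<in> \<G>" "y \<in> \<G>" "v \<in> V x" "w \<in> W y"
  shows "vec_ten v w \<in> gten V W (x \<otimes> y)"
  unfolding gr_ten_def using assms by (intro seqvec.span_base) blast

lemma gr_unit_closed: "(gr_unit G :: ('a, 'k::field) grspace) \<in> graded_spaces G"
proof -
  have "\<exists>B. finite B \<and> (gr_unit G g :: 'k vec set) = seqvec.span B" for g
  proof (cases "g = \<one>")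
    case True
    then show ?thesis
      by (intro exI[of _ "{vec_unit}"]) (simp add: gr_unit_def)
  next
    case False
    then show ?thesis
      by (intro exI[of _ "{}"]) (simp only: gr_unit_def if_False finite.emptyI seqvec.span_empty simp_thms)
  qed
  moreover have "\<forall>g\<in>\<G>. u g = 0"
    if u: "(\<forall>g\<in>\<G>. u g \<in> gr_unit G g) \<and> (\<Sum>g\<in>\<G>. u g) = 0" for u :: "'a \<Rightarrow> 'k vec"
  proof -
    have 0: "u g = 0" if "g \<in> \<G>" "g \<noteq> \<one>" for g
      using bspec[OF conjunct1[OF u] that(1)] that(2) by (simp only: gr_unit_def if_False singleton_iff)
    have "(\<Sum>g\<in>\<G>. u g) = u \<one>"
      by (rule sum_if_eq[OF finite_carrier one_closed 0])
    then have "u \<one> = 0"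
      using u by (simp only:)
    then show ?thesis
      using 0 by metis
  qed
  moreover have "seqvec.subspace (gr_unit G g :: 'k vec set)" for g
    by (simp add: gr_unit_def)
  moreover have "(gr_unit G g :: 'k vec set) = {0}" if "g \<notin> \<G>" for g
    using that one_closed by (auto simp: gr_unit_def)
  ultimately show ?thesis
    unfolding graded_spaces_def by blast
qed

lemma total_ten:
  fixes V W :: "('a, 'k::field) grspace"
  assumes V: "V \<in> graded_spaces G" and W: "W \<in> graded_spaces G" and v: "v \<in> tot V" and w: "w \<in> tot W"
  shows "vec_ten v w \<in> tot (gten V W)"
proof -
  note S = total_subspace[OF ten_closed[OF V W]]
  obtain u where u: "\<forall>g\<in>\<G>. u g \<in> V g" "v = (\<Sum>g\<in>\<G>. u g)"
    using v by (rule totalE)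
  obtain u' where u': "\<forall>g\<in>\<G>. u' g \<in> W g" "w = (\<Sum>g\<in>\<G>. u' g)"
    using w by (rule totalE)
  have vw: "vec_ten v w = (\<Sum>g\<in>\<G>. \<Sum>h\<in>\<G>. vec_ten (u g) (u' h))"
    by (simp only: u(2) u'(2) linear_on_sum[OF vec_ten_linear(1)] linear_on_sum[OF vec_ten_linear(2)]) (rule sum.swap)
  have m: "vec_ten (u g) (u' h) \<in> tot (gten V W)" if "g \<in> \<G>" "h \<in> \<G>" for g h
    by (rule hom_total[OF ten_closed[OF V W] _ gr_ten_mem[where x = g and y = h]]) (use that u(1) u'(1) in simp_all)
  show ?thesis
    unfolding vw by (rule seqvec.subspace_sum[OF S], rule seqvec.subspace_sum[OF S], rule m)
qed

lemma linear_on_total_eq: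
  assumes V: "V \<in> graded_spaces G" and f: "linear_on (tot V) f" "linear_on (tot V) f'"
    and eq: "\<And>g v. g \<in> \<G> \<Longrightarrow> v \<in> V g \<Longrightarrow> f v = f' v" and v: "v \<in> tot V"
  shows "f v = f' v"
proof (rule linear_on_eq[OF f total_subspace[OF V]])
  show "v \<in> seqvec.span (\<Union>g\<in>\<G>. V g)"
  proof -
    obtain u where u: "\<forall>g\<in>\<G>. u g \<in> V g" "v = (\<Sum>g\<in>\<G>. u g)"
      using v by (rule totalE)
    show ?thesis
      unfolding u(2) by (rule seqvec.span_sum, rule seqvec.span_base) (use u(1) in blast)
  qed
qed (use eq hom_total[OF V] in auto)

lemma linear_on_ten_eq:
  assumes V: "V \<in> graded_spaces G" and W: "W \<in> graded_spaces G"
    and f: "linear_on (tot (gten V W)) f" "linear_on (tot (gten V W)) f'"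
    and eq: "\<And>x y v w. \<lbrakk>x \<in> \<G>; y \<in> \<G>; v \<in> V x; w \<in> W y\<rbrakk> \<Longrightarrow> f (vec_ten v w) = f' (vec_ten v w)"
    and t: "t \<in> tot (gten V W)"
  shows "f t = f' t"
proof (rule linear_on_total_eq[OF ten_closed[OF V W] f _ t])
  fix g t assume g: "g \<in> \<G>" and t: "t \<in> gten V W g"
  show "f t = f' t"
    by (rule linear_on_eq[OF f total_subspace[OF ten_closed[OF V W]] t[unfolded gr_ten_def]])
      (use eq total_ten[OF V W hom_total[OF V] hom_total[OF W]] in blast)+
qed

text \<open>The second factor is itself a space of sums of pure tensors, so determination by pure
  tensors is used twice, the second time with the homogeneous vector \<open>u\<close> held
  fixed.\<close>

lemma linear_on_ten3_eq:
  fixes U V W :: "('a, 'k::field) grspace"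
  assumes U: "U \<in> graded_spaces G" and V: "V \<in> graded_spaces G" and W: "W \<in> graded_spaces G"
    and f: "linear_on (tot (gten U (gten V W))) f" "linear_on (tot (gten U (gten V W))) f'"
    and eq: "\<And>x y z u v w. \<lbrakk>x \<in> \<G>; y \<in> \<G>; z \<in> \<G>; u \<in> U x; v \<in> V y; w \<in> W z\<rbrakk> \<Longrightarrow>
      f (vec_ten u (vec_ten v w)) = f' (vec_ten u (vec_ten v w))"
    and t: "t \<in> tot (gten U (gten V W))"
  shows "f t = f' t"
proof (rule linear_on_ten_eq[OF U ten_closed[OF V W] f _ t])
  fix x y u s assume *: "x \<in> \<G>" "y \<in> \<G>" "u \<in> U x" "s \<in> gten V W y"
  note u = hom_total[OF U *(1,3)] and s = hom_total[OF ten_closed[OF V W] *(2,4)]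
  have lin: "linear_on (tot (gten V W)) (\<lambda>s. h (vec_ten u s))"
    if "linear_on (tot (gten U (gten V W))) h" for h :: "'k vec \<Rightarrow> 'k vec"
    using linear_onD[OF that] total_ten[OF U ten_closed[OF V W] u] by (simp add: linear_on_def vec_ten_simps)
  show "f (vec_ten u s) = f' (vec_ten u s)"
    by (rule linear_on_ten_eq[OF V W lin[OF f(1)] lin[OF f(2)] _ s]) (use eq * in blast)
qed

lemma linear_on_ten3'_eq:
  fixes U V W :: "('a, 'k::field) grspace"
  assumes U: "U \<in> graded_spaces G" and V: "V \<in> graded_spaces G" and W: "W \<in> graded_spaces G"
    and f: "linear_on (tot (gten (gten U V) W)) f" "linear_on (tot (gten (gten U V) W)) f'"
    and eq: "\<And>x y z u v w. \<lbrakk>x \<in> \<G>; y \<in> \<G>; z \<in> \<G>; u \<in> U x; v \<in> V y; w \<in> W z\<rbrakk> \<Longrightarrow>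
      f (vec_ten (vec_ten u v) w) = f' (vec_ten (vec_ten u v) w)"
    and t: "t \<in> tot (gten (gten U V) W)"
  shows "f t = f' t"
proof (rule linear_on_ten_eq[OF ten_closed[OF U V] W f _ t])
  fix x y s w assume *: "x \<in> \<G>" "y \<in> \<G>" "s \<in> gten U V x" "w \<in> W y"
  note w = hom_total[OF W *(2,4)] and s = hom_total[OF ten_closed[OF U V] *(1,3)]
  have lin: "linear_on (tot (gten U V)) (\<lambda>s. h (vec_ten s w))"
    if "linear_on (tot (gten (gten U V) W)) h" for h :: "'k vec \<Rightarrow> 'k vec"
    using linear_onD[OF that] total_ten[OF ten_closed[OF U V] W _ w] by (simp add: linear_on_def vec_ten_simps)
  show "f (vec_ten s w) = f' (vec_ten s w)"
    by (rule linear_on_ten_eq[OF U V lin[OF f(1)] lin[OF f(2)] _ s]) (use eq * in blast)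
qed

lemma gr_ten_mem_map:
  assumes V: "V \<in> graded_spaces G" and W: "W \<in> graded_spaces G" and X: "X \<in> graded_spaces G"
    and f: "linear_on UNIV f"
    and eq: "\<And>x y v w. \<lbrakk>x \<in> \<G>; y \<in> \<G>; v \<in> V x; w \<in> W y\<rbrakk> \<Longrightarrow> f (vec_ten v w) \<in> X (x \<otimes> y)"
    and g: "g \<in> \<G>" and t: "t \<in> gten V W g"
  shows "f t \<in> X g"
proof -
  have "gten V W g \<subseteq> {t. f t \<in> X g}"
    unfolding gr_ten_def using eq
    by (intro seqvec.span_minimal subspace_vimage[OF f gradedD(1)[OF X g]]) blast
  then show ?thesis
    using t by blast
qed

end

section \<open>The category of graded vector spaces\<close>

locale graded_setup = finite_group G for G (structure) +
  fixes \<omega> :: "'a \<Rightarrow> 'a \<Rightarrow> 'a \<Rightarrow> 'k::field"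
  assumes cocycle: "is_cocycle3 G \<omega>"
begin

abbreviation "C \<equiv> graded_vect G \<omega>"

abbreviation comp_C (infixl \<open>\<bullet>\<close> 60) where "g \<bullet> f \<equiv> g \<cdot>\<^bsub>C\<^esub> f"

abbreviation ten_C (infixl \<open>\<odot>\<close> 70) where "f \<odot> g \<equiv> f \<boxdot>\<^bsub>C\<^esub> g"

abbreviation "GS \<equiv> (graded_spaces G :: ('a, 'k) grspace set)"

definition ap :: "('a, 'k) grmap \<Rightarrow> 'k vec \<Rightarrow> 'k vec" where
  "ap f = fst (snd f)"

lemma omega_nonzero [simp]: "\<lbrakk>x \<in> \<G>; y \<in> \<G>; z \<in> \<G>\<rbrakk> \<Longrightarrow> \<omega> x y z \<noteq> 0"
  using cocycle by (simp add: is_cocycle3_def)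

lemma omega_cocycle: "\<lbrakk>x \<in> \<G>; y \<in> \<G>; z \<in> \<G>; w \<in> \<G>\<rbrakk> \<Longrightarrow>
    \<omega> y z w * \<omega> x (y \<otimes> z) w * \<omega> x y z = \<omega> (x \<otimes> y) z w * \<omega> x y (z \<otimes> w)"
  using cocycle by (simp add: is_cocycle3_def)

lemma ap_simp [simp]: "ap (V, f, W) = f"
  by (simp add: ap_def)

lemma graded_vect_simps [simp]:
  "Obj C = graded_spaces G" "Arr C = graded_maps G" "Dom C (V, f, W) = V" "Cod C (V, f, W) = W"
  "Id C V = (V, (\<lambda>v\<in>tot V. v), V)"
  "Comp C (V', g, W') (V, f, W) = (V, compose (tot V) g f, W')"
  "Plus C (V, f, W) (V', g, W') = (V, (\<lambda>v\<in>tot V. f v + g v), W)"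
  "Scale C c (V, f, W) = (V, (\<lambda>v\<in>tot V. vec_scale c (f v)), W)"
  "TenO C = gten" "UnitO C = gr_unit G"
  by (simp_all add: graded_vect_def)

lemma hom_iff: "f \<in> Hom C V W \<longleftrightarrow> f = (V, ap f, W) \<and> V \<in> GS \<and> W \<in> GS \<and> ap f \<in> extensional (tot V) \<and>
    linear_on (tot V) (ap f) \<and> (\<forall>g\<in>\<G>. \<forall>v\<in>V g. ap f v \<in> W g)"
  by (cases f) (auto simp: Hom_def graded_maps_def)

lemma homD:
  assumes "f \<in> Hom C V W"
  shows "f = (V, ap f, W)" "V \<in> GS" "W \<in> GS" "ap f \<in> extensional (tot V)" "linear_on (tot V) (ap f)"
    "g \<in> \<G> \<Longrightarrow> v \<in> V g \<Longrightarrow> ap f v \<in> W g"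
  using assms unfolding hom_iff by blast+

lemma homI:
  assumes "V \<in> GS" "W \<in> GS" "linear_on (tot V) F" "\<And>g v. g \<in> \<G> \<Longrightarrow> v \<in> V g \<Longrightarrow> F v \<in> W g"
  shows "(V, restrict F (tot V), W) \<in> Hom C V W"
  unfolding hom_iff using assms hom_total[OF assms(1)] linear_on_restrict[OF total_subspace[OF assms(1)]]
  by simp

lemma hom_eqI_total:
  assumes f: "f \<in> Hom C V W" and f': "f' \<in> Hom C V W" and eq: "\<And>v. v \<in> tot V \<Longrightarrow> ap f v = ap f' v"
  shows "f = f'"
proof -
  have "ap f = ap f'"
    by (rule extensionalityI[OF homD(4)[OF f] homD(4)[OF f'] eq])
  then show ?thesis
    using homD(1)[OF f] homD(1)[OF f'] by simp
qed

lemma hom_eqI: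
  assumes f: "f \<in> Hom C V W" and f': "f' \<in> Hom C V W"
    and eq: "\<And>g v. g \<in> \<G> \<Longrightarrow> v \<in> V g \<Longrightarrow> ap f v = ap f' v"
  shows "f = f'"
  by (rule hom_eqI_total[OF f f']) (rule linear_on_total_eq[OF homD(2)[OF f] homD(5)[OF f] homD(5)[OF f'] eq])

lemma hom_ten_eqI:
  assumes f: "f \<in> Hom C (gten V W) X" and f': "f' \<in> Hom C (gten V W) X" and VW: "V \<in> GS" "W \<in> GS"
    and eq: "\<And>x y v w. \<lbrakk>x \<in> \<G>; y \<in> \<G>; v \<in> V x; w \<in> W y\<rbrakk> \<Longrightarrow>
      ap f (vec_ten v w) = ap f' (vec_ten v w)"
  shows "f = f'"
  by (rule hom_eqI_total[OF f f']) (rule linear_on_ten_eq[OF VW homD(5)[OF f] homD(5)[OF f'] eq])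

lemma hom_ten3_eqI:
  assumes f: "f \<in> Hom C (gten U (gten V W)) X" and f': "f' \<in> Hom C (gten U (gten V W)) X"
    and UVW: "U \<in> GS" "V \<in> GS" "W \<in> GS"
    and eq: "\<And>x y z u v w. \<lbrakk>x \<in> \<G>; y \<in> \<G>; z \<in> \<G>; u \<in> U x; v \<in> V y; w \<in> W z\<rbrakk> \<Longrightarrow>
      ap f (vec_ten u (vec_ten v w)) = ap f' (vec_ten u (vec_ten v w))"
  shows "f = f'"
  by (rule hom_eqI_total[OF f f']) (rule linear_on_ten3_eq[OF UVW homD(5)[OF f] homD(5)[OF f'] eq])

lemma hom_ten3'_eqI:
  assumes f: "f \<in> Hom C (gten (gten U V) W) X" and f': "f' \<in> Hom C (gten (gten U V) W) X"
    and UVW: "U \<in> GS" "V \<in> GS" "W \<in> GS"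
    and eq: "\<And>x y z u v w. \<lbrakk>x \<in> \<G>; y \<in> \<G>; z \<in> \<G>; u \<in> U x; v \<in> V y; w \<in> W z\<rbrakk> \<Longrightarrow>
      ap f (vec_ten (vec_ten u v) w) = ap f' (vec_ten (vec_ten u v) w)"
  shows "f = f'"
  by (rule hom_eqI_total[OF f f']) (rule linear_on_ten3'_eq[OF UVW homD(5)[OF f] homD(5)[OF f'] eq])

lemma hom_extend:
  assumes f: "f \<in> Hom C V W"
  obtains F where "linear_on UNIV F" "\<And>v. v \<in> tot V \<Longrightarrow> ap f v = F v"
proof -
  obtain F where "linear_on UNIV F" "\<And>v. v \<in> tot V \<Longrightarrow> F v = ap f v"
    using linear_on_extend[OF homD(5)[OF f] total_subspace[OF homD(2)[OF f]]] by metis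
  then show thesis
    by (intro that[of F]) simp_all
qed

lemma ap_total:
  assumes f: "f \<in> Hom C V W" and v: "v \<in> tot V"
  shows "ap f v \<in> tot W"
proof -
  obtain F where F: "linear_on UNIV F" "\<And>v. v \<in> tot V \<Longrightarrow> ap f v = F v"
    using hom_extend[OF f] by metis
  obtain u where u: "\<forall>g\<in>\<G>. u g \<in> V g" "v = (\<Sum>g\<in>\<G>. u g)"
    using v by (rule totalE)
  have uh: "F (u g) \<in> W g" if g: "g \<in> \<G>" for g
    using homD(6)[OF f g bspec[OF u(1) g]] F(2)[OF hom_total[OF homD(2)[OF f] g bspec[OF u(1) g]]] by simp
  have "ap f v = (\<Sum>g\<in>\<G>. F (u g))"
    unfolding F(2)[OF v] unfolding u(2) by (rule linear_on_sum[OF F(1)])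
  then show ?thesis
    unfolding total_iff using uh by (intro exI[of _ "\<lambda>g. F (u g)"]) simp
qed

lemma ap_comp:
  assumes "f \<in> Hom C V W" "g \<in> Hom C W X" "v \<in> tot V"
  shows "ap (g \<bullet> f) v = ap g (ap f v)"
  using assms by (subst homD(1)[OF assms(1)], subst homD(1)[OF assms(2)]) (simp add: compose_eq)

lemma ap_id [simp]: "v \<in> tot V \<Longrightarrow> ap (V, \<lambda>v\<in>tot V. v, V) v = v"
  by simp

lemma ap_scale: "f \<in> Hom C V W \<Longrightarrow> v \<in> tot V \<Longrightarrow> ap f (vec_scale c v) = vec_scale c (ap f v)"
  using linear_onD(2)[OF homD(5)] .

lemma ap_add: "\<lbrakk>f \<in> Hom C V W; v \<in> tot V; w \<in> tot V\<rbrakk> \<Longrightarrow> ap f (v + w) = ap f v + ap f w"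
  using linear_onD(1)[OF homD(5)] .

lemma hom_comp:
  assumes f: "f \<in> Hom C V W" and g: "g \<in> Hom C W X"
  shows "g \<bullet> f \<in> Hom C V X"
proof -
  have "g \<bullet> f = (V, restrict (\<lambda>v. ap g (ap f v)) (tot V), X)"
    by (subst homD(1)[OF f], subst homD(1)[OF g]) (simp add: compose_def)
  also have "\<dots> \<in> Hom C V X"
  proof (rule homI[OF homD(2)[OF f] homD(3)[OF g]])
    show "linear_on (tot V) (\<lambda>v. ap g (ap f v))"
      using ap_total[OF f] by (simp add: linear_on_def ap_add[OF f] ap_scale[OF f] ap_add[OF g] ap_scale[OF g])
  qed (use homD(6)[OF f] homD(6)[OF g] in blast)
  finally show ?thesis .
qed

lemma id_in_hom: "V \<in> GS \<Longrightarrow> (V, \<lambda>v\<in>tot V. v, V) \<in> Hom C V V"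
  by (rule homI) (simp_all add: linear_on_def)

text \<open>A morphism given by \<open>the_linear\<close> can be computed with only after existence
  and uniqueness are known. The arrow \<open>f\<close> supplies the former; \<open>uniq\<close> is
  in each use an instance of determination by values on a spanning set.\<close>

lemma the_linear_eq:
  assumes f: "f \<in> Hom C A B" and P: "P (ap f)"
    and uniq: "\<And>h. \<lbrakk>h \<in> extensional (tot A); linear_on (tot A) h; P h\<rbrakk> \<Longrightarrow>
      \<forall>t\<in>tot A. h t = ap f t"
  shows "(A, the_linear (tot A) P, B) = f"
proof -
  have "the_linear (tot A) P = ap f"
    unfolding the_linear_def
  proof (rule the_equality)
    fix h assume h: "h \<in> extensional (tot A) \<and> linear_on (tot A) h \<and> P h"
    show "h = ap f"
      by (rule extensionalityI[of _ "tot A"]) (use h uniq homD(4)[OF f] in blast)+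
  qed (use homD(4,5)[OF f] P in blast)
  then show ?thesis
    using homD(1)[OF f] by simp
qed

text \<open>The map described in the definition of \<open>TenA\<close> exists because both factors
  extend to the whole sequence space, where \<open>tens\<close> is available.\<close>

lemma ten_in_hom_ap:
  assumes f: "f \<in> Hom C V V'" and g: "g \<in> Hom C W W'"
  shows "f \<odot> g \<in> Hom C (gten V W) (gten V' W')"
    and "v \<in> tot V \<Longrightarrow> w \<in> tot W \<Longrightarrow> ap (f \<odot> g) (vec_ten v w) = vec_ten (ap f v) (ap g w)"
proof -
  note VW = homD(2)[OF f] homD(2)[OF g] and VW' = homD(3)[OF f] homD(3)[OF g]
  obtain F where F: "linear_on UNIV F" "\<And>v. v \<in> tot V \<Longrightarrow> ap f v = F v"
    using hom_extend[OF f] by metis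
  obtain H where H: "linear_on UNIV H" "\<And>v. v \<in> tot W \<Longrightarrow> ap g v = H v"
    using hom_extend[OF g] by metis
  define a where "a = (gten V W, restrict (tens F H) (tot (gten V W)), gten V' W')"
  have FV: "F v \<in> V' x" if "x \<in> \<G>" "v \<in> V x" for x v
    using homD(6)[OF f that] F(2)[OF hom_total[OF VW(1) that]] by simp
  have HW: "H v \<in> W' x" if "x \<in> \<G>" "v \<in> W x" for x v
    using homD(6)[OF g that] H(2)[OF hom_total[OF VW(2) that]] by simp
  have a: "a \<in> Hom C (gten V W) (gten V' W')"
    unfolding a_def
  proof (rule homI[OF ten_closed[OF VW] ten_closed[OF VW'] linear_on_subset[OF tens_linear[OF F(1) H(1)] subset_UNIV]])
    show "tens F H t \<in> gten V' W' k" if "k \<in> \<G>" "t \<in> gten V W k" for k t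
      by (rule gr_ten_mem_map[OF VW ten_closed[OF VW'] tens_linear[OF F(1) H(1)] _ that])
        (simp add: tens_vec_ten[OF F(1) H(1)] gr_ten_mem FV HW)
  qed
  have ap_a: "ap a (vec_ten v w) = vec_ten (ap f v) (ap g w)" if "v \<in> tot V" "w \<in> tot W" for v w
    unfolding a_def using that total_ten[OF VW that] by (simp add: tens_vec_ten[OF F(1) H(1)] F(2) H(2))
  have "f \<odot> g = (gten V W, the_linear (tot (gten V W)) (\<lambda>\<phi>.
           \<forall>v\<in>tot V. \<forall>w\<in>tot W. \<phi> (vec_ten v w) = vec_ten (ap f v) (ap g w)), gten V' W')"
    by (subst homD(1)[OF f], subst homD(1)[OF g]) (simp add: graded_vect_def)
  also have "\<dots> = a"
  proof (rule the_linear_eq[OF a])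
    fix h assume h: "linear_on (tot (gten V W)) h"
      "\<forall>v\<in>tot V. \<forall>w\<in>tot W. h (vec_ten v w) = vec_ten (ap f v) (ap g w)"
    show "\<forall>t\<in>tot (gten V W). h t = ap a t"
    proof
      fix t assume t: "t \<in> tot (gten V W)"
      show "h t = ap a t"
        by (rule linear_on_ten_eq[OF VW h(1) homD(5)[OF a] _ t])
          (simp add: h(2) ap_a hom_total[OF VW(1)] hom_total[OF VW(2)])
    qed
  qed (use ap_a in blast)
  finally have fa: "f \<odot> g = a" .
  show "f \<odot> g \<in> Hom C (gten V W) (gten V' W')"
    unfolding fa by (rule a)
  show "v \<in> tot V \<Longrightarrow> w \<in> tot W \<Longrightarrow> ap (f \<odot> g) (vec_ten v w) = vec_ten (ap f v) (ap g w)"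
    unfolding fa by (rule ap_a)
qed

lemmas ten_in_hom = ten_in_hom_ap(1) and ap_ten = ten_in_hom_ap(2)

text \<open>Replaces the universal property of the tensor product: a linear map may be prescribed
  separately for every pair of degrees. The pieces are glued along the degree projections, so
  nothing has to be checked on relations between tensors.\<close>

lemma ten_hom_exists:
  assumes V: "V \<in> GS" and W: "W \<in> GS" and X: "X \<in> GS"
    and F: "\<And>x y. x \<in> \<G> \<Longrightarrow> y \<in> \<G> \<Longrightarrow> linear_on UNIV (F x y)"
    and FX: "\<And>x y v w. \<lbrakk>x \<in> \<G>; y \<in> \<G>; v \<in> V x; w \<in> W y\<rbrakk> \<Longrightarrow> F x y (vec_ten v w) \<in> X (x \<otimes> y)"
  shows "\<exists>f\<in>Hom C (gten V W) X. \<forall>x\<in>\<G>. \<forall>y\<in>\<G>. \<forall>v\<in>V x. \<forall>w\<in>W y.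
    ap f (vec_ten v w) = F x y (vec_ten v w)"
proof -
  define \<Phi> where "\<Phi> t = (\<Sum>x\<in>\<G>. \<Sum>y\<in>\<G>. F x y (tens (proj V x) (proj W y) t))" for t
  have lin: "linear_on UNIV \<Phi>"
    unfolding \<Phi>_def
    by (rule linear_on_sums, rule linear_on_sums)
      (rule linear_on_compose[OF F tens_linear[OF proj(1)[OF V] proj(1)[OF W]]])
  have \<Phi>: "\<Phi> (vec_ten v w) = F x y (vec_ten v w)"
    if x: "x \<in> \<G>" and y: "y \<in> \<G>" and v: "v \<in> V x" and w: "w \<in> W y" for x y v w
  proof -
    have 0: "F x' y' 0 = 0" if "x' \<in> \<G>" "y' \<in> \<G>" for x' y'
      using linear_on_zero[OF F[OF that] seqvec.subspace_UNIV] .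
    have t: "tens (proj V x') (proj W y') (vec_ten v w) = (if x' = x \<and> y' = y then vec_ten v w else 0)"
      if "x' \<in> \<G>" "y' \<in> \<G>" for x' y'
      using proj(3)[OF V that(1) x v] proj(3)[OF W that(2) y w]
      by (simp add: tens_vec_ten[OF proj(1)[OF V that(1)] proj(1)[OF W that(2)]] vec_ten_simps)
    have "\<Phi> (vec_ten v w) = (\<Sum>y'\<in>\<G>. F x y' (tens (proj V x) (proj W y') (vec_ten v w)))"
      unfolding \<Phi>_def by (rule sum_if_eq[OF finite_carrier x]) (simp add: t 0)
    also have "\<dots> = F x y (tens (proj V x) (proj W y) (vec_ten v w))"
      by (rule sum_if_eq[OF finite_carrier y]) (simp add: t 0 x)
    finally show ?thesis
      by (simp add: t x y)
  qed
  let ?f = "(gten V W, restrict \<Phi> (tot (gten V W)), X)"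
  have "?f \<in> Hom C (gten V W) X"
  proof (rule homI[OF ten_closed[OF V W] X linear_on_subset[OF lin subset_UNIV]])
    show "\<Phi> t \<in> X k" if "k \<in> \<G>" "t \<in> gten V W k" for k t
      by (rule gr_ten_mem_map[OF V W X lin _ that]) (simp add: \<Phi> FX)
  qed
  moreover have "ap ?f (vec_ten v w) = F x y (vec_ten v w)"
    if "x \<in> \<G>" "y \<in> \<G>" "v \<in> V x" "w \<in> W y" for x y v w
    using \<Phi>[OF that] total_ten[OF V W hom_total[OF V that(1,3)] hom_total[OF W that(2,4)]] by simp
  ultimately show ?thesis
    by blast
qed

text \<open>The scalar may depend on all three degrees, as the associator requires.\<close>

lemma ten3_hom_exists:
  assumes U: "U \<in> GS" and V: "V \<in> GS" and W: "W \<in> GS" and X: "X \<in> GS"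
    and F: "linear_on UNIV F"
    and FX: "\<And>x y z u v w. \<lbrakk>x \<in> \<G>; y \<in> \<G>; z \<in> \<G>; u \<in> U x; v \<in> V y; w \<in> W z\<rbrakk> \<Longrightarrow>
      F (vec_ten u (vec_ten v w)) \<in> X (x \<otimes> (y \<otimes> z))"
  shows "\<exists>f\<in>Hom C (gten U (gten V W)) X. \<forall>x\<in>\<G>. \<forall>y\<in>\<G>. \<forall>z\<in>\<G>.
    \<forall>u\<in>U x. \<forall>v\<in>V y. \<forall>w\<in>W z. ap f (vec_ten u (vec_ten v w)) = vec_scale (c x y z) (F (vec_ten u (vec_ten v w)))"
proof -
  \<comment> \<open>Only the degrees of the second and third factor are separated here; the degree
    \<open>x\<close> of the first one is selected by the later use of
    \<open>ten_hom_exists\<close>.\<close>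
  define \<Phi> where "\<Phi> x t = (\<Sum>y\<in>\<G>. \<Sum>z\<in>\<G>.
      vec_scale (c x y z) (F (tens (\<lambda>u. u) (tens (proj V y) (proj W z)) t)))" for x t
  have id: "linear_on UNIV (\<lambda>u :: 'k vec. u)"
    by (simp add: linear_on_def)
  have lin: "linear_on UNIV (\<Phi> x)" for x
    unfolding \<Phi>_def
    by (rule linear_on_sums, rule linear_on_sums, rule linear_on_scale)
      (rule linear_on_compose[OF F tens_linear[OF id tens_linear[OF proj(1)[OF V] proj(1)[OF W]]]])
  have F0: "F 0 = 0"
    by (rule linear_on_zero[OF F seqvec.subspace_UNIV])
  have \<Phi>: "\<Phi> x (vec_ten u (vec_ten v w)) = vec_scale (c x y z) (F (vec_ten u (vec_ten v w)))"
    if y: "y \<in> \<G>" and z: "z \<in> \<G>" and v: "v \<in> V y" and w: "w \<in> W z" for x y z u v w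
  proof -
    let ?T = "\<lambda>y' z'. vec_scale (c x y' z') (F (tens (\<lambda>u. u) (tens (proj V y') (proj W z')) (vec_ten u (vec_ten v w))))"
    have t: "?T y' z' = (if y' = y \<and> z' = z then vec_scale (c x y z) (F (vec_ten u (vec_ten v w))) else 0)"
      if "y' \<in> \<G>" "z' \<in> \<G>" for y' z'
      using proj(3)[OF V that(1) y v] proj(3)[OF W that(2) z w]
      by (simp add: tens_vec_ten[OF id tens_linear[OF proj(1)[OF V that(1)] proj(1)[OF W that(2)]]]
          tens_vec_ten[OF proj(1)[OF V that(1)] proj(1)[OF W that(2)]] vec_ten_simps F0)
    have "\<Phi> x (vec_ten u (vec_ten v w)) = (\<Sum>z'\<in>\<G>. ?T y z')"
      unfolding \<Phi>_def by (rule sum_if_eq[OF finite_carrier y]) (simp add: t)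
    also have "\<dots> = ?T y z"
      by (rule sum_if_eq[OF finite_carrier z]) (simp add: t y)
    finally show ?thesis
      by (simp add: t y z)
  qed
  have "\<Phi> x (vec_ten u s) \<in> X (x \<otimes> k)" if x: "x \<in> \<G>" and k: "k \<in> \<G>" and u: "u \<in> U x" and s: "s \<in> gten V W k" for x k u s
  proof -
    have "gten V W k \<subseteq> {s. \<Phi> x (vec_ten u s) \<in> X (x \<otimes> k)}"
      unfolding gr_ten_def
    proof (rule seqvec.span_minimal)
      show "seqvec.subspace {s. \<Phi> x (vec_ten u s) \<in> X (x \<otimes> k)}"
        by (rule subspace_vimage[OF linear_on_compose[OF lin vec_ten_linear(2)] gradedD(1)[OF X]]) (use x k in simp)
      show "{vec_ten v w | v w xa y. xa \<in> \<G> \<and> y \<in> \<G> \<and> xa \<otimes> y = k \<and> v \<in> V xa \<and> w \<in> W y}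
        \<subseteq> {s. \<Phi> x (vec_ten u s) \<in> X (x \<otimes> k)}"
      proof (rule subsetI)
        fix s assume "s \<in> {vec_ten v w | v w xa y. xa \<in> \<G> \<and> y \<in> \<G> \<and> xa \<otimes> y = k \<and> v \<in> V xa \<and> w \<in> W y}"
        then obtain v w y z where *: "s = vec_ten v w" "y \<in> \<G>" "z \<in> \<G>" "y \<otimes> z = k" "v \<in> V y" "w \<in> W z"
          by blast
        have "F (vec_ten u s) \<in> X (x \<otimes> k)"
          using FX[OF x *(2,3) u *(5,6)] by (simp only: *(1,4))
        then show "s \<in> {s. \<Phi> x (vec_ten u s) \<in> X (x \<otimes> k)}"
          unfolding mem_Collect_eq *(1) \<Phi>[OF *(2,3,5,6)] by (rule gr_scale(1)[OF X])
      qed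
    qed
    then show ?thesis
      using s by blast
  qed
  then obtain f where f: "f \<in> Hom C (gten U (gten V W)) X"
    and ap: "\<forall>x\<in>\<G>. \<forall>k\<in>\<G>. \<forall>u\<in>U x. \<forall>s\<in>gten V W k. ap f (vec_ten u s) = \<Phi> x (vec_ten u s)"
    using ten_hom_exists[OF U ten_closed[OF V W] X, of "\<lambda>x k. \<Phi> x"] lin by blast
  show ?thesis
  proof (rule bexI[OF _ f], intro ballI)
    fix x y z u v w assume *: "x \<in> \<G>" "y \<in> \<G>" "z \<in> \<G>" "u \<in> U x" "v \<in> V y" "w \<in> W z"
    have "ap f (vec_ten u (vec_ten v w)) = \<Phi> x (vec_ten u (vec_ten v w))"
      using ap gr_ten_mem[of y z v V w W] * by blast
    then show "ap f (vec_ten u (vec_ten v w)) = vec_scale (c x y z) (F (vec_ten u (vec_ten v w)))"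
      by (simp only: \<Phi>[OF *(2,3,5,6)])
  qed
qed

text \<open>The plain reassociation, without scalar. Followed by the diagonal map with entries
  \<open>1 / \<omega> x y z\<close> on the other bracketing, it inverts the associator.\<close>

lemma unassoc_hom_exists:
  assumes U: "U \<in> GS" and V: "V \<in> GS" and W: "W \<in> GS"
  shows "\<exists>f\<in>Hom C (gten (gten U V) W) (gten U (gten V W)). \<forall>x\<in>\<G>. \<forall>y\<in>\<G>. \<forall>z\<in>\<G>.
    \<forall>u\<in>U x. \<forall>v\<in>V y. \<forall>w\<in>W z. ap f (vec_ten (vec_ten u v) w) = vec_ten u (vec_ten v w)"
proof -
  let ?X = "gten U (gten V W)"
  note UV = ten_closed[OF U V] and X = ten_closed[OF U ten_closed[OF V W]]
  have m: "vassoc' (vec_ten s w) \<in> ?X (k \<otimes> z)" if *: "k \<in> \<G>" "z \<in> \<G>" "s \<in> gten U V k" "w \<in> W z" for k z s w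
  proof -
    have "gten U V k \<subseteq> {s. vassoc' (vec_ten s w) \<in> ?X (k \<otimes> z)}"
      unfolding gr_ten_def[of G U V]
    proof (rule seqvec.span_minimal[OF subsetI])
      show "seqvec.subspace {s. vassoc' (vec_ten s w) \<in> ?X (k \<otimes> z)}"
        by (rule subspace_vimage[OF linear_on_compose[OF maps_linear(3) vec_ten_linear(1)] gradedD(1)[OF X m_closed[OF *(1,2)]]])
      fix s assume "s \<in> {vec_ten v w | v w x y. x \<in> \<G> \<and> y \<in> \<G> \<and> x \<otimes> y = k \<and> v \<in> U x \<and> w \<in> V y}"
      then obtain u v x y where s: "s = vec_ten u v" "x \<in> \<G>" "y \<in> \<G>" "x \<otimes> y = k" "u \<in> U x" "v \<in> V y"
        by blast
      have "vec_ten u (vec_ten v w) \<in> ?X (x \<otimes> (y \<otimes> z))"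
        by (rule gr_ten_mem[of _ _ u U "vec_ten v w" "gten V W", OF s(2) m_closed[OF s(3) *(2)] s(5)
              gr_ten_mem[of y z v V w W, OF s(3) *(2) s(6) *(4)]])
      then show "s \<in> {s. vassoc' (vec_ten s w) \<in> ?X (k \<otimes> z)}"
        using s(2,3) *(2) by (simp add: s(1) s(4)[symmetric] m_assoc)
    qed
    then show ?thesis
      using *(3) by blast
  qed
  obtain f where f: "f \<in> Hom C (gten (gten U V) W) ?X"
    "\<forall>k\<in>\<G>. \<forall>z\<in>\<G>. \<forall>s\<in>gten U V k. \<forall>w\<in>W z. ap f (vec_ten s w) = vassoc' (vec_ten s w)"
    using ten_hom_exists[OF UV W X, of "\<lambda>k z. vassoc'"] m maps_linear(3) by blast
  show ?thesis
  proof (rule bexI[OF _ f(1)], intro ballI)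
    fix x y z u v w assume *: "x \<in> \<G>" "y \<in> \<G>" "z \<in> \<G>" "u \<in> U x" "v \<in> V y" "w \<in> W z"
    have "ap f (vec_ten (vec_ten u v) w) = vassoc' (vec_ten (vec_ten u v) w)"
      using f(2) gr_ten_mem[of x y u U v V] * by blast
    then show "ap f (vec_ten (vec_ten u v) w) = vec_ten u (vec_ten v w)"
      by simp
  qed
qed

lemma assoc_in_hom_ap:
  assumes U: "U \<in> GS" and V: "V \<in> GS" and W: "W \<in> GS"
  shows "Assoc C U V W \<in> Hom C (gten U (gten V W)) (gten (gten U V) W)"
    and "\<lbrakk>x \<in> \<G>; y \<in> \<G>; z \<in> \<G>; u \<in> U x; v \<in> V y; w \<in> W z\<rbrakk> \<Longrightarrow>
      ap (Assoc C U V W) (vec_ten u (vec_ten v w)) = vec_scale (\<omega> x y z) (vec_ten (vec_ten u v) w)"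
proof -
  note VW = ten_closed[OF V W] and UV = ten_closed[OF U V]
  have "\<exists>f\<in>Hom C (gten U (gten V W)) (gten (gten U V) W).
    \<forall>x\<in>\<G>. \<forall>y\<in>\<G>. \<forall>z\<in>\<G>. \<forall>u\<in>U x. \<forall>v\<in>V y. \<forall>w\<in>W z.
      ap f (vec_ten u (vec_ten v w)) = vec_scale (\<omega> x y z) (vassoc (vec_ten u (vec_ten v w)))"
  proof (rule ten3_hom_exists[OF U V W ten_closed[OF UV W] maps_linear(2)])
    fix x y z u v w assume *: "x \<in> \<G>" "y \<in> \<G>" "z \<in> \<G>" "u \<in> U x" "v \<in> V y" "w \<in> W z"
    show "vassoc (vec_ten u (vec_ten v w)) \<in> gten (gten U V) W (x \<otimes> (y \<otimes> z))"
      using gr_ten_mem[of "x \<otimes> y" z "vec_ten u v" "gten U V" w W] gr_ten_mem[of x y u U v V] * by (simp add: m_assoc)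
  qed
  then obtain a where a: "a \<in> Hom C (gten U (gten V W)) (gten (gten U V) W)"
    and apa: "\<forall>x\<in>\<G>. \<forall>y\<in>\<G>. \<forall>z\<in>\<G>. \<forall>u\<in>U x. \<forall>v\<in>V y. \<forall>w\<in>W z.
      ap a (vec_ten u (vec_ten v w)) = vec_scale (\<omega> x y z) (vec_ten (vec_ten u v) w)"
    by auto
  have "Assoc C U V W = (gten U (gten V W),
         the_linear (tot (gten U (gten V W))) (\<lambda>\<phi>.
           \<forall>x\<in>\<G>. \<forall>y\<in>\<G>. \<forall>z\<in>\<G>. \<forall>u\<in>U x. \<forall>v\<in>V y. \<forall>w\<in>W z.
             \<phi> (vec_ten u (vec_ten v w)) = vec_scale (\<omega> x y z) (vec_ten (vec_ten u v) w)),
         gten (gten U V) W)"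
    by (simp add: graded_vect_def)
  also have "\<dots> = a"
  proof (rule the_linear_eq[OF a], rule apa, rule ballI)
    fix h t assume h: "linear_on (tot (gten U (gten V W))) h"
      "\<forall>x\<in>\<G>. \<forall>y\<in>\<G>. \<forall>z\<in>\<G>. \<forall>u\<in>U x. \<forall>v\<in>V y. \<forall>w\<in>W z.
             h (vec_ten u (vec_ten v w)) = vec_scale (\<omega> x y z) (vec_ten (vec_ten u v) w)"
      and t: "t \<in> tot (gten U (gten V W))"
    show "h t = ap a t"
      by (rule linear_on_ten3_eq[OF U V W h(1) homD(5)[OF a] _ t]) (use h(2) apa in simp)
  qed
  finally have eq: "Assoc C U V W = a" .
  show "Assoc C U V W \<in> Hom C (gten U (gten V W)) (gten (gten U V) W)"
    unfolding eq by (rule a)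
  show "\<lbrakk>x \<in> \<G>; y \<in> \<G>; z \<in> \<G>; u \<in> U x; v \<in> V y; w \<in> W z\<rbrakk> \<Longrightarrow>
      ap (Assoc C U V W) (vec_ten u (vec_ten v w)) = vec_scale (\<omega> x y z) (vec_ten (vec_ten u v) w)"
    unfolding eq using apa by blast
qed

lemmas assoc_in_hom = assoc_in_hom_ap(1) and ap_assoc = assoc_in_hom_ap(2)

sublocale C: tensor_precategory C
proof
  fix f assume "f \<in> Arr C"
  then show "Dom C f \<in> Obj C" "Cod C f \<in> Obj C"
    by (auto simp: graded_maps_def)
next
  fix f g h X Y Z W assume f: "f \<in> Hom C W X" and g: "g \<in> Hom C X Y" and h: "h \<in> Hom C Y Z"
  note gf = hom_comp[OF f g] and hg = hom_comp[OF g h]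
  show "h \<bullet> g \<bullet> f = h \<bullet> (g \<bullet> f)"
    by (rule hom_eqI_total[OF hom_comp[OF f hg] hom_comp[OF gf h]])
      (simp add: ap_comp[OF f hg] ap_comp[OF gf h] ap_comp[OF f g] ap_comp[OF g h] ap_total[OF f])
next
  fix f X Y assume f: "f \<in> Hom C X Y"
  note iY = id_in_hom[OF homD(3)[OF f]] and iX = id_in_hom[OF homD(2)[OF f]]
  show "Id C Y \<bullet> f = f"
    unfolding graded_vect_simps by (rule hom_eqI_total[OF hom_comp[OF f iY] f]) (simp add: ap_comp[OF f iY] ap_total[OF f])
  show "f \<bullet> Id C X = f"
    unfolding graded_vect_simps by (rule hom_eqI_total[OF hom_comp[OF iX f] f]) (simp add: ap_comp[OF iX f])
next
  fix X Y assume o: "X \<in> Obj C" "Y \<in> Obj C"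
  then have XY: "X \<in> GS" "Y \<in> GS" by simp_all
  note i = ten_in_hom[OF id_in_hom[OF XY(1)] id_in_hom[OF XY(2)]]
  show "Id C X \<odot> Id C Y = Id C (X \<boxtimes>\<^bsub>C\<^esub> Y)"
    unfolding graded_vect_simps
    by (rule hom_ten_eqI[OF i id_in_hom[OF ten_closed[OF XY]] XY])
      (simp add: ap_ten[OF id_in_hom[OF XY(1)] id_in_hom[OF XY(2)]] hom_total[OF XY(1)] hom_total[OF XY(2)]
        total_ten[OF XY])
next
  fix f f' g g' X X' X'' Y Y' Y''
  assume f: "f \<in> Hom C X X'" and f': "f' \<in> Hom C X' X''" and g: "g \<in> Hom C Y Y'" and g': "g' \<in> Hom C Y' Y''"
  note XY = homD(2)[OF f] homD(2)[OF g]
  note t = ten_in_hom[OF f g] and t' = ten_in_hom[OF f' g'] and tc = ten_in_hom[OF hom_comp[OF f f'] hom_comp[OF g g']]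
  show "(f' \<odot> g') \<bullet> (f \<odot> g) = (f' \<bullet> f) \<odot> (g' \<bullet> g)"
  proof (rule hom_ten_eqI[OF hom_comp[OF t t'] tc XY])
    fix x y v w assume *: "x \<in> \<G>" "y \<in> \<G>" "v \<in> X x" "w \<in> Y y"
    note v = hom_total[OF XY(1) *(1,3)] and w = hom_total[OF XY(2) *(2,4)]
    show "ap ((f' \<odot> g') \<bullet> (f \<odot> g)) (vec_ten v w) = ap ((f' \<bullet> f) \<odot> (g' \<bullet> g)) (vec_ten v w)"
      by (simp add: ap_comp[OF t t' total_ten[OF XY v w]] ap_ten[OF f g v w] ap_ten[OF f' g' ap_total[OF f v] ap_total[OF g w]]
          ap_ten[OF hom_comp[OF f f'] hom_comp[OF g g'] v w] ap_comp[OF f f' v] ap_comp[OF g g' w])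
  qed
next
  fix f g X Y c assume f: "f \<in> Hom C X Y"
  show "Scale C c f \<in> Hom C X Y"
    by (subst homD(1)[OF f], unfold graded_vect_simps, rule homI[OF homD(2,3)[OF f]])
      (use homD(6)[OF f] gr_scale(1)[OF homD(3)[OF f]] in
        \<open>simp_all add: linear_on_def ap_add[OF f] ap_scale[OF f] seqvec.scale_right_distrib mult.commute\<close>)
  assume g: "g \<in> Hom C X Y"
  show "Plus C f g \<in> Hom C X Y"
    by (subst homD(1)[OF f], subst homD(1)[OF g], unfold graded_vect_simps, rule homI[OF homD(2,3)[OF f]])
      (use homD(6)[OF f] homD(6)[OF g] gr_scale(2)[OF homD(3)[OF f]] in
        \<open>simp_all add: linear_on_def ap_add[OF f] ap_scale[OF f] ap_add[OF g] ap_scale[OF g] seqvec.scale_right_distrib add_ac\<close>)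
qed (auto intro!: hom_comp id_in_hom ten_closed gr_unit_closed ten_in_hom assoc_in_hom)

end

section \<open>Conjugation in the group\<close>

context finite_group
begin

definition cj :: "'a \<Rightarrow> 'a \<Rightarrow> 'a" where
  "cj g x = g \<otimes> x \<otimes> inv g"

lemma inv_cancel [simp]:
  "x \<in> \<G> \<Longrightarrow> y \<in> \<G> \<Longrightarrow> inv x \<otimes> (x \<otimes> y) = y"
  "x \<in> \<G> \<Longrightarrow> y \<in> \<G> \<Longrightarrow> x \<otimes> (inv x \<otimes> y) = y"
  by (simp_all add: m_assoc[symmetric])

lemma cj_closed [simp]: "g \<in> \<G> \<Longrightarrow> x \<in> \<G> \<Longrightarrow> cj g x \<in> \<G>"
  by (simp add: cj_def)

lemma cj_swap: "g \<in> \<G> \<Longrightarrow> x \<in> \<G> \<Longrightarrow> cj g x \<otimes> g = g \<otimes> x"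
  by (simp add: cj_def m_assoc)

lemma cj_mult: "\<lbrakk>g \<in> \<G>; x \<in> \<G>; y \<in> \<G>\<rbrakk> \<Longrightarrow> cj g (x \<otimes> y) = cj g x \<otimes> cj g y"
  by (simp add: cj_def m_assoc)

lemma cj_cj: "\<lbrakk>g \<in> \<G>; h \<in> \<G>; x \<in> \<G>\<rbrakk> \<Longrightarrow> cj (g \<otimes> h) x = cj g (cj h x)"
  by (simp add: cj_def m_assoc inv_mult_group)

lemma cj_one [simp]: "x \<in> \<G> \<Longrightarrow> cj \<one> x = x" "g \<in> \<G> \<Longrightarrow> cj g \<one> = \<one>"
  by (simp_all add: cj_def)

lemma cj_inv: "g \<in> \<G> \<Longrightarrow> x \<in> \<G> \<Longrightarrow> cj (inv g) (cj g x) = x"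
  "g \<in> \<G> \<Longrightarrow> x \<in> \<G> \<Longrightarrow> cj g (cj (inv g) x) = x"
  by (simp_all add: cj_cj[symmetric])

end

context graded_setup
begin

subsection \<open>Scalars built from the cocycle\<close>

text \<open>\<open>theta d x y\<close> measures the failure of the operators \<open>\<rho>\<^sub>g\<close> of a half-braiding to be multiplicative
  on the component of degree \<open>d\<close>: \<open>\<rho>\<^sub>x\<^sub>y = theta d x y \<cdot> \<rho>\<^sub>x \<rho>\<^sub>y\<close>. Likewise
  \<open>\<rho>\<^sub>g (v \<otimes> w) = kappa g x y \<cdot> \<rho>\<^sub>g v \<otimes> \<rho>\<^sub>g w\<close> for \<open>v\<close>, \<open>w\<close> of degrees \<open>x\<close>, \<open>y\<close>.\<close>

definition theta :: "'a \<Rightarrow> 'a \<Rightarrow> 'a \<Rightarrow> 'k" where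
  "theta d x y = \<omega> x (cj y d) y / (\<omega> x y d * \<omega> (cj (x \<otimes> y) d) x y)"

definition kappa :: "'a \<Rightarrow> 'a \<Rightarrow> 'a \<Rightarrow> 'k" where
  "kappa g x y = \<omega> g x y * \<omega> (cj g x) (cj g y) g / \<omega> (cj g x) g y"

lemma theta_nonzero [simp]: "\<lbrakk>d \<in> \<G>; x \<in> \<G>; y \<in> \<G>\<rbrakk> \<Longrightarrow> theta d x y \<noteq> 0"
  by (simp add: theta_def)

lemma kappa_nonzero [simp]: "\<lbrakk>g \<in> \<G>; x \<in> \<G>; y \<in> \<G>\<rbrakk> \<Longrightarrow> kappa g x y \<noteq> 0"
  by (simp add: kappa_def)

text \<open>The cocycle equation solved for each of its five values. The identities below substitute
  a few such instances, chosen so that the values that are left cancel.\<close>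

lemma omega_solve:
  assumes "x \<in> \<G>" "y \<in> \<G>" "z \<in> \<G>" "w \<in> \<G>"
  shows "\<omega> (x \<otimes> y) z w = \<omega> y z w * \<omega> x (y \<otimes> z) w * \<omega> x y z / \<omega> x y (z \<otimes> w)"
    and "\<omega> x y (z \<otimes> w) = \<omega> y z w * \<omega> x (y \<otimes> z) w * \<omega> x y z / \<omega> (x \<otimes> y) z w"
    and "\<omega> x (y \<otimes> z) w = \<omega> (x \<otimes> y) z w * \<omega> x y (z \<otimes> w) / (\<omega> y z w * \<omega> x y z)"
    and "\<omega> y z w = \<omega> (x \<otimes> y) z w * \<omega> x y (z \<otimes> w) / (\<omega> x (y \<otimes> z) w * \<omega> x y z)"
    and "\<omega> x y z = \<omega> (x \<otimes> y) z w * \<omega> x y (z \<otimes> w) / (\<omega> x (y \<otimes> z) w * \<omega> y z w)"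
  using omega_cocycle[OF assms] assms by (simp_all add: field_simps)

text \<open>The operator of a product of three group elements can be split at either place; this is
  the condition that both ways give the same scalar. Without it the objects \<open>I(x)\<close>
  would not exist.\<close>

lemma theta_cocycle:
  assumes [simp]: "d \<in> \<G>" "y \<in> \<G>" "z \<in> \<G>" "h \<in> \<G>"
  shows "theta d (y \<otimes> z) h * theta (cj h d) y z = theta d y (z \<otimes> h) * theta d z h"
proof -
  \<comment> \<open>The successive conjugates of \<open>d\<close>. The relations \<open>c\<close>
    identify products such as \<open>D \<otimes> y\<close> and \<open>y \<otimes> d2\<close>, which
    is what makes the values of the chosen cocycle instances match.\<close>
  define d1 d2 D where "d1 = cj h d" and "d2 = cj z d1" and "D = cj y d2"
  have [simp]: "d1 \<in> \<G>" "d2 \<in> \<G>" "D \<in> \<G>"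
    by (simp_all add: d1_def d2_def D_def)
  have c: "d1 \<otimes> h = h \<otimes> d" "d2 \<otimes> z = z \<otimes> d1" "D \<otimes> y = y \<otimes> d2"
    by (simp_all add: d1_def d2_def D_def cj_swap)
  have e: "cj (y \<otimes> z) d1 = D" "cj (y \<otimes> z \<otimes> h) d = D" "cj (z \<otimes> h) d = d2" "cj (y \<otimes> (z \<otimes> h)) d = D"
    by (simp_all add: cj_cj d1_def d2_def D_def)
  have 1: "\<omega> (y \<otimes> z) h d = \<omega> z h d * \<omega> y (z \<otimes> h) d * \<omega> y z h / \<omega> y z (h \<otimes> d)"
    by (rule omega_solve(1)) simp_all
  have 2: "\<omega> (y \<otimes> z) d1 h = \<omega> z d1 h * \<omega> y (z \<otimes> d1) h * \<omega> y z d1 / \<omega> y z (h \<otimes> d)"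
    using omega_solve(1)[of y z d1 h] by (simp add: c)
  have 3: "\<omega> y d2 (z \<otimes> h) = \<omega> d2 z h * \<omega> y (z \<otimes> d1) h * \<omega> y d2 z / \<omega> (y \<otimes> d2) z h"
    using omega_solve(2)[of y d2 z h] by (simp add: c)
  have 4: "\<omega> D (y \<otimes> z) h = \<omega> (y \<otimes> d2) z h * \<omega> D y (z \<otimes> h) / (\<omega> y z h * \<omega> D y z)"
    using omega_solve(3)[of D y z h] by (simp add: c)
  show ?thesis
    unfolding theta_def d1_def[symmetric] e d2_def[symmetric] unfolding 1 2 3 4 by (simp add: mult_ac)
qed

text \<open>Both sides arise from the operator of \<open>z \<otimes> h\<close> on a product of
  vectors of degrees \<open>x\<close> and \<open>y\<close>, so this is what closes the center under
  tensor products. For central \<open>z\<close> and \<open>h\<close> it says that \<beta> is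
  multiplicative up to a coboundary.\<close>

lemma kappa_theta:
  assumes [simp]: "x \<in> \<G>" "y \<in> \<G>" "z \<in> \<G>" "h \<in> \<G>"
  shows "kappa z (cj h x) (cj h y) * kappa h x y * theta (x \<otimes> y) z h =
    kappa (z \<otimes> h) x y * theta x z h * theta y z h"
proof -
  define x1 x2 y1 y2 where "x1 = cj h x" and "x2 = cj z x1" and "y1 = cj h y" and "y2 = cj z y1"
  have [simp]: "x1 \<in> \<G>" "x2 \<in> \<G>" "y1 \<in> \<G>" "y2 \<in> \<G>"
    by (simp_all add: x1_def x2_def y1_def y2_def)
  have c: "x1 \<otimes> h = h \<otimes> x" "y1 \<otimes> h = h \<otimes> y" "x2 \<otimes> z = z \<otimes> x1" "y2 \<otimes> z = z \<otimes> y1"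
    by (simp_all add: x1_def x2_def y1_def y2_def cj_swap)
  have e: "cj (z \<otimes> h) x = x2" "cj (z \<otimes> h) y = y2" "cj (z \<otimes> h) (x \<otimes> y) = x2 \<otimes> y2" "cj h (x \<otimes> y) = x1 \<otimes> y1"
    by (simp_all add: cj_cj cj_mult x1_def x2_def y1_def y2_def)
  have 1: "\<omega> z h (x \<otimes> y) = \<omega> h x y * \<omega> z (h \<otimes> x) y * \<omega> z h x / \<omega> (z \<otimes> h) x y"
    by (rule omega_solve(2)) simp_all
  have 2: "\<omega> x1 h y = \<omega> (z \<otimes> x1) h y * \<omega> z x1 (h \<otimes> y) / (\<omega> z (h \<otimes> x) y * \<omega> z x1 h)"
    using omega_solve(4)[of z x1 h y] by (simp add: c)
  have 3: "\<omega> z (x1 \<otimes> y1) h = \<omega> (z \<otimes> x1) y1 h * \<omega> z x1 (h \<otimes> y) / (\<omega> x1 y1 h * \<omega> z x1 y1)"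
    using omega_solve(3)[of z x1 y1 h] by (simp add: c)
  have 4: "\<omega> x2 (z \<otimes> h) y = \<omega> (z \<otimes> x1) h y * \<omega> x2 z (h \<otimes> y) / (\<omega> z h y * \<omega> x2 z h)"
    using omega_solve(3)[of x2 z h y] by (simp add: c)
  have 5: "\<omega> x2 z y1 = \<omega> (z \<otimes> x1) y1 h * \<omega> x2 z (h \<otimes> y) / (\<omega> x2 (z \<otimes> y1) h * \<omega> z y1 h)"
    using omega_solve(5)[of x2 z y1 h] by (simp add: c)
  have 6: "\<omega> (x2 \<otimes> y2) z h = \<omega> y2 z h * \<omega> x2 (z \<otimes> y1) h * \<omega> x2 y2 z / \<omega> x2 y2 (z \<otimes> h)"
    using omega_solve(1)[of x2 y2 z h] by (simp add: c)
  show ?thesis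
    unfolding theta_def kappa_def e x1_def[symmetric] y1_def[symmetric] x2_def[symmetric] y2_def[symmetric]
    unfolding 1 2 3 4 5 6 by (simp add: field_simps)
qed

text \<open>Up to inversion, \<open>kappa g\<close> is an explicit primitive of the quotient of
  \<omega> conjugated by \<open>g\<close> and \<omega>: inner automorphisms lie in the stabiliser.
  The same identity makes the associator an arrow of the center, and for central \<open>g\<close> it
  is the 2-cocycle condition.\<close>

lemma kappa_coboundary:
  assumes [simp]: "x \<in> \<G>" "y \<in> \<G>" "z \<in> \<G>" "g \<in> \<G>"
  shows "kappa g (x \<otimes> y) z * kappa g x y * \<omega> x y z =
    kappa g y z * kappa g x (y \<otimes> z) * \<omega> (cj g x) (cj g y) (cj g z)"
proof -
  define x1 y1 z1 where "x1 = cj g x" and "y1 = cj g y" and "z1 = cj g z"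
  have [simp]: "x1 \<in> \<G>" "y1 \<in> \<G>" "z1 \<in> \<G>"
    by (simp_all add: x1_def y1_def z1_def)
  have c: "x1 \<otimes> g = g \<otimes> x" "y1 \<otimes> g = g \<otimes> y" "z1 \<otimes> g = g \<otimes> z"
    by (simp_all add: x1_def y1_def z1_def cj_swap)
  have e: "cj g (x \<otimes> y) = x1 \<otimes> y1" "cj g (y \<otimes> z) = y1 \<otimes> z1"
    by (simp_all add: cj_mult x1_def y1_def z1_def)
  have 1: "\<omega> g x (y \<otimes> z) = \<omega> x y z * \<omega> g (x \<otimes> y) z * \<omega> g x y / \<omega> (g \<otimes> x) y z"
    by (rule omega_solve(2)) simp_all
  have 2: "\<omega> x1 g (y \<otimes> z) = \<omega> g y z * \<omega> x1 (g \<otimes> y) z * \<omega> x1 g y / \<omega> (g \<otimes> x) y z"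
    using omega_solve(2)[of x1 g y z] by (simp add: c)
  have 3: "\<omega> (x1 \<otimes> y1) g z = \<omega> y1 g z * \<omega> x1 (g \<otimes> y) z * \<omega> x1 y1 g / \<omega> x1 y1 (g \<otimes> z)"
    using omega_solve(1)[of x1 y1 g z] by (simp add: c)
  have 4: "\<omega> (x1 \<otimes> y1) z1 g = \<omega> y1 z1 g * \<omega> x1 (y1 \<otimes> z1) g * \<omega> x1 y1 z1 / \<omega> x1 y1 (g \<otimes> z)"
    using omega_solve(1)[of x1 y1 z1 g] by (simp add: c)
  show ?thesis
    unfolding kappa_def e x1_def[symmetric] y1_def[symmetric] z1_def[symmetric]
    unfolding 1 2 3 4 by (simp add: field_simps)
qed

text \<open>This makes \<open>\<rho>\<^sub>g\<close> a morphism of the center out of the object conjugated by \<open>g\<close>.\<close>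

lemma kappa_theta_conj:
  assumes [simp]: "d \<in> \<G>" "g \<in> \<G>" "h \<in> \<G>"
  shows "kappa g (cj h d) h * theta d (cj g h) g = kappa g h d * theta d g h"
proof -
  have e: "cj (cj g h \<otimes> g) d = cj g (cj h d)" "cj (g \<otimes> h) d = cj g (cj h d)"
    by (simp_all add: cj_swap cj_cj)
  show ?thesis
    unfolding kappa_def theta_def e by (simp add: field_simps)
qed

subsection \<open>Isomorphisms of graded spaces\<close>

lemma is_inverse_homI:
  assumes f: "f \<in> Hom C V W" and h: "h \<in> Hom C W V"
    and "\<And>g v. g \<in> \<G> \<Longrightarrow> v \<in> V g \<Longrightarrow> ap h (ap f v) = v"
    and "\<And>g w. g \<in> \<G> \<Longrightarrow> w \<in> W g \<Longrightarrow> ap f (ap h w) = w"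
  shows "is_inverse C f h"
proof (rule C.is_inverseI[OF f h])
  note VW = homD(2,3)[OF f]
  show "h \<bullet> f = Id C V"
    unfolding graded_vect_simps
    by (rule hom_eqI[OF hom_comp[OF f h] id_in_hom[OF VW(1)]])
      (simp add: ap_comp[OF f h] hom_total[OF VW(1)] assms(3))
  show "f \<bullet> h = Id C W"
    unfolding graded_vect_simps
    by (rule hom_eqI[OF hom_comp[OF h f] id_in_hom[OF VW(2)]])
      (simp add: ap_comp[OF h f] hom_total[OF VW(2)] assms(4))
qed

lemma ap_Inv:
  assumes f: "f \<in> Hom C V W" and i: "is_iso C f"
  shows "v \<in> tot V \<Longrightarrow> ap (Inv C f) (ap f v) = v" "w \<in> tot W \<Longrightarrow> ap f (ap (Inv C f) w) = w"
proof -
  note h = C.Inv_hom[OF i f]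
  have d: "Dom C f = V" "Cod C f = W"
    using f by (simp_all add: Hom_def)
  have e: "Inv C f \<bullet> f = Id C V" "f \<bullet> Inv C f = Id C W"
    using C.Inv_simps(5,6)[OF i] by (simp_all only: d)
  show "v \<in> tot V \<Longrightarrow> ap (Inv C f) (ap f v) = v"
    using ap_comp[OF f h, of v] by (simp add: e)
  show "w \<in> tot W \<Longrightarrow> ap f (ap (Inv C f) w) = w"
    using ap_comp[OF h f, of w] by (simp add: e)
qed

text \<open>The inverses on the components, composed with the degree projections, add up to a linear
  map on the total space.\<close>

lemma is_iso_if_bij:
  assumes f: "f \<in> Hom C V W" and bij: "\<And>g. g \<in> \<G> \<Longrightarrow> bij_betw (ap f) (V g) (W g)"
  shows "is_iso C f"
proof -
  note V = homD(2)[OF f] and W = homD(3)[OF f]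
  define r where "r g = inv_into (V g) (ap f)" for g
  have rV: "r g w \<in> V g" and fr: "ap f (r g w) = w" if "g \<in> \<G>" "w \<in> W g" for g w
    using that bij_betw_imp_surj_on[OF bij[OF that(1)]] unfolding r_def
    by (simp_all only: inv_into_into f_inv_into_f)
  have rf: "r g v' = v" if "g \<in> \<G>" "v \<in> V g" "ap f v = v'" for g v v'
    using that bij_betw_imp_inj_on[OF bij[OF that(1)]] unfolding r_def by (metis inv_into_f_f)
  define h where "h w = (\<Sum>g\<in>\<G>. r g (proj W g w))" for w
  have lin1: "linear_on UNIV (\<lambda>w. r g (proj W g w))" if g: "g \<in> \<G>" for g
    unfolding linear_on_def
  proof (intro conjI ballI allI)
    fix u v c
    note p = linear_onD[OF proj(1)[OF W g]] and pW = proj(2)[OF W g]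
    note t = hom_total[OF V g rV[OF g pW]]
    show "r g (proj W g (u + v)) = r g (proj W g u) + r g (proj W g v)"
      by (rule rf[OF g gr_scale(2)[OF V rV[OF g pW] rV[OF g pW]]])
        (simp add: ap_add[OF f t t] fr[OF g pW] p)
    show "r g (proj W g (vec_scale c v)) = vec_scale c (r g (proj W g v))"
      by (rule rf[OF g gr_scale(1)[OF V rV[OF g pW]]])
        (simp add: ap_scale[OF f t] fr[OF g pW] p)
  qed
  have lin: "linear_on UNIV h"
    unfolding h_def by (rule linear_on_sums) (rule lin1)
  have h: "h w = r g w" if g: "g \<in> \<G>" and w: "w \<in> W g" for g w
  proof -
    have "h w = r g (proj W g w)"
      unfolding h_def
    proof (rule sum_if_eq[OF finite_carrier g])
      fix k assume k: "k \<in> \<G>" "k \<noteq> g"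
      have "ap f 0 = 0"
        by (rule linear_on_zero[OF homD(5)[OF f] total_subspace[OF V]])
      then show "r k (proj W k w) = 0"
        using rf[OF k(1) gradedD(5)[OF V]] proj(3)[OF W k(1) g w] k by simp
    qed
    then show ?thesis
      using proj(3)[OF W g g w] by simp
  qed
  let ?h = "(W, restrict h (tot W), V)"
  have hh: "?h \<in> Hom C W V"
    by (rule homI[OF W V linear_on_subset[OF lin subset_UNIV]]) (simp add: h rV)
  have "is_inverse C f ?h"
    by (rule is_inverse_homI[OF f hh])
      (simp_all add: hom_total[OF W] homD(6)[OF f] h rf fr)
  then show ?thesis
    by (rule C.is_isoI)
qed

lemma bij_if_is_iso:
  assumes f: "f \<in> Hom C V W" and i: "is_iso C f" and g: "g \<in> \<G>"
  shows "bij_betw (ap f) (V g) (W g)"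
  by (rule bij_betw_byWitness[of _ "ap (Inv C f)"])
    (use ap_Inv[OF f i] homD(6)[OF f g] homD(6)[OF C.Inv_hom[OF i f] g] hom_total[OF homD(2)[OF f] g]
      hom_total[OF homD(3)[OF f] g] in blast)+

lemma assoc_iso:
  assumes U: "U \<in> GS" and V: "V \<in> GS" and W: "W \<in> GS"
  shows "is_iso C (Assoc C U V W)"
    and "\<lbrakk>x \<in> \<G>; y \<in> \<G>; z \<in> \<G>; u \<in> U x; v \<in> V y; w \<in> W z\<rbrakk> \<Longrightarrow>
      ap (Inv C (Assoc C U V W)) (vec_ten (vec_ten u v) w) = vec_scale (1 / \<omega> x y z) (vec_ten u (vec_ten v w))"
proof -
  note VW = ten_closed[OF V W] and UV = ten_closed[OF U V] and A = assoc_in_hom[OF U V W]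
  note UVW = ten_closed[OF U VW] and UVW' = ten_closed[OF UV W]
  obtain f where f: "f \<in> Hom C (gten (gten U V) W) (gten U (gten V W))"
    and apf: "\<forall>x\<in>\<G>. \<forall>y\<in>\<G>. \<forall>z\<in>\<G>. \<forall>u\<in>U x. \<forall>v\<in>V y. \<forall>w\<in>W z. ap f (vec_ten (vec_ten u v) w) = vec_ten u (vec_ten v w)"
    using unassoc_hom_exists[OF U V W] by blast
  obtain h where h: "h \<in> Hom C (gten U (gten V W)) (gten U (gten V W))"
    and aph: "\<forall>x\<in>\<G>. \<forall>y\<in>\<G>. \<forall>z\<in>\<G>. \<forall>u\<in>U x. \<forall>v\<in>V y. \<forall>w\<in>W z.
      ap h (vec_ten u (vec_ten v w)) = vec_scale (1 / \<omega> x y z) (vec_ten u (vec_ten v w))"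
  proof -
    have "linear_on UNIV (\<lambda>t :: 'k vec. t)" by (simp add: linear_on_def)
    moreover have "vec_ten u (vec_ten v w) \<in> gten U (gten V W) (x \<otimes> (y \<otimes> z))"
      if "x \<in> \<G>" "y \<in> \<G>" "z \<in> \<G>" "u \<in> U x" "v \<in> V y" "w \<in> W z" for x y z u v w
      using gr_ten_mem[of x "y \<otimes> z" u U "vec_ten v w" "gten V W"] gr_ten_mem[of y z v V w W] that by simp
    ultimately show ?thesis
      using ten3_hom_exists[OF U V W UVW, of "\<lambda>t. t" "\<lambda>x y z. 1 / \<omega> x y z"] that by blast
  qed
  define b where "b = h \<bullet> f"
  have b: "b \<in> Hom C (gten (gten U V) W) (gten U (gten V W))"
    unfolding b_def by (rule hom_comp[OF f h])
  have apb: "\<forall>x\<in>\<G>. \<forall>y\<in>\<G>. \<forall>z\<in>\<G>. \<forall>u\<in>U x. \<forall>v\<in>V y. \<forall>w\<in>W z.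
      ap b (vec_ten (vec_ten u v) w) = vec_scale (1 / \<omega> x y z) (vec_ten u (vec_ten v w))"
  proof (intro ballI)
    fix x y z u v w assume *: "x \<in> \<G>" "y \<in> \<G>" "z \<in> \<G>" "u \<in> U x" "v \<in> V y" "w \<in> W z"
    note t = total_ten[OF UV W total_ten[OF U V hom_total[OF U *(1,4)] hom_total[OF V *(2,5)]] hom_total[OF W *(3,6)]]
    show "ap b (vec_ten (vec_ten u v) w) = vec_scale (1 / \<omega> x y z) (vec_ten u (vec_ten v w))"
      unfolding b_def ap_comp[OF f h t] using apf aph * by simp
  qed
  have "is_inverse C (Assoc C U V W) b"
  proof (rule C.is_inverseI[OF A b])
    have "b \<bullet> Assoc C U V W = (gten U (gten V W), \<lambda>v\<in>tot (gten U (gten V W)). v, gten U (gten V W))"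
    proof (rule hom_ten3_eqI[OF hom_comp[OF A b] id_in_hom[OF UVW] U V W])
      fix x y z u v w assume *: "x \<in> \<G>" "y \<in> \<G>" "z \<in> \<G>" "u \<in> U x" "v \<in> V y" "w \<in> W z"
      note h = hom_total[OF U *(1,4)] hom_total[OF V *(2,5)] hom_total[OF W *(3,6)]
      show "ap (b \<bullet> Assoc C U V W) (vec_ten u (vec_ten v w)) = ap (gten U (gten V W),
         \<lambda>v\<in>tot (gten U (gten V W)). v, gten U (gten V W)) (vec_ten u (vec_ten v w))"
        using * by (simp add: ap_comp[OF A b] total_ten U V W VW UV h ap_assoc ap_scale[OF b] apb)
    qed
    then show "b \<bullet> Assoc C U V W = Id C (gten U (gten V W))"
      by simp
    have "Assoc C U V W \<bullet> b = (gten (gten U V) W, \<lambda>v\<in>tot (gten (gten U V) W). v, gten (gten U V) W)"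
    proof (rule hom_ten3'_eqI[OF hom_comp[OF b A] id_in_hom[OF UVW'] U V W])
      fix x y z u v w assume *: "x \<in> \<G>" "y \<in> \<G>" "z \<in> \<G>" "u \<in> U x" "v \<in> V y" "w \<in> W z"
      note h = hom_total[OF U *(1,4)] hom_total[OF V *(2,5)] hom_total[OF W *(3,6)]
      show "ap (Assoc C U V W \<bullet> b) (vec_ten (vec_ten u v) w) = ap (gten (gten U V) W,
         \<lambda>v\<in>tot (gten (gten U V) W). v, gten (gten U V) W) (vec_ten (vec_ten u v) w)"
        using * by (simp add: ap_comp[OF b A] total_ten U V W VW UV h ap_assoc ap_scale[OF A] apb)
    qed
    then show "Assoc C U V W \<bullet> b = Id C (gten (gten U V) W)"
      by simp
  qed
  then show "is_iso C (Assoc C U V W)"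
    and "\<lbrakk>x \<in> \<G>; y \<in> \<G>; z \<in> \<G>; u \<in> U x; v \<in> V y; w \<in> W z\<rbrakk> \<Longrightarrow>
      ap (Inv C (Assoc C U V W)) (vec_ten (vec_ten u v) w) = vec_scale (1 / \<omega> x y z) (vec_ten u (vec_ten v w))"
    using C.is_isoI C.Inv_eq apb by simp_all
qed

subsection \<open>One-dimensional graded spaces\<close>

text \<open>The same vector spans the line in every degree. As
  \<open>vec_ten vec_unit vec_unit = vec_unit\<close>, products of such lines are again such lines,
  on the nose.\<close>

definition delta :: "'a \<Rightarrow> ('a, 'k) grspace" where
  "delta g = (\<lambda>h. if h = g then seqvec.span {vec_unit} else {0})"

lemma span_unit: "t \<in> seqvec.span {vec_unit} \<longleftrightarrow> t = vec_scale (t 0) vec_unit"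
proof -
  have "t = vec_scale (t 0) vec_unit" if "t = vec_scale k vec_unit" for k
    using that by (simp add: vec_unit_def)
  then show ?thesis
    unfolding seqvec.span_singleton by blast
qed

lemma vec_unit_in_span [simp]: "vec_unit \<in> seqvec.span {vec_unit}"
  by (rule seqvec.span_base) simp

lemma delta_closed [simp]:
  assumes g: "g \<in> \<G>"
  shows "delta g \<in> GS"
proof -
  have "\<exists>B. finite B \<and> (delta g h) = seqvec.span B" for h
  proof (cases "h = g")
    case True
    then show ?thesis
      by (intro exI[of _ "{vec_unit}"]) (simp add: delta_def)
  next
    case False
    then show ?thesis
      by (intro exI[of _ "{}"]) (simp only: delta_def if_False finite.emptyI seqvec.span_empty simp_thms)
  qed
  moreover have "\<forall>h\<in>\<G>. u h = 0"
    if u: "(\<forall>h\<in>\<G>. u h \<in> delta g h) \<and> (\<Sum>h\<in>\<G>. u h) = 0" for u :: "'a \<Rightarrow> 'k vec"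
  proof -
    have 0: "u h = 0" if "h \<in> \<G>" "h \<noteq> g" for h
      using bspec[OF conjunct1[OF u] that(1)] that(2) by (simp only: delta_def if_False singleton_iff)
    have "(\<Sum>h\<in>\<G>. u h) = u g"
      by (rule sum_if_eq[OF finite_carrier g 0])
    then have "u g = 0"
      using u by (simp only:)
    then show ?thesis
      using 0 by metis
  qed
  moreover have "seqvec.subspace (delta g h)" for h
    by (simp add: delta_def)
  moreover have "delta g h = {0}" if "h \<notin> \<G>" for h
    using that g by (auto simp: delta_def)
  ultimately show ?thesis
    unfolding graded_spaces_def by blast
qed

lemma vec_unit_delta [simp]: "vec_unit \<in> delta g g"
  by (simp add: delta_def)

lemma delta_cases: "t \<in> delta g h \<Longrightarrow> (h = g \<and> t = vec_scale (t 0) vec_unit) \<or> t = 0"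
  using span_unit[of t] by (auto simp: delta_def split: if_splits)

lemma delta_total [simp]: "g \<in> \<G> \<Longrightarrow> vec_unit \<in> tot (delta g)"
  by (rule hom_total[of _ g]) simp_all

text \<open>Homogeneous vectors as arrows out of a line. Naturality along these arrows reduces
  statements about all objects to statements about lines.\<close>

definition pt :: "'a \<Rightarrow> ('a, 'k) grspace \<Rightarrow> 'k vec \<Rightarrow> ('a, 'k) grmap" where
  "pt g X x = (delta g, \<lambda>t\<in>tot (delta g). vec_scale (t 0) x, X)"

lemma pt_in_hom:
  assumes "g \<in> \<G>" "X \<in> GS" "x \<in> X g"
  shows "pt g X x \<in> Hom C (delta g) X" "ap (pt g X x) vec_unit = x"
proof -
  show "pt g X x \<in> Hom C (delta g) X"
    unfolding pt_def
  proof (rule homI)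
    show "linear_on (tot (delta g)) (\<lambda>t. vec_scale (t 0) x)"
      by (auto simp: linear_on_def fun_eq_iff algebra_simps)
    fix h v assume "h \<in> \<G>" "v \<in> delta g h"
    then show "vec_scale (v 0) x \<in> X h"
      using gr_scale(1)[OF assms(2,3)] delta_cases[of v g h] gradedD(5)[OF assms(2)]
      by auto
  qed (use assms in simp_all)
  show "ap (pt g X x) vec_unit = x"
    using assms by (simp add: pt_def) (simp add: vec_unit_def)
qed

text \<open>In a product with a line every vector is a pure tensor, and its degree determines that
  of the other factor. This justifies recovering that factor by \<open>rcut\<close> or
  \<open>lcut\<close>.\<close>

lemma ten_delta:
  assumes Z: "Z \<in> GS" and g: "g \<in> \<G>" and k: "k \<in> \<G>"
  shows "t \<in> gten Z (delta g) k \<Longrightarrow> t = vec_ten (rcut t) vec_unit \<and> rcut t \<in> Z (k \<otimes> inv g)"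
    and "t \<in> gten (delta g) Z k \<Longrightarrow> t = vec_ten vec_unit (lcut t) \<and> lcut t \<in> Z (inv g \<otimes> k)"
proof -
  have lin: "linear_on UNIV (rcut :: 'k vec \<Rightarrow> _)" "linear_on UNIV (lcut :: 'k vec \<Rightarrow> _)"
    by (rule maps_linear)+
  have r0: "rcut 0 = (0 :: 'k vec)" "lcut 0 = (0 :: 'k vec)"
    by (simp_all add: rcut_def lcut_def fun_eq_iff)
  have sub: "seqvec.subspace {t. t = vec_ten (rcut t) vec_unit \<and> rcut t \<in> Z (k \<otimes> inv g)}"
    "seqvec.subspace {t. t = vec_ten vec_unit (lcut t) \<and> lcut t \<in> Z (inv g \<otimes> k)}"
    by (rule seqvec.subspaceI; use gr_scale[OF Z] gradedD(5)[OF Z] in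
        \<open>simp add: linear_onD[OF lin(1)] linear_onD[OF lin(2)] r0 vec_ten_simps\<close>)+
  have "gten Z (delta g) k \<subseteq> {t. t = vec_ten (rcut t) vec_unit \<and> rcut t \<in> Z (k \<otimes> inv g)}"
    unfolding gr_ten_def
  proof (rule seqvec.span_minimal[OF _ sub(1)], rule subsetI)
    fix t assume "t \<in> {vec_ten v w | v w x y. x \<in> \<G> \<and> y \<in> \<G> \<and> x \<otimes> y = k \<and> v \<in> Z x \<and> w \<in> delta g y}"
    then obtain v w x y where *: "t = vec_ten v w" "x \<in> \<G>" "y \<in> \<G>" "x \<otimes> y = k" "v \<in> Z x" "w \<in> delta g y"
      by blast
    have x: "k \<otimes> inv g = x" if "y = g"
      using *(2-4) that by (simp add: *(4)[symmetric] m_assoc)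
    show "t \<in> {t. t = vec_ten (rcut t) vec_unit \<and> rcut t \<in> Z (k \<otimes> inv g)}"
    proof (cases "w = 0")
      case True
      then show ?thesis
        by (simp add: *(1) vec_ten_simps r0 gradedD(5)[OF Z])
    next
      case False
      then obtain c where c: "w = vec_scale c vec_unit" and y: "y = g"
        using delta_cases[OF *(6)] by blast
      show ?thesis
        unfolding *(1) c using gr_scale(1)[OF Z *(5)] by (simp add: linear_onD[OF lin(1)] x[OF y])
    qed
  qed
  then show "t \<in> gten Z (delta g) k \<Longrightarrow> t = vec_ten (rcut t) vec_unit \<and> rcut t \<in> Z (k \<otimes> inv g)"
    by blast
  have "gten (delta g) Z k \<subseteq> {t. t = vec_ten vec_unit (lcut t) \<and> lcut t \<in> Z (inv g \<otimes> k)}"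
    unfolding gr_ten_def
  proof (rule seqvec.span_minimal[OF _ sub(2)], rule subsetI)
    fix t assume "t \<in> {vec_ten v w | v w x y. x \<in> \<G> \<and> y \<in> \<G> \<and> x \<otimes> y = k \<and> v \<in> delta g x \<and> w \<in> Z y}"
    then obtain v w x y where *: "t = vec_ten v w" "x \<in> \<G>" "y \<in> \<G>" "x \<otimes> y = k" "v \<in> delta g x" "w \<in> Z y"
      by blast
    have x: "inv g \<otimes> k = y" if "x = g"
      using *(2-4) that by (simp add: *(4)[symmetric])
    show "t \<in> {t. t = vec_ten vec_unit (lcut t) \<and> lcut t \<in> Z (inv g \<otimes> k)}"
    proof (cases "v = 0")
      case True
      then show ?thesis
        by (simp add: *(1) vec_ten_simps r0 gradedD(5)[OF Z])
    next
      case False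
      then obtain c where c: "v = vec_scale c vec_unit" and y: "x = g"
        using delta_cases[OF *(5)] by blast
      show ?thesis
        unfolding *(1) c using gr_scale(1)[OF Z *(6)] by (simp add: linear_onD[OF lin(2)] x[OF y])
    qed
  qed
  then show "t \<in> gten (delta g) Z k \<Longrightarrow> t = vec_ten vec_unit (lcut t) \<and> lcut t \<in> Z (inv g \<otimes> k)"
    by blast
qed

end

section \<open>The center of the category of graded vector spaces\<close>

context graded_setup
begin

declare graded_vect_simps(5) [simp del]

lemma id_hom' [simp]: "V \<in> GS \<Longrightarrow> Id C V \<in> Hom C V V"
  using C.id_hom by simp

lemma ap_Id [simp]: "v \<in> tot V \<Longrightarrow> ap (Id C V) v = v"
  by (simp add: graded_vect_simps(5))

abbreviation "D \<equiv> drinfeld_center C"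

abbreviation "CO \<equiv> center_objs C"

abbreviation "CA \<equiv> center_arrs C"

abbreviation "cten \<equiv> center_ten C"

abbreviation "indo \<equiv> ind_obj C"

lemma linear_on_total_map:
  assumes V: "V \<in> GS" and W: "W \<in> GS" and f: "linear_on (tot V) f"
    and mem: "\<And>d v. d \<in> \<G> \<Longrightarrow> v \<in> V d \<Longrightarrow> f v \<in> W (s d)" and s: "\<And>d. d \<in> \<G> \<Longrightarrow> s d \<in> \<G>"
    and v: "v \<in> tot V"
  shows "f v \<in> tot W"
proof -
  obtain r where r: "\<forall>d\<in>\<G>. r d \<in> V d" "v = (\<Sum>d\<in>\<G>. r d)"
    using v by (rule totalE)
  obtain F where F: "linear_on UNIV F" "\<And>v. v \<in> tot V \<Longrightarrow> F v = f v"
    using linear_on_extend[OF f total_subspace[OF V]] by metis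
  have "F (r d) \<in> tot W" if d: "d \<in> \<G>" for d
  proof -
    have rd: "r d \<in> V d"
      using r(1) d by blast
    show ?thesis
      unfolding F(2)[OF hom_total[OF V d rd]] by (rule hom_total[OF W s[OF d] mem[OF d rd]])
  qed
  then have "F (\<Sum>d\<in>\<G>. r d) \<in> tot W"
    unfolding linear_on_sum[OF F(1)] by (rule seqvec.subspace_sum[OF total_subspace[OF W]])
  then show ?thesis
    using F(2)[OF v] unfolding r(2)[symmetric] by simp
qed

text \<open>By naturality a half-braiding is determined by the operators \<open>act P g\<close> on the underlying space:
  \<open>\<gamma> (x \<otimes> z) = act P g z \<otimes> x\<close> for \<open>x\<close> of degree \<open>g\<close>.\<close>

definition act :: "('a, 'k) grspace \<times> (('a, 'k) grspace \<Rightarrow> ('a, 'k) grmap) \<Rightarrow> 'a \<Rightarrow> 'k vec \<Rightarrow> 'k vec" where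
  "act P g z = rcut (ap (snd P (delta g)) (vec_ten vec_unit z))"

lemma actI: "ap (\<gamma> (delta g)) (vec_ten vec_unit z) = vec_ten r vec_unit \<Longrightarrow> act (Z, \<gamma>) g z = r"
  by (simp add: act_def)

text \<open>The half-braiding preserves the degree \<open>g \<otimes> d\<close>, and in the target
  the factor from the line has degree \<open>g\<close>; what remains has degree
  \<open>cj g d\<close>. Only one component of the half-braiding is assumed, so that the lemma also
  serves while an object is under construction.\<close>

lemma act_delta:
  assumes Z: "fst P \<in> GS" and g: "g \<in> \<G>"
    and hom: "snd P (delta g) \<in> Hom C (gten (delta g) (fst P)) (gten (fst P) (delta g))"
  shows "linear_on (tot (fst P)) (act P g)"
    and "\<And>d z. d \<in> \<G> \<Longrightarrow> z \<in> fst P d \<Longrightarrow> act P g z \<in> fst P (cj g d)"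
    and "\<And>z. z \<in> tot (fst P) \<Longrightarrow> ap (snd P (delta g)) (vec_ten vec_unit z) = vec_ten (act P g z) vec_unit"
proof -
  have t: "vec_ten vec_unit z \<in> tot (gten (delta g) (fst P))" if "z \<in> tot (fst P)" for z
    using total_ten[OF delta_closed[OF g] Z delta_total[OF g] that] .
  show lin: "linear_on (tot (fst P)) (act P g)"
    unfolding linear_on_def act_def
    by (simp add: vec_ten_simps ap_add[OF hom] ap_scale[OF hom] t linear_onD[OF maps_linear(5)])
  have 1: "act P g z \<in> fst P (cj g d) \<and> ap (snd P (delta g)) (vec_ten vec_unit z) = vec_ten (act P g z) vec_unit"
    if d: "d \<in> \<G>" and z: "z \<in> fst P d" for d z
  proof -
    have "vec_ten vec_unit z \<in> gten (delta g) (fst P) (g \<otimes> d)"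
      by (rule gr_ten_mem) (use g d z in simp_all)
    then have "ap (snd P (delta g)) (vec_ten vec_unit z) \<in> gten (fst P) (delta g) (g \<otimes> d)"
      using homD(6)[OF hom] g d by simp
    from ten_delta(1)[OF Z g _ this] show ?thesis
      using g d by (simp add: act_def cj_def)
  qed
  then show "\<And>d z. d \<in> \<G> \<Longrightarrow> z \<in> fst P d \<Longrightarrow> act P g z \<in> fst P (cj g d)"
    by blast
  have l1: "linear_on (tot (fst P)) (\<lambda>z. ap (snd P (delta g)) (vec_ten vec_unit z))"
    by (simp add: linear_on_def vec_ten_simps ap_add[OF hom] ap_scale[OF hom] t)
  have l2: "linear_on (tot (fst P)) (\<lambda>z. vec_ten (act P g z) vec_unit)"
    by (simp add: linear_on_def vec_ten_simps linear_onD[OF lin])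
  show "ap (snd P (delta g)) (vec_ten vec_unit z) = vec_ten (act P g z) vec_unit" if z: "z \<in> tot (fst P)" for z
    by (rule linear_on_total_eq[OF Z l1 l2 _ z]) (use 1 in blast)
qed

lemma center_GS:
  assumes P: "P \<in> CO"
  shows "fst P \<in> GS" "\<And>X. X \<in> GS \<Longrightarrow> snd P X \<in> Hom C (gten X (fst P)) (gten (fst P) X)"
    "\<And>X. X \<in> GS \<Longrightarrow> is_iso C (snd P X)"
  using C.center_objsD(1,3,4)[OF P] by simp_all

lemma act_linear: "P \<in> CO \<Longrightarrow> g \<in> \<G> \<Longrightarrow> linear_on (tot (fst P)) (act P g)"
  by (rule act_delta(1)[OF center_GS(1) _ center_GS(2)]) simp_all

lemma act_mem: "\<lbrakk>P \<in> CO; g \<in> \<G>; d \<in> \<G>; z \<in> fst P d\<rbrakk> \<Longrightarrow> act P g z \<in> fst P (cj g d)"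
  by (rule act_delta(2)[OF center_GS(1) _ center_GS(2)]) simp_all

lemma act_total: "\<lbrakk>P \<in> CO; g \<in> \<G>; z \<in> tot (fst P)\<rbrakk> \<Longrightarrow> act P g z \<in> tot (fst P)"
  by (rule linear_on_total_map[where s = "cj g", OF center_GS(1) center_GS(1) act_linear act_mem]) simp_all

text \<open>Naturality of the half-braiding along \<open>pt g X x\<close> transports the formula
  from the line \<open>delta g\<close> to an arbitrary \<open>X\<close>.\<close>

lemma act_braid:
  assumes P: "P \<in> CO" and X: "X \<in> GS" and g: "g \<in> \<G>" and x: "x \<in> X g"
    and z: "z \<in> tot (fst P)"
  shows "ap (snd P X) (vec_ten x z) = vec_ten (act P g z) x"
proof -
  note Z = center_GS(1)[OF P] and p = pt_in_hom[OF g X x] and dg = delta_closed[OF g]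
  note Xh = center_GS(2)[OF P X] and dh = center_GS(2)[OF P dg]
  note pi = ten_in_hom[OF p(1) id_hom'[OF Z]] and ip = ten_in_hom[OF id_hom'[OF Z] p(1)]
  have u: "vec_unit \<in> tot (delta g)"
    using g by simp
  note t = total_ten[OF dg Z u z]
  note az = act_total[OF P g z]
  have "ap (snd P X \<bullet> (pt g X x \<odot> Id C (fst P))) (vec_ten vec_unit z) = ap (snd P X) (vec_ten x z)"
    by (simp add: ap_comp[OF pi Xh t] ap_ten[OF p(1) id_hom'[OF Z] u z] p(2) z)
  moreover have "ap ((Id C (fst P) \<odot> pt g X x) \<bullet> snd P (delta g)) (vec_ten vec_unit z) = vec_ten (act P g z) x"
    by (simp add: ap_comp[OF dh ip t] act_delta(3)[OF Z g dh z] ap_ten[OF id_hom'[OF Z] p(1) az u] p(2) az)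
  ultimately show ?thesis
    using C.center_objsD(5)[OF P p(1)] by simp
qed

text \<open>On the component of degree \<open>g \<otimes> d\<close> the half-braiding at
  \<open>delta g\<close> is \<open>act P g\<close> up to the factor \<open>vec_unit\<close> on
  either side. Its invertibility is what later turns the operators into isomorphisms of graded
  spaces.\<close>

lemma act_bij:
  assumes P: "P \<in> CO" and g: "g \<in> \<G>" and d: "d \<in> \<G>"
  shows "bij_betw (act P g) (fst P d) (fst P (cj g d))"
proof -
  note Z = center_GS(1)[OF P] and dg = delta_closed[OF g]
  note dh = center_GS(2)[OF P dg] and di = center_GS(3)[OF P dg]
  have gd: "g \<otimes> d \<in> \<G>"
    using g d by simp
  have e: "ap (snd P (delta g)) (vec_ten vec_unit z) = vec_ten (act P g z) vec_unit" if "z \<in> fst P d" for z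
    by (rule act_delta(3)[OF Z g dh hom_total[OF Z d that]])
  have m: "vec_ten vec_unit z \<in> gten (delta g) (fst P) (g \<otimes> d)" if "z \<in> fst P d" for z
    by (rule gr_ten_mem) (use g d that in simp_all)
  note bij = bij_if_is_iso[OF dh di gd]
  have "inj_on (act P g) (fst P d)"
  proof (rule inj_onI)
    fix z z' assume z: "z \<in> fst P d" "z' \<in> fst P d" "act P g z = act P g z'"
    have "ap (snd P (delta g)) (vec_ten vec_unit z) = ap (snd P (delta g)) (vec_ten vec_unit z')"
      by (simp only: e[OF z(1)] e[OF z(2)] z(3))
    then have "vec_ten vec_unit z = vec_ten vec_unit z'"
      by (rule inj_onD[OF bij_betw_imp_inj_on[OF bij] _ m[OF z(1)] m[OF z(2)]])
    then have "lcut (vec_ten vec_unit z) = lcut (vec_ten vec_unit z')"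
      by (rule arg_cong)
    then show "z = z'"
      by simp
  qed
  moreover have "act P g ` fst P d = fst P (cj g d)"
  proof
    show "act P g ` fst P d \<subseteq> fst P (cj g d)"
      using act_mem[OF P g d] by blast
    show "fst P (cj g d) \<subseteq> act P g ` fst P d"
    proof
      fix w assume w: "w \<in> fst P (cj g d)"
      have "vec_ten w vec_unit \<in> gten (fst P) (delta g) (cj g d \<otimes> g)"
        by (rule gr_ten_mem) (use g d w in simp_all)
      then have "vec_ten w vec_unit \<in> ap (snd P (delta g)) ` gten (delta g) (fst P) (g \<otimes> d)"
        using bij_betw_imp_surj_on[OF bij] by (simp add: cj_swap g d)
      then obtain t where t: "t \<in> gten (delta g) (fst P) (g \<otimes> d)" "vec_ten w vec_unit = ap (snd P (delta g)) t"
        by blast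
      have l: "t = vec_ten vec_unit (lcut t)" "lcut t \<in> fst P d"
        using ten_delta(2)[OF Z g gd t(1)] g d by simp_all
      have "vec_ten w vec_unit = vec_ten (act P g (lcut t)) vec_unit"
        using e[OF l(2)] t(2) l(1) by simp
      then have "w = act P g (lcut t)"
        by (rule vec_ten_cancel_right) simp
      then show "w \<in> act P g ` fst P d"
        using l(2) by blast
    qed
  qed
  ultimately show ?thesis
    by (simp add: bij_betw_def)
qed

text \<open>The scalar \<open>theta\<close> is the product of the values of the three associators.
  The arrows \<open>a\<close> and \<open>b\<close> are arbitrary, so that the formula serves both to
  read off a relation from an object of the center and to verify the hexagon for a new one.\<close>

lemma hexagon_eval:
  assumes GS: "X \<in> GS" "Y \<in> GS" "Z \<in> GS"
    and a: "a \<in> Hom C (gten X Z) (gten Z X)" and b: "b \<in> Hom C (gten Y Z) (gten Z Y)"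
  defines "H \<equiv> Inv C (Assoc C Z X Y) \<bullet> (a \<odot> Id C Y) \<bullet> Assoc C X Z Y \<bullet> (Id C X \<odot> b) \<bullet> Inv C (Assoc C X Y Z)"
  shows "H \<in> Hom C (gten (gten X Y) Z) (gten Z (gten X Y))"
    and "\<lbrakk>g \<in> \<G>; h \<in> \<G>; d \<in> \<G>; x \<in> X g; y \<in> Y h; z \<in> Z d;
      ap b (vec_ten y z) = vec_ten z1 y; z1 \<in> Z (cj h d); ap a (vec_ten x z1) = vec_ten z2 x; z2 \<in> Z (cj g (cj h d))\<rbrakk> \<Longrightarrow>
      ap H (vec_ten (vec_ten x y) z) = vec_scale (theta d g h) (vec_ten z2 (vec_ten x y))"
proof -
  note iXYZ = C.Inv_hom[OF assoc_iso(1)[OF GS] assoc_in_hom[OF GS]]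
    and iZXY = C.Inv_hom[OF assoc_iso(1)[OF GS(3,1,2)] assoc_in_hom[OF GS(3,1,2)]] and XZY = assoc_in_hom[OF GS(1,3,2)]
  note aY = ten_in_hom[OF a id_hom'[OF GS(2)]] and Xb = ten_in_hom[OF id_hom'[OF GS(1)] b]
  note c1 = hom_comp[OF aY iZXY] and c2 = hom_comp[OF XZY hom_comp[OF aY iZXY]]
  note c3 = hom_comp[OF Xb c2]
  show "H \<in> Hom C (gten (gten X Y) Z) (gten Z (gten X Y))"
    unfolding H_def by (rule hom_comp[OF iXYZ c3])
  assume *: "g \<in> \<G>" "h \<in> \<G>" "d \<in> \<G>" "x \<in> X g" "y \<in> Y h" "z \<in> Z d"
    "ap b (vec_ten y z) = vec_ten z1 y" "z1 \<in> Z (cj h d)" "ap a (vec_ten x z1) = vec_ten z2 x" "z2 \<in> Z (cj g (cj h d))"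
  have k [simp]: "cj h d \<in> \<G>" "cj g (cj h d) \<in> \<G>"
    using * by simp_all
  have t [simp]: "x \<in> tot X" "y \<in> tot Y" "z \<in> tot Z" "z1 \<in> tot Z" "z2 \<in> tot Z"
    by (rule hom_total[OF GS(1) *(1,4)], rule hom_total[OF GS(2) *(2,5)],
        rule hom_total[OF GS(3) *(3,6)], rule hom_total[OF GS(3) k(1) *(8)],
        rule hom_total[OF GS(3) k(2) *(10)])
  note T = total_ten ten_closed GS
  have "ap H (vec_ten (vec_ten x y) z) = vec_scale (1 / \<omega> g h d * (\<omega> g (cj h d) h * (1 / \<omega> (cj g (cj h d)) g h))) (vec_ten z2 (vec_ten x y))"
    unfolding H_def
    using * by (simp add: ap_comp[OF iXYZ c3] ap_comp[OF Xb c2] ap_comp[OF XZY c1] ap_comp[OF aY iZXY] T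
        assoc_iso(2)[OF GS, of g h d] ap_scale[OF c3] ap_scale[OF c2] ap_scale[OF c1] ap_scale[OF iZXY]
        ap_ten[OF id_hom'[OF GS(1)] b] ap_assoc[of X Z Y g "cj h d" h]
        ap_ten[OF a id_hom'[OF GS(2)]] assoc_iso(2)[OF GS(3,1,2), of "cj g (cj h d)" g h])
  then show "ap H (vec_ten (vec_ten x y) z) = vec_scale (theta d g h) (vec_ten z2 (vec_ten x y))"
    using * by (simp add: theta_def cj_cj mult.assoc)
qed

text \<open>The hexagon at the lines \<open>delta g\<close> and \<open>delta h\<close>.\<close>

lemma act_act:
  assumes P: "P \<in> CO" and g: "g \<in> \<G>" "h \<in> \<G>" "d \<in> \<G>" and z: "z \<in> fst P d"
  shows "act P (g \<otimes> h) z = vec_scale (theta d g h) (act P g (act P h z))"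
proof -
  note Z = center_GS(1)[OF P] and dd = delta_closed[OF g(1)] delta_closed[OF g(2)]
  note hg = center_GS(2)[OF P dd(1)] and hh = center_GS(2)[OF P dd(2)]
  have zt: "z \<in> tot (fst P)"
    by (rule hom_total[OF Z g(3) z])
  have k: "cj h d \<in> \<G>" using g by simp
  note a1 = act_mem[OF P g(2,3) z]
  note a2 = act_mem[OF P g(1) k a1]
  note b1 = act_delta(3)[OF Z g(2) hh zt] and b2 = act_delta(3)[OF Z g(1) hg hom_total[OF Z k a1]]
  have uu: "vec_ten vec_unit vec_unit \<in> gten (delta g) (delta h) (g \<otimes> h)"
    by (rule gr_ten_mem) (use g in simp_all)
  have "vec_ten (act P (g \<otimes> h) z) (vec_ten vec_unit vec_unit) =
     ap (snd P (gten (delta g) (delta h))) (vec_ten (vec_ten vec_unit vec_unit) z)"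
    by (rule act_braid[OF P ten_closed[OF dd] _ uu zt, symmetric]) (use g in simp)
  also have "\<dots> = vec_scale (theta d g h) (vec_ten (act P g (act P h z)) (vec_ten vec_unit vec_unit))"
    using C.center_objsD(6)[OF P, of "delta g" "delta h"] dd
      hexagon_eval(2)[OF dd Z hg hh g(1,2,3) vec_unit_delta vec_unit_delta z b1 a1 b2 a2]
    by simp
  also have "\<dots> = vec_ten (vec_scale (theta d g h) (act P g (act P h z))) (vec_ten vec_unit vec_unit)"
    by simp
  finally show ?thesis
    by (rule vec_ten_cancel_right) simp
qed

text \<open>A half-braiding that acts through operators depending only on the degree of the vector
  in \<open>X\<close> is automatically natural, and its hexagon reduces to the scalar relation
  \<open>hex\<close>.\<close>

lemma center_objsI:
  assumes Z: "Z \<in> GS" and ext: "\<gamma> \<in> extensional GS"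
    and hom: "\<And>X. X \<in> GS \<Longrightarrow> \<gamma> X \<in> Hom C (gten X Z) (gten Z X)"
    and iso: "\<And>X. X \<in> GS \<Longrightarrow> is_iso C (\<gamma> X)"
    and br: "\<And>X g d x z. \<lbrakk>X \<in> GS; g \<in> \<G>; d \<in> \<G>; x \<in> X g; z \<in> Z d\<rbrakk> \<Longrightarrow>
      ap (\<gamma> X) (vec_ten x z) = vec_ten (act (Z, \<gamma>) g z) x"
    and hex: "\<And>g h d z. \<lbrakk>g \<in> \<G>; h \<in> \<G>; d \<in> \<G>; z \<in> Z d\<rbrakk> \<Longrightarrow>
      act (Z, \<gamma>) (g \<otimes> h) z = vec_scale (theta d g h) (act (Z, \<gamma>) g (act (Z, \<gamma>) h z))"
  shows "(Z, \<gamma>) \<in> CO"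
proof -
  let ?r = "act (Z, \<gamma>)"
  have mem: "?r g z \<in> Z (cj g d)" if "g \<in> \<G>" "d \<in> \<G>" "z \<in> Z d" for g d z
    using act_delta(2)[of "(Z, \<gamma>)" g d z] Z hom that by simp
  have nat: "\<gamma> Y \<bullet> (f \<odot> Id C Z) = (Id C Z \<odot> f) \<bullet> \<gamma> X" if f: "f \<in> Hom C X Y" for X Y f
  proof -
    note XY = homD(2,3)[OF f] and iZ = id_hom'[OF Z]
    note fZ = ten_in_hom[OF f iZ] and Zf = ten_in_hom[OF iZ f]
    show ?thesis
    proof (rule hom_ten_eqI[OF hom_comp[OF fZ hom[OF XY(2)]] hom_comp[OF hom[OF XY(1)] Zf] XY(1) Z])
      fix g d x z assume *: "g \<in> \<G>" "d \<in> \<G>" "x \<in> X g" "z \<in> Z d"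
      note t = hom_total[OF XY(1) *(1,3)] hom_total[OF Z *(2,4)]
      have m: "?r g z \<in> tot Z"
        using hom_total[OF Z _ mem[OF *(1,2,4)]] * by simp
      show "ap (\<gamma> Y \<bullet> (f \<odot> Id C Z)) (vec_ten x z) = ap ((Id C Z \<odot> f) \<bullet> \<gamma> X) (vec_ten x z)"
        using * by (simp add: ap_comp[OF fZ hom[OF XY(2)]] ap_comp[OF hom[OF XY(1)] Zf] total_ten[OF XY(1) Z t]
          ap_ten[OF f iZ t] br[OF XY(1) *] t br[OF XY(2) *(1,2) homD(6)[OF f *(1,3)] *(4)] ap_ten[OF iZ f m t(1)] m)
    qed
  qed
  have hexa: "\<gamma> (gten X Y) = Inv C (Assoc C Z X Y) \<bullet> (\<gamma> X \<odot> Id C Y) \<bullet> Assoc C X Z Y \<bullet>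
          (Id C X \<odot> \<gamma> Y) \<bullet> Inv C (Assoc C X Y Z)" if XY: "X \<in> GS" "Y \<in> GS" for X Y
  proof (rule hom_ten3'_eqI[OF hom[OF ten_closed[OF XY]] hexagon_eval(1)[OF XY Z hom[OF XY(1)] hom[OF XY(2)]] XY Z])
    fix g h d x y z assume *: "g \<in> \<G>" "h \<in> \<G>" "d \<in> \<G>" "x \<in> X g" "y \<in> Y h" "z \<in> Z d"
    have k: "cj h d \<in> \<G>" using * by simp
    note m1 = mem[OF *(2,3,6)]
    note m2 = mem[OF *(1) k m1]
    have "ap (\<gamma> (gten X Y)) (vec_ten (vec_ten x y) z) = vec_ten (?r (g \<otimes> h) z) (vec_ten x y)"
      by (rule br[OF ten_closed[OF XY] _ *(3) gr_ten_mem *(6)]) (use * in simp_all)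
    then show "ap (\<gamma> (gten X Y)) (vec_ten (vec_ten x y) z) = ap (Inv C (Assoc C Z X Y) \<bullet> (\<gamma> X \<odot> Id C Y) \<bullet> Assoc C X Z Y \<bullet>
          (Id C X \<odot> \<gamma> Y) \<bullet> Inv C (Assoc C X Y Z)) (vec_ten (vec_ten x y) z)"
      using hex[OF *(1-3,6)] hexagon_eval(2)[OF XY Z hom[OF XY(1)] hom[OF XY(2)] * br[OF XY(2) *(2,3,5,6)] m1 br[OF XY(1) *(1) k *(4) m1] m2]
      by simp
  qed
  show ?thesis
    unfolding center_objs_def is_half_braiding_def using Z ext hom iso nat hexa by simp
qed

text \<open>In one direction compatibility is tested at the lines \<open>delta g\<close> only; in
  the other, the operators give the half-braiding at every object by
  \<open>act_braid\<close>.\<close>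

lemma center_arrs_iff:
  assumes P: "P \<in> CO" and Q: "Q \<in> CO"
  shows "(P, f, Q) \<in> CA \<longleftrightarrow> f \<in> Hom C (fst P) (fst Q) \<and>
    (\<forall>g\<in>\<G>. \<forall>d\<in>\<G>. \<forall>z\<in>fst P d. ap f (act P g z) = act Q g (ap f z))"
proof (cases "f \<in> Hom C (fst P) (fst Q)")
  case f: True
  note Z = center_GS(1)[OF P] and W = center_GS(1)[OF Q]
  have ev: "ap ((f \<odot> Id C X) \<bullet> snd P X) (vec_ten x z) = vec_ten (ap f (act P g z)) x"
    "ap (snd Q X \<bullet> (Id C X \<odot> f)) (vec_ten x z) = vec_ten (act Q g (ap f z)) x"
    if X: "X \<in> GS" and *: "g \<in> \<G>" "d \<in> \<G>" "x \<in> X g" "z \<in> fst P d" for X g d x z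
  proof -
    note t = hom_total[OF X *(1,3)] hom_total[OF Z *(2,4)] and iX = id_hom'[OF X]
    note fX = ten_in_hom[OF f iX] and Xf = ten_in_hom[OF iX f] and gP = center_GS(2)[OF P X] and gQ = center_GS(2)[OF Q X]
    have m: "act P g z \<in> tot (fst P)"
      using hom_total[OF Z _ act_mem[OF P *(1,2,4)]] * by simp
    show "ap ((f \<odot> Id C X) \<bullet> snd P X) (vec_ten x z) = vec_ten (ap f (act P g z)) x"
      by (simp add: ap_comp[OF gP fX total_ten[OF X Z t]] act_braid[OF P X *(1,3) t(2)] ap_ten[OF f iX m t(1)] t)
    show "ap (snd Q X \<bullet> (Id C X \<odot> f)) (vec_ten x z) = vec_ten (act Q g (ap f z)) x"
      by (simp add: ap_comp[OF Xf gQ total_ten[OF X Z t]] act_braid[OF Q X *(1,3) ap_total[OF f t(2)]] ap_ten[OF iX f t] t)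
  qed
  show ?thesis
  proof
    assume a: "(P, f, Q) \<in> CA"
    have "ap f (act P g z) = act Q g (ap f z)" if *: "g \<in> \<G>" "d \<in> \<G>" "z \<in> fst P d" for g d z
    proof -
      note dg = delta_closed[OF *(1)]
      have "vec_ten (ap f (act P g z)) vec_unit = vec_ten (act Q g (ap f z)) vec_unit"
        using ev[OF dg *(1,2) vec_unit_delta *(3)] C.center_arrsD(4)[OF a, of "delta g"] dg by simp
      then show ?thesis
        by (rule vec_ten_cancel_right) simp
    qed
    then show "f \<in> Hom C (fst P) (fst Q) \<and>
      (\<forall>g\<in>\<G>. \<forall>d\<in>\<G>. \<forall>z\<in>fst P d. ap f (act P g z) = act Q g (ap f z))"
      using f by blast
  next
    assume a: "f \<in> Hom C (fst P) (fst Q) \<and>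
      (\<forall>g\<in>\<G>. \<forall>d\<in>\<G>. \<forall>z\<in>fst P d. ap f (act P g z) = act Q g (ap f z))"
    have "(f \<odot> Id C X) \<bullet> snd P X = snd Q X \<bullet> (Id C X \<odot> f)" if X: "X \<in> GS" for X
    proof -
      note iX = id_hom'[OF X]
      note fX = ten_in_hom[OF f iX] and Xf = ten_in_hom[OF iX f] and gP = center_GS(2)[OF P X] and gQ = center_GS(2)[OF Q X]
      show ?thesis
        by (rule hom_ten_eqI[OF hom_comp[OF gP fX] hom_comp[OF Xf gQ] X Z]) (use a in \<open>simp add: ev[OF X]\<close>)
    qed
    then show "(P, f, Q) \<in> CA"
      using P Q f by (simp add: center_arrs_def)
  qed
qed (simp add: center_arrs_def)

text \<open>Origin of \<open>kappa\<close>: the composite contains two associators and one inverse,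
  taken at \<open>(g, a, b)\<close>, then at \<open>(cj g a, g, b)\<close> for the inverse, and
  finally at \<open>(cj g a, cj g b, g)\<close>.\<close>

lemma center_ten_eval:
  assumes P: "P \<in> CO" and Q: "Q \<in> CO" and X: "X \<in> GS"
  shows "snd (cten P Q) X \<in> Hom C (gten X (gten (fst P) (fst Q))) (gten (gten (fst P) (fst Q)) X)"
    and "is_iso C (snd (cten P Q) X)"
    and "\<lbrakk>g \<in> \<G>; a \<in> \<G>; b \<in> \<G>; x \<in> X g; v \<in> fst P a; w \<in> fst Q b\<rbrakk> \<Longrightarrow>
      ap (snd (cten P Q) X) (vec_ten x (vec_ten v w)) =
      vec_ten (vec_scale (kappa g a b) (vec_ten (act P g v) (act Q g w))) x"
proof -
  note Z = center_GS(1)[OF P] and W = center_GS(1)[OF Q]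
  note gP = center_GS(2)[OF P X] and gQ = center_GS(2)[OF Q X]
  note a1 = assoc_in_hom[OF X Z W] and i2 = C.Inv_hom[OF assoc_iso(1)[OF Z X W] assoc_in_hom[OF Z X W]] and a3 = assoc_in_hom[OF Z W X]
  note PW = ten_in_hom[OF gP id_hom'[OF W]] and ZQ = ten_in_hom[OF id_hom'[OF Z] gQ]
  let ?c1 = "Assoc C (fst P) (fst Q) X \<bullet> (Id C (fst P) \<odot> snd Q X)"
  let ?c2 = "?c1 \<bullet> Inv C (Assoc C (fst P) X (fst Q))"
  let ?c3 = "?c2 \<bullet> (snd P X \<odot> Id C (fst Q))"
  note c1 = hom_comp[OF ZQ a3] and c2 = hom_comp[OF i2 hom_comp[OF ZQ a3]]
  note c3 = hom_comp[OF PW c2]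
  have e: "snd (cten P Q) X = ?c3 \<bullet> Assoc C X (fst P) (fst Q)"
    using X by (simp add: center_ten_def)
  show "snd (cten P Q) X \<in> Hom C (gten X (gten (fst P) (fst Q))) (gten (gten (fst P) (fst Q)) X)"
    unfolding e by (rule hom_comp[OF a1 c3])
  have iso: "is_iso C (Assoc C (fst P) (fst Q) X)" "is_iso C (Assoc C (fst P) X (fst Q))" "is_iso C (Assoc C X (fst P) (fst Q))"
    using assoc_iso(1) X Z W by blast+
  have d: "Dom C f = A" "Cod C f = B" if "f \<in> Hom C A B" for f A B
    using that by (simp_all add: Hom_def)
  show "is_iso C (snd (cten P Q) X)"
    unfolding e
    by (intro C.is_iso_comp C.is_iso_ten C.is_iso_id C.is_iso_Inv iso center_GS(3)[OF P X] center_GS(3)[OF Q X])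
      (simp_all add: Z W d[OF c3] d[OF a1] d[OF c2] d[OF PW] d[OF c1] d[OF i2] d[OF a3] d[OF ZQ] del: C.ten_simps C.comp_simps C.Inv_simps)
  assume *: "g \<in> \<G>" "a \<in> \<G>" "b \<in> \<G>" "x \<in> X g" "v \<in> fst P a" "w \<in> fst Q b"
  have k [simp]: "cj g a \<in> \<G>" "cj g b \<in> \<G>"
    using * by simp_all
  note av = act_mem[OF P *(1,2,5)] and aw = act_mem[OF Q *(1,3,6)]
  have t [simp]: "x \<in> tot X" "v \<in> tot (fst P)" "w \<in> tot (fst Q)" "act P g v \<in> tot (fst P)" "act Q g w \<in> tot (fst Q)"
    by (rule hom_total[OF X *(1,4)], rule hom_total[OF Z *(2,5)],
        rule hom_total[OF W *(3,6)], rule hom_total[OF Z k(1) av],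
        rule hom_total[OF W k(2) aw])
  note T = total_ten ten_closed X Z W
  have "ap (snd (cten P Q) X) (vec_ten x (vec_ten v w)) =
     vec_scale (\<omega> g a b * (1 / \<omega> (cj g a) g b * \<omega> (cj g a) (cj g b) g)) (vec_ten (vec_ten (act P g v) (act Q g w)) x)"
    unfolding e
    using * av aw by (simp add: ap_comp[OF a1 c3] ap_comp[OF PW c2] ap_comp[OF i2 c1] ap_comp[OF ZQ a3] T
        ap_assoc[OF X Z W, of g a b] ap_scale[OF c3] ap_scale[OF c2] ap_scale[OF c1] ap_scale[OF a3]
        ap_ten[OF gP id_hom'[OF W]] act_braid[OF P X *(1,4)] act_braid[OF Q X *(1,4)] assoc_iso(2)[OF Z X W, of "cj g a" g b]
        ap_ten[OF id_hom'[OF Z] gQ] ap_assoc[OF Z W X, of "cj g a" "cj g b" g])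
  then show "ap (snd (cten P Q) X) (vec_ten x (vec_ten v w)) =
      vec_ten (vec_scale (kappa g a b) (vec_ten (act P g v) (act Q g w))) x"
    using * by (simp add: kappa_def)
qed

lemma center_ten_fst [simp]: "fst (cten P Q) = gten (fst P) (fst Q)"
  by (simp add: center_ten_def)

lemma act_center_ten:
  assumes P: "P \<in> CO" and Q: "Q \<in> CO"
    and *: "g \<in> \<G>" "a \<in> \<G>" "b \<in> \<G>" "v \<in> fst P a" "w \<in> fst Q b"
  shows "act (cten P Q) g (vec_ten v w) = vec_scale (kappa g a b) (vec_ten (act P g v) (act Q g w))"
  using center_ten_eval(3)[OF P Q delta_closed[OF *(1)] *(1,2,3) vec_unit_delta *(4,5)]
  by (simp add: act_def linear_onD[OF maps_linear(5)] del: vec_ten_scale)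

lemma ten_component_eq:
  assumes V: "V \<in> GS" and W: "W \<in> GS" and f: "linear_on (tot (gten V W)) f" "linear_on (tot (gten V W)) f'"
    and eq: "\<And>a b v w. \<lbrakk>a \<in> \<G>; b \<in> \<G>; a \<otimes> b = d; v \<in> V a; w \<in> W b\<rbrakk> \<Longrightarrow> f (vec_ten v w) = f' (vec_ten v w)"
    and t: "t \<in> gten V W d"
  shows "f t = f' t"
  by (rule linear_on_eq[OF f total_subspace[OF ten_closed[OF V W]] t[unfolded gr_ten_def]])
    (use eq total_ten[OF V W hom_total[OF V] hom_total[OF W]] in blast)+

text \<open>Multiplicativity of the operators on the product is \<open>kappa_theta\<close>, combined
  with the relation for each factor.\<close>

lemma center_ten_closed:
  assumes P: "P \<in> CO" and Q: "Q \<in> CO"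
  shows "cten P Q \<in> CO"
proof -
  note Z = center_GS(1)[OF P] and W = center_GS(1)[OF Q]
  note ZW = ten_closed[OF Z W] and ev = center_ten_eval[OF P Q]
  define \<gamma> where "\<gamma> = snd (cten P Q)"
  have PQ: "cten P Q = (gten (fst P) (fst Q), \<gamma>)"
    by (simp add: \<gamma>_def prod_eq_iff)
  let ?A = "cten P Q"
  have lin: "linear_on (tot (gten (fst P) (fst Q))) (act ?A g)" if "g \<in> \<G>" for g
    using act_delta(1)[of ?A g] ZW ev(1)[OF delta_closed[OF that]] that by simp
  have mem: "act ?A g t \<in> gten (fst P) (fst Q) (cj g d)" if "g \<in> \<G>" "d \<in> \<G>" "t \<in> gten (fst P) (fst Q) d" for g d t
    using act_delta(2)[of ?A g d t] ZW ev(1)[OF delta_closed[OF that(1)]] that by simp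
  have mem_total: "act ?A g t \<in> tot (gten (fst P) (fst Q))" if g: "g \<in> \<G>" and t: "t \<in> tot (gten (fst P) (fst Q))" for g t
    by (rule linear_on_total_map[where s = "cj g", OF ZW ZW lin[OF g] mem[OF g] _ t]) (use g in simp_all)
  have "(gten (fst P) (fst Q), \<gamma>) \<in> CO"
  proof (rule center_objsI[OF ZW])
    show "\<gamma> \<in> extensional GS"
      by (simp add: \<gamma>_def center_ten_def)
    show "\<gamma> X \<in> Hom C (gten X (gten (fst P) (fst Q))) (gten (gten (fst P) (fst Q)) X)" "is_iso C (\<gamma> X)"
      if "X \<in> GS" for X
      unfolding \<gamma>_def using ev(1,2)[OF that] .
    fix g d assume g: "g \<in> \<G>" and d: "d \<in> \<G>"
    {
      fix X x t assume X: "X \<in> GS" and x: "x \<in> X g" and t: "t \<in> gten (fst P) (fst Q) d"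
      have xt: "x \<in> tot X"
        by (rule hom_total[OF X g x])
      have l1: "linear_on (tot (gten (fst P) (fst Q))) (\<lambda>t. ap (\<gamma> X) (vec_ten x t))"
        unfolding \<gamma>_def
        by (simp add: linear_on_def vec_ten_simps ap_add[OF ev(1)[OF X]] ap_scale[OF ev(1)[OF X]] total_ten[OF X ZW xt])
      have l2: "linear_on (tot (gten (fst P) (fst Q))) (\<lambda>t. vec_ten (act ?A g t) x)"
        by (simp add: linear_on_def vec_ten_simps linear_onD[OF lin[OF g]])
      show "ap (\<gamma> X) (vec_ten x t) = vec_ten (act (gten (fst P) (fst Q), \<gamma>) g t) x"
        unfolding PQ[symmetric]
        by (rule ten_component_eq[OF Z W l1 l2 _ t])
          (simp add: \<gamma>_def ev(3)[OF X g _ _ x] act_center_ten[OF P Q g] del: vec_ten_scale)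
    }
    fix h t assume h: "h \<in> \<G>" and t: "t \<in> gten (fst P) (fst Q) d"
    have gh: "g \<otimes> h \<in> \<G>" using g h by simp
    have l: "linear_on (tot (gten (fst P) (fst Q))) (\<lambda>t. vec_scale (theta d g h) (act ?A g (act ?A h t)))"
      using mem_total[OF h]
      by (simp add: linear_on_def linear_onD[OF lin[OF g]] linear_onD[OF lin[OF h]] seqvec.scale_right_distrib mult.commute)
    show "act (gten (fst P) (fst Q), \<gamma>) (g \<otimes> h) t =
      vec_scale (theta d g h) (act (gten (fst P) (fst Q), \<gamma>) g (act (gten (fst P) (fst Q), \<gamma>) h t))"
      unfolding PQ[symmetric]
    proof (rule ten_component_eq[OF Z W lin[OF gh] l _ t])
      fix a b v w assume *: "a \<in> \<G>" "b \<in> \<G>" "a \<otimes> b = d" "v \<in> fst P a" "w \<in> fst Q b"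
      note av = act_mem[OF P h *(1,4)] and aw = act_mem[OF Q h *(2,5)]
      have k: "cj h a \<in> \<G>" "cj h b \<in> \<G>"
        using * h by simp_all
      have tt: "vec_ten (act P h v) (act Q h w) \<in> tot (gten (fst P) (fst Q))"
        by (rule total_ten[OF Z W hom_total[OF Z k(1) av] hom_total[OF W k(2) aw]])
      have eq: "kappa (g \<otimes> h) a b * theta a g h * theta b g h = theta d g h * (kappa h a b * kappa g (cj h a) (cj h b))"
        using kappa_theta[OF *(1,2) g h] *(3) by (simp add: mult_ac)
      show "act ?A (g \<otimes> h) (vec_ten v w) = vec_scale (theta d g h) (act ?A g (act ?A h (vec_ten v w)))"
        using eq by (simp add: act_center_ten[OF P Q gh *(1,2,4,5)] act_center_ten[OF P Q h *(1,2,4,5)]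
            act_center_ten[OF P Q g k av aw] linear_onD(2)[OF lin[OF g] tt]
            act_act[OF P g h *(1,4)] act_act[OF Q g h *(2,5)] mult_ac)
    qed
  qed
  then show ?thesis
    unfolding PQ .
qed

text \<open>Since half-braidings are extensional, objects of the center can be shown to be equal
  rather than just isomorphic; this makes induction compose strictly on objects.\<close>

lemma center_obj_eqI:
  assumes P: "P \<in> CO" and Q: "Q \<in> CO" and f: "fst P = fst Q"
    and eq: "\<And>g d z. \<lbrakk>g \<in> \<G>; d \<in> \<G>; z \<in> fst P d\<rbrakk> \<Longrightarrow> act P g z = act Q g z"
  shows "P = Q"
proof (rule prod_eqI[OF f])
  note Z = center_GS(1)[OF P]
  show "snd P = snd Q"
  proof (rule extensionalityI[OF C.center_objsD(2)[OF P] C.center_objsD(2)[OF Q]])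
    fix X assume "X \<in> Obj C"
    then have X: "X \<in> GS" by simp
    show "snd P X = snd Q X"
    proof (rule hom_ten_eqI[OF center_GS(2)[OF P X] center_GS(2)[OF Q X, folded f] X Z])
      fix g d x z assume *: "g \<in> \<G>" "d \<in> \<G>" "x \<in> X g" "z \<in> fst P d"
      note zt = hom_total[OF Z *(2,4)]
      show "ap (snd P X) (vec_ten x z) = ap (snd Q X) (vec_ten x z)"
        using act_braid[OF P X *(1,3) zt] act_braid[OF Q X *(1,3)] zt f eq[OF *(1,2,4)] by simp
    qed
  qed
qed

text \<open>For arrows out of a tensor product, commutation with the operators is needed on pure
  tensors only, where the operators of the product are known.\<close>

lemma center_arrs_tenI:
  assumes P: "P \<in> CO" and Q: "Q \<in> CO" and R: "R \<in> CO"
    and f: "f \<in> Hom C (gten (fst P) (fst Q)) (fst R)"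
    and eq: "\<And>g a b v w. \<lbrakk>g \<in> \<G>; a \<in> \<G>; b \<in> \<G>; v \<in> fst P a; w \<in> fst Q b\<rbrakk> \<Longrightarrow>
      vec_scale (kappa g a b) (ap f (vec_ten (act P g v) (act Q g w))) = act R g (ap f (vec_ten v w))"
  shows "(cten P Q, f, R) \<in> CA"
proof -
  note Z = center_GS(1)[OF P] and W = center_GS(1)[OF Q] and PQ = center_ten_closed[OF P Q]
  have "ap f (act (cten P Q) g t) = act R g (ap f t)"
    if g: "g \<in> \<G>" and d: "d \<in> \<G>" and t: "t \<in> gten (fst P) (fst Q) d" for g d t
  proof (rule ten_component_eq[OF Z W _ _ _ t])
    note l = linear_onD[OF act_linear[OF PQ g], unfolded center_ten_fst] and lR = linear_onD[OF act_linear[OF R g]]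
      and m = act_total[OF PQ g, unfolded center_ten_fst] and mf = ap_total[OF f]
    show "linear_on (tot (gten (fst P) (fst Q))) (\<lambda>t. ap f (act (cten P Q) g t))"
      by (simp add: linear_on_def l m ap_add[OF f] ap_scale[OF f])
    show "linear_on (tot (gten (fst P) (fst Q))) (\<lambda>t. act R g (ap f t))"
      by (simp add: linear_on_def ap_add[OF f] ap_scale[OF f] mf lR)
    fix a b v w assume *: "a \<in> \<G>" "b \<in> \<G>" "a \<otimes> b = d" "v \<in> fst P a" "w \<in> fst Q b"
    have "vec_ten (act P g v) (act Q g w) \<in> tot (gten (fst P) (fst Q))"
      by (rule total_ten[OF Z W act_total[OF P g hom_total[OF Z *(1,4)]] act_total[OF Q g hom_total[OF W *(2,5)]]])
    then show "ap f (act (cten P Q) g (vec_ten v w)) = act R g (ap f (vec_ten v w))"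
      using eq[OF g *(1,2,4,5)] by (simp add: act_center_ten[OF P Q g *(1,2,4,5)] ap_scale[OF f])
  qed
  then show ?thesis
    unfolding center_arrs_iff[OF PQ R] using f by simp
qed

text \<open>On homogeneous tensors the claim is \<open>kappa_coboundary\<close>.\<close>

lemma center_assoc:
  assumes P: "P \<in> CO" and Q: "Q \<in> CO" and R: "R \<in> CO"
  shows "(cten P (cten Q R), Assoc C (fst P) (fst Q) (fst R), cten (cten P Q) R) \<in> CA"
proof -
  note U = center_GS(1)[OF P] and V = center_GS(1)[OF Q] and W = center_GS(1)[OF R]
  note QR = center_ten_closed[OF Q R] and PQ = center_ten_closed[OF P Q]
  note PQR = center_ten_closed[OF PQ R]
  note A = assoc_in_hom[OF U V W] and VW = ten_closed[OF V W] and UV = ten_closed[OF U V]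
  show ?thesis
  proof (rule center_arrs_tenI[OF P QR PQR])
    show "Assoc C (fst P) (fst Q) (fst R) \<in> Hom C (gten (fst P) (fst (cten Q R))) (fst (cten (cten P Q) R))"
      using A by simp
    fix g a b u t assume g: "g \<in> \<G>" and a: "a \<in> \<G>" and b: "b \<in> \<G>"
      and u: "u \<in> fst P a" and t: "t \<in> fst (cten Q R) b"
    let ?A = "Assoc C (fst P) (fst Q) (fst R)"
    note ut = hom_total[OF U a u]
    note gut = act_total[OF P g ut]
    note lQR = linear_onD[OF act_linear[OF QR g], unfolded center_ten_fst] and mQR = act_total[OF QR g, unfolded center_ten_fst]
      and lPQR = linear_onD[OF act_linear[OF PQR g], unfolded center_ten_fst]
    show "vec_scale (kappa g a b) (ap ?A (vec_ten (act P g u) (act (cten Q R) g t))) =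
        act (cten (cten P Q) R) g (ap ?A (vec_ten u t))"
    proof (rule ten_component_eq[OF V W _ _ _ t[unfolded center_ten_fst]])
      show "linear_on (tot (gten (fst Q) (fst R)))
        (\<lambda>t. vec_scale (kappa g a b) (ap ?A (vec_ten (act P g u) (act (cten Q R) g t))))"
        by (simp add: linear_on_def lQR vec_ten_simps ap_add[OF A] ap_scale[OF A] total_ten[OF U VW gut] mQR
            seqvec.scale_right_distrib mult.commute)
      show "linear_on (tot (gten (fst Q) (fst R))) (\<lambda>t. act (cten (cten P Q) R) g (ap ?A (vec_ten u t)))"
        by (simp add: linear_on_def vec_ten_simps ap_add[OF A] ap_scale[OF A] total_ten[OF U VW ut] lPQR ap_total[OF A])
      fix c d v w assume *: "c \<in> \<G>" "d \<in> \<G>" "c \<otimes> d = b" "v \<in> fst Q c" "w \<in> fst R d"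
      note h = act_mem[OF P g a u] act_mem[OF Q g *(1,4)] act_mem[OF R g *(2,5)]
      have k: "cj g a \<in> \<G>" "cj g c \<in> \<G>" "cj g d \<in> \<G>"
        using g a * by simp_all
      note tt = hom_total[OF U k(1) h(1)] hom_total[OF V k(2) h(2)] hom_total[OF W k(3) h(3)]
      note tv = hom_total[OF V *(1,4)] and tw = hom_total[OF W *(2,5)]
      have uv: "vec_ten u v \<in> fst (cten P Q) (a \<otimes> c)"
        unfolding center_ten_fst by (rule gr_ten_mem) (use a u * in simp_all)
      have ac: "a \<otimes> c \<in> \<G>" using a * by simp
      have eq: "kappa g (a \<otimes> c) d * kappa g a c * \<omega> a c d = kappa g c d * kappa g a b * \<omega> (cj g a) (cj g c) (cj g d)"
        using kappa_coboundary[OF a *(1,2) g] *(3) by simp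
      have "vec_scale (kappa g a b) (ap ?A (vec_ten (act P g u) (act (cten Q R) g (vec_ten v w)))) =
        vec_scale (kappa g c d * kappa g a b * \<omega> (cj g a) (cj g c) (cj g d))
          (vec_ten (vec_ten (act P g u) (act Q g v)) (act R g w))"
        by (simp add: act_center_ten[OF Q R g *(1,2,4,5)] ap_scale[OF A] total_ten U V W VW tt ap_assoc[OF U V W k h] mult_ac)
      also have "\<dots> = act (cten (cten P Q) R) g (ap ?A (vec_ten u (vec_ten v w)))"
        unfolding eq[symmetric]
        by (simp add: ap_assoc[OF U V W a *(1,2) u *(4,5)] lPQR(2) total_ten U V W UV ut tv tw
            act_center_ten[OF PQ R g ac *(2) uv *(5)] act_center_ten[OF P Q g a *(1) u *(4)] mult_ac)
      finally show "vec_scale (kappa g a b) (ap ?A (vec_ten (act P g u) (act (cten Q R) g (vec_ten v w)))) =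
        act (cten (cten P Q) R) g (ap ?A (vec_ten u (vec_ten v w)))" .
    qed
  qed
qed

text \<open>On homogeneous tensors the claim is \<open>kappa_theta_conj\<close>, once the operators
  of \<open>g\<close> and \<open>a\<close> have been interchanged.\<close>

lemma center_braid:
  assumes P: "P \<in> CO" and Q: "Q \<in> CO"
  shows "(cten P Q, snd Q (fst P), cten Q P) \<in> CA"
proof -
  note Z = center_GS(1)[OF P] and W = center_GS(1)[OF Q]
  note gQ = center_GS(2)[OF Q Z]
  show ?thesis
  proof (rule center_arrs_tenI[OF P Q center_ten_closed[OF Q P]])
    show "snd Q (fst P) \<in> Hom C (gten (fst P) (fst Q)) (fst (cten Q P))"
      using gQ by simp
    fix g a b v w assume *: "g \<in> \<G>" "a \<in> \<G>" "b \<in> \<G>" "v \<in> fst P a" "w \<in> fst Q b"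
    note av = act_mem[OF P *(1,2,4)] and aw = act_mem[OF Q *(1,3,5)] and aw' = act_mem[OF Q *(2,3,5)]
    have k: "cj g a \<in> \<G>" "cj g b \<in> \<G>" "cj a b \<in> \<G>" using * by simp_all
    note wt = hom_total[OF W *(3,5)]
    \<comment> \<open>The element \<open>g \<otimes> a\<close> is factored as \<open>cj g a\<close>
      times \<open>g\<close> and as \<open>g\<close> times \<open>a\<close>; comparing the two
      interchanges the operators at the cost of a quotient of values of
      \<open>theta\<close>.\<close>
    have e1: "act Q (g \<otimes> a) w = vec_scale (theta b (cj g a) g) (act Q (cj g a) (act Q g w))"
      using act_act[OF Q k(1) *(1,3,5)] * by (simp add: cj_swap)
    have e2: "act Q (g \<otimes> a) w = vec_scale (theta b g a) (act Q g (act Q a w))"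
      using act_act[OF Q *(1-3,5)] .
    have e: "act Q (cj g a) (act Q g w) = vec_scale (theta b g a / theta b (cj g a) g) (act Q g (act Q a w))"
    proof -
      have "vec_scale (1 / theta b (cj g a) g) (act Q (g \<otimes> a) w) = act Q (cj g a) (act Q g w)"
        using k * by (simp add: e1)
      then show ?thesis
        unfolding e2 by simp
    qed
    have kk: "kappa g a b * (theta b g a / theta b (cj g a) g) = kappa g (cj a b) a"
      using kappa_theta_conj[of b g a] k * by (simp add: field_simps)
    have "vec_scale (kappa g a b) (ap (snd Q (fst P)) (vec_ten (act P g v) (act Q g w))) =
        vec_scale (kappa g (cj a b) a) (vec_ten (act Q g (act Q a w)) (act P g v))"
      unfolding kk[symmetric] by (simp add: act_braid[OF Q Z k(1) av hom_total[OF W k(2) aw]] e)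
    also have "\<dots> = act (cten Q P) g (ap (snd Q (fst P)) (vec_ten v w))"
      by (simp add: act_braid[OF Q Z *(2,4) wt] act_center_ten[OF Q P *(1) k(3) *(2) aw' *(4)])
    finally show "vec_scale (kappa g a b) (ap (snd Q (fst P)) (vec_ten (act P g v) (act Q g w))) =
      act (cten Q P) g (ap (snd Q (fst P)) (vec_ten v w))" .
  qed
qed

lemma gr_unit_delta: "gr_unit G = delta \<one>"
  by (simp add: gr_unit_def delta_def)

text \<open>Treats both unit constraints at once: each cuts off a factor \<open>vec_unit\<close> and
  multiplies degree \<open>g\<close> by a nonzero scalar \<open>c g\<close>; \<open>pu\<close> puts
  the factor back.\<close>

lemma cut_iso:
  fixes A X :: "('a, 'k) grspace"
  assumes A: "A \<in> GS" and X: "X \<in> GS" and lin: "linear_on UNIV ct" and c: "\<And>g. g \<in> \<G> \<Longrightarrow> c g \<noteq> 0"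
    and ct: "\<And>g s. g \<in> \<G> \<Longrightarrow> s \<in> A g \<Longrightarrow> ct s \<in> X g \<and> pu (ct s) = s"
    and pu: "\<And>g x. g \<in> \<G> \<Longrightarrow> x \<in> X g \<Longrightarrow> pu x \<in> A g \<and> ct (pu x) = x"
  defines "f \<equiv> (A, the_linear (tot A) (\<lambda>\<phi>. \<forall>x\<in>\<G>. \<forall>v\<in>X x. \<phi> (pu v) = vec_scale (c x) v), X)"
  shows "f \<in> Hom C A X" "g \<in> \<G> \<Longrightarrow> x \<in> X g \<Longrightarrow> ap f (pu x) = vec_scale (c g) x" "is_iso C f"
proof -
  define \<Phi> where "\<Phi> t = (\<Sum>g\<in>\<G>. vec_scale (c g) (ct (proj A g t)))" for t
  have \<Phi>_lin: "linear_on UNIV \<Phi>"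
    unfolding \<Phi>_def by (rule linear_on_sums, rule linear_on_scale) (rule linear_on_compose[OF lin proj(1)[OF A]])
  have \<Phi>: "\<Phi> s = vec_scale (c g) (ct s)" if g: "g \<in> \<G>" and s: "s \<in> A g" for g s
  proof -
    have "\<Phi> s = vec_scale (c g) (ct (proj A g s))"
      unfolding \<Phi>_def
      by (rule sum_if_eq[OF finite_carrier g]) (simp add: proj(3)[OF A _ g s] linear_on_zero[OF lin seqvec.subspace_UNIV])
    then show ?thesis
      by (simp add: proj(3)[OF A g g s])
  qed
  define h where "h = (A, restrict \<Phi> (tot A), X)"
  have h: "h \<in> Hom C A X"
    unfolding h_def
    by (rule homI[OF A X linear_on_subset[OF \<Phi>_lin subset_UNIV]]) (simp add: \<Phi> gr_scale(1)[OF X] ct)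
  have hs: "ap h s = vec_scale (c g) (ct s)" if "g \<in> \<G>" "s \<in> A g" for g s
    using \<Phi>[OF that] hom_total[OF A that] by (simp add: h_def)
  have hx: "\<forall>g\<in>\<G>. \<forall>x\<in>X g. ap h (pu x) = vec_scale (c g) x"
    using hs pu by simp
  have fh: "f = h"
    unfolding f_def
  proof (rule the_linear_eq[OF h], rule hx, rule ballI)
    fix k t assume k: "linear_on (tot A) k" "\<forall>x\<in>\<G>. \<forall>v\<in>X x. k (pu v) = vec_scale (c x) v" and t: "t \<in> tot A"
    show "k t = ap h t"
    proof (rule linear_on_total_eq[OF A k(1) homD(5)[OF h] _ t])
      fix g s assume *: "g \<in> \<G>" "s \<in> A g"
      show "k s = ap h s"
        unfolding hs[OF *] using k(2) *(1) ct[OF *] by metis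
    qed
  qed
  show "f \<in> Hom C A X" "g \<in> \<G> \<Longrightarrow> x \<in> X g \<Longrightarrow> ap f (pu x) = vec_scale (c g) x"
    unfolding fh using h hx by simp_all
  show "is_iso C f"
    unfolding fh
  proof (rule is_iso_if_bij[OF h], rule bij_betw_byWitness[of _ "\<lambda>x. vec_scale (1 / c g) (pu x)" for g])
    fix g assume g: "g \<in> \<G>"
    have 1: "pu (vec_scale r x) = vec_scale r (pu x)" if x: "x \<in> X g" for r x
      using ct[OF g gr_scale(1)[OF A conjunct1[OF pu[OF g x]], of r]] pu[OF g x] linear_onD(2)[OF lin UNIV_I] by metis
    have ps: "vec_scale r (pu x) \<in> A g" if "x \<in> X g" for r x
      using gr_scale(1)[OF A conjunct1[OF pu[OF g that]]] .
    show "\<forall>s\<in>A g. vec_scale (1 / c g) (pu (ap h s)) = s"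
      using ct[OF g] c[OF g] by (simp add: hs[OF g] 1)
    show "\<forall>x\<in>X g. ap h (vec_scale (1 / c g) (pu x)) = x"
      using pu[OF g] c[OF g] by (simp add: hs[OF g ps] linear_onD(2)[OF lin UNIV_I])
    show "ap h ` A g \<subseteq> X g"
      using homD(6)[OF h g] by (rule image_subsetI)
    show "(\<lambda>x. vec_scale (1 / c g) (pu x)) ` X g \<subseteq> A g"
      using ps by (rule image_subsetI)
  qed
qed

lemma unit_constraints:
  assumes X: "X \<in> GS"
  shows "RUnit C X \<in> Hom C (gten X (gr_unit G)) X"
    and "g \<in> \<G> \<Longrightarrow> x \<in> X g \<Longrightarrow> ap (RUnit C X) (vec_ten x vec_unit) = vec_scale (1 / \<omega> g \<one> \<one>) x"
    and "is_iso C (RUnit C X)"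
    and "LUnit C X \<in> Hom C (gten (gr_unit G) X) X"
    and "g \<in> \<G> \<Longrightarrow> x \<in> X g \<Longrightarrow> ap (LUnit C X) (vec_ten vec_unit x) = vec_scale (\<omega> \<one> \<one> g) x"
    and "is_iso C (LUnit C X)"
proof -
  note U = delta_closed[OF one_closed]
  have R: "RUnit C X = (gten X (delta \<one>), the_linear (tot (gten X (delta \<one>))) (\<lambda>\<phi>.
      \<forall>x\<in>\<G>. \<forall>v\<in>X x. \<phi> (vec_ten v vec_unit) = vec_scale (1 / \<omega> x \<one> \<one>) v), X)"
    and L: "LUnit C X = (gten (delta \<one>) X, the_linear (tot (gten (delta \<one>) X)) (\<lambda>\<phi>.
      \<forall>x\<in>\<G>. \<forall>v\<in>X x. \<phi> (vec_ten vec_unit v) = vec_scale (\<omega> \<one> \<one> x) v), X)"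
    by (simp_all add: graded_vect_def gr_unit_delta)
  have cr: "rcut s \<in> X g \<and> vec_ten (rcut s) vec_unit = s" if "g \<in> \<G>" "s \<in> gten X (delta \<one>) g" for g s
    using ten_delta(1)[OF X one_closed that] that(1) by simp
  have cl: "lcut s \<in> X g \<and> vec_ten vec_unit (lcut s) = s" if "g \<in> \<G>" "s \<in> gten (delta \<one>) X g" for g s
    using ten_delta(2)[OF X one_closed that] that(1) by simp
  have pr: "vec_ten x vec_unit \<in> gten X (delta \<one>) g \<and> rcut (vec_ten x vec_unit) = x" if "g \<in> \<G>" "x \<in> X g" for g x
    using gr_ten_mem[of g \<one> x X vec_unit "delta \<one>"] that by simp
  have pl: "vec_ten vec_unit x \<in> gten (delta \<one>) X g \<and> lcut (vec_ten vec_unit x) = x" if "g \<in> \<G>" "x \<in> X g" for g x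
    using gr_ten_mem[of \<one> g vec_unit "delta \<one>" x X] that by simp
  have nz: "1 / \<omega> g \<one> \<one> \<noteq> 0" "\<omega> \<one> \<one> g \<noteq> 0" if "g \<in> \<G>" for g
    using that by simp_all
  note r = cut_iso[where c = "\<lambda>g. 1 / \<omega> g \<one> \<one>" and pu = "\<lambda>v. vec_ten v vec_unit", OF ten_closed[OF X U] X maps_linear(5) nz(1) cr pr]
  note l = cut_iso[where c = "\<lambda>g. \<omega> \<one> \<one> g" and pu = "\<lambda>v. vec_ten vec_unit v", OF ten_closed[OF U X] X maps_linear(4) nz(2) cl pl]
  show "RUnit C X \<in> Hom C (gten X (gr_unit G)) X"
    unfolding R gr_unit_delta using r(1) .
  show "LUnit C X \<in> Hom C (gten (gr_unit G) X) X"
    unfolding L gr_unit_delta using l(1) .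
  show "is_iso C (RUnit C X)"
    unfolding R using r(3) .
  show "is_iso C (LUnit C X)"
    unfolding L using l(3) .
  assume *: "g \<in> \<G>" "x \<in> X g"
  show "ap (RUnit C X) (vec_ten x vec_unit) = vec_scale (1 / \<omega> g \<one> \<one>) x"
    unfolding R by (rule r(2)) (simp_all add: *)
  show "ap (LUnit C X) (vec_ten vec_unit x) = vec_scale (\<omega> \<one> \<one> g) x"
    unfolding L by (rule l(2)) (simp_all add: *)
qed

text \<open>Instances of the cocycle equation with two neighbouring units. They control how far
  \<omega> is from being normalised.\<close>

lemma omega_unit:
  assumes "x \<in> \<G>" "y \<in> \<G>"
  shows "\<omega> x \<one> y = \<omega> x \<one> \<one> * \<omega> \<one> \<one> y"
    and "\<omega> (x \<otimes> y) \<one> \<one> = \<omega> y \<one> \<one> * \<omega> x y \<one>"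
    and "\<omega> \<one> \<one> (x \<otimes> y) = \<omega> \<one> x y * \<omega> \<one> \<one> x"
  using omega_cocycle[of x \<one> \<one> y] omega_cocycle[of x y \<one> \<one>] omega_cocycle[of \<one> \<one> x y] assms by (simp_all add: mult.commute)

lemma center_unit_eval:
  assumes X: "X \<in> GS"
  shows "snd (center_unit C) X \<in> Hom C (gten X (delta \<one>)) (gten (delta \<one>) X)"
    and "is_iso C (snd (center_unit C) X)"
    and "g \<in> \<G> \<Longrightarrow> x \<in> X g \<Longrightarrow>
      ap (snd (center_unit C) X) (vec_ten x vec_unit) = vec_ten (vec_scale (1 / (\<omega> g \<one> \<one> * \<omega> \<one> \<one> g)) vec_unit) x"
proof -
  note U = unit_constraints[OF X]
  note iL = C.Inv_hom[OF U(6,4)] and UX = ten_closed[OF gr_unit_closed X]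
  have e: "snd (center_unit C) X = Inv C (LUnit C X) \<bullet> RUnit C X"
    using X by (simp add: center_unit_def)
  show "snd (center_unit C) X \<in> Hom C (gten X (delta \<one>)) (gten (delta \<one>) X)"
    unfolding e using hom_comp[OF U(1) iL] by (simp add: gr_unit_delta)
  show "is_iso C (snd (center_unit C) X)"
    unfolding e using U iL by (intro C.is_iso_comp C.is_iso_Inv) (simp_all add: Hom_def)
  assume g: "g \<in> \<G>" and x: "x \<in> X g"
  note xt = hom_total[OF X g x]
  have u: "(vec_unit :: 'k vec) \<in> tot (gr_unit G)"
    by (simp add: gr_unit_delta)
  have l: "ap (Inv C (LUnit C X)) x = vec_scale (1 / \<omega> \<one> \<one> g) (vec_ten vec_unit x)"
  proof -
    have t: "vec_scale (1 / \<omega> \<one> \<one> g) (vec_ten vec_unit x) \<in> tot (gten (gr_unit G) X)"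
      by (rule seqvec.subspace_scale[OF total_subspace[OF UX] total_ten[OF gr_unit_closed X u xt]])
    have "ap (LUnit C X) (vec_scale (1 / \<omega> \<one> \<one> g) (vec_ten vec_unit x)) = x"
      using U(5)[OF g x] g by (simp add: ap_scale[OF U(4)] total_ten[OF gr_unit_closed X u xt])
    then show ?thesis
      using ap_Inv(1)[OF U(4,6) t] by simp
  qed
  show "ap (snd (center_unit C) X) (vec_ten x vec_unit) = vec_ten (vec_scale (1 / (\<omega> g \<one> \<one> * \<omega> \<one> \<one> g)) vec_unit) x"
    unfolding e by (simp add: ap_comp[OF U(1) iL] total_ten[OF X gr_unit_closed xt u] U(2)[OF g x] ap_scale[OF iL xt] l)
qed

lemma center_unit_fst [simp]: "fst (center_unit C) = delta \<one>"
  by (simp add: center_unit_def gr_unit_delta)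

lemma act_center_unit:
  assumes g: "g \<in> \<G>" and z: "z \<in> delta \<one> d"
  shows "act (center_unit C) g z = vec_scale (1 / (\<omega> g \<one> \<one> * \<omega> \<one> \<one> g)) z"
proof -
  note ev = center_unit_eval[OF delta_closed[OF g]]
  have u: "act (center_unit C) g vec_unit = vec_scale (1 / (\<omega> g \<one> \<one> * \<omega> \<one> \<one> g)) vec_unit"
    unfolding act_def ev(3)[OF g vec_unit_delta] by (simp add: linear_onD[OF maps_linear(5)] del: vec_ten_scale)
  have lin: "linear_on (tot (delta \<one>)) (act (center_unit C) g)"
    using act_delta(1)[of "center_unit C" g] ev(1) g by simp
  have 0: "act (center_unit C) g 0 = 0"
    by (rule linear_on_zero[OF lin total_subspace[OF delta_closed[OF one_closed]]])
  consider c where "z = vec_scale c vec_unit" | "z = 0"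
    using delta_cases[OF z] by blast
  then show ?thesis
  proof cases
    case (1 c)
    show ?thesis
      unfolding 1 linear_onD(2)[OF lin delta_total[OF one_closed]] u by (simp add: mult.commute)
  next
    case 2
    show ?thesis
      unfolding 2 0 by (simp only: seqvec.scale_zero_right)
  qed
qed

lemma center_unit_closed: "center_unit C \<in> CO"
proof -
  define \<gamma> where "\<gamma> = snd (center_unit C)"
  have U: "center_unit C = (delta \<one>, \<gamma>)"
    by (simp add: \<gamma>_def prod_eq_iff)
  have "(delta \<one>, \<gamma>) \<in> CO"
  proof (rule center_objsI[OF delta_closed[OF one_closed]])
    show "\<gamma> \<in> extensional GS"
      by (simp add: \<gamma>_def center_unit_def)
    show "\<gamma> X \<in> Hom C (gten X (delta \<one>)) (gten (delta \<one>) X)" "is_iso C (\<gamma> X)" if "X \<in> GS" for X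
      unfolding \<gamma>_def using center_unit_eval(1,2)[OF that] .
    fix g d assume g: "g \<in> \<G>" and d: "d \<in> \<G>"
    {
      fix X x z assume X: "X \<in> GS" and x: "x \<in> X g" and z: "z \<in> delta \<one> d"
      note ev = center_unit_eval[OF X]
      have z': "z = vec_scale (z 0) vec_unit"
        using delta_cases[OF z] by (auto simp: fun_eq_iff)
      have t: "vec_ten x vec_unit \<in> tot (gten X (delta \<one>))"
        by (rule total_ten[OF X delta_closed[OF one_closed] hom_total[OF X g x] delta_total[OF one_closed]])
      have "ap (\<gamma> X) (vec_ten x (vec_scale (z 0) vec_unit)) = vec_ten (vec_scale (1 / (\<omega> g \<one> \<one> * \<omega> \<one> \<one> g)) (vec_scale (z 0) vec_unit)) x"
        unfolding \<gamma>_def by (simp add: ap_scale[OF ev(1) t] ev(3)[OF g x] mult.commute)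
      then show "ap (\<gamma> X) (vec_ten x z) = vec_ten (act (delta \<one>, \<gamma>) g z) x"
        unfolding U[symmetric] act_center_unit[OF g z] z'[symmetric] .
    }
    fix h z assume h: "h \<in> \<G>" and z: "z \<in> delta \<one> d"
    have hz: "vec_scale c z \<in> delta \<one> d" for c
      by (rule gr_scale(1)[OF delta_closed[OF one_closed] z])
    have gh: "g \<otimes> h \<in> \<G>" using g h by simp
    have c: "d = \<one> \<or> z = 0"
      using delta_cases[OF z] by auto
    \<comment> \<open>Nonzero vectors have degree \<open>\<one>\<close>, and there
      \<open>theta\<close> is the coboundary of the function
      \<open>\<omega> g \<one> \<one> * \<omega> \<one> \<one> g\<close>, by whose inverse
      \<open>g\<close> acts on the unit object.\<close>
    have "theta \<one> g h = \<omega> g \<one> \<one> * \<omega> \<one> \<one> h / (\<omega> g h \<one> * \<omega> \<one> g h)"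
      using g h by (simp add: theta_def omega_unit(1)[OF g h])
    then have "1 / (\<omega> (g \<otimes> h) \<one> \<one> * \<omega> \<one> \<one> (g \<otimes> h)) =
        theta \<one> g h * (1 / (\<omega> g \<one> \<one> * \<omega> \<one> \<one> g) * (1 / (\<omega> h \<one> \<one> * \<omega> \<one> \<one> h)))"
      using g h by (simp add: omega_unit(2,3)[OF g h] field_simps)
    then show "act (delta \<one>, \<gamma>) (g \<otimes> h) z = vec_scale (theta d g h) (act (delta \<one>, \<gamma>) g (act (delta \<one>, \<gamma>) h z))"
      unfolding U[symmetric] act_center_unit[OF gh z] act_center_unit[OF h z] act_center_unit[OF g hz]
      using c by (auto simp: seqvec.scale_zero_right)
  qed
  then show ?thesis
    unfolding U .
qed

lemma D_hom_iff: "x \<in> Hom D P Q \<longleftrightarrow> (\<exists>f. x = (P, f, Q) \<and> (P, f, Q) \<in> CA)"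
  by (rule C.center_hom_iff)

lemma center_comp:
  assumes f: "(P, f, Q) \<in> CA" and g: "(Q, g, R) \<in> CA"
  shows "(P, g \<bullet> f, R) \<in> CA"
proof -
  note f' = C.center_arrsD[OF f] and g' = C.center_arrsD[OF g]
  note Z = center_GS(1)[OF f'(1)]
  show ?thesis
    unfolding center_arrs_iff[OF f'(1) g'(2)]
  proof (intro conjI ballI hom_comp[OF f'(3) g'(3)])
    fix k d z assume *: "k \<in> \<G>" "d \<in> \<G>" "z \<in> fst P d"
    note zt = hom_total[OF Z *(2,3)]
    show "ap (g \<bullet> f) (act P k z) = act R k (ap (g \<bullet> f) z)"
      using f g * homD(6)[OF f'(3) *(2,3)]
      by (simp add: center_arrs_iff f'(1,2) g'(2) ap_comp[OF f'(3) g'(3)] zt act_total[OF f'(1) *(1) zt])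
  qed
qed

lemma center_ten_arr:
  assumes f: "(P, f, Q) \<in> CA" and g: "(P', g, Q') \<in> CA"
  shows "(cten P P', f \<odot> g, cten Q Q') \<in> CA"
proof -
  note f' = C.center_arrsD[OF f] and g' = C.center_arrsD[OF g]
  note Z = center_GS(1)[OF f'(1)] and W = center_GS(1)[OF g'(1)]
  show ?thesis
  proof (rule center_arrs_tenI[OF f'(1) g'(1) center_ten_closed[OF f'(2) g'(2)]])
    show "f \<odot> g \<in> Hom C (gten (fst P) (fst P')) (fst (cten Q Q'))"
      using ten_in_hom[OF f'(3) g'(3)] by simp
    fix k a b v w assume *: "k \<in> \<G>" "a \<in> \<G>" "b \<in> \<G>" "v \<in> fst P a" "w \<in> fst P' b"
    note t = hom_total[OF Z *(2,4)] hom_total[OF W *(3,5)]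
    note fv = homD(6)[OF f'(3) *(2,4)] and gw = homD(6)[OF g'(3) *(3,5)]
    show "vec_scale (kappa k a b) (ap (f \<odot> g) (vec_ten (act P k v) (act P' k w))) =
        act (cten Q Q') k (ap (f \<odot> g) (vec_ten v w))"
      using f g * by (simp add: center_arrs_iff f'(1,2) g'(1,2) ap_ten[OF f'(3) g'(3) t] act_center_ten[OF f'(2) g'(2) *(1-3) fv gw]
          ap_ten[OF f'(3) g'(3) act_total[OF f'(1) *(1) t(1)] act_total[OF g'(1) *(1) t(2)]])
  qed
qed

lemma center_id: "P \<in> CO \<Longrightarrow> (P, Id C (fst P), P) \<in> CA"
  using id_hom'[OF center_GS(1)] act_total hom_total[OF center_GS(1)] by (simp add: center_arrs_iff)

lemma center_linear:
  assumes f: "(P, f, Q) \<in> CA"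
  shows "(P, Scale C c f, Q) \<in> CA" "(P, g, Q) \<in> CA \<Longrightarrow> (P, Plus C f g, Q) \<in> CA"
proof -
  note f' = C.center_arrsD[OF f]
  note Z = center_GS(1)[OF f'(1)] and PQ = f'(1,2)
  have sc: "ap (Scale C c f) z = vec_scale c (ap f z)" if "z \<in> tot (fst P)" for z
    using that by (subst homD(1)[OF f'(3)]) simp
  have lQ: "linear_on (tot (fst Q)) (act Q k)" if "k \<in> \<G>" for k
    using act_linear[OF f'(2) that] .
  show "(P, Scale C c f, Q) \<in> CA"
    unfolding center_arrs_iff[OF PQ]
  proof (intro conjI ballI C.scale_hom[OF f'(3)])
    fix k d z assume *: "k \<in> \<G>" "d \<in> \<G>" "z \<in> fst P d"
    note zt = hom_total[OF Z *(2,3)]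
    show "ap (Scale C c f) (act P k z) = act Q k (ap (Scale C c f) z)"
      using f * by (simp add: sc zt act_total[OF PQ(1) *(1) zt] linear_onD(2)[OF lQ[OF *(1)]] ap_total[OF f'(3) zt] center_arrs_iff PQ)
  qed
  assume g: "(P, g, Q) \<in> CA"
  note g' = C.center_arrsD[OF g]
  have pl: "ap (Plus C f g) z = ap f z + ap g z" if "z \<in> tot (fst P)" for z
    using that by (subst homD(1)[OF f'(3)], subst homD(1)[OF g'(3)]) simp
  show "(P, Plus C f g, Q) \<in> CA"
    unfolding center_arrs_iff[OF PQ]
  proof (intro conjI ballI C.plus_hom[OF f'(3) g'(3)])
    fix k d z assume *: "k \<in> \<G>" "d \<in> \<G>" "z \<in> fst P d"
    note zt = hom_total[OF Z *(2,3)]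
    show "ap (Plus C f g) (act P k z) = act Q k (ap (Plus C f g) z)"
      using f g * by (simp add: pl zt act_total[OF PQ(1) *(1) zt] linear_onD(1)[OF lQ[OF *(1)]] ap_total[OF f'(3) zt] ap_total[OF g'(3) zt] center_arrs_iff PQ)
  qed
qed

sublocale D: braided_precategory D
proof
  fix f assume "f \<in> Arr D"
  then show "Dom D f \<in> Obj D" "Cod D f \<in> Obj D"
    using C.center_arrsD(1,2) by (cases f; simp; blast)+
next
  fix f g h P Q R S assume "f \<in> Hom D S P" "g \<in> Hom D P Q" "h \<in> Hom D Q R"
  then obtain f' g' h' where *: "f = (S, f', P)" "g = (P, g', Q)" "h = (Q, h', R)"
    and a: "(S, f', P) \<in> CA" "(P, g', Q) \<in> CA" "(Q, h', R) \<in> CA"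
    unfolding D_hom_iff by blast
  show "h \<cdot>\<^bsub>D\<^esub> g \<cdot>\<^bsub>D\<^esub> f = h \<cdot>\<^bsub>D\<^esub> (g \<cdot>\<^bsub>D\<^esub> f)"
    unfolding * using C.comp_assoc[OF C.center_arrsD(3)[OF a(1)] C.center_arrsD(3)[OF a(2)] C.center_arrsD(3)[OF a(3)]] by simp
next
  fix f P Q assume "f \<in> Hom D P Q"
  then obtain f' where *: "f = (P, f', Q)" and a: "(P, f', Q) \<in> CA"
    unfolding D_hom_iff by blast
  show "Id D Q \<cdot>\<^bsub>D\<^esub> f = f" "f \<cdot>\<^bsub>D\<^esub> Id D P = f"
    unfolding * using C.id_left[OF C.center_arrsD(3)[OF a]] C.id_right[OF C.center_arrsD(3)[OF a]] by simp_all
next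
  fix P Q assume "P \<in> Obj D" "Q \<in> Obj D"
  then show "Id D P \<boxdot>\<^bsub>D\<^esub> Id D Q = Id D (P \<boxtimes>\<^bsub>D\<^esub> Q)"
    using C.ten_id center_GS(1) by simp
next
  fix f f' g g' X X' X'' Y Y' Y''
  assume "f \<in> Hom D X X'" "f' \<in> Hom D X' X''" "g \<in> Hom D Y Y'" "g' \<in> Hom D Y' Y''"
  then obtain a a' b b' where *: "f = (X, a, X')" "f' = (X', a', X'')" "g = (Y, b, Y')" "g' = (Y', b', Y'')"
    and c: "(X, a, X') \<in> CA" "(X', a', X'') \<in> CA" "(Y, b, Y') \<in> CA" "(Y', b', Y'') \<in> CA"
    unfolding D_hom_iff by blast
  show "(f' \<boxdot>\<^bsub>D\<^esub> g') \<cdot>\<^bsub>D\<^esub> (f \<boxdot>\<^bsub>D\<^esub> g) = (f' \<cdot>\<^bsub>D\<^esub> f) \<boxdot>\<^bsub>D\<^esub> (g' \<cdot>\<^bsub>D\<^esub> g)"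
    unfolding * using C.ten_comp[OF c[THEN C.center_arrsD(3)]] by simp
next
  fix f g P Q c assume "f \<in> Hom D P Q"
  then obtain f' where *: "f = (P, f', Q)" and a: "(P, f', Q) \<in> CA"
    unfolding D_hom_iff by blast
  show "Scale D c f \<in> Hom D P Q"
    unfolding * D_hom_iff using center_linear(1)[OF a] by simp
  assume "g \<in> Hom D P Q"
  then obtain g' where **: "g = (P, g', Q)" and b: "(P, g', Q) \<in> CA"
    unfolding D_hom_iff by blast
  show "Plus D f g \<in> Hom D P Q"
    unfolding * ** D_hom_iff using center_linear(2)[OF a b] by simp
next
  fix X Y Z f g assume "f \<in> Hom D X Y" "g \<in> Hom D Y Z"
  then show "g \<cdot>\<^bsub>D\<^esub> f \<in> Hom D X Z"
    unfolding D_hom_iff using center_comp by fastforce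
next
  fix X Y X' Y' f g assume "f \<in> Hom D X X'" "g \<in> Hom D Y Y'"
  then show "f \<boxdot>\<^bsub>D\<^esub> g \<in> Hom D (X \<boxtimes>\<^bsub>D\<^esub> Y) (X' \<boxtimes>\<^bsub>D\<^esub> Y')"
    unfolding D_hom_iff using center_ten_arr by fastforce
qed (simp_all add: D_hom_iff center_id center_ten_closed center_unit_closed center_assoc center_braid)

end

section \<open>The autoequivalences given by automorphisms and cochains\<close>

context finite_group
begin

text \<open>Restricted to the carrier because \<open>auto\<close> consists of extensional
  functions.\<close>

definition inv_auto :: "('a \<Rightarrow> 'a) \<Rightarrow> 'a \<Rightarrow> 'a" where
  "inv_auto a = (\<lambda>x\<in>\<G>. inv_into \<G> a x)"

lemma autoD:
  assumes "a \<in> auto G"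
  shows "x \<in> \<G> \<Longrightarrow> a x \<in> \<G>"
    and "x \<in> \<G> \<Longrightarrow> y \<in> \<G> \<Longrightarrow> a (x \<otimes> y) = a x \<otimes> a y"
    and "bij_betw a \<G> \<G>"
    and "a \<one> = \<one>"
    and "x \<in> \<G> \<Longrightarrow> a (inv x) = inv (a x)"
    and "a \<in> extensional \<G>"
proof -
  have h: "a \<in> hom G G" and b: "a \<in> Bij \<G>"
    using assms by (simp_all add: auto_def)
  interpret a: group_hom G G a
    by unfold_locales (rule h)
  show "x \<in> \<G> \<Longrightarrow> a x \<in> \<G>" "x \<in> \<G> \<Longrightarrow> y \<in> \<G> \<Longrightarrow> a (x \<otimes> y) = a x \<otimes> a y"
    "a \<one> = \<one>" "x \<in> \<G> \<Longrightarrow> a (inv x) = inv (a x)"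
    by simp_all
  show "bij_betw a \<G> \<G>" "a \<in> extensional \<G>"
    using b by (simp_all add: Bij_def)
qed

lemma inv_into_auto:
  assumes a: "a \<in> auto G"
  shows "x \<in> \<G> \<Longrightarrow> inv_into \<G> a (a x) = x" "x \<in> \<G> \<Longrightarrow> a (inv_into \<G> a x) = x"
    "x \<in> \<G> \<Longrightarrow> inv_into \<G> a x \<in> \<G>"
  using autoD(3)[OF a] by (simp_all add: bij_betw_inv_into_left bij_betw_inv_into_right bij_betw_apply[OF bij_betw_inv_into])

lemma inv_auto_closed: "a \<in> auto G \<Longrightarrow> inv_auto a \<in> auto G"
  by (simp del: restrict_apply add: inv_auto_def auto_def restrict_inv_into_Bij restrict_inv_into_hom)

lemma compose_auto: "a \<in> auto G \<Longrightarrow> b \<in> auto G \<Longrightarrow> compose \<G> a b \<in> auto G"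
  unfolding auto_def using compose_Bij group.hom_compose[OF is_group] by blast

lemma compose_inv_auto:
  assumes a: "a \<in> auto G"
  shows "compose \<G> a (inv_auto a) = (\<lambda>x\<in>\<G>. x)" "compose \<G> (inv_auto a) a = (\<lambda>x\<in>\<G>. x)"
  using inv_into_auto[OF a] autoD(1)[OF a] by (auto simp: compose_def inv_auto_def fun_eq_iff)

lemma auto_eq_iff: "a \<in> auto G \<Longrightarrow> b \<in> auto G \<Longrightarrow> a = b \<longleftrightarrow> (\<forall>x\<in>\<G>. a x = b x)"
  using extensionalityI autoD(6) by blast

lemma auto_cj: "\<lbrakk>a \<in> auto G; g \<in> \<G>; x \<in> \<G>\<rbrakk> \<Longrightarrow> a (cj g x) = cj (a g) (a x)"
  by (simp add: cj_def autoD)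

lemma regrade_at: "a \<in> auto G \<Longrightarrow> x \<in> \<G> \<Longrightarrow> shift a V (a x) = V x"
  by (simp add: regrade_def autoD(1) inv_into_auto)

lemma regrade_mem: "\<lbrakk>a \<in> auto G; x \<in> \<G>; v \<in> V x\<rbrakk> \<Longrightarrow> v \<in> shift a V (a x)"
  by (simp add: regrade_at)

lemma regradeE:
  assumes "a \<in> auto G" "y \<in> \<G>"
  obtains x where "x \<in> \<G>" "y = a x" "shift a V y = V x"
proof (rule that)
  show "inv_into \<G> a y \<in> \<G>" "y = a (inv_into \<G> a y)"
    "shift a V y = V (inv_into \<G> a y)"
    using inv_into_auto[OF assms(1)] assms(2) by (simp_all add: regrade_def)
qed

lemma sum_auto: "a \<in> auto G \<Longrightarrow> (\<Sum>x\<in>\<G>. u (a x)) = (\<Sum>x\<in>\<G>. u x)"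
  by (rule sum.reindex_bij_betw[OF autoD(3)])

lemma regrade_closed:
  fixes V :: "('a, 'k::field) grspace"
  assumes a: "a \<in> auto G" and V: "V \<in> graded_spaces G"
  shows "shift a V \<in> graded_spaces G"
proof -
  have 1: "\<forall>y\<in>\<G>. u y = 0"
    if u: "(\<forall>y\<in>\<G>. u y \<in> shift a V y) \<and> (\<Sum>y\<in>\<G>. u y) = 0" for u
  proof
    fix y assume y: "y \<in> \<G>"
    have m: "u (a x) \<in> V x" if "x \<in> \<G>" for x
      using bspec[OF conjunct1[OF u] autoD(1)[OF a that]] unfolding regrade_at[OF a that] .
    have s: "(\<Sum>x\<in>\<G>. u (a x)) = 0"
      unfolding sum_auto[OF a] using u by blast
    have "u (a (inv_into \<G> a y)) = 0"
      by (rule gradedD(3)[of V "\<lambda>x. u (a x)", OF V m s]) (use inv_into_auto[OF a] y in simp_all)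
    then show "u y = 0"
      using inv_into_auto[OF a] y by simp
  qed
  have 2: "seqvec.subspace (shift a V g) \<and> (\<exists>B. finite B \<and> shift a V g = seqvec.span B)"
    if "g \<in> \<G>" for g
    unfolding regrade_def using that gradedD(1,2)[OF V inv_into_auto(3)[OF a that]] by simp
  have 3: "shift a V g = {0}" if "g \<notin> \<G>" for g
    using that by (simp add: regrade_def)
  show ?thesis
    unfolding graded_spaces_def
    by (rule CollectI, intro conjI, rule ballI, rule 2, assumption, rule allI, rule impI, rule 1, assumption,
        rule allI, rule impI, rule 3)
qed

lemma regrade_total:
  fixes V :: "('a, 'k::field) grspace"
  assumes a: "a \<in> auto G"
  shows "tot (shift a V) = tot V"
proof (rule Set.set_eqI, rule iffI)
  fix v assume "v \<in> tot V"
  then obtain u where u: "\<forall>g\<in>\<G>. u g \<in> V g" "v = (\<Sum>g\<in>\<G>. u g)"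
    by (rule totalE)
  let ?u = "\<lambda>y. u (inv_into \<G> a y)"
  have "\<forall>y\<in>\<G>. ?u y \<in> shift a V y"
  proof
    fix y assume y: "y \<in> \<G>"
    show "?u y \<in> shift a V y"
      using bspec[OF u(1) inv_into_auto(3)[OF a y]] y by (simp only: regrade_def if_True)
  qed
  moreover have "v = (\<Sum>y\<in>\<G>. ?u y)"
    unfolding u(2) by (rule sum.reindex_bij_betw[OF bij_betw_inv_into[OF autoD(3)[OF a]], symmetric])
  ultimately show "v \<in> tot (shift a V)"
    unfolding total_iff by (intro exI[of _ ?u] conjI)
next
  fix v assume "v \<in> tot (shift a V)"
  then obtain u where u: "\<forall>g\<in>\<G>. u g \<in> shift a V g" "v = (\<Sum>g\<in>\<G>. u g)"
    by (rule totalE)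
  have "\<forall>x\<in>\<G>. u (a x) \<in> V x"
  proof
    fix x assume x: "x \<in> \<G>"
    show "u (a x) \<in> V x"
      using bspec[OF u(1) autoD(1)[OF a x]] by (simp only: regrade_at[OF a x])
  qed
  moreover have "v = (\<Sum>x\<in>\<G>. u (a x))"
    unfolding u(2) sum_auto[OF a] ..
  ultimately show "v \<in> tot V"
    unfolding total_iff by (intro exI[of _ "\<lambda>x. u (a x)"] conjI)
qed

text \<open>An equality of graded spaces, since an automorphism maps the pairs of degrees with
  product \<open>g\<close> onto those with product \<open>a g\<close>. Hence the tensor structure of
  \<open>F\<^sub>a\<^sub>,\<^sub>\<mu>\<close> can be multiplication by scalars.\<close>

lemma regrade_ten:
  fixes V W :: "('a, 'k::field) grspace"
  assumes a: "a \<in> auto G"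
  shows "gten (shift a V) (shift a W) = shift a (gten V W)"
proof
  fix k
  show "gten (shift a V) (shift a W) k = shift a (gten V W) k"
  proof (cases "k \<in> \<G>")
    case True
    then obtain g where g: "g \<in> \<G>" "k = a g" "shift a (gten V W) k = gten V W g"
      by (rule regradeE[OF a])
    have "{vec_ten v w | v w x y. x \<in> \<G> \<and> y \<in> \<G> \<and> x \<otimes> y = k \<and> v \<in> shift a V x \<and> w \<in> shift a W y} =
      {vec_ten v w | v w x y. x \<in> \<G> \<and> y \<in> \<G> \<and> x \<otimes> y = g \<and> v \<in> V x \<and> w \<in> W y}" (is "?L = ?R")
    proof
      show "?L \<subseteq> ?R"
      proof
        fix t assume "t \<in> ?L"
        then obtain v w x y where *: "t = vec_ten v w" "x \<in> \<G>" "y \<in> \<G>" "x \<otimes> y = k"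
          "v \<in> shift a V x" "w \<in> shift a W y"
          by blast
        obtain x' where x': "x' \<in> \<G>" "x = a x'" "shift a V x = V x'"
          by (rule regradeE[OF a *(2)])
        obtain y' where y': "y' \<in> \<G>" "y = a y'" "shift a W y = W y'"
          by (rule regradeE[OF a *(3)])
        have "a (x' \<otimes> y') = a g"
          using *(4) by (simp add: autoD(2)[OF a] x' y' g)
        then have "x' \<otimes> y' = g"
          using bij_betw_imp_inj_on[OF autoD(3)[OF a]] x'(1) y'(1) g(1) by (simp add: inj_on_def)
        then show "t \<in> ?R"
          using * x' y' by blast
      qed
      show "?R \<subseteq> ?L"
      proof
        fix t assume "t \<in> ?R"
        then obtain v w x y where *: "t = vec_ten v w" "x \<in> \<G>" "y \<in> \<G>" "x \<otimes> y = g" "v \<in> V x" "w \<in> W y"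
          by blast
        then have "a x \<otimes> a y = k"
          by (simp add: g(2) autoD(2)[OF a, symmetric])
        then show "t \<in> ?L"
          using * autoD(1)[OF a] regrade_mem[OF a *(2), of v V] regrade_mem[OF a *(3), of w W] by blast
      qed
    qed
    then show ?thesis
      unfolding g(3) by (simp only: gr_ten_def)
  next
    case False
    then have "{vec_ten v w | v w x y. x \<in> \<G> \<and> y \<in> \<G> \<and> x \<otimes> y = k \<and> v \<in> shift a V x \<and> w \<in> shift a W y} = {}"
      by auto
    then show ?thesis
      unfolding gr_ten_def using False by (simp only: seqvec.span_empty regrade_def if_False)
  qed
qed

lemma regrade_compose:
  fixes V :: "('a, 'k::field) grspace"
  assumes a: "a \<in> auto G" and b: "b \<in> auto G"
  shows "shift a (shift b V) = shift (compose \<G> a b) V"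
proof
  fix k
  note ab = compose_auto[OF a b]
  show "shift a (shift b V) k = shift (compose \<G> a b) V k"
  proof (cases "k \<in> \<G>")
    case True
    then obtain g where g: "g \<in> \<G>" "k = compose \<G> a b g" "shift (compose \<G> a b) V k = V g"
      by (rule regradeE[OF ab])
    have k: "k = a (b g)"
      using g by (simp add: compose_eq)
    show ?thesis
      unfolding g(3) unfolding k using g(1) by (simp add: regrade_at[OF a] regrade_at[OF b] autoD(1)[OF b])
  qed (simp add: regrade_def)
qed

lemma regrade_id:
  fixes V :: "('a, 'k::field) grspace"
  assumes V: "V \<in> graded_spaces G"
  shows "shift (\<lambda>x\<in>\<G>. x) V = V"
proof
  fix k
  show "shift (\<lambda>x\<in>\<G>. x) V k = V k"
    using regrade_at[OF id_in_auto, of k V] gradedD(4)[OF V, of k] by (cases "k \<in> \<G>") (simp_all add: regrade_def)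
qed

lemma regrade_inv:
  fixes V :: "('a, 'k::field) grspace"
  assumes a: "a \<in> auto G" and V: "V \<in> graded_spaces G"
  shows "shift a (shift (inv_auto a) V) = V" "shift (inv_auto a) (shift a V) = V"
  by (simp_all add: regrade_compose[OF a inv_auto_closed[OF a]] regrade_compose[OF inv_auto_closed[OF a] a]
      compose_inv_auto[OF a] regrade_id[OF V])

end

context graded_setup
begin

text \<open>The admissible indices of the functors \<open>F\<^sub>a\<^sub>,\<^sub>\<mu>\<close>.
  Under \<open>pmul\<close> and \<open>pinv\<close> they behave like a group, in which most of the
  later calculations take place.\<close>

definition pair :: "('a \<Rightarrow> 'a) \<Rightarrow> ('a \<Rightarrow> 'a \<Rightarrow> 'k) \<Rightarrow> bool" where
  "pair a \<mu> \<longleftrightarrow> a \<in> auto G \<and> \<mu> \<in> stab_cochains G \<omega> a"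

lemma pairD:
  assumes "pair a \<mu>"
  shows "a \<in> auto G" "\<And>x y. x \<in> \<G> \<Longrightarrow> y \<in> \<G> \<Longrightarrow> \<mu> x y \<noteq> 0"
    and "\<And>x y z. \<lbrakk>x \<in> \<G>; y \<in> \<G>; z \<in> \<G>\<rbrakk> \<Longrightarrow>
      \<omega> (a x) (a y) (a z) = \<omega> x y z * \<mu> y z * \<mu> x (y \<otimes> z) / (\<mu> (x \<otimes> y) z * \<mu> x y)"
    and "\<And>x y. \<not> (x \<in> \<G> \<and> y \<in> \<G>) \<Longrightarrow> \<mu> x y = 1"
proof -
  have m: "\<mu> \<in> cochains2 G" "\<forall>x\<in>\<G>. \<forall>y\<in>\<G>. \<forall>z\<in>\<G>.
       coboundary2 G \<mu> x y z = \<omega> (a x) (a y) (a z) / \<omega> x y z"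
    using assms by (simp_all add: pair_def stab_cochains_def)
  show "a \<in> auto G" using assms by (simp add: pair_def)
  show "\<And>x y. x \<in> \<G> \<Longrightarrow> y \<in> \<G> \<Longrightarrow> \<mu> x y \<noteq> 0"
    "\<And>x y. \<not> (x \<in> \<G> \<and> y \<in> \<G>) \<Longrightarrow> \<mu> x y = 1"
    using m(1) unfolding cochains2_def by blast+
  fix x y z assume *: "x \<in> \<G>" "y \<in> \<G>" "z \<in> \<G>"
  have "coboundary2 G \<mu> x y z = \<omega> (a x) (a y) (a z) / \<omega> x y z"
    using m(2) * by blast
  then have "\<omega> (a x) (a y) (a z) = \<omega> x y z * coboundary2 G \<mu> x y z"
    using * by simp
  then show "\<omega> (a x) (a y) (a z) = \<omega> x y z * \<mu> y z * \<mu> x (y \<otimes> z) / (\<mu> (x \<otimes> y) z * \<mu> x y)"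
    by (simp add: coboundary2_def)
qed

lemma pairI:
  assumes a: "a \<in> auto G" and m: "\<And>x y. x \<in> \<G> \<Longrightarrow> y \<in> \<G> \<Longrightarrow> \<mu> x y \<noteq> 0"
    and e: "\<And>x y z. \<lbrakk>x \<in> \<G>; y \<in> \<G>; z \<in> \<G>\<rbrakk> \<Longrightarrow>
      \<omega> (a x) (a y) (a z) * (\<mu> (x \<otimes> y) z * \<mu> x y) = \<omega> x y z * \<mu> y z * \<mu> x (y \<otimes> z)"
    and o: "\<And>x y. \<not> (x \<in> \<G> \<and> y \<in> \<G>) \<Longrightarrow> \<mu> x y = 1"
  shows "pair a \<mu>"
proof -
  have "coboundary2 G \<mu> x y z = \<omega> (a x) (a y) (a z) / \<omega> x y z" if "x \<in> \<G>" "y \<in> \<G>" "z \<in> \<G>" for x y z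
    using e[OF that] that m by (simp add: coboundary2_def frac_eq_eq mult_ac)
  then show ?thesis
    unfolding pair_def stab_cochains_def cochains2_def using a m o by simp
qed

abbreviation "FF \<equiv> F_functor G"

lemma FF_simps [simp]:
  "FO (FF a \<mu>) = shift a" "FA (FF a \<mu>) (V, f, W) = (shift a V, f, shift a W)"
  by (simp_all add: F_functor_def)

lemma FA_hom:
  assumes a: "a \<in> auto G" and f: "f \<in> Hom C V W"
  shows "FA (FF a \<mu>) f \<in> Hom C (shift a V) (shift a W)" and "ap (FA (FF a \<mu>) f) = ap f"
proof -
  have e: "FA (FF a \<mu>) f = (shift a V, ap f, shift a W)"
    by (subst homD(1)[OF f]) simp
  show "ap (FA (FF a \<mu>) f) = ap f"
    unfolding e by simp
  show "FA (FF a \<mu>) f \<in> Hom C (shift a V) (shift a W)"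
    unfolding hom_iff e ap_simp regrade_total[OF a]
  proof (intro conjI ballI refl regrade_closed[OF a] homD(2-5)[OF f])
    fix k v assume k: "k \<in> \<G>" and v: "v \<in> shift a V k"
    obtain g where g: "g \<in> \<G>" "k = a g" "shift a V k = V g"
      by (rule regradeE[OF a k])
    show "ap f v \<in> shift a W k"
      using homD(6)[OF f g(1)] v by (simp add: g(2) regrade_at[OF a g(1)])
  qed
qed

text \<open>The test vectors are taken from \<open>V x\<close> instead of the regraded component, so
  that degrees appear as \<open>x\<close> and not through the inverse of \<open>a\<close>.\<close>

lemma hom_regrade_ten_eqI:
  assumes a: "a \<in> auto G" and V: "V \<in> GS" and W: "W \<in> GS"
    and h: "h \<in> Hom C (gten (shift a V) (shift a W)) X" "h' \<in> Hom C (gten (shift a V) (shift a W)) X"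
    and eq: "\<And>x y v w. \<lbrakk>x \<in> \<G>; y \<in> \<G>; v \<in> V x; w \<in> W y\<rbrakk> \<Longrightarrow> ap h (vec_ten v w) = ap h' (vec_ten v w)"
  shows "h = h'"
proof (rule hom_ten_eqI[OF h regrade_closed[OF a V] regrade_closed[OF a W]])
  fix x y v w assume *: "x \<in> \<G>" "y \<in> \<G>" "v \<in> shift a V x" "w \<in> shift a W y"
  obtain x' where x': "x' \<in> \<G>" "x = a x'" "shift a V x = V x'"
    by (rule regradeE[OF a *(1)])
  obtain y' where y': "y' \<in> \<G>" "y = a y'" "shift a W y = W y'"
    by (rule regradeE[OF a *(2)])
  show "ap h (vec_ten v w) = ap h' (vec_ten v w)"
    using eq[OF x'(1) y'(1)] * x' y' by simp
qed

lemma FJ_props: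
  assumes p: "pair a \<mu>" and V: "V \<in> GS" and W: "W \<in> GS"
  shows "FJ (FF a \<mu>) V W \<in> Hom C (gten (shift a V) (shift a W)) (shift a (gten V W))"
    and "\<lbrakk>x \<in> \<G>; y \<in> \<G>; v \<in> V x; w \<in> W y\<rbrakk> \<Longrightarrow>
      ap (FJ (FF a \<mu>) V W) (vec_ten v w) = vec_scale (\<mu> x y) (vec_ten v w)"
    and "is_iso C (FJ (FF a \<mu>) V W)"
    and "\<lbrakk>x \<in> \<G>; y \<in> \<G>; v \<in> V x; w \<in> W y\<rbrakk> \<Longrightarrow>
      ap (Inv C (FJ (FF a \<mu>) V W)) (vec_ten v w) = vec_scale (1 / \<mu> x y) (vec_ten v w)"
proof -
  let ?F = "FF a \<mu>"
  note a = pairD(1)[OF p] and m = pairD(2)[OF p]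
  let ?V = "shift a V" and ?W = "shift a W"
  note rV = regrade_closed[OF a V] and rW = regrade_closed[OF a W]
  note VW = ten_closed[OF rV rW]
  \<comment> \<open>A vector of degree \<open>x\<close> in \<open>V\<close> has degree
    \<open>a x\<close> after regrading, so the scalar is prescribed through the inverse of
    \<open>a\<close>. Arbitrary \<open>c\<close> allows \<open>1 / \<mu>\<close>, which yields the
    inverse.\<close>
  have ex: "\<exists>f\<in>Hom C (gten ?V ?W) (gten ?V ?W). \<forall>x\<in>\<G>. \<forall>y\<in>\<G>. \<forall>v\<in>V x. \<forall>w\<in>W y.
      ap f (vec_ten v w) = vec_scale (c x y) (vec_ten v w)" for c :: "'a \<Rightarrow> 'a \<Rightarrow> 'k"
  proof -
    have "\<exists>f\<in>Hom C (gten ?V ?W) (gten ?V ?W). \<forall>x\<in>\<G>. \<forall>y\<in>\<G>. \<forall>v\<in>?V x. \<forall>w\<in>?W y.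
      ap f (vec_ten v w) = vec_scale (c (inv_into \<G> a x) (inv_into \<G> a y)) (vec_ten v w)"
    proof (rule ten_hom_exists[OF rV rW VW])
      show "linear_on UNIV (vec_scale k)" for k :: 'k
        by (simp add: linear_on_def seqvec.scale_right_distrib mult.commute)
      fix x y v w assume *: "x \<in> \<G>" "y \<in> \<G>" "v \<in> ?V x" "w \<in> ?W y"
      show "vec_scale (c (inv_into \<G> a x) (inv_into \<G> a y)) (vec_ten v w) \<in> gten ?V ?W (x \<otimes> y)"
        by (rule gr_scale(1)[OF VW gr_ten_mem]) (use * in simp_all)
    qed
    then obtain f where f: "f \<in> Hom C (gten ?V ?W) (gten ?V ?W)"
      and apf: "\<forall>x\<in>\<G>. \<forall>y\<in>\<G>. \<forall>v\<in>?V x. \<forall>w\<in>?W y.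
      ap f (vec_ten v w) = vec_scale (c (inv_into \<G> a x) (inv_into \<G> a y)) (vec_ten v w)"
      by blast
    have "ap f (vec_ten v w) = vec_scale (c x y) (vec_ten v w)" if "x \<in> \<G>" "y \<in> \<G>" "v \<in> V x" "w \<in> W y" for x y v w
      using apf[rule_format, of "a x" "a y" v w] that autoD(1)[OF a] regrade_mem[OF a that(1), of v V] regrade_mem[OF a that(2), of w W]
      by (simp add: inv_into_auto[OF a])
    then show ?thesis
      using f by blast
  qed
  note hom_eq = hom_regrade_ten_eqI[OF a V W]
  have tt: "vec_ten v w \<in> tot (gten ?V ?W)" if "x \<in> \<G>" "y \<in> \<G>" "v \<in> V x" "w \<in> W y" for x y v w
    by (rule total_ten[OF rV rW]) (use that hom_total[OF V] hom_total[OF W] in \<open>simp_all add: regrade_total[OF a]\<close>)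
  obtain j where j: "j \<in> Hom C (gten ?V ?W) (gten ?V ?W)"
    and apj: "\<forall>x\<in>\<G>. \<forall>y\<in>\<G>. \<forall>v\<in>V x. \<forall>w\<in>W y. ap j (vec_ten v w) = vec_scale (\<mu> x y) (vec_ten v w)"
    using ex[of \<mu>] by blast
  obtain j' where j': "j' \<in> Hom C (gten ?V ?W) (gten ?V ?W)"
    and apj': "\<forall>x\<in>\<G>. \<forall>y\<in>\<G>. \<forall>v\<in>V x. \<forall>w\<in>W y. ap j' (vec_ten v w) = vec_scale (1 / \<mu> x y) (vec_ten v w)"
    using ex[of "\<lambda>x y. 1 / \<mu> x y"] by blast
  have inv: "is_inverse C j j'"
  proof (rule C.is_inverseI[OF j j'])
    show "j' \<bullet> j = Id C (gten ?V ?W)"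
      by (rule hom_eq[OF hom_comp[OF j j'] id_hom'[OF VW]])
        (simp add: ap_comp[OF j j'] tt apj apj' ap_scale[OF j'] m)
    show "j \<bullet> j' = Id C (gten ?V ?W)"
      by (rule hom_eq[OF hom_comp[OF j' j] id_hom'[OF VW]])
        (simp add: ap_comp[OF j' j] tt apj apj' ap_scale[OF j] m)
  qed
  have "FJ ?F V W = (gten ?V ?W, the_linear (tot (gten ?V ?W)) (\<lambda>\<phi>.
           \<forall>x\<in>\<G>. \<forall>y\<in>\<G>. \<forall>v\<in>V x. \<forall>w\<in>W y.
             \<phi> (vec_ten v w) = vec_scale (\<mu> x y) (vec_ten v w)), gten ?V ?W)"
    by (simp add: F_functor_def regrade_ten[OF a])
  also have "\<dots> = j"
  proof (rule the_linear_eq[OF j], rule apj, rule ballI)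
    fix h t assume h: "h \<in> extensional (tot (gten ?V ?W))" "linear_on (tot (gten ?V ?W)) h"
      "\<forall>x\<in>\<G>. \<forall>y\<in>\<G>. \<forall>v\<in>V x. \<forall>w\<in>W y. h (vec_ten v w) = vec_scale (\<mu> x y) (vec_ten v w)"
      and t: "t \<in> tot (gten ?V ?W)"
    show "h t = ap j t"
    proof (rule linear_on_ten_eq[OF rV rW h(2) homD(5)[OF j] _ t])
      fix x y v w assume *: "x \<in> \<G>" "y \<in> \<G>" "v \<in> ?V x" "w \<in> ?W y"
      obtain x' where x': "x' \<in> \<G>" "x = a x'" "?V x = V x'"
        by (rule regradeE[OF a *(1)])
      obtain y' where y': "y' \<in> \<G>" "y = a y'" "?W y = W y'"
        by (rule regradeE[OF a *(2)])
      show "h (vec_ten v w) = ap j (vec_ten v w)"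
        using h(3) apj * x' y' by simp
    qed
  qed
  finally have J: "FJ ?F V W = j" .
  show "FJ ?F V W \<in> Hom C (gten ?V ?W) (shift a (gten V W))"
    unfolding J regrade_ten[OF a, symmetric] by (rule j)
  show "is_iso C (FJ ?F V W)"
    unfolding J by (rule C.is_isoI[OF inv])
  assume *: "x \<in> \<G>" "y \<in> \<G>" "v \<in> V x" "w \<in> W y"
  show "ap (FJ ?F V W) (vec_ten v w) = vec_scale (\<mu> x y) (vec_ten v w)"
    unfolding J using apj * by blast
  show "ap (Inv C (FJ ?F V W)) (vec_ten v w) = vec_scale (1 / \<mu> x y) (vec_ten v w)"
    unfolding J C.Inv_eq[OF inv] using apj' * by blast
qed

lemma FF_functor:
  assumes a: "a \<in> auto G"
  shows "is_functor C C (FF a \<mu>)"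
  unfolding is_functor_def
proof (intro conjI ballI)
  fix X assume "X \<in> Obj C"
  then show "FO (FF a \<mu>) X \<in> Obj C" "FA (FF a \<mu>) (Id C X) = Id C (FO (FF a \<mu>) X)"
    using regrade_closed[OF a] by (simp_all add: graded_vect_simps(5) regrade_total[OF a])
next
  fix X Y f assume "f \<in> Hom C X Y"
  then show "FA (FF a \<mu>) f \<in> Hom C (FO (FF a \<mu>) X) (FO (FF a \<mu>) Y)"
    using FA_hom(1)[OF a] by simp
next
  fix X Y Z f g assume f: "f \<in> Hom C X Y" and g: "g \<in> Hom C Y Z"
  note Ff = FA_hom[OF a f, of \<mu>] and Fg = FA_hom[OF a g, of \<mu>] and Fgf = FA_hom[OF a hom_comp[OF f g], of \<mu>]
  show "FA (FF a \<mu>) (g \<bullet> f) = FA (FF a \<mu>) g \<bullet> FA (FF a \<mu>) f"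
    by (rule hom_eqI_total[OF Fgf(1) hom_comp[OF Ff(1) Fg(1)]])
      (simp add: Fgf(2) ap_comp[OF Ff(1) Fg(1)] Ff(2) Fg(2) regrade_total[OF a] ap_comp[OF f g])
qed

lemma regrade_unit: "a \<in> auto G \<Longrightarrow> shift a (delta \<one>) = delta \<one>"
proof
  fix k assume a: "a \<in> auto G"
  show "shift a (delta \<one>) k = delta \<one> k"
  proof (cases "k \<in> \<G>")
    case True
    then obtain g where g: "g \<in> \<G>" "k = a g" "shift a (delta \<one>) k = delta \<one> g"
      by (rule regradeE[OF a])
    have "a g = \<one> \<longleftrightarrow> g = \<one>"
      using bij_betw_imp_inj_on[OF autoD(3)[OF a]] autoD(4)[OF a] g(1) by (metis inj_onD one_closed)
    then show ?thesis
      unfolding g(3) unfolding g(2) by (simp add: delta_def)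
  qed (auto simp: regrade_def delta_def)
qed

text \<open>Compatibility of the scalars \<mu> with the associators, evaluated on three homogeneous
  vectors, is exactly the equation for the coboundary of \<mu>.\<close>

lemma FF_tensor_functor:
  assumes p: "pair a \<mu>"
  shows "is_tensor_functor C C (FF a \<mu>)"
  unfolding is_tensor_functor_def is_linear_functor_def
proof (intro conjI ballI allI)
  let ?F = "FF a \<mu>"
  note a = pairD(1)[OF p]
  show "is_functor C C ?F"
    by (rule FF_functor[OF a])
  show "isomorphic C (FO ?F (UnitO C)) (UnitO C)"
    unfolding isomorphic_def using C.id_hom[OF C.unit_obj] C.is_iso_id[OF C.unit_obj]
    by (auto simp: gr_unit_delta regrade_unit[OF a])
  fix X Y assume "X \<in> Obj C" "Y \<in> Obj C"
  then have XY: "X \<in> GS" "Y \<in> GS" by simp_all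
  note J = FJ_props[OF p XY]
  show "FJ ?F X Y \<in> Hom C (FO ?F X \<boxtimes>\<^bsub>C\<^esub> FO ?F Y) (FO ?F (X \<boxtimes>\<^bsub>C\<^esub> Y))" "is_iso C (FJ ?F X Y)"
    using J by simp_all
  {
    fix f c assume f: "f \<in> Hom C X Y"
    show "FA ?F (Scale C c f) = Scale C c (FA ?F f)"
      by (subst (1 2) homD(1)[OF f]) (simp add: regrade_total[OF a])
    fix g assume g: "g \<in> Hom C X Y"
    show "FA ?F (Plus C f g) = Plus C (FA ?F f) (FA ?F g)"
      by (subst (1 2) homD(1)[OF f], subst (1 2) homD(1)[OF g]) (simp add: regrade_total[OF a])
  }
  {
    fix X' Y' f g assume "X' \<in> Obj C" "Y' \<in> Obj C" and f: "f \<in> Hom C X X'" and g: "g \<in> Hom C Y Y'"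
    then have XY': "X' \<in> GS" "Y' \<in> GS" by simp_all
    note J' = FJ_props[OF p XY']
    note Ff = FA_hom[OF a f, of \<mu>] and Fg = FA_hom[OF a g, of \<mu>]
    note t = ten_in_hom[OF Ff(1) Fg(1)] and Ft = FA_hom[OF a ten_in_hom[OF f g], of \<mu>]
    show "FJ ?F X' Y' \<bullet> (FA ?F f \<odot> FA ?F g) = FA ?F (f \<odot> g) \<bullet> FJ ?F X Y"
    proof (rule hom_regrade_ten_eqI[OF a XY hom_comp[OF t J'(1)] hom_comp[OF J(1) Ft(1)]])
      fix x y v w assume *: "x \<in> \<G>" "y \<in> \<G>" "v \<in> X x" "w \<in> Y y"
      have v: "v \<in> tot (shift a X)" and w: "w \<in> tot (shift a Y)"
        using hom_total[OF XY(1) *(1,3)] hom_total[OF XY(2) *(2,4)] by (simp_all add: regrade_total[OF a])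
      have vw: "vec_ten v w \<in> tot (gten (shift a X) (shift a Y))" "vec_ten v w \<in> tot (gten X Y)"
        using total_ten[OF regrade_closed[OF a XY(1)] regrade_closed[OF a XY(2)] v w]
          total_ten[OF XY hom_total[OF XY(1) *(1,3)] hom_total[OF XY(2) *(2,4)]] by simp_all
      show "ap (FJ ?F X' Y' \<bullet> (FA ?F f \<odot> FA ?F g)) (vec_ten v w) =
        ap (FA ?F (f \<odot> g) \<bullet> FJ ?F X Y) (vec_ten v w)"
        using homD(6)[OF f *(1,3)] homD(6)[OF g *(2,4)] *
        by (simp add: ap_comp[OF t J'(1)] ap_comp[OF J(1) Ft(1)] vw ap_ten[OF Ff(1) Fg(1) v w] Ff(2) Fg(2) Ft(2) J'(2)
            J(2) ap_scale[OF ten_in_hom[OF f g]] ap_ten[OF f g] v[unfolded regrade_total[OF a]] w[unfolded regrade_total[OF a]])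
    qed
  }
  fix Z assume "Z \<in> Obj C"
  then have Z: "Z \<in> GS" by simp
  note rX = regrade_closed[OF a XY(1)] and rY = regrade_closed[OF a XY(2)] and rZ = regrade_closed[OF a Z]
  note XYo = ten_closed[OF XY] and YZ = ten_closed[OF XY(2) Z]
  note JXY_Z = FJ_props[OF p XYo Z] and JX_YZ = FJ_props[OF p XY(1) YZ] and JYZ = FJ_props[OF p XY(2) Z]
  note A = assoc_in_hom[OF rX rY rZ] and FA' = FA_hom[OF a assoc_in_hom[OF XY Z], of \<mu>]
  note J1 = ten_in_hom[OF J(1) id_hom'[OF rZ]] and J2 = ten_in_hom[OF id_hom'[OF rX] JYZ(1)]
  note l1 = hom_comp[OF J1 JXY_Z(1)] and r1 = hom_comp[OF JX_YZ(1) FA'(1)]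
  have "FJ ?F (gten X Y) Z \<bullet> (FJ ?F X Y \<odot> Id C (shift a Z)) \<bullet> Assoc C (shift a X) (shift a Y) (shift a Z) =
        FA ?F (Assoc C X Y Z) \<bullet> FJ ?F X (gten Y Z) \<bullet> (Id C (shift a X) \<odot> FJ ?F Y Z)"
  proof (rule hom_ten3_eqI[OF hom_comp[OF A l1] hom_comp[OF J2 r1] rX rY rZ])
    fix x' y' z' u v w assume *: "x' \<in> \<G>" "y' \<in> \<G>" "z' \<in> \<G>" "u \<in> shift a X x'" "v \<in> shift a Y y'" "w \<in> shift a Z z'"
    note t = hom_total[OF rX *(1,4)] hom_total[OF rY *(2,5)] hom_total[OF rZ *(3,6)]
    note t' = t[unfolded regrade_total[OF a]]
    obtain x where x: "x \<in> \<G>" "x' = a x" "shift a X x' = X x"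
      by (rule regradeE[OF a *(1)])
    obtain y where y: "y \<in> \<G>" "y' = a y" "shift a Y y' = Y y"
      by (rule regradeE[OF a *(2)])
    obtain z where z: "z \<in> \<G>" "z' = a z" "shift a Z z' = Z z"
      by (rule regradeE[OF a *(3)])
    have m: "u \<in> X x" "v \<in> Y y" "w \<in> Z z"
      using * x y z by simp_all
    have xy: "x \<otimes> y \<in> \<G>" "y \<otimes> z \<in> \<G>"
      using x y z by simp_all
    note uv = gr_ten_mem[of x y u X v Y, OF x(1) y(1) m(1,2)] and vw = gr_ten_mem[of y z v Y w Z, OF y(1) z(1) m(2,3)]
    note T = total_ten XY Z XYo YZ rX rY rZ ten_closed
    have uvt: "vec_ten u v \<in> tot (gten (shift a X) (shift a Y))"
      by (rule total_ten[OF rX rY t(1,2)])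
    have vwt: "vec_ten v w \<in> tot (gten (shift a Y) (shift a Z))"
      by (rule total_ten[OF rY rZ t(2,3)])
    have uvr: "vec_ten u v \<in> tot (shift a (gten X Y))" "vec_ten v w \<in> tot (shift a (gten Y Z))"
      using uvt vwt by (simp_all add: regrade_ten[OF a])
    have uv_w: "vec_ten (vec_ten u v) w \<in> tot (gten (shift a (gten X Y)) (shift a Z))"
      by (rule total_ten[OF regrade_closed[OF a XYo] rZ uvr(1) t(3)])
    have u_vw: "vec_ten u (vec_ten v w) \<in> tot (gten (shift a X) (shift a (gten Y Z)))"
      by (rule total_ten[OF rX regrade_closed[OF a YZ] t(1) uvr(2)])
    have "ap (FJ ?F (gten X Y) Z \<bullet> (FJ ?F X Y \<odot> Id C (shift a Z)) \<bullet> Assoc C (shift a X) (shift a Y) (shift a Z))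
        (vec_ten u (vec_ten v w)) = vec_scale (\<omega> (a x) (a y) (a z) * (\<mu> x y * \<mu> (x \<otimes> y) z)) (vec_ten (vec_ten u v) w)"
      using * x(1) y(1) z(1) by (simp add: ap_comp[OF A l1] T t ap_assoc[OF rX rY rZ *] ap_scale[OF l1] ap_comp[OF J1 JXY_Z(1)]
          ap_ten[OF J(1) id_hom'[OF rZ] uvt t(3)] J(2)[OF x(1) y(1) m(1,2)] ap_scale[OF JXY_Z(1) uv_w] JXY_Z(2)[OF xy(1) z(1) uv m(3)] x(2) y(2) z(2))
    also have "\<dots> = vec_scale (\<mu> y z * (\<mu> x (y \<otimes> z) * \<omega> x y z)) (vec_ten (vec_ten u v) w)"
    proof -
      have "\<omega> (a x) (a y) (a z) * (\<mu> x y * \<mu> (x \<otimes> y) z) = \<mu> y z * (\<mu> x (y \<otimes> z) * \<omega> x y z)"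
        using x(1) y(1) z(1) pairD(2)[OF p] by (simp add: pairD(3)[OF p] field_simps)
      then show ?thesis by simp
    qed
    also have "\<dots> = ap (FA ?F (Assoc C X Y Z) \<bullet> FJ ?F X (gten Y Z) \<bullet> (Id C (shift a X) \<odot> FJ ?F Y Z)) (vec_ten u (vec_ten v w))"
      by (simp add: ap_comp[OF J2 r1] T t ap_ten[OF id_hom'[OF rX] JYZ(1) t(1) vwt] JYZ(2)[OF y(1) z(1) m(2,3)]
          ap_scale[OF r1 u_vw] ap_comp[OF JX_YZ(1) FA'(1) u_vw] JX_YZ(2)[OF x(1) xy(2) m(1) vw] FA'(2) ap_scale[OF assoc_in_hom[OF XY Z]] t'
          ap_assoc[OF XY Z x(1) y(1) z(1) m])
    finally show "ap (FJ ?F (gten X Y) Z \<bullet> (FJ ?F X Y \<odot> Id C (shift a Z)) \<bullet> Assoc C (shift a X) (shift a Y) (shift a Z))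
        (vec_ten u (vec_ten v w)) =
      ap (FA ?F (Assoc C X Y Z) \<bullet> FJ ?F X (gten Y Z) \<bullet> (Id C (shift a X) \<odot> FJ ?F Y Z)) (vec_ten u (vec_ten v w))" .
  qed
  then show "FJ ?F (X \<boxtimes>\<^bsub>C\<^esub> Y) Z \<bullet> (FJ ?F X Y \<odot> Id C (FO ?F Z)) \<bullet> Assoc C (FO ?F X) (FO ?F Y) (FO ?F Z) =
        FA ?F (Assoc C X Y Z) \<bullet> FJ ?F X (Y \<boxtimes>\<^bsub>C\<^esub> Z) \<bullet> (Id C (FO ?F X) \<odot> FJ ?F Y Z)"
    by simp
qed

lemma FF_equivalence:
  assumes a: "a \<in> auto G"
  shows "is_equivalence C C (FF a \<mu>)"
\<comment> \<open>An equivalence is a matter of objects and arrows, which the cochain does not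
  affect; so \<mu> is reused for the inverse automorphism although the two need not form a
  pair.\<close>
proof (rule C.is_equivalence_if_inverse[OF FF_functor[OF a] FF_functor[OF inv_auto_closed[OF a], of \<mu>]])
  show "FO (FF a \<mu>) (FO (FF (inv_auto a) \<mu>) X) = X" "FO (FF (inv_auto a) \<mu>) (FO (FF a \<mu>) X) = X" if "X \<in> Obj C" for X
    using that by (simp_all add: regrade_inv[OF a])
  show "FA (FF a \<mu>) (FA (FF (inv_auto a) \<mu>) f) = f" "FA (FF (inv_auto a) \<mu>) (FA (FF a \<mu>) f) = f" if "f \<in> Arr C" for f
    using that by (cases f; simp add: graded_maps_def regrade_inv[OF a])+
qed

lemma FF_autoeq: "pair a \<mu> \<Longrightarrow> FF a \<mu> \<in> tensor_autoeqs C"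
  unfolding tensor_autoeqs_def using FF_tensor_functor FF_equivalence pairD(1) by blast

text \<open>The cochain of the composite of \<open>F\<^sub>a\<^sub>,\<^sub>\<mu>\<close> after
  \<open>F\<^sub>b\<^sub>,\<^sub>\<nu>\<close>: the outer functor meets vectors of degree
  \<open>x\<close> in degree \<open>b x\<close>.\<close>

definition pmul :: "('a \<Rightarrow> 'a) \<Rightarrow> ('a \<Rightarrow> 'a \<Rightarrow> 'k) \<Rightarrow> ('a \<Rightarrow> 'a \<Rightarrow> 'k) \<Rightarrow> 'a \<Rightarrow> 'a \<Rightarrow> 'k" where
  "pmul b \<mu> \<nu> x y = (if x \<in> \<G> \<and> y \<in> \<G> then \<mu> (b x) (b y) * \<nu> x y else 1)"

definition pinv :: "('a \<Rightarrow> 'a) \<Rightarrow> ('a \<Rightarrow> 'a \<Rightarrow> 'k) \<Rightarrow> 'a \<Rightarrow> 'a \<Rightarrow> 'k" where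
  "pinv a \<mu> x y = (if x \<in> \<G> \<and> y \<in> \<G> then 1 / \<mu> (inv_auto a x) (inv_auto a y) else 1)"

lemma pair_one: "pair (\<lambda>x\<in>\<G>. x) (\<lambda>x y. 1)"
  by (rule pairI[OF id_in_auto]) simp_all

lemma pair_mult:
  assumes p: "pair a \<mu>" and q: "pair b \<nu>"
  shows "pair (compose \<G> a b) (pmul b \<mu> \<nu>)"
proof (rule pairI[OF compose_auto[OF pairD(1)[OF p] pairD(1)[OF q]]])
  note b = autoD(1,2)[OF pairD(1)[OF q]]
  fix x y assume xy: "x \<in> \<G>" "y \<in> \<G>"
  show "pmul b \<mu> \<nu> x y \<noteq> 0"
    using xy pairD(2)[OF p] pairD(2)[OF q] b by (simp add: pmul_def)
  fix z assume z: "z \<in> \<G>"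
  show "\<omega> (compose \<G> a b x) (compose \<G> a b y) (compose \<G> a b z) *
      (pmul b \<mu> \<nu> (x \<otimes> y) z * pmul b \<mu> \<nu> x y) = \<omega> x y z * pmul b \<mu> \<nu> y z * pmul b \<mu> \<nu> x (y \<otimes> z)"
    using xy z pairD(2)[OF p] pairD(2)[OF q] b by (simp add: compose_eq pmul_def pairD(3)[OF p] pairD(3)[OF q] field_simps)
qed (auto simp: pmul_def)

lemma pair_inv:
  assumes p: "pair a \<mu>"
  shows "pair (inv_auto a) (pinv a \<mu>)"
proof (rule pairI[OF inv_auto_closed[OF pairD(1)[OF p]]])
  note b = autoD(1,2)[OF inv_auto_closed[OF pairD(1)[OF p]]]
  fix x y assume xy: "x \<in> \<G>" "y \<in> \<G>"
  show "pinv a \<mu> x y \<noteq> 0"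
    using xy pairD(2)[OF p] b by (simp add: pinv_def)
  fix z assume z: "z \<in> \<G>"
  have e: "a (inv_auto a x) = x" if "x \<in> \<G>" for x
    using inv_into_auto[OF pairD(1)[OF p]] that by (simp add: inv_auto_def)
  have "\<omega> x y z = \<omega> (inv_auto a x) (inv_auto a y) (inv_auto a z) * \<mu> (inv_auto a y) (inv_auto a z) * \<mu> (inv_auto a x) (inv_auto a (y \<otimes> z)) /
     (\<mu> (inv_auto a (x \<otimes> y)) (inv_auto a z) * \<mu> (inv_auto a x) (inv_auto a y))"
    using pairD(3)[OF p, of "inv_auto a x" "inv_auto a y" "inv_auto a z"] xy z b e by simp
  then show "\<omega> (inv_auto a x) (inv_auto a y) (inv_auto a z) * (pinv a \<mu> (x \<otimes> y) z * pinv a \<mu> x y) =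
      \<omega> x y z * pinv a \<mu> y z * pinv a \<mu> x (y \<otimes> z)"
    using xy z pairD(2)[OF p] b by (simp add: pinv_def)
qed (auto simp: pinv_def)

lemma pmul_pinv:
  assumes p: "pair a \<mu>"
  shows "pmul (inv_auto a) \<mu> (pinv a \<mu>) = (\<lambda>x y. 1)" "pmul a (pinv a \<mu>) \<mu> = (\<lambda>x y. 1)"
  using pairD(2)[OF p] autoD(1)[OF inv_auto_closed[OF pairD(1)[OF p]]] autoD(1)[OF pairD(1)[OF p]]
    inv_into_auto[OF pairD(1)[OF p]]
  by (auto simp: pmul_def pinv_def fun_eq_iff inv_auto_def)

text \<open>Regrading composes strictly, so the composition law holds on the nose for objects,
  arrows and tensor structures.\<close>

lemma FF_comp_agree:
  assumes p: "pair a \<mu>" and q: "pair b \<nu>"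
  shows "C.agree (comp_tensor_functor C (FF a \<mu>) (FF b \<nu>)) (FF (compose \<G> a b) (pmul b \<mu> \<nu>))"
  unfolding C.agree_def comp_tensor_functor_def fctr.simps tfctr.simps
proof (intro conjI ballI)
  let ?F = "FF a \<mu>"
  note a = pairD(1)[OF p] and b = pairD(1)[OF q] and pq = pair_mult[OF p q]
  fix X assume "X \<in> Obj C"
  then have X: "X \<in> GS" by simp
  show "FO ?F (FO (FF b \<nu>) X) = FO (FF (compose \<G> a b) (pmul b \<mu> \<nu>)) X"
    by (simp add: regrade_compose[OF a b])
  fix Y assume "Y \<in> Obj C"
  then have Y: "Y \<in> GS" by simp
  note rX = regrade_closed[OF b X] and rY = regrade_closed[OF b Y]
  note Jb = FJ_props[OF q X Y] and Ja = FJ_props[OF p rX rY] and Jab = FJ_props[OF pq X Y]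
  note FJb = FA_hom[OF a Jb(1), of \<mu>]
  note Ja1 = Ja(1)[unfolded regrade_ten[OF b]] and FJb1 = FJb(1)[unfolded regrade_ten[OF b]]
  note h = hom_comp[OF Ja1 FJb1]
  have e: "shift a (shift b X) = shift (compose \<G> a b) X"
    "shift a (shift b Y) = shift (compose \<G> a b) Y"
    "shift a (shift b (gten X Y)) = shift (compose \<G> a b) (gten X Y)"
    by (simp_all add: regrade_compose[OF a b])
  have "FA ?F (FJ (FF b \<nu>) X Y) \<bullet> FJ ?F (shift b X) (shift b Y) = FJ (FF (compose \<G> a b) (pmul b \<mu> \<nu>)) X Y"
  proof (rule hom_regrade_ten_eqI[OF compose_auto[OF a b] X Y h[unfolded e] Jab(1)])
    fix x y v w assume *: "x \<in> \<G>" "y \<in> \<G>" "v \<in> X x" "w \<in> Y y"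
    note v = regrade_mem[OF b *(1), of v X, OF *(3)] and w = regrade_mem[OF b *(2), of w Y, OF *(4)]
    note t = hom_total[OF X *(1,3)] hom_total[OF Y *(2,4)]
    have t': "v \<in> tot (shift b X)" "w \<in> tot (shift b Y)"
      "v \<in> tot (shift a (shift b X))" "w \<in> tot (shift a (shift b Y))"
      using t by (simp_all add: regrade_total[OF a] regrade_total[OF b])
    note vw = total_ten[OF regrade_closed[OF a rX] regrade_closed[OF a rY] t'(3,4)]
    note vw' = total_ten[OF rX rY t'(1,2)]
    show "ap (FA ?F (FJ (FF b \<nu>) X Y) \<bullet> FJ ?F (shift b X) (shift b Y)) (vec_ten v w) =
        ap (FJ (FF (compose \<G> a b) (pmul b \<mu> \<nu>)) X Y) (vec_ten v w)"
      using * by (simp add: ap_comp[OF Ja1 FJb1 vw] Ja(2)[OF autoD(1)[OF b *(1)] autoD(1)[OF b *(2)] v w] FJb(2) ap_scale[OF Jb(1) vw']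
          Jb(2)[OF *] Jab(2)[OF *]) (simp add: pmul_def)
  qed
  then show "FA ?F (FJ (FF b \<nu>) X Y) \<bullet> FJ ?F (FO (FF b \<nu>) X) (FO (FF b \<nu>) Y) =
      FJ (FF (compose \<G> a b) (pmul b \<mu> \<nu>)) X Y"
    by simp
next
  let ?F = "FF a \<mu>"
  note a = pairD(1)[OF p] and b = pairD(1)[OF q]
  fix f assume "f \<in> Arr C"
  show "FA ?F (FA (FF b \<nu>) f) = FA (FF (compose \<G> a b) (pmul b \<mu> \<nu>)) f"
    by (cases f) (simp add: regrade_compose[OF a b])
qed

lemma FF_id_agree: "C.agree (FF (\<lambda>x\<in>\<G>. x) (\<lambda>x y. 1)) (id_tensor_functor C)"
  unfolding C.agree_def id_tensor_functor_def fctr.simps tfctr.simps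
proof (intro conjI ballI)
  fix X assume "X \<in> Obj C"
  then have X: "X \<in> GS" by simp
  show "FO (FF (\<lambda>x\<in>\<G>. x) (\<lambda>x y. 1)) X = X"
    by (simp add: regrade_id[OF X])
  fix Y assume "Y \<in> Obj C"
  then have Y: "Y \<in> GS" by simp
  note J = FJ_props[OF pair_one X Y] and XY = ten_closed[OF X Y]
  have "FJ (FF (\<lambda>x\<in>\<G>. x) (\<lambda>x y. 1)) X Y = Id C (gten X Y)"
    by (rule hom_ten_eqI[OF J(1)[unfolded regrade_id[OF X] regrade_id[OF Y] regrade_id[OF XY]] id_hom'[OF XY] X Y])
      (simp add: J(2) total_ten[OF X Y hom_total[OF X] hom_total[OF Y]])
  then show "FJ (FF (\<lambda>x\<in>\<G>. x) (\<lambda>x y. 1)) X Y = Id C (X \<boxtimes>\<^bsub>C\<^esub> Y)"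
    by simp
next
  fix f assume "f \<in> Arr C"
  then show "FA (FF (\<lambda>x\<in>\<G>. x) (\<lambda>x y. 1)) f = f"
    by (cases f) (simp add: graded_maps_def regrade_id)
qed

end

section \<open>The induced braided autoequivalences\<close>

context graded_setup
begin

text \<open>Origin of the factor: the tensor structure before the half-braiding contributes
  \<open>\<mu> g d\<close>, and the inverse one after it, where the degrees are
  \<open>cj g d\<close> and \<open>g\<close>, contributes the denominator.\<close>

lemma ind_eval:
  assumes p: "pair a \<mu>" and P: "P \<in> CO" and X: "X \<in> GS"
  shows "snd (indo (FF a \<mu>) P) X \<in> Hom C (gten X (shift a (fst P))) (gten (shift a (fst P)) X)"
    and "is_iso C (snd (indo (FF a \<mu>) P) X)"
    and "\<lbrakk>g \<in> \<G>; d \<in> \<G>; x \<in> X (a g); z \<in> fst P d\<rbrakk> \<Longrightarrow>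
      ap (snd (indo (FF a \<mu>) P) X) (vec_ten x z) = vec_ten (vec_scale (\<mu> g d / \<mu> (cj g d) g) (act P g z)) x"
proof -
  let ?F = "FF a \<mu>"
  note a = pairD(1)[OF p] and Z = center_GS(1)[OF P]
  \<comment> \<open>Regrading is strictly invertible, so \<open>X\<close> is the image of
    \<open>Y\<close>, and an identity can be used as the isomorphism in
    \<open>ind_half_braiding\<close>; the chosen quasi-inverse disappears.\<close>
  define Y where "Y = shift (inv_auto a) X"
  have Y: "Y \<in> GS" unfolding Y_def by (rule regrade_closed[OF inv_auto_closed[OF a] X])
  have rY: "shift a Y = X" unfolding Y_def by (rule regrade_inv(1)[OF a X])
  note rZ = regrade_closed[OF a Z]
  have Yo: "Y \<in> Obj C" and Xo: "X \<in> Obj C" using X Y by simp_all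
  have z: "Id C X \<in> Hom C (FO ?F Y) X"
    using X by (simp add: rY)
  note ihb = C.ind_half_braiding[OF FF_tensor_functor[OF p] FF_equivalence[OF a] P Yo z C.is_iso_id(1)[OF Xo]]
  show "snd (indo ?F P) X \<in> Hom C (gten X (shift a (fst P))) (gten (shift a (fst P)) X)"
    "is_iso C (snd (indo ?F P) X)"
    using ihb(2,3) by simp_all
  note JYZ = FJ_props[OF p Y Z, unfolded rY] and JZY = FJ_props[OF p Z Y, unfolded rY]
  note gY = center_GS(2)[OF P Y] and Fg = FA_hom[OF a center_GS(2)[OF P Y], of \<mu>]
  note iJ = C.Inv_hom[OF JZY(3,1)]
  note h1 = hom_comp[OF JYZ(1) Fg(1)]
  note h2 = hom_comp[OF h1 iJ]
  have e: "snd (indo ?F P) X = Inv C (FJ ?F (fst P) Y) \<bullet> (FA ?F (snd P Y) \<bullet> FJ ?F Y (fst P))"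
  proof -
    have "Id C (shift a (fst P)) \<odot> Id C X = Id C (gten (shift a (fst P)) X)"
      "Id C X \<odot> Id C (shift a (fst P)) = Id C (gten X (shift a (fst P)))"
      using C.ten_id[of "shift a (fst P)" X] C.ten_id[of X "shift a (fst P)"] X rZ by simp_all
    then show ?thesis
      unfolding ihb(1) C.is_iso_id(2)[OF Xo] FF_simps
      using C.id_left[OF h2] C.id_right[OF JYZ(1)] by simp
  qed
  assume *: "g \<in> \<G>" "d \<in> \<G>" "x \<in> X (a g)" "z \<in> fst P d"
  have x: "x \<in> Y g"
    using *(3) regrade_at[OF a *(1), of Y] by (simp add: rY)
  note zt = hom_total[OF Z *(2,4)] and xt = hom_total[OF Y *(1) x] and az = act_mem[OF P *(1,2,4)]
  have k: "cj g d \<in> \<G>" using * by simp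
  have t: "vec_ten x z \<in> tot (gten X (shift a (fst P)))"
    using total_ten[OF X rZ] xt zt by (simp add: regrade_total[OF a] rY[symmetric])
  have t': "vec_ten x z \<in> tot (gten Y (fst P))"
    by (rule total_ten[OF Y Z xt zt])
  have t'': "vec_ten (act P g z) x \<in> tot (shift a (gten (fst P) Y))"
    unfolding regrade_total[OF a] by (rule total_ten[OF Z Y hom_total[OF Z k az] xt])
  show "ap (snd (indo ?F P) X) (vec_ten x z) = vec_ten (vec_scale (\<mu> g d / \<mu> (cj g d) g) (act P g z)) x"
    unfolding e
    by (simp add: ap_comp[OF h1 iJ t] ap_comp[OF JYZ(1) Fg(1) t] JYZ(2)[OF *(1,2) x *(4)] Fg(2) ap_scale[OF gY t']
        act_braid[OF P Y *(1) x zt] ap_scale[OF iJ t''] JZY(4)[OF k *(1) az x])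
qed

lemma ind_obj_eq: "indo (FF a \<mu>) P = (shift a (fst P), snd (indo (FF a \<mu>) P))"
  by (simp add: prod_eq_iff C.ind_obj_fst)

lemma act_ind:
  assumes p: "pair a \<mu>" and P: "P \<in> CO" and *: "g \<in> \<G>" "d \<in> \<G>" "z \<in> fst P d"
  shows "act (indo (FF a \<mu>) P) (a g) z = vec_scale (\<mu> g d / \<mu> (cj g d) g) (act P g z)"
  by (subst ind_obj_eq, rule actI,
      rule ind_eval(3)[OF p P delta_closed[OF autoD(1)[OF pairD(1)[OF p] *(1)]] *(1,2) vec_unit_delta *(3)])

text \<open>What has to be seen is that the operators, rescaled by values of \<mu>, are
  multiplicative with \<open>theta\<close> evaluated at images under \<open>a\<close>.\<close>

lemma ind_obj_closed:
  assumes p: "pair a \<mu>" and P: "P \<in> CO"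
  shows "indo (FF a \<mu>) P \<in> CO"
proof -
  note a = pairD(1)[OF p] and Z = center_GS(1)[OF P]
  let ?\<gamma> = "snd (indo (FF a \<mu>) P)"
  have "(shift a (fst P), ?\<gamma>) \<in> CO"
  proof (rule center_objsI[OF regrade_closed[OF a Z]])
    show "?\<gamma> \<in> extensional GS"
      using C.ind_obj_extensional by simp
    show "?\<gamma> X \<in> Hom C (gten X (shift a (fst P))) (gten (shift a (fst P)) X)" "is_iso C (?\<gamma> X)"
      if "X \<in> GS" for X
      using ind_eval(1,2)[OF p P that] .
  next
    fix X g' d' x z assume X: "X \<in> GS" and *: "g' \<in> \<G>" "d' \<in> \<G>" "x \<in> X g'" "z \<in> shift a (fst P) d'"
    obtain g where g: "g \<in> \<G>" "g' = a g" "shift a (fst P) g' = fst P g"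
      by (rule regradeE[OF a *(1)])
    obtain d where d: "d \<in> \<G>" "d' = a d" "shift a (fst P) d' = fst P d"
      by (rule regradeE[OF a *(2)])
    have x: "x \<in> X (a g)" and z: "z \<in> fst P d"
      using * g d by simp_all
    show "ap (?\<gamma> X) (vec_ten x z) = vec_ten (act (shift a (fst P), ?\<gamma>) g' z) x"
      unfolding ind_obj_eq[symmetric] g(2) act_ind[OF p P g(1) d(1) z] by (rule ind_eval(3)[OF p P X g(1) d(1) x z])
  next
    fix g' h' d' z assume *: "g' \<in> \<G>" "h' \<in> \<G>" "d' \<in> \<G>" "z \<in> shift a (fst P) d'"
    obtain g where g: "g \<in> \<G>" "g' = a g" "shift a (fst P) g' = fst P g"
      by (rule regradeE[OF a *(1)])
    obtain h where h: "h \<in> \<G>" "h' = a h" "shift a (fst P) h' = fst P h"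
      by (rule regradeE[OF a *(2)])
    obtain d where d: "d \<in> \<G>" "d' = a d" "shift a (fst P) d' = fst P d"
      by (rule regradeE[OF a *(3)])
    have z: "z \<in> fst P d"
      using * d by simp
    define d1 D where "d1 = cj h d" and "D = cj g d1"
    have c [simp]: "d1 \<in> \<G>" "D \<in> \<G>" "g \<otimes> h \<in> \<G>"
      using g(1) h(1) d(1) by (simp_all add: d1_def D_def)
    have cs: "d1 \<otimes> h = h \<otimes> d" "D \<otimes> g = g \<otimes> d1" "cj (g \<otimes> h) d = D"
      using g(1) h(1) d(1) by (simp_all add: d1_def D_def cj_swap cj_cj)
    have e: "a g \<otimes> a h = a (g \<otimes> h)" "cj (a h) (a d) = a d1" "cj (a (g \<otimes> h)) (a d) = a D"
      using autoD(2)[OF a g(1) h(1)] auto_cj[OF a, symmetric] g(1) h(1) d(1) c autoD(1)[OF a] by (simp_all add: d1_def D_def cj_cj)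
    have z1: "act P h z \<in> fst P d1"
      unfolding d1_def by (rule act_mem[OF P h(1) d(1) z])
    have z1': "vec_scale k (act P h z) \<in> fst P d1" for k
      by (rule gr_scale(1)[OF Z z1])
    have m: "\<mu> x y \<noteq> 0" if "x \<in> \<G>" "y \<in> \<G>" for x y
      using pairD(2)[OF p that] .
    \<comment> \<open>Each of the three values of \<omega> in \<open>theta\<close> at images under
      \<open>a\<close> is rewritten by the coboundary equation; the values of \<mu> that survive are
      the rescaling factors of the three operators.\<close>
    have th: "\<mu> (g \<otimes> h) d / \<mu> D (g \<otimes> h) * theta d g h =
      theta (a d) (a g) (a h) * (\<mu> g d1 / \<mu> D g) * (\<mu> h d / \<mu> d1 h)"
      unfolding theta_def e cs d1_def[symmetric]
      using m g(1) h(1) d(1) by (simp add: pairD(3)[OF p] cs field_simps)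
    have sc: "act P g (vec_scale k (act P h z)) = vec_scale k (act P g (act P h z))" for k
      by (rule linear_onD(2)[OF act_linear[OF P g(1)] hom_total[OF Z c(1) z1]])
    show "act (shift a (fst P), ?\<gamma>) (g' \<otimes> h') z =
      vec_scale (theta d' g' h') (act (shift a (fst P), ?\<gamma>) g' (act (shift a (fst P), ?\<gamma>) h' z))"
      unfolding ind_obj_eq[symmetric] g(2) h(2) d(2) e act_ind[OF p P c(3) d(1) z] act_ind[OF p P h(1) d(1) z] d1_def[symmetric]
        act_ind[OF p P g(1) c(1) z1'] cs sc act_act[OF P g(1) h(1) d(1) z] D_def[symmetric] vec_scale_vec_scale th
      by (simp add: mult_ac)
  qed
  then show ?thesis
    unfolding ind_obj_eq[symmetric] .
qed

lemma ind_arr: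
  assumes p: "pair a \<mu>" and f: "(P, f, Q) \<in> CA"
  shows "(indo (FF a \<mu>) P, FA (FF a \<mu>) f, indo (FF a \<mu>) Q) \<in> CA"
proof -
  note a = pairD(1)[OF p] and f' = C.center_arrsD[OF f]
  note Z = center_GS(1)[OF f'(1)]
  note Ff = FA_hom[OF a f'(3), of \<mu>]
  show ?thesis
    unfolding center_arrs_iff[OF ind_obj_closed[OF p f'(1)] ind_obj_closed[OF p f'(2)]] C.ind_obj_fst FF_simps Ff(2)
  proof (intro conjI ballI Ff(1))
    fix g' d' z assume *: "g' \<in> \<G>" "d' \<in> \<G>" "z \<in> shift a (fst P) d'"
    obtain g where g: "g \<in> \<G>" "g' = a g" "shift a (fst P) g' = fst P g"
      by (rule regradeE[OF a *(1)])
    obtain d where d: "d \<in> \<G>" "d' = a d" "shift a (fst P) d' = fst P d"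
      by (rule regradeE[OF a *(2)])
    have z: "z \<in> fst P d" using *(3) d(3) by simp
    have k: "cj g d \<in> \<G>" using g(1) d(1) by simp
    have "ap f (act P g z) = act Q g (ap f z)"
      using f g(1) d(1) z by (simp add: center_arrs_iff[OF f'(1,2)])
    then show "ap f (act (indo (FF a \<mu>) P) g' z) = act (indo (FF a \<mu>) Q) g' (ap f z)"
      unfolding g(2) act_ind[OF p f'(1) g(1) d(1) z] act_ind[OF p f'(2) g(1) d(1) homD(6)[OF f'(3) d(1) z]]
      by (simp add: ap_scale[OF f'(3) hom_total[OF Z k act_mem[OF f'(1) g(1) d(1) z]]])
  qed
qed

lemma ind_FJ:
  assumes p: "pair a \<mu>" and P: "P \<in> CO" and Q: "Q \<in> CO"
  shows "(cten (indo (FF a \<mu>) P) (indo (FF a \<mu>) Q), FJ (FF a \<mu>) (fst P) (fst Q),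
    indo (FF a \<mu>) (cten P Q)) \<in> CA"
proof -
  let ?F = "FF a \<mu>"
  note a = pairD(1)[OF p] and Z = center_GS(1)[OF P] and W = center_GS(1)[OF Q]
  note iP = ind_obj_closed[OF p P] and iQ = ind_obj_closed[OF p Q] and PQ = center_ten_closed[OF P Q]
  note J = FJ_props[OF p Z W] and iPQ = ind_obj_closed[OF p PQ]
  note rZ = regrade_closed[OF a Z] and rW = regrade_closed[OF a W]
  show ?thesis
  proof (rule center_arrs_tenI[OF iP iQ iPQ])
    show "FJ ?F (fst P) (fst Q) \<in> Hom C (gten (fst (indo ?F P)) (fst (indo ?F Q)))
        (fst (indo ?F (cten P Q)))"
      using J(1) by (simp add: C.ind_obj_fst)
    fix g' x' y' v w assume *: "g' \<in> \<G>" "x' \<in> \<G>" "y' \<in> \<G>"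
      "v \<in> fst (indo ?F P) x'" "w \<in> fst (indo ?F Q) y'"
    obtain g where g: "g \<in> \<G>" "g' = a g" "shift a (fst P) g' = fst P g"
      by (rule regradeE[OF a *(1)])
    obtain x where x: "x \<in> \<G>" "x' = a x" "shift a (fst P) x' = fst P x"
      by (rule regradeE[OF a *(2)])
    obtain y where y: "y \<in> \<G>" "y' = a y" "shift a (fst Q) y' = fst Q y"
      by (rule regradeE[OF a *(3)])
    have v: "v \<in> fst P x" and w: "w \<in> fst Q y"
      using *(4,5) x(3) y(3) by (simp_all add: C.ind_obj_fst)
    define x1 y1 where "x1 = cj g x" and "y1 = cj g y"
    have c [simp]: "x1 \<in> \<G>" "y1 \<in> \<G>" "x \<otimes> y \<in> \<G>"
      using g(1) x(1) y(1) by (simp_all add: x1_def y1_def)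
    have cs: "x1 \<otimes> g = g \<otimes> x" "y1 \<otimes> g = g \<otimes> y" "cj g (x \<otimes> y) = x1 \<otimes> y1"
      using g(1) x(1) y(1) by (simp_all add: x1_def y1_def cj_swap cj_mult)
    have e: "cj (a g) (a x) = a x1" "cj (a g) (a y) = a y1"
      using auto_cj[OF a] g(1) x(1) y(1) by (simp_all add: x1_def y1_def)
    note av = act_mem[OF P g(1) x(1) v, folded x1_def] and aw = act_mem[OF Q g(1) y(1) w, folded y1_def]
    have m: "\<mu> x y \<noteq> 0" if "x \<in> \<G>" "y \<in> \<G>" for x y
      using pairD(2)[OF p that] .
    \<comment> \<open>The analogous identity for \<open>kappa\<close>: the surviving values of \<mu>
      are the rescaling factors in degrees \<open>x\<close>, \<open>y\<close> and
      \<open>x \<otimes> y\<close>, and the tensor structure before and after the operators.\<close>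
    have k: "kappa (a g) (a x) (a y) * (\<mu> g x / \<mu> x1 g) * (\<mu> g y / \<mu> y1 g) * \<mu> x1 y1 =
        \<mu> x y * (\<mu> g (x \<otimes> y) / \<mu> (x1 \<otimes> y1) g) * kappa g x y"
      unfolding kappa_def e x1_def[symmetric] y1_def[symmetric]
      using m g(1) x(1) y(1) by (simp add: pairD(3)[OF p] cs field_simps)
    have vw: "vec_ten v w \<in> gten (fst P) (fst Q) (x \<otimes> y)"
      by (rule gr_ten_mem[of x y v "fst P" w "fst Q", OF x(1) y(1) v w])
    have vw': "vec_ten v w \<in> fst (cten P Q) (x \<otimes> y)" "vec_scale c (vec_ten v w) \<in> fst (cten P Q) (x \<otimes> y)" for c
      using vw gr_scale(1)[OF ten_closed[OF Z W] vw] by simp_all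
    have tt: "vec_ten (act P g v) (act Q g w) \<in> tot (gten (shift a (fst P)) (shift a (fst Q)))"
      by (rule total_ten[OF rZ rW])
        (simp_all add: regrade_total[OF a] hom_total[OF Z c(1) av] hom_total[OF W c(2) aw])
    have tvw: "vec_ten v w \<in> tot (gten (fst P) (fst Q))"
      by (rule total_ten[OF Z W hom_total[OF Z x(1) v] hom_total[OF W y(1) w]])
    have "vec_scale (kappa g' x' y') (ap (FJ ?F (fst P) (fst Q)) (vec_ten (act (indo ?F P) g' v) (act (indo ?F Q) g' w))) =
      vec_scale (kappa (a g) (a x) (a y) * (\<mu> g x / \<mu> x1 g) * (\<mu> g y / \<mu> y1 g) * \<mu> x1 y1) (vec_ten (act P g v) (act Q g w))"
      unfolding g(2) x(2) y(2) act_ind[OF p P g(1) x(1) v] act_ind[OF p Q g(1) y(1) w] x1_def[symmetric] y1_def[symmetric]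
      by (simp add: ap_scale[OF J(1) tt] J(2)[OF c(1,2) av aw] mult_ac)
    also have "\<dots> = act (indo ?F (cten P Q)) g' (ap (FJ ?F (fst P) (fst Q)) (vec_ten v w))"
      unfolding k J(2)[OF x(1) y(1) v w] g(2) act_ind[OF p PQ g(1) c(3) vw'(2)] cs
      using linear_onD(2)[OF act_linear[OF PQ g(1)], unfolded center_ten_fst, OF tvw]
      by (simp add: act_center_ten[OF P Q g(1) x(1) y(1) v w] mult_ac)
    finally show "vec_scale (kappa g' x' y') (ap (FJ ?F (fst P) (fst Q)) (vec_ten (act (indo ?F P) g' v) (act (indo ?F Q) g' w))) =
      act (indo ?F (cten P Q)) g' (ap (FJ ?F (fst P) (fst Q)) (vec_ten v w))" .
  qed
qed

text \<open>An equality of objects: the spaces regrade strictly, and the rescaling factors multiply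
  according to \<open>pmul\<close>.\<close>

lemma ind_obj_comp:
  assumes p: "pair a \<mu>" and q: "pair b \<nu>" and P: "P \<in> CO"
  shows "indo (FF a \<mu>) (indo (FF b \<nu>) P) = indo (FF (compose \<G> a b) (pmul b \<mu> \<nu>)) P"
proof -
  note a = pairD(1)[OF p] and b = pairD(1)[OF q] and pq = pair_mult[OF p q] and Z = center_GS(1)[OF P]
  note ab = compose_auto[OF a b]
  note Q = ind_obj_closed[OF q P]
  show ?thesis
  proof (rule center_obj_eqI[OF ind_obj_closed[OF p Q] ind_obj_closed[OF pq P]])
    show f: "fst (indo (FF a \<mu>) (indo (FF b \<nu>) P)) = fst (indo (FF (compose \<G> a b) (pmul b \<mu> \<nu>)) P)"
      by (simp add: C.ind_obj_fst regrade_compose[OF a b])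
    fix g' d' z assume *: "g' \<in> \<G>" "d' \<in> \<G>" "z \<in> fst (indo (FF a \<mu>) (indo (FF b \<nu>) P)) d'"
    obtain g where g: "g \<in> \<G>" "g' = compose \<G> a b g" "shift (compose \<G> a b) (fst P) g' = fst P g"
      by (rule regradeE[OF ab *(1)])
    obtain d where d: "d \<in> \<G>" "d' = compose \<G> a b d" "shift (compose \<G> a b) (fst P) d' = fst P d"
      by (rule regradeE[OF ab *(2)])
    have z: "z \<in> fst P d"
      using *(3) d(3) by (simp add: C.ind_obj_fst regrade_compose[OF a b])
    have z': "z \<in> fst (indo (FF b \<nu>) P) (b d)"
      using z by (simp add: C.ind_obj_fst regrade_at[OF b d(1)])
    have k: "cj g d \<in> \<G>" using g(1) d(1) by simp
    have e: "compose \<G> a b g = a (b g)"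
      using g(1) by (simp add: compose_eq)
    have r: "act (indo (FF (compose \<G> a b) (pmul b \<mu> \<nu>)) P) g' z =
      vec_scale (pmul b \<mu> \<nu> g d / pmul b \<mu> \<nu> (cj g d) g) (act P g z)"
      unfolding g(2) by (rule act_ind[OF pq P g(1) d(1) z])
    show "act (indo (FF a \<mu>) (indo (FF b \<nu>) P)) g' z = act (indo (FF (compose \<G> a b) (pmul b \<mu> \<nu>)) P) g' z"
      unfolding r unfolding g(2) e act_ind[OF p Q autoD(1)[OF b g(1)] autoD(1)[OF b d(1)] z'] act_ind[OF q P g(1) d(1) z]
      using g(1) d(1) k by (simp add: pmul_def auto_cj[OF b])
  qed
qed

lemma ind_obj_id:
  assumes P: "P \<in> CO"
  shows "indo (FF (\<lambda>x\<in>\<G>. x) (\<lambda>x y. 1)) P = P"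
proof (rule center_obj_eqI[OF ind_obj_closed[OF pair_one P] P])
  note Z = center_GS(1)[OF P]
  show "fst (indo (FF (\<lambda>x\<in>\<G>. x) (\<lambda>x y. 1)) P) = fst P"
    by (simp add: C.ind_obj_fst regrade_id[OF Z])
  fix g d z assume *: "g \<in> \<G>" "d \<in> \<G>" "z \<in> fst (indo (FF (\<lambda>x\<in>\<G>. x) (\<lambda>x y. 1)) P) d"
  then have "z \<in> fst P d"
    by (simp add: C.ind_obj_fst regrade_id[OF Z])
  from act_ind[OF pair_one P *(1,2) this] show "act (indo (FF (\<lambda>x\<in>\<G>. x) (\<lambda>x y. 1)) P) g z = act P g z"
    using *(1) by simp
qed

lemma ind_simps:
  "FO (ind C A) = indo A" "FA (ind C A) (P, f, Q) = (indo A P, FA A f, indo A Q)"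
  "FJ (ind C A) P Q = (cten (indo A P) (indo A Q), FJ A (fst P) (fst Q), indo A (cten P Q))"
  by (simp_all add: ind_def)

lemma ind_functor:
  assumes p: "pair a \<mu>"
  shows "is_functor D D (ind C (FF a \<mu>))"
  unfolding is_functor_def
proof (intro conjI ballI)
  let ?F = "FF a \<mu>"
  note T = C.tensor_functorD[OF FF_tensor_functor[OF p]]
  fix P assume "P \<in> Obj D"
  then have P: "P \<in> CO" by simp
  show "FO (ind C ?F) P \<in> Obj D"
    using ind_obj_closed[OF p P] by (simp add: ind_simps)
  show "FA (ind C ?F) (Id D P) = Id D (FO (ind C ?F) P)"
    using T(3)[of "fst P"] center_GS(1)[OF P] by (simp add: ind_simps C.ind_obj_fst)
next
  let ?F = "FF a \<mu>"
  fix P Q f assume "f \<in> Hom D P Q"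
  then obtain f' where f: "f = (P, f', Q)" and f': "(P, f', Q) \<in> CA"
    unfolding D_hom_iff by blast
  show "FA (ind C ?F) f \<in> Hom D (FO (ind C ?F) P) (FO (ind C ?F) Q)"
    using ind_arr[OF p f'] by (simp add: f ind_simps D_hom_iff)
next
  let ?F = "FF a \<mu>"
  note T = C.tensor_functorD[OF FF_tensor_functor[OF p]]
  fix P Q R f g assume "f \<in> Hom D P Q" "g \<in> Hom D Q R"
  then obtain f' g' where f: "f = (P, f', Q)" "(P, f', Q) \<in> CA" and g: "g = (Q, g', R)" "(Q, g', R) \<in> CA"
    unfolding D_hom_iff by blast
  show "FA (ind C ?F) (g \<cdot>\<^bsub>D\<^esub> f) = FA (ind C ?F) g \<cdot>\<^bsub>D\<^esub> FA (ind C ?F) f"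
    using T(5)[OF C.center_arrsD(3)[OF f(2)] C.center_arrsD(3)[OF g(2)]] by (simp add: f(1) g(1) ind_simps)
qed

text \<open>The two values of \<omega> in the action on the unit object change under
  \<open>a\<close> by quotients of values of \<mu> whose product is inverse to the rescaling factor
  \<open>\<mu> g \<one> / \<mu> \<one> g\<close>, so the object is unchanged.\<close>

lemma ind_unit:
  assumes p: "pair a \<mu>"
  shows "indo (FF a \<mu>) (center_unit C) = center_unit C"
proof (rule center_obj_eqI[OF ind_obj_closed[OF p center_unit_closed] center_unit_closed])
  let ?F = "FF a \<mu>"
  note a = pairD(1)[OF p]
  show f: "fst (indo ?F (center_unit C)) = fst (center_unit C)"
    by (simp add: C.ind_obj_fst regrade_unit[OF a])
  fix g' d z assume *: "g' \<in> \<G>" "d \<in> \<G>" "z \<in> fst (indo ?F (center_unit C)) d"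
  obtain g where g: "g \<in> \<G>" "g' = a g" "shift a (delta \<one>) g' = delta \<one> g"
    by (rule regradeE[OF a *(1)])
  have z: "z \<in> delta \<one> d"
    using *(3) f by simp
  have l: "act (indo ?F (center_unit C)) g' 0 = 0" "act (center_unit C) g' 0 = 0"
    by (rule linear_on_zero[OF act_linear[OF ind_obj_closed[OF p center_unit_closed] *(1)] total_subspace[OF center_GS(1)[OF ind_obj_closed[OF p center_unit_closed]]]],
        rule linear_on_zero[OF act_linear[OF center_unit_closed *(1)] total_subspace[OF center_GS(1)[OF center_unit_closed]]])
  show "act (indo ?F (center_unit C)) g' z = act (center_unit C) g' z"
  proof (cases "z = 0")
    case True
    then show ?thesis using l by simp
  next
    case False
    then have d: "d = \<one>"
      using delta_cases[OF z] by blast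
    have m: "\<mu> x y \<noteq> 0" if "x \<in> \<G>" "y \<in> \<G>" for x y
      using pairD(2)[OF p that] .
    have 1: "\<omega> (a g) \<one> \<one> = \<omega> g \<one> \<one> * \<mu> \<one> \<one> / \<mu> g \<one>"
      using pairD(3)[OF p g(1) one_closed one_closed] m[OF g(1) one_closed] g(1) by (simp add: autoD(4)[OF a])
    have 2: "\<omega> \<one> \<one> (a g) = \<omega> \<one> \<one> g * \<mu> \<one> g / \<mu> \<one> \<one>"
      using pairD(3)[OF p one_closed one_closed g(1)] m[OF one_closed g(1)] g(1) by (simp add: autoD(4)[OF a])
    have "vec_scale (\<mu> g \<one> / \<mu> \<one> g * (1 / (\<omega> g \<one> \<one> * \<omega> \<one> \<one> g))) z = vec_scale (1 / (\<omega> (a g) \<one> \<one> * \<omega> \<one> \<one> (a g))) z"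
      unfolding 1 2 using m g(1) by (simp add: field_simps)
    then show ?thesis
      using act_ind[OF p center_unit_closed g(1) *(2), of z] z g(1)
      unfolding g(2) act_center_unit[OF autoD(1)[OF a g(1)] z] act_center_unit[OF g(1) z] d by simp
  qed
qed

lemma ind_tensor_functor:
  assumes p: "pair a \<mu>"
  shows "is_tensor_functor D D (ind C (FF a \<mu>))"
  unfolding is_tensor_functor_def is_linear_functor_def
proof (intro conjI ballI allI)
  let ?F = "FF a \<mu>"
  note T = C.tensor_functorD[OF FF_tensor_functor[OF p]]
  show "is_functor D D (ind C ?F)"
    by (rule ind_functor[OF p])
  show "isomorphic D (FO (ind C ?F) (UnitO D)) (UnitO D)"
    unfolding isomorphic_def using D.id_hom[OF D.unit_obj] D.is_iso_id[OF D.unit_obj]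
    by (auto simp: ind_simps ind_unit[OF p])
  fix P Q assume "P \<in> Obj D" "Q \<in> Obj D"
  then have P: "P \<in> CO" and Q: "Q \<in> CO" by simp_all
  note Z = center_GS(1)[OF P] and W = center_GS(1)[OF Q]
  show "FJ (ind C ?F) P Q \<in> Hom D (FO (ind C ?F) P \<boxtimes>\<^bsub>D\<^esub> FO (ind C ?F) Q) (FO (ind C ?F) (P \<boxtimes>\<^bsub>D\<^esub> Q))"
    using ind_FJ[OF p P Q] by (simp add: ind_simps D_hom_iff)
  show "is_iso D (FJ (ind C ?F) P Q)"
    unfolding ind_simps by (rule C.center_Inv(2)[OF ind_FJ[OF p P Q] FJ_props(3)[OF p Z W]])
  {
    fix f c assume "f \<in> Hom D P Q"
    then obtain f' where f: "f = (P, f', Q)" "(P, f', Q) \<in> CA"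
      unfolding D_hom_iff by blast
    note fh = C.center_arrsD(3)[OF f(2)]
    show "FA (ind C ?F) (Scale D c f) = Scale D c (FA (ind C ?F) f)"
      using T(10)[OF fh] by (simp add: f(1) ind_simps)
    fix g assume "g \<in> Hom D P Q"
    then obtain g' where g: "g = (P, g', Q)" "(P, g', Q) \<in> CA"
      unfolding D_hom_iff by blast
    show "FA (ind C ?F) (Plus D f g) = Plus D (FA (ind C ?F) f) (FA (ind C ?F) g)"
      using T(9)[OF fh C.center_arrsD(3)[OF g(2)]] by (simp add: f(1) g(1) ind_simps)
  }
  {
    fix P' Q' f g assume "f \<in> Hom D P P'" "g \<in> Hom D Q Q'"
    then obtain f' g' where f: "f = (P, f', P')" "(P, f', P') \<in> CA" and g: "g = (Q, g', Q')" "(Q, g', Q') \<in> CA"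
      unfolding D_hom_iff by blast
    show "FJ (ind C ?F) P' Q' \<cdot>\<^bsub>D\<^esub> (FA (ind C ?F) f \<boxdot>\<^bsub>D\<^esub> FA (ind C ?F) g) = FA (ind C ?F) (f \<boxdot>\<^bsub>D\<^esub> g) \<cdot>\<^bsub>D\<^esub> FJ (ind C ?F) P Q"
      using T(8)[OF C.center_arrsD(3)[OF f(2)] C.center_arrsD(3)[OF g(2)]] by (simp add: f(1) g(1) ind_simps)
  }
  fix R assume "R \<in> Obj D"
  then have R: "R \<in> CO" by simp
  have "FJ ?F (gten (fst P) (fst Q)) (fst R) \<bullet> (FJ ?F (fst P) (fst Q) \<odot> Id C (FO ?F (fst R))) \<bullet>
      Assoc C (FO ?F (fst P)) (FO ?F (fst Q)) (FO ?F (fst R)) =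
    FA ?F (Assoc C (fst P) (fst Q) (fst R)) \<bullet> FJ ?F (fst P) (gten (fst Q) (fst R)) \<bullet>
      (Id C (FO ?F (fst P)) \<odot> FJ ?F (fst Q) (fst R))"
    using FF_tensor_functor[OF p] Z W center_GS(1)[OF R] unfolding is_tensor_functor_def by simp
  then show "FJ (ind C ?F) (P \<boxtimes>\<^bsub>D\<^esub> Q) R \<cdot>\<^bsub>D\<^esub> (FJ (ind C ?F) P Q \<boxdot>\<^bsub>D\<^esub> Id D (FO (ind C ?F) R)) \<cdot>\<^bsub>D\<^esub>
      Assoc D (FO (ind C ?F) P) (FO (ind C ?F) Q) (FO (ind C ?F) R) =
    FA (ind C ?F) (Assoc D P Q R) \<cdot>\<^bsub>D\<^esub> FJ (ind C ?F) P (Q \<boxtimes>\<^bsub>D\<^esub> R) \<cdot>\<^bsub>D\<^esub>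
      (Id D (FO (ind C ?F) P) \<boxdot>\<^bsub>D\<^esub> FJ (ind C ?F) Q R)"
    by (simp add: ind_simps C.ind_obj_fst)
qed

text \<open>The braiding of the center is the half-braiding itself, and conjugation by the tensor
  structure in its induced version is the condition on a braided functor. The inverse pair induces a
  strict inverse on objects and arrows.\<close>

lemma ind_autoeq:
  assumes p: "pair a \<mu>"
  shows "ind C (FF a \<mu>) \<in> braided_autoeqs D"
  unfolding braided_autoeqs_def is_braided_functor_def
proof (rule CollectI, intro conjI ballI ind_tensor_functor[OF p])
  note a = pairD(1)[OF p]
  let ?F = "FF a \<mu>"
  fix P Q assume "P \<in> Obj D" "Q \<in> Obj D"
  then have P: "P \<in> CO" and Q: "Q \<in> CO" by simp_all
  note Z = center_GS(1)[OF P] and W = center_GS(1)[OF Q]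
  note J = FJ_props[OF p Z W] and J' = FJ_props[OF p W Z] and gQ = center_GS(2)[OF Q Z]
  note Fg = FA_hom[OF a gQ, of \<mu>] and rZ = regrade_closed[OF a Z] and rW = regrade_closed[OF a W]
  note iQ = ind_eval[OF p Q rZ]
  have "FA ?F (snd Q (fst P)) \<bullet> FJ ?F (fst P) (fst Q) = FJ ?F (fst Q) (fst P) \<bullet> snd (indo ?F Q) (shift a (fst P))"
  proof (rule hom_regrade_ten_eqI[OF a Z W hom_comp[OF J(1) Fg(1)] hom_comp[OF iQ(1) J'(1)]])
    fix x y v w assume *: "x \<in> \<G>" "y \<in> \<G>" "v \<in> fst P x" "w \<in> fst Q y"
    note t = hom_total[OF Z *(1,3)] hom_total[OF W *(2,4)]
    have vw: "vec_ten v w \<in> tot (gten (shift a (fst P)) (shift a (fst Q)))" "vec_ten v w \<in> tot (gten (fst P) (fst Q))"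
      using total_ten[OF rZ rW] total_ten[OF Z W t] t by (simp_all add: regrade_total[OF a])
    note aw = act_mem[OF Q *(1,2,4)]
    have k: "cj x y \<in> \<G>" using * by simp
    have wv: "vec_ten (act Q x w) v \<in> tot (gten (shift a (fst Q)) (shift a (fst P)))"
      by (rule total_ten[OF rW rZ]) (simp_all add: regrade_total[OF a] t hom_total[OF W k aw])
    show "ap (FA ?F (snd Q (fst P)) \<bullet> FJ ?F (fst P) (fst Q)) (vec_ten v w) =
      ap (FJ ?F (fst Q) (fst P) \<bullet> snd (indo ?F Q) (shift a (fst P))) (vec_ten v w)"
      using pairD(2)[OF p k *(1)]
      by (simp add: ap_comp[OF J(1) Fg(1) vw(1)] J(2)[OF *] Fg(2) ap_scale[OF gQ vw(2)] act_braid[OF Q Z *(1,3) t(2)]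
          ap_comp[OF iQ(1) J'(1) vw(1)] iQ(3)[OF *(1,2) regrade_mem[OF a *(1), of v "fst P", OF *(3)] *(4)]
          ap_scale[OF J'(1) wv] J'(2)[OF k *(1) aw *(3)])
  qed
  then show "FA (ind C ?F) (Braid D P Q) \<cdot>\<^bsub>D\<^esub> FJ (ind C ?F) P Q = FJ (ind C ?F) Q P \<cdot>\<^bsub>D\<^esub> Braid D (FO (ind C ?F) P) (FO (ind C ?F) Q)"
    by (simp add: ind_simps C.ind_obj_fst)
next
  note a = pairD(1)[OF p] and q = pair_inv[OF p]
  let ?F = "FF a \<mu>" and ?K = "FF (inv_auto a) (pinv a \<mu>)"
  have o: "indo ?F (indo ?K P) = P" "indo ?K (indo ?F P) = P" if "P \<in> CO" for P
    by (simp_all add: ind_obj_comp[OF p q that] ind_obj_comp[OF q p that] compose_inv_auto[OF a] pmul_pinv[OF p] ind_obj_id[OF that])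
  show "is_equivalence D D (ind C ?F)"
  proof (rule D.is_equivalence_if_inverse[OF ind_functor[OF p] ind_functor[OF q]])
    show "FO (ind C ?F) (FO (ind C ?K) P) = P" "FO (ind C ?K) (FO (ind C ?F) P) = P" if "P \<in> Obj D" for P
      using o that by (simp_all add: ind_simps)
    have ff: "FA ?F (FA ?K f) = f" "FA ?K (FA ?F f) = f" if "f \<in> graded_maps G" for f
      using that by (cases f; simp add: graded_maps_def regrade_inv[OF a])+
    fix f assume "f \<in> Arr D"
    then obtain P f' Q where f: "f = (P, f', Q)" "(P, f', Q) \<in> CA"
      by (cases f) auto
    have fh: "f' \<in> graded_maps G"
      using C.center_arrsD(3)[OF f(2)] by (simp add: Hom_def)
    show "FA (ind C ?F) (FA (ind C ?K) f) = f" "FA (ind C ?K) (FA (ind C ?F) f) = f"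
      using o[OF C.center_arrsD(1)[OF f(2)]] o[OF C.center_arrsD(2)[OF f(2)]] ff[OF fh] by (simp_all add: f(1) ind_simps)
  qed
qed

lemma ind_comp_agree:
  assumes p: "pair a \<mu>" and q: "pair b \<nu>"
  shows "D.agree (ind C (FF (compose \<G> a b) (pmul b \<mu> \<nu>))) (comp_tensor_functor D (ind C (FF a \<mu>)) (ind C (FF b \<nu>)))"
proof -
  let ?F = "FF a \<mu>"
  note A = FF_comp_agree[OF p q, unfolded C.agree_def comp_tensor_functor_def fctr.simps tfctr.simps]
  show ?thesis
    unfolding D.agree_def comp_tensor_functor_def fctr.simps tfctr.simps
  proof (intro conjI ballI)
    fix P assume "P \<in> Obj D"
    then have P: "P \<in> CO" by simp
    show "FO (ind C (FF (compose \<G> a b) (pmul b \<mu> \<nu>))) P = FO (ind C ?F) (FO (ind C (FF b \<nu>)) P)"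
      by (simp add: ind_simps ind_obj_comp[OF p q P])
    fix Q assume "Q \<in> Obj D"
    then have Q: "Q \<in> CO" by simp
    show "FJ (ind C (FF (compose \<G> a b) (pmul b \<mu> \<nu>))) P Q = FA (ind C ?F) (FJ (ind C (FF b \<nu>)) P Q) \<cdot>\<^bsub>D\<^esub>
        FJ (ind C ?F) (FO (ind C (FF b \<nu>)) P) (FO (ind C (FF b \<nu>)) Q)"
      using A center_GS(1)[OF P] center_GS(1)[OF Q]
      by (simp add: ind_simps C.ind_obj_fst ind_obj_comp[OF p q] P Q center_ten_closed)
  next
    fix f assume "f \<in> Arr D"
    then obtain P f' Q where f: "f = (P, f', Q)" "(P, f', Q) \<in> CA"
      by (cases f) auto
    have "f' \<in> graded_maps G"
      using C.center_arrsD(3)[OF f(2)] by (simp add: Hom_def)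
    then show "FA (ind C (FF (compose \<G> a b) (pmul b \<mu> \<nu>))) f = FA (ind C ?F) (FA (ind C (FF b \<nu>)) f)"
      using A by (simp add: f(1) ind_simps ind_obj_comp[OF p q] C.center_arrsD(1,2)[OF f(2)])
  qed
qed

lemma ind_id_agree: "D.agree (ind C (FF (\<lambda>x\<in>\<G>. x) (\<lambda>x y. 1))) (id_tensor_functor D)"
proof -
  note A = FF_id_agree[unfolded C.agree_def id_tensor_functor_def fctr.simps tfctr.simps]
  show ?thesis
    unfolding D.agree_def id_tensor_functor_def fctr.simps tfctr.simps
  proof (intro conjI ballI)
    fix P assume "P \<in> Obj D"
    then have P: "P \<in> CO" by simp
    show "FO (ind C (FF (\<lambda>x\<in>\<G>. x) (\<lambda>x y. 1))) P = P"
      by (simp add: ind_simps ind_obj_id[OF P])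
    fix Q assume "Q \<in> Obj D"
    then have Q: "Q \<in> CO" by simp
    show "FJ (ind C (FF (\<lambda>x\<in>\<G>. x) (\<lambda>x y. 1))) P Q = Id D (P \<boxtimes>\<^bsub>D\<^esub> Q)"
      using A center_GS(1)[OF P] center_GS(1)[OF Q]
      by (simp add: ind_simps ind_obj_id P Q center_ten_closed)
  next
    fix f assume "f \<in> Arr D"
    then obtain P f' Q where f: "f = (P, f', Q)" "(P, f', Q) \<in> CA"
      by (cases f) auto
    have "f' \<in> graded_maps G"
      using C.center_arrsD(3)[OF f(2)] by (simp add: Hom_def)
    then show "FA (ind C (FF (\<lambda>x\<in>\<G>. x) (\<lambda>x y. 1))) f = f"
      using A by (simp add: f(1) ind_simps ind_obj_id C.center_arrsD(1,2)[OF f(2)])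
  qed
qed

end

section \<open>Classification of the tensor autoequivalences\<close>

context graded_setup
begin

text \<open>Quantifying over all degrees \<open>k\<close> forces the components outside degree
  \<open>h\<close> to vanish. The generator \<open>e\<close> is kept because structure constants are
  read off with respect to it.\<close>

definition line :: "('a, 'k) grspace \<Rightarrow> 'a \<Rightarrow> 'k vec \<Rightarrow> bool" where
  "line A h e \<longleftrightarrow> A \<in> GS \<and> h \<in> \<G> \<and> e \<in> A h \<and> e \<noteq> 0 \<and>
    (\<forall>k\<in>\<G>. \<forall>v\<in>A k. v = 0 \<or> (k = h \<and> (\<exists>c. v = vec_scale c e)))"

lemma lineD:
  assumes "line A h e"
  shows "A \<in> GS" "h \<in> \<G>" "e \<in> A h" "e \<noteq> 0" "e \<in> tot A"
    and "\<And>k v. \<lbrakk>k \<in> \<G>; v \<in> A k; v \<noteq> 0\<rbrakk> \<Longrightarrow> k = h \<and> (\<exists>c. v = vec_scale c e)"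
proof -
  show 1: "A \<in> GS" "h \<in> \<G>" "e \<in> A h" "e \<noteq> 0"
    using assms unfolding line_def by blast+
  show "e \<in> tot A"
    by (rule hom_total[OF 1(1-3)])
  show "\<And>k v. \<lbrakk>k \<in> \<G>; v \<in> A k; v \<noteq> 0\<rbrakk> \<Longrightarrow> k = h \<and> (\<exists>c. v = vec_scale c e)"
    using assms unfolding line_def by blast
qed

lemma singleton_extend:
  assumes "e \<noteq> (0 :: 'k vec)"
  obtains F :: "'k vec \<Rightarrow> 'k vec" where "linear_on UNIV F" "F e = w" "\<forall>v. \<exists>c. F v = vec_scale c w"
proof -
  have i: "seqvec.independent {e}"
    using assms by simp
  let ?F = "seqpair.construct {e} (\<lambda>_. w)"
  have "linear_on UNIV ?F"
    using seqpair.linear_construct[OF i, of "\<lambda>_. w"] by (simp add: Vector_Spaces.linear_iff linear_on_def)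
  moreover have "?F e = w"
    by (rule seqpair.construct_basis[OF i]) simp
  moreover have "\<forall>v. \<exists>c. ?F v = vec_scale c w"
  proof
    fix v
    show "\<exists>c. ?F v = vec_scale c w"
      using seqpair.construct_in_span[OF i, of "\<lambda>_. w" v] by (auto simp: seqvec.span_singleton)
  qed
  ultimately show ?thesis
    by (rule that)
qed

lemma ap_Plus: "\<lbrakk>f \<in> Hom C V W; g \<in> Hom C V W; v \<in> tot V\<rbrakk> \<Longrightarrow> ap (Plus C f g) v = ap f v + ap g v"
  by (subst homD(1), assumption, subst (2) homD(1), assumption) simp

lemma ap_Scale: "f \<in> Hom C V W \<Longrightarrow> v \<in> tot V \<Longrightarrow> ap (Scale C c f) v = vec_scale c (ap f v)"
  by (subst homD(1), assumption) simp

lemma line_hom_exists: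
  assumes l: "line A h e" and X: "X \<in> GS" and w: "w \<in> X h"
  shows "\<exists>r\<in>Hom C A X. ap r e = w"
proof -
  note l' = lineD[OF l]
  obtain F :: "'k vec \<Rightarrow> 'k vec" where F: "linear_on UNIV F" "F e = w" "\<forall>v. \<exists>c. F v = vec_scale c w"
    by (rule singleton_extend[OF l'(4), where w = w])
  have "(A, restrict F (tot A), X) \<in> Hom C A X"
  proof (rule homI[OF l'(1) X linear_on_subset[OF F(1) subset_UNIV]])
    fix k v assume k: "k \<in> \<G>" "v \<in> A k"
    show "F v \<in> X k"
    proof (cases "v = 0")
      case True
      then show ?thesis
        using linear_on_zero[OF F(1) seqvec.subspace_UNIV] gradedD(5)[OF X] by simp
    next
      case False
      obtain c where "F v = vec_scale c w"
        using F(3) by blast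
      then show ?thesis
        using l'(6)[OF k False] gr_scale(1)[OF X w] by simp
    qed
  qed
  then show ?thesis
    using F(2) l'(5) by (intro bexI) simp_all
qed

lemma line_hom_eqI:
  assumes l: "line A h e" and r: "r \<in> Hom C A X" "r' \<in> Hom C A X" and eq: "ap r e = ap r' e"
  shows "r = r'"
proof (rule hom_eqI[OF r])
  note l' = lineD[OF l]
  fix k v assume k: "k \<in> \<G>" "v \<in> A k"
  have 0: "ap r 0 = 0" "ap r' 0 = 0"
    by (rule linear_on_zero[OF homD(5)[OF r(1)] total_subspace[OF l'(1)]], rule linear_on_zero[OF homD(5)[OF r(2)] total_subspace[OF l'(1)]])
  show "ap r v = ap r' v"
  proof (cases "v = 0")
    case False
    then obtain c where "v = vec_scale c e"
      using l'(6)[OF k False] by blast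
    then show ?thesis
      using ap_scale[OF r(1) l'(5)] ap_scale[OF r(2) l'(5)] eq by simp
  qed (simp add: 0)
qed

lemma line_delta: "g \<in> \<G> \<Longrightarrow> line (delta g) g vec_unit"
  unfolding line_def using delta_cases by (auto; blast)

lemma delta_ten:
  assumes x: "x \<in> \<G>" and y: "y \<in> \<G>"
  shows "gten (delta x) (delta y) = delta (x \<otimes> y)"
proof
  fix k
  note T = ten_closed[OF delta_closed[OF x] delta_closed[OF y]] and xy = m_closed[OF x y]
  show "gten (delta x) (delta y) k = delta (x \<otimes> y) k"
  proof (cases "k \<in> \<G>")
    case k: True
    have u: "vec_unit \<in> gten (delta x) (delta y) (x \<otimes> y)"
      using gr_ten_mem[of x y vec_unit "delta x" vec_unit "delta y"] x y by (simp add: vec_ten_unit_unit)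
    show ?thesis
    proof
      show "gten (delta x) (delta y) k \<subseteq> delta (x \<otimes> y) k"
      proof
        fix t assume t: "t \<in> gten (delta x) (delta y) k"
        note t' = ten_delta(1)[OF delta_closed[OF x] y k t]
        show "t \<in> delta (x \<otimes> y) k"
        proof (cases "t = 0")
          case True
          then show ?thesis
            using gradedD(5)[OF delta_closed[OF xy]] by simp
        next
          case False
          then have "rcut t \<noteq> 0"
            using t' by (metis vec_ten_simps(3))
          then obtain c where c: "rcut t = vec_scale c vec_unit" "k \<otimes> inv y = x"
            using delta_cases[of "rcut t" x "k \<otimes> inv y"] t' by blast
          have kxy: "k = x \<otimes> y"
            using c(2) k y by (metis inv_solve_right' xy m_assoc inv_closed l_inv r_one)
          have "t = vec_scale c vec_unit"
            using t' c(1) by (metis vec_ten_scale(1) vec_ten_unit_unit)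
          then show ?thesis
            unfolding kxy using gr_scale(1)[OF delta_closed[OF xy] vec_unit_delta] by simp
        qed
      qed
      show "delta (x \<otimes> y) k \<subseteq> gten (delta x) (delta y) k"
      proof
        fix t assume "t \<in> delta (x \<otimes> y) k"
        then consider "t = 0" | c where "t = vec_scale c vec_unit" "k = x \<otimes> y"
          using delta_cases by blast
        then show "t \<in> gten (delta x) (delta y) k"
          using gradedD(5)[OF T] gr_scale(1)[OF T u] by cases simp_all
      qed
    qed
  next
    case False
    then show ?thesis
      using gradedD(4)[OF T] gradedD(4)[OF delta_closed[OF xy]] by simp
  qed
qed

text \<open>Full faithfulness makes every endomorphism of the image a scalar. The image is nonzero,
  and the projection onto a line in one of its components is an endomorphism that fixes a nonzero
  vector, hence is the identity.\<close>

lemma autoeq_line: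
  assumes \<alpha>: "\<alpha> \<in> tensor_autoeqs C" and g: "g \<in> \<G>"
  shows "\<exists>h e. line (FO \<alpha> (delta g)) h e"
proof -
  have T: "is_tensor_functor C C \<alpha>" and E: "is_equivalence C C \<alpha>"
    using \<alpha> by (simp_all add: tensor_autoeqs_def)
  note T' = C.tensor_functorD[OF T] and dg = delta_closed[OF g]
  have dgo: "delta g \<in> Obj C" using dg by simp
  let ?A = "FO \<alpha> (delta g)"
  have A: "?A \<in> GS" using T'(2)[OF dgo] by simp
  have sc: "ap (Scale C c (Id C X)) v = vec_scale c v" if "X \<in> GS" "v \<in> tot X" for c X v
    using that by (simp add: graded_vect_simps(5))
  have end_scalar: "\<exists>c. \<forall>v\<in>tot ?A. ap p v = vec_scale c v" if p: "p \<in> Hom C ?A ?A" for p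
  proof -
    obtain q where q: "q \<in> Hom C (delta g) (delta g)" "FA \<alpha> q = p"
      using C.equivalence_full[OF E dgo dgo p] by blast
    obtain c where c: "ap q vec_unit = vec_scale c vec_unit"
      using delta_cases[OF homD(6)[OF q(1) g vec_unit_delta]] seqvec.scale_zero_left by metis
    have "q = Scale C c (Id C (delta g))"
      by (rule line_hom_eqI[OF line_delta[OF g] q(1) C.scale_hom[OF id_hom'[OF dg]]]) (simp add: c sc[OF dg] g)
    then have "p = Scale C c (Id C ?A)"
      using q(2) T'(10)[OF id_hom'[OF dg], of c] T'(3)[OF dgo] by simp
    then show ?thesis
      using sc[OF A] by blast
  qed
  have "\<exists>h\<in>\<G>. \<exists>e\<in>?A h. e \<noteq> 0"
  proof (rule ccontr)
    assume "\<not> (\<exists>h\<in>\<G>. \<exists>e\<in>?A h. e \<noteq> 0)"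
    then have z: "v = 0" if "h \<in> \<G>" "v \<in> ?A h" for h v
      using that by blast
    \<comment> \<open>On a zero image the zero map is the identity; faithfulness would carry this
      back to \<open>delta g\<close>, where it is false.\<close>
    have "Scale C 0 (Id C ?A) = Id C ?A"
    proof (rule hom_eqI[OF C.scale_hom[OF id_hom'[OF A]] id_hom'[OF A]])
      fix k v assume k: "k \<in> \<G>" "v \<in> ?A k"
      have "v \<in> tot ?A"
        by (rule hom_total[OF A k])
      then show "ap (Scale C 0 (Id C ?A)) v = ap (Id C ?A) v"
        using z[OF k] by (simp add: sc[OF A])
    qed
    then have "FA \<alpha> (Scale C 0 (Id C (delta g))) = FA \<alpha> (Id C (delta g))"
      using T'(10)[OF id_hom'[OF dg]] T'(3)[OF dgo] by simp
    then have "Scale C 0 (Id C (delta g)) = Id C (delta g)"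
      by (rule C.equivalence_faithful[OF E C.scale_hom[OF id_hom'[OF dg]] id_hom'[OF dg]])
    then have "ap (Scale C 0 (Id C (delta g))) vec_unit = ap (Id C (delta g)) vec_unit"
      by simp
    then show False
      using sc[OF dg delta_total[OF g], of 0] g by simp
  qed
  then obtain h e where h: "h \<in> \<G>" and e: "e \<in> ?A h" "e \<noteq> 0"
    by blast
  obtain F :: "'k vec \<Rightarrow> 'k vec" where F: "linear_on UNIV F" "F e = e" "\<forall>v. \<exists>c. F v = vec_scale c e"
    by (rule singleton_extend[OF e(2), where w = e])
  have F0: "F 0 = 0"
    by (rule linear_on_zero[OF F(1) seqvec.subspace_UNIV])
  let ?p = "(?A, restrict (\<lambda>v. F (proj ?A h v)) (tot ?A), ?A)"
  have p: "?p \<in> Hom C ?A ?A"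
  proof (rule homI[OF A A linear_on_subset[OF linear_on_compose[OF F(1) proj(1)[OF A h]] subset_UNIV]])
    fix k v assume k: "k \<in> \<G>" "v \<in> ?A k"
    obtain c where "F v = vec_scale c e"
      using F(3) by blast
    then show "F (proj ?A h v) \<in> ?A k"
      using proj(3)[OF A h k] gr_scale(1)[OF A e(1), of c] gradedD(5)[OF A] F0 by (cases "h = k") simp_all
  qed
  obtain c where c: "\<forall>v\<in>tot ?A. ap ?p v = vec_scale c v"
    using end_scalar[OF p] by blast
  have et: "e \<in> tot ?A"
    by (rule hom_total[OF A h e(1)])
  have "vec_scale c e = vec_scale 1 e"
    using bspec[OF c et] et proj(3)[OF A h h e(1)] F(2) by simp
  then have c1: "c = 1"
    by (rule vec_scale_cancel) (rule e(2))
  have "v = 0 \<or> (k = h \<and> (\<exists>c. v = vec_scale c e))" if k: "k \<in> \<G>" "v \<in> ?A k" for k v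
  proof -
    have vt: "v \<in> tot ?A"
      by (rule hom_total[OF A k])
    have "F (proj ?A h v) = v"
      using bspec[OF c vt] vt c1 by simp
    then show ?thesis
      using proj(3)[OF A h k] F(3)[rule_format, of v] F0 by (cases "h = k") auto
  qed
  then have "line ?A h e"
    unfolding line_def using A h e by blast
  then show ?thesis
    by blast
qed

text \<open>Lines go to lines, so \<alpha> moves degrees by some \<open>a\<close>, and its tensor
  structure in chosen generators \<open>e g\<close> of the images of the lines is given by scalars
  \<mu>. A vector of \<open>V\<close> is an arrow out of a line; the values of \<alpha> on these
  arrows provide the comparison with \<open>F\<^sub>a\<^sub>,\<^sub>\<mu>\<close> at
  \<open>V\<close>.\<close>

lemma tensor_autoeq_classification:
  assumes \<alpha>: "\<alpha> \<in> tensor_autoeqs C"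
  shows "\<exists>a \<mu>. pair a \<mu> \<and> tensor_functor_iso C C (FF a \<mu>) \<alpha>"
proof -
  have T: "is_tensor_functor C C \<alpha>" and E: "is_equivalence C C \<alpha>"
    using \<alpha> by (simp_all add: tensor_autoeqs_def)
  note T' = C.tensor_functorD[OF T]
  have "\<forall>g\<in>\<G>. \<exists>he. line (FO \<alpha> (delta g)) (fst he) (snd he)"
    using autoeq_line[OF \<alpha>] by (metis fst_conv snd_conv)
  then obtain he where he: "\<forall>g\<in>\<G>. line (FO \<alpha> (delta g)) (fst (he g)) (snd (he g))"
    by (metis bchoice)
  define a where "a = (\<lambda>g\<in>\<G>. fst (he g))"
  define e where "e g = snd (he g)" for g
  define A where "A g = FO \<alpha> (delta g)" for g
  have l: "line (A g) (a g) (e g)" if "g \<in> \<G>" for g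
    using he that by (simp add: A_def a_def e_def)
  note L = lineD[OF l]
  have FOGS: "FO \<alpha> V \<in> GS" if "V \<in> GS" for V
    using T'(2)[of V] that by simp
  have inj: "inj_on a \<G>"
  proof (rule inj_onI)
    fix x y assume x: "x \<in> \<G>" and y: "y \<in> \<G>" and eq: "a x = a y"
    note dx = delta_closed[OF x] and dy = delta_closed[OF y]
    \<comment> \<open>Equal degrees would give a nonzero arrow between the images, and by fullness
      one between the lines \<open>delta x\<close> and \<open>delta y\<close>, where for
      \<open>x \<noteq> y\<close> only zero exists.\<close>
    obtain p where p: "p \<in> Hom C (A x) (A y)" "ap p (e x) = e y"
      using line_hom_exists[OF l[OF x] L(1)[OF y], of "e y"] L(3)[OF y] eq by auto
    have o: "delta x \<in> Obj C" "delta y \<in> Obj C" using dx dy by simp_all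
    obtain q where q: "q \<in> Hom C (delta x) (delta y)" "FA \<alpha> q = p"
      using C.equivalence_full[OF E o] p(1) unfolding A_def by blast
    show "x = y"
    proof (rule ccontr)
      assume "x \<noteq> y"
      then have "ap q vec_unit = 0"
        using delta_cases[OF homD(6)[OF q(1) x vec_unit_delta]] by blast
      then have "Scale C 0 q = q"
        by (intro line_hom_eqI[OF line_delta[OF x] C.scale_hom[OF q(1)] q(1)])
          (simp only: ap_Scale[OF q(1) delta_total[OF x]] seqvec.scale_zero_right)
      then have "Scale C 0 p = p"
        using T'(10)[OF q(1), of 0] q(2) by simp
      moreover have "ap (Scale C 0 p) (e x) = vec_scale 0 (e y)"
        using ap_Scale[OF p(1) L(5)[OF x], of 0] p(2) by simp
      ultimately show False
        using p(2) L(4)[OF y] by (simp add: seqvec.scale_zero_left)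
    qed
  qed
  have sub: "a ` \<G> \<subseteq> \<G>"
    using L(2) by blast
  have bij: "bij_betw a \<G> \<G>"
    using endo_inj_surj[OF finite_carrier sub inj] inj by (simp add: bij_betw_def)
  note dd = delta_closed
  have J: "FJ \<alpha> (delta x) (delta y) \<in> Hom C (gten (A x) (A y)) (A (x \<otimes> y))" "is_iso C (FJ \<alpha> (delta x) (delta y))"
    if "x \<in> \<G>" "y \<in> \<G>" for x y
    using T'(6)[of "delta x" "delta y"] T'(7)[of "delta x" "delta y"] that dd by (simp_all add: A_def delta_ten)
  have ee: "vec_ten (e x) (e y) \<in> gten (A x) (A y) (a x \<otimes> a y)" "vec_ten (e x) (e y) \<in> tot (gten (A x) (A y))"
    if "x \<in> \<G>" "y \<in> \<G>" for x y
    using gr_ten_mem[of "a x" "a y" "e x" "A x" "e y" "A y"] total_ten[OF L(1)[OF that(1)] L(1)[OF that(2)] L(5)[OF that(1)] L(5)[OF that(2)]]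
      L(2,3) that by simp_all
  have Jne: "ap (FJ \<alpha> (delta x) (delta y)) (vec_ten (e x) (e y)) \<noteq> 0" if xy: "x \<in> \<G>" "y \<in> \<G>" for x y
  proof
    assume z: "ap (FJ \<alpha> (delta x) (delta y)) (vec_ten (e x) (e y)) = 0"
    have "ap (Inv C (FJ \<alpha> (delta x) (delta y))) 0 = 0"
      by (rule linear_on_zero[OF homD(5)[OF C.Inv_hom[OF J(2,1)[OF xy]]] total_subspace[OF homD(2)[OF C.Inv_hom[OF J(2,1)[OF xy]]]]])
    then show False
      using ap_Inv(1)[OF J[OF xy] ee(2)[OF xy]] z L(4) xy by simp
  qed
  \<comment> \<open>The tensor structure sends the product of two generators to a nonzero vector of
    degree \<open>a x \<otimes> a y\<close> in a line of degree \<open>a (x \<otimes> y)\<close>. So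
    \<open>a\<close> is multiplicative, and the vector is a multiple of the generator.\<close>
  have ax: "a x \<otimes> a y = a (x \<otimes> y) \<and> (\<exists>c. ap (FJ \<alpha> (delta x) (delta y)) (vec_ten (e x) (e y)) = vec_scale c (e (x \<otimes> y)))"
    if xy: "x \<in> \<G>" "y \<in> \<G>" for x y
    by (rule L(6)[OF m_closed[OF xy] _ homD(6)[OF J(1)[OF xy] _ ee(1)[OF xy]] Jne[OF xy]])
      (use L(2) xy in simp_all)
  have "a \<in> hom G G"
    unfolding hom_def using L(2) ax by (simp add: Pi_iff)
  then have a: "a \<in> auto G"
    using bij by (simp add: auto_def Bij_def a_def)
  define \<mu> where "\<mu> x y = (if x \<in> \<G> \<and> y \<in> \<G> then
      (SOME c. ap (FJ \<alpha> (delta x) (delta y)) (vec_ten (e x) (e y)) = vec_scale c (e (x \<otimes> y))) else 1)" for x y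
  have \<mu>: "ap (FJ \<alpha> (delta x) (delta y)) (vec_ten (e x) (e y)) = vec_scale (\<mu> x y) (e (x \<otimes> y))"
    if xy: "x \<in> \<G>" "y \<in> \<G>" for x y
    using someI_ex[OF conjunct2[OF ax[OF xy]]] xy by (simp add: \<mu>_def)
  have \<mu>0: "\<mu> x y \<noteq> 0" if xy: "x \<in> \<G>" "y \<in> \<G>" for x y
    using \<mu>[OF xy] Jne[OF xy] seqvec.scale_zero_left by metis
  have p: "pair a \<mu>"
  proof (rule pairI[OF a \<mu>0])
    fix x y z assume x: "x \<in> \<G>" and y: "y \<in> \<G>" and z: "z \<in> \<G>"
    have xy: "x \<otimes> y \<in> \<G>" and yz: "y \<otimes> z \<in> \<G>" and xyz: "x \<otimes> y \<otimes> z \<in> \<G>" using x y z by simp_all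
    note J1 = J[OF x y] and J2 = J[OF xy z] and J3 = J[OF y z] and J4 = J[OF x yz]
    note Ax = L(1)[OF x] and Ay = L(1)[OF y] and Az = L(1)[OF z]
    \<comment> \<open>On lines the associator is a scalar, which a linear functor preserves. The
      coherence of \<alpha> at three lines then becomes the equation between \<mu> and
      \<omega>.\<close>
    have asc: "Assoc C (delta x) (delta y) (delta z) = Scale C (\<omega> x y z) (Id C (delta (x \<otimes> y \<otimes> z)))"
    proof (rule line_hom_eqI[OF line_delta[OF xyz] _ C.scale_hom[OF id_hom'[OF dd[OF xyz]]]])
      show "Assoc C (delta x) (delta y) (delta z) \<in> Hom C (delta (x \<otimes> y \<otimes> z)) (delta (x \<otimes> y \<otimes> z))"
        using assoc_in_hom[OF dd[OF x] dd[OF y] dd[OF z]] x y z xy yz by (simp add: delta_ten m_assoc)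
      have "ap (Assoc C (delta x) (delta y) (delta z)) vec_unit = vec_scale (\<omega> x y z) vec_unit"
        using ap_assoc[OF dd[OF x] dd[OF y] dd[OF z] x y z vec_unit_delta vec_unit_delta vec_unit_delta]
        by (simp add: vec_ten_unit_unit)
      then show "ap (Assoc C (delta x) (delta y) (delta z)) vec_unit = ap (Scale C (\<omega> x y z) (Id C (delta (x \<otimes> y \<otimes> z)))) vec_unit"
        using delta_total[OF xyz] by (simp add: graded_vect_simps(5))
    qed
    have FAsc: "FA \<alpha> (Assoc C (delta x) (delta y) (delta z)) = Scale C (\<omega> x y z) (Id C (A (x \<otimes> y \<otimes> z)))"
      unfolding asc A_def using T'(10)[OF id_hom'[OF dd[OF xyz]]] T'(3)[of "delta (x \<otimes> y \<otimes> z)"] dd[OF xyz] by simp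
    have hex0: "FJ \<alpha> (gten (delta x) (delta y)) (delta z) \<bullet> (FJ \<alpha> (delta x) (delta y) \<odot> Id C (FO \<alpha> (delta z))) \<bullet>
          Assoc C (FO \<alpha> (delta x)) (FO \<alpha> (delta y)) (FO \<alpha> (delta z)) =
        FA \<alpha> (Assoc C (delta x) (delta y) (delta z)) \<bullet> FJ \<alpha> (delta x) (gten (delta y) (delta z)) \<bullet>
          (Id C (FO \<alpha> (delta x)) \<odot> FJ \<alpha> (delta y) (delta z))"
      using T dd[OF x] dd[OF y] dd[OF z] unfolding is_tensor_functor_def by simp
    note hex = hex0[unfolded FAsc delta_ten[OF x y] delta_ten[OF y z], folded A_def]
    note aA = assoc_in_hom[OF Ax Ay Az] and Jz = ten_in_hom[OF J1(1) id_hom'[OF Az]] and xJ = ten_in_hom[OF id_hom'[OF Ax] J3(1)]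
    have J4': "FJ \<alpha> (delta x) (delta (y \<otimes> z)) \<in> Hom C (gten (A x) (A (y \<otimes> z))) (A (x \<otimes> y \<otimes> z))"
      using J4(1) x y z by (simp add: m_assoc)
    have sI: "Scale C (\<omega> x y z) (Id C (A (x \<otimes> y \<otimes> z))) \<in> Hom C (A (x \<otimes> y \<otimes> z)) (A (x \<otimes> y \<otimes> z))"
      by (rule C.scale_hom[OF id_hom'[OF L(1)[OF xyz]]])
    note h1 = hom_comp[OF Jz J2(1)] and h2 = hom_comp[OF J4' sI]
    have te: "e x \<in> tot (A x)" "e y \<in> tot (A y)" "e z \<in> tot (A z)" "e (x \<otimes> y) \<in> tot (A (x \<otimes> y))"
      "e (y \<otimes> z) \<in> tot (A (y \<otimes> z))" "e (x \<otimes> y \<otimes> z) \<in> tot (A (x \<otimes> y \<otimes> z))"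
      using L(5) x y z xy yz xyz by blast+
    note tt = total_ten[OF Ax ten_closed[OF Ay Az] te(1) ee(2)[OF y z]]
    have t2: "vec_ten (vec_ten (e x) (e y)) (e z) \<in> tot (gten (gten (A x) (A y)) (A z))"
      by (rule total_ten[OF ten_closed[OF Ax Ay] Az ee(2)[OF x y] te(3)])
    have lhs: "ap (FJ \<alpha> (delta (x \<otimes> y)) (delta z) \<bullet> (FJ \<alpha> (delta x) (delta y) \<odot> Id C (A z)) \<bullet> Assoc C (A x) (A y) (A z)) (vec_ten (e x) (vec_ten (e y) (e z)))
      = vec_scale (\<omega> (a x) (a y) (a z) * (\<mu> x y * \<mu> (x \<otimes> y) z)) (e (x \<otimes> y \<otimes> z))"
      by (simp add: ap_comp[OF aA h1 tt] ap_assoc[OF Ax Ay Az L(2)[OF x] L(2)[OF y] L(2)[OF z] L(3)[OF x] L(3)[OF y] L(3)[OF z]]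
          ap_scale[OF h1 t2] ap_comp[OF Jz J2(1) t2] ap_ten[OF J1(1) id_hom'[OF Az] ee(2)[OF x y] te(3)] \<mu>[OF x y] te(3)
          ap_scale[OF J2(1) ee(2)[OF xy z]] \<mu>[OF xy z])
    have rhs: "ap (Scale C (\<omega> x y z) (Id C (A (x \<otimes> y \<otimes> z))) \<bullet> FJ \<alpha> (delta x) (delta (y \<otimes> z)) \<bullet> (Id C (A x) \<odot> FJ \<alpha> (delta y) (delta z))) (vec_ten (e x) (vec_ten (e y) (e z)))
      = vec_scale (\<mu> y z * (\<mu> x (y \<otimes> z) * \<omega> x y z)) (e (x \<otimes> y \<otimes> z))"
    proof -
      have s: "ap (Scale C (\<omega> x y z) (Id C (A (x \<otimes> y \<otimes> z)))) (e (x \<otimes> y \<otimes> z)) = vec_scale (\<omega> x y z) (e (x \<otimes> y \<otimes> z))"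
        using te(6) by (simp add: graded_vect_simps(5))
      have m4: "ap (FJ \<alpha> (delta x) (delta (y \<otimes> z))) (vec_ten (e x) (e (y \<otimes> z))) = vec_scale (\<mu> x (y \<otimes> z)) (e (x \<otimes> y \<otimes> z))"
        using \<mu>[OF x yz] x y z by (simp add: m_assoc)
      show ?thesis
        by (simp add: ap_comp[OF xJ h2 tt] ap_ten[OF id_hom'[OF Ax] J3(1) te(1) ee(2)[OF y z]] te(1) \<mu>[OF y z] ap_scale[OF h2 ee(2)[OF x yz]]
            ap_comp[OF J4' sI ee(2)[OF x yz]] m4 ap_scale[OF sI te(6)] s)
    qed
    have "\<omega> (a x) (a y) (a z) * (\<mu> x y * \<mu> (x \<otimes> y) z) = \<mu> y z * (\<mu> x (y \<otimes> z) * \<omega> x y z)"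
      by (rule vec_scale_cancel[OF _ L(4)[OF xyz]]) (simp only: lhs[symmetric] rhs[symmetric] hex)
    then show "\<omega> (a x) (a y) (a z) * (\<mu> (x \<otimes> y) z * \<mu> x y) = \<omega> x y z * \<mu> y z * \<mu> x (y \<otimes> z)"
      by (simp add: mult_ac)
  next
    show "\<mu> x y = 1" if "\<not> (x \<in> \<G> \<and> y \<in> \<G>)" for x y
      using that by (auto simp: \<mu>_def)
  qed
  \<comment> \<open>The prospective component of the comparison on degree \<open>g\<close>: the
    image of the arrow belonging to \<open>v\<close>, evaluated at the chosen generator.\<close>
  define R where "R V g v = ap (FA \<alpha> (pt g V v)) (e g)" for V g v
  have pt: "FA \<alpha> (pt g V v) \<in> Hom C (A g) (FO \<alpha> V)" if "V \<in> GS" "g \<in> \<G>" "v \<in> V g" for V g v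
    unfolding A_def by (rule T'(4)[OF pt_in_hom(1)[OF that(2,1,3)]])
  have Rmem: "R V g v \<in> FO \<alpha> V (a g)" if "V \<in> GS" "g \<in> \<G>" "v \<in> V g" for V g v
    unfolding R_def by (rule homD(6)[OF pt[OF that] L(2,3)[OF that(2)]])
  have Radd: "R V g (v + w) = R V g v + R V g w" if V: "V \<in> GS" and g: "g \<in> \<G>" and v: "v \<in> V g" and w: "w \<in> V g" for V g v w
  proof -
    note P = pt_in_hom[OF g V v] and Q = pt_in_hom[OF g V w] and S = pt_in_hom[of g V "v + w", OF g V gr_scale(2)[OF V v w]]
    have "pt g V (v + w) = Plus C (pt g V v) (pt g V w)"
    proof (rule line_hom_eqI[OF line_delta[OF g] S(1) C.plus_hom[OF P(1) Q(1)]])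
      have "ap (Plus C (pt g V v) (pt g V w)) vec_unit = ap (pt g V v) vec_unit + ap (pt g V w) vec_unit"
        by (rule ap_Plus[OF P(1) Q(1) delta_total[OF g]])
      then show "ap (pt g V (v + w)) vec_unit = ap (Plus C (pt g V v) (pt g V w)) vec_unit"
        using P(2) Q(2) S(2) by simp
    qed
    then have "FA \<alpha> (pt g V (v + w)) = Plus C (FA \<alpha> (pt g V v)) (FA \<alpha> (pt g V w))"
      using T'(9)[OF P(1) Q(1)] by simp
    then show ?thesis
      unfolding R_def by (simp only: ap_Plus[OF pt[OF V g v] pt[OF V g w] L(5)[OF g]])
  qed
  have Rscale: "R V g (vec_scale c v) = vec_scale c (R V g v)" if V: "V \<in> GS" and g: "g \<in> \<G>" and v: "v \<in> V g" for V g v c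
  proof -
    note P = pt_in_hom[OF g V v] and S = pt_in_hom[of g V "vec_scale c v", OF g V gr_scale(1)[OF V v, of c]]
    have "pt g V (vec_scale c v) = Scale C c (pt g V v)"
    proof (rule line_hom_eqI[OF line_delta[OF g] S(1) C.scale_hom[OF P(1)]])
      have "ap (Scale C c (pt g V v)) vec_unit = vec_scale c (ap (pt g V v) vec_unit)"
        by (rule ap_Scale[OF P(1) delta_total[OF g]])
      then show "ap (pt g V (vec_scale c v)) vec_unit = ap (Scale C c (pt g V v)) vec_unit"
        using P(2) S(2) by simp
    qed
    then have "FA \<alpha> (pt g V (vec_scale c v)) = Scale C c (FA \<alpha> (pt g V v))"
      using T'(10)[OF P(1)] by simp
    moreover have "ap (Scale C c (FA \<alpha> (pt g V v))) (e g) = vec_scale c (ap (FA \<alpha> (pt g V v)) (e g))"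
      by (rule ap_Scale[OF pt[OF V g v] L(5)[OF g]])
    ultimately show ?thesis
      unfolding R_def by simp
  qed
  \<comment> \<open>The linear maps \<open>R V g\<close> on the components are glued along the
    degree projections.\<close>
  have ex: "\<exists>n. n \<in> Hom C (shift a V) (FO \<alpha> V) \<and> (\<forall>g\<in>\<G>. \<forall>v\<in>V g. ap n v = R V g v)" if V: "V \<in> GS" for V
  proof -
    define \<Phi> where "\<Phi> v = (\<Sum>g\<in>\<G>. R V g (proj V g v))" for v
    have lin: "linear_on UNIV \<Phi>"
      unfolding \<Phi>_def
    proof (rule linear_on_sums)
      fix g assume g: "g \<in> \<G>"
      show "linear_on UNIV (\<lambda>v. R V g (proj V g v))"
        unfolding linear_on_def using linear_onD[OF proj(1)[OF V g]] Radd[OF V g proj(2)[OF V g] proj(2)[OF V g]]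
          Rscale[OF V g proj(2)[OF V g]] by simp
    qed
    have R0: "R V g 0 = 0" if g: "g \<in> \<G>" for g
      using Rscale[OF V g gradedD(5)[OF V], of 0] seqvec.scale_zero_left by metis
    have \<Phi>: "\<Phi> v = R V g v" if g: "g \<in> \<G>" and v: "v \<in> V g" for g v
    proof -
      have "\<Phi> v = R V g (proj V g v)"
        unfolding \<Phi>_def by (rule sum_if_eq[OF finite_carrier g]) (use proj(3)[OF V _ g v] R0 in simp)
      then show ?thesis
        using proj(3)[OF V g g v] by simp
    qed
    let ?n = "(shift a V, restrict \<Phi> (tot (shift a V)), FO \<alpha> V)"
    have "?n \<in> Hom C (shift a V) (FO \<alpha> V)"
    proof (rule homI[OF regrade_closed[OF a V] FOGS[OF V] linear_on_subset[OF lin subset_UNIV]])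
      fix k v assume k: "k \<in> \<G>" and v: "v \<in> shift a V k"
      obtain g where g: "g \<in> \<G>" "k = a g" "shift a V k = V g"
        by (rule regradeE[OF a k])
      then show "\<Phi> v \<in> FO \<alpha> V k"
        using v \<Phi>[of g v] Rmem[OF V g(1), of v] by simp
    qed
    moreover have "ap ?n v = R V g v" if "g \<in> \<G>" "v \<in> V g" for g v
      using \<Phi>[OF that] hom_total[OF V that] by (simp add: regrade_total[OF a])
    ultimately show ?thesis
      by blast
  qed
  define \<eta> where "\<eta> V = (SOME n. n \<in> Hom C (shift a V) (FO \<alpha> V) \<and> (\<forall>g\<in>\<G>. \<forall>v\<in>V g. ap n v = R V g v))" for V
  have \<eta>: "\<eta> V \<in> Hom C (shift a V) (FO \<alpha> V)" "\<And>g v. g \<in> \<G> \<Longrightarrow> v \<in> V g \<Longrightarrow> ap (\<eta> V) v = R V g v" if "V \<in> GS" for V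
    using someI_ex[OF ex[OF that], folded \<eta>_def] by blast+
  have iso: "is_iso C (\<eta> V)" if V: "V \<in> GS" for V
  proof (rule is_iso_if_bij[OF \<eta>(1)[OF V]])
    fix k assume k: "k \<in> \<G>"
    obtain g where g: "g \<in> \<G>" "k = a g" "shift a V k = V g"
      by (rule regradeE[OF a k])
    have "inj_on (ap (\<eta> V)) (V g)"
    proof (rule inj_onI)
      fix v v' assume v: "v \<in> V g" and v': "v' \<in> V g" and "ap (\<eta> V) v = ap (\<eta> V) v'"
      then have "R V g v = R V g v'"
        using \<eta>(2)[OF V g(1)] by simp
      then have "FA \<alpha> (pt g V v) = FA \<alpha> (pt g V v')"
        unfolding R_def by (rule line_hom_eqI[OF l[OF g(1)] pt[OF V g(1) v] pt[OF V g(1) v']])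
      then have "pt g V v = pt g V v'"
        by (rule C.equivalence_faithful[OF E pt_in_hom(1)[OF g(1) V v] pt_in_hom(1)[OF g(1) V v']])
      then show "v = v'"
        using pt_in_hom(2)[OF g(1) V v] pt_in_hom(2)[OF g(1) V v'] by argo
    qed
    moreover have "ap (\<eta> V) ` V g = FO \<alpha> V (a g)"
    proof
      show "ap (\<eta> V) ` V g \<subseteq> FO \<alpha> V (a g)"
      proof (rule image_subsetI)
        fix v assume v: "v \<in> V g"
        show "ap (\<eta> V) v \<in> FO \<alpha> V (a g)"
          unfolding \<eta>(2)[OF V g(1) v] by (rule Rmem[OF V g(1) v])
      qed
      show "FO \<alpha> V (a g) \<subseteq> ap (\<eta> V) ` V g"
      proof
        fix w assume w: "w \<in> FO \<alpha> V (a g)"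
        \<comment> \<open>Surjectivity comes from fullness, as injectivity came from faithfulness:
          vectors on either side are arrows out of a line.\<close>
        obtain r where r: "r \<in> Hom C (A g) (FO \<alpha> V)" "ap r (e g) = w"
          using line_hom_exists[OF l[OF g(1)] FOGS[OF V] w] by blast
        have o: "delta g \<in> Obj C" "V \<in> Obj C" using V g(1) by simp_all
        obtain q where q: "q \<in> Hom C (delta g) V" "FA \<alpha> q = r"
          using C.equivalence_full[OF E o r(1)[unfolded A_def]] by blast
        define v where "v = ap q vec_unit"
        have v: "v \<in> V g"
          unfolding v_def by (rule homD(6)[OF q(1) g(1) vec_unit_delta])
        have "q = pt g V v"
          by (rule line_hom_eqI[OF line_delta[OF g(1)] q(1) pt_in_hom(1)[OF g(1) V v]])
            (simp only: pt_in_hom(2)[OF g(1) V v], simp only: v_def)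
        then have "ap (\<eta> V) v = w"
          using \<eta>(2)[OF V g(1) v] q(2) r(2) by (simp add: R_def)
        then show "w \<in> ap (\<eta> V) ` V g"
          using v by blast
      qed
    qed
    ultimately show "bij_betw (ap (\<eta> V)) (shift a V k) (FO \<alpha> V k)"
      unfolding g(3) unfolding g(2) by (simp add: bij_betw_def)
  qed
  have nat: "\<eta> W \<bullet> FA (FF a \<mu>) f = FA \<alpha> f \<bullet> \<eta> V" if f: "f \<in> Hom C V W" for V W f
  proof -
    note V = homD(2)[OF f] and W = homD(3)[OF f]
    note Ff = FA_hom[OF a f, of \<mu>] and af = T'(4)[OF f]
    show ?thesis
    proof (rule hom_eqI[OF hom_comp[OF Ff(1) \<eta>(1)[OF W]] hom_comp[OF \<eta>(1)[OF V] af]])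
      fix k v assume k: "k \<in> \<G>" and v: "v \<in> shift a V k"
      obtain g where g: "g \<in> \<G>" "k = a g" "shift a V k = V g"
        by (rule regradeE[OF a k])
      have vg: "v \<in> V g" using v g(3) by simp
      note vt = hom_total[OF V g(1) vg]
      note fv = homD(6)[OF f g(1) vg]
      note P = pt_in_hom[OF g(1) V vg] and Q = pt_in_hom[OF g(1) W fv]
      have "pt g W (ap f v) = f \<bullet> pt g V v"
        by (rule line_hom_eqI[OF line_delta[OF g(1)] Q(1) hom_comp[OF P(1) f]])
          (simp add: Q(2) ap_comp[OF P(1) f delta_total[OF g(1)]] P(2))
      then have "FA \<alpha> (pt g W (ap f v)) = FA \<alpha> f \<bullet> FA \<alpha> (pt g V v)"
        using T'(5)[OF P(1) f] by simp
      then have "R W g (ap f v) = ap (FA \<alpha> f) (R V g v)"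
        unfolding R_def by (simp add: ap_comp[OF pt[OF V g(1) vg] af L(5)[OF g(1)]])
      then show "ap (\<eta> W \<bullet> FA (FF a \<mu>) f) v = ap (FA \<alpha> f \<bullet> \<eta> V) v"
        using vt by (simp add: ap_comp[OF Ff(1) \<eta>(1)[OF W]] ap_comp[OF \<eta>(1)[OF V] af] regrade_total[OF a] Ff(2)
            \<eta>(2)[OF W g(1) fv] \<eta>(2)[OF V g(1) vg])
    qed
  qed
  have ten: "\<eta> (gten V W) \<bullet> FJ (FF a \<mu>) V W = FJ \<alpha> V W \<bullet> (\<eta> V \<odot> \<eta> W)" if V: "V \<in> GS" and W: "W \<in> GS" for V W
  proof -
    note VW = ten_closed[OF V W] and JF = FJ_props[OF p V W]
    have Ja: "FJ \<alpha> V W \<in> Hom C (gten (FO \<alpha> V) (FO \<alpha> W)) (FO \<alpha> (gten V W))"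
      using T'(6)[of V W] V W by simp
    note \<eta>\<eta> = ten_in_hom[OF \<eta>(1)[OF V] \<eta>(1)[OF W]]
    show ?thesis
    proof (rule hom_regrade_ten_eqI[OF a V W hom_comp[OF JF(1) \<eta>(1)[OF VW]] hom_comp[OF \<eta>\<eta> Ja]])
      fix x y v w assume *: "x \<in> \<G>" "y \<in> \<G>" "v \<in> V x" "w \<in> W y"
      have xy: "x \<otimes> y \<in> \<G>" using * by simp
      note vw = gr_ten_mem[of x y v V w W, OF *]
      have vt: "v \<in> tot (shift a V)" and wt: "w \<in> tot (shift a W)"
        using hom_total[OF V *(1,3)] hom_total[OF W *(2,4)] by (simp_all add: regrade_total[OF a])
      note t = total_ten[OF regrade_closed[OF a V] regrade_closed[OF a W] vt wt]
      have t2: "vec_ten v w \<in> tot (shift a (gten V W))"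
        using t by (simp add: regrade_ten[OF a])
      note P = pt_in_hom[OF *(1) V *(3)] and Q = pt_in_hom[OF *(2) W *(4)] and S = pt_in_hom[OF xy VW vw]
      note aP = pt[OF V *(1,3)] and aQ = pt[OF W *(2,4)] and aS = pt[OF VW xy vw]
      \<comment> \<open>Products of lines are lines on the nose, so the arrow of a product is the
        product of the arrows, and naturality of the tensor structure of \<alpha> applies.\<close>
      have eq: "pt x V v \<odot> pt y W w = pt (x \<otimes> y) (gten V W) (vec_ten v w)"
      proof (rule line_hom_eqI[OF line_delta[OF xy] _ S(1)])
        show "pt x V v \<odot> pt y W w \<in> Hom C (delta (x \<otimes> y)) (gten V W)"
          using ten_in_hom[OF P(1) Q(1)] by (simp add: delta_ten *)
        have "ap (pt x V v \<odot> pt y W w) (vec_ten vec_unit vec_unit) = vec_ten v w"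
          by (simp add: ap_ten[OF P(1) Q(1) delta_total[OF *(1)] delta_total[OF *(2)]] P(2) Q(2))
        then show "ap (pt x V v \<odot> pt y W w) vec_unit = ap (pt (x \<otimes> y) (gten V W) (vec_ten v w)) vec_unit"
          by (simp add: S(2) vec_ten_unit_unit)
      qed
      have n: "FJ \<alpha> V W \<bullet> (FA \<alpha> (pt x V v) \<odot> FA \<alpha> (pt y W w)) =
          FA \<alpha> (pt (x \<otimes> y) (gten V W) (vec_ten v w)) \<bullet> FJ \<alpha> (delta x) (delta y)"
        using T'(8)[OF P(1) Q(1)] by (simp add: eq)
      have "ap (FJ \<alpha> V W) (vec_ten (R V x v) (R W y w)) = ap (FJ \<alpha> V W \<bullet> (FA \<alpha> (pt x V v) \<odot> FA \<alpha> (pt y W w))) (vec_ten (e x) (e y))"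
        unfolding R_def
        by (simp add: ap_comp[OF ten_in_hom[OF aP aQ] Ja ee(2)[OF *(1,2)]] ap_ten[OF aP aQ L(5)[OF *(1)] L(5)[OF *(2)]])
      also have "\<dots> = vec_scale (\<mu> x y) (R (gten V W) (x \<otimes> y) (vec_ten v w))"
        unfolding n R_def by (simp add: ap_comp[OF J(1)[OF *(1,2)] aS ee(2)[OF *(1,2)]] \<mu>[OF *(1,2)] ap_scale[OF aS L(5)[OF xy]])
      finally show "ap (\<eta> (gten V W) \<bullet> FJ (FF a \<mu>) V W) (vec_ten v w) = ap (FJ \<alpha> V W \<bullet> (\<eta> V \<odot> \<eta> W)) (vec_ten v w)"
        by (simp add: ap_comp[OF JF(1) \<eta>(1)[OF VW] t] ap_comp[OF \<eta>\<eta> Ja t] JF(2)[OF *] ap_scale[OF \<eta>(1)[OF VW] t2]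
            \<eta>(2)[OF VW xy vw] ap_ten[OF \<eta>(1)[OF V] \<eta>(1)[OF W] vt wt] \<eta>(2)[OF V *(1,3)] \<eta>(2)[OF W *(2,4)])
    qed
  qed
  have "tensor_functor_iso C C (FF a \<mu>) \<alpha>"
    unfolding tensor_functor_iso_def is_nat_iso_def
    by (rule exI[of _ \<eta>]) (use \<eta>(1) iso nat ten in simp)
  then show ?thesis
    using p by blast
qed

end

section \<open>Kernel of the induction homomorphism\<close>

context finite_group
begin

definition inner :: "'a \<Rightarrow> 'a \<Rightarrow> 'a" where
  "inner g = (\<lambda>x\<in>\<G>. g \<otimes> x \<otimes> inv g)"

lemma inner_apply [simp]: "x \<in> \<G> \<Longrightarrow> inner g x = cj g x"
  by (simp add: inner_def cj_def)

lemma inner_auto: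
  assumes g: "g \<in> \<G>"
  shows "inner g \<in> auto G"
proof -
  have "bij_betw (inner g) \<G> \<G>"
    by (rule bij_betw_byWitness[of _ "cj (inv g)"]) (use g in \<open>auto simp: cj_inv\<close>)
  moreover have "inner g \<in> hom G G"
    using g by (auto intro!: homI simp: cj_mult)
  ultimately show ?thesis
    by (simp add: auto_def Bij_def inner_def)
qed

end

context graded_setup
begin

text \<open>By \<open>kappa_coboundary\<close> the inverse of \<open>kappa g\<close> has the
  coboundary required for conjugation by \<open>g\<close>; the factor made from \<nu> is itself a
  coboundary and does not change it.\<close>

lemma pair_inner_iff:
  assumes g: "g \<in> \<G>" and \<nu>: "\<And>x. x \<in> \<G> \<Longrightarrow> \<nu> x \<noteq> 0"
    and \<mu>: "\<And>x y. x \<in> \<G> \<Longrightarrow> y \<in> \<G> \<Longrightarrow> \<mu> x y = \<nu> x * \<nu> y / (\<nu> (x \<otimes> y) * kappa g x y)"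
    and o: "\<And>x y. \<not> (x \<in> \<G> \<and> y \<in> \<G>) \<Longrightarrow> \<mu> x y = 1"
  shows "pair (inner g) \<mu>"
proof (rule pairI[OF inner_auto[OF g] _ _ o])
  show "\<mu> x y \<noteq> 0" if "x \<in> \<G>" "y \<in> \<G>" for x y
    using \<mu>[OF that] \<nu> that g by simp
  fix x y z assume *: "x \<in> \<G>" "y \<in> \<G>" "z \<in> \<G>"
  then have "kappa g (x \<otimes> y) z \<noteq> 0" "kappa g x y \<noteq> 0" "kappa g y z \<noteq> 0" "kappa g x (y \<otimes> z) \<noteq> 0"
    "\<nu> x \<noteq> 0" "\<nu> y \<noteq> 0" "\<nu> z \<noteq> 0" "\<nu> (x \<otimes> y) \<noteq> 0" "\<nu> (y \<otimes> z) \<noteq> 0" "\<nu> (x \<otimes> y \<otimes> z) \<noteq> 0" "x \<otimes> (y \<otimes> z) = x \<otimes> y \<otimes> z"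
    using g \<nu> by (simp_all add: m_assoc)
  then show "\<omega> (inner g x) (inner g y) (inner g z) * (\<mu> (x \<otimes> y) z * \<mu> x y) = \<omega> x y z * \<mu> y z * \<mu> x (y \<otimes> z)"
    using kappa_coboundary[OF * g] * by (simp add: \<mu> field_simps)
qed

lemma bij_betw_vec_scale:
  assumes V: "V \<in> GS" and c: "c \<noteq> 0"
  shows "bij_betw (vec_scale c) (V d) (V d)"
  by (rule bij_betw_byWitness[of _ "vec_scale (1 / c)"]) (use c gr_scale(1)[OF V] in auto)

text \<open>The operator \<open>\<rho>\<^sub>g\<close> conjugates degrees, hence is a graded map
  only out of the space regraded by conjugation with \<open>g\<close>.\<close>

lemma conj_hom_exists:
  assumes P: "P \<in> CO" and g: "g \<in> \<G>" and \<nu>: "\<And>x. x \<in> \<G> \<Longrightarrow> \<nu> x \<noteq> 0"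
  shows "\<exists>f\<in>Hom C (shift (inner g) (fst P)) (fst P). is_iso C f \<and>
    (\<forall>d\<in>\<G>. \<forall>z\<in>fst P d. ap f z = vec_scale (\<nu> d) (act P g z))"
proof -
  note a = inner_auto[OF g]
  note Z = center_GS(1)[OF P]
  define Z' where "Z' = fst P"
  note Z = Z[folded Z'_def]
  note rZ = regrade_closed[OF a Z]
  \<comment> \<open>Rescales the component of degree \<open>d\<close> by \<open>\<nu> d\<close>;
    composing with the operator gives a single linear map instead of one for each degree.\<close>
  define s where "s z = (\<Sum>d\<in>\<G>. vec_scale (\<nu> d) (proj Z' d z))" for z
  have s_lin: "linear_on UNIV s"
    unfolding s_def by (rule linear_on_sums) (rule linear_on_scale[OF proj(1)[OF Z]])
  have s_total: "s z \<in> tot Z'" for z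
    unfolding s_def total_iff
    by (rule exI[of _ "\<lambda>d. vec_scale (\<nu> d) (proj Z' d z)"]) (use gr_scale(1)[OF Z] proj(2)[OF Z] in simp)
  have s: "s z = vec_scale (\<nu> d) z" if d: "d \<in> \<G>" and z: "z \<in> Z' d" for d z
  proof -
    have "s z = vec_scale (\<nu> d) (proj Z' d z)"
      unfolding s_def by (rule sum_if_eq[OF finite_carrier d]) (simp add: proj(3)[OF Z _ d z])
    then show ?thesis
      by (simp add: proj(3)[OF Z d d z])
  qed
  note al = act_linear[OF P g, folded Z'_def]
  have F: "linear_on (tot (shift (inner g) Z')) (\<lambda>z. act P g (s z))"
    unfolding linear_on_def using linear_onD[OF al] linear_onD[OF s_lin] s_total by simp
  have ev: "act P g (s z) = vec_scale (\<nu> d) (act P g z)" if d: "d \<in> \<G>" and z: "z \<in> Z' d" for d z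
    unfolding s[OF that] by (rule linear_onD(2)[OF al hom_total[OF Z that]])
  let ?f = "(shift (inner g) Z', restrict (\<lambda>z. act P g (s z)) (tot (shift (inner g) Z')), Z')"
  have f: "?f \<in> Hom C (shift (inner g) Z') Z'"
  proof (rule homI[OF rZ Z F])
    fix k v assume k: "k \<in> \<G>" and v: "v \<in> shift (inner g) Z' k"
    obtain d where d: "d \<in> \<G>" "k = inner g d" "shift (inner g) Z' k = Z' d"
      by (rule regradeE[OF a k])
    have v: "v \<in> Z' d" using v d(3) by simp
    show "act P g (s v) \<in> Z' k"
      unfolding ev[OF d(1) v] d(2) inner_apply[OF d(1)]
      by (rule gr_scale(1)[OF Z act_mem[OF P g d(1) v[unfolded Z'_def], folded Z'_def]])
  qed
  have fe: "ap ?f z = vec_scale (\<nu> d) (act P g z)" if "d \<in> \<G>" "z \<in> Z' d" for d z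
    using ev[OF that] hom_total[OF Z that] by (simp add: regrade_total[OF a])
  have "is_iso C ?f"
  proof (rule is_iso_if_bij[OF f])
    fix k assume k: "k \<in> \<G>"
    obtain d where d: "d \<in> \<G>" "k = inner g d" "shift (inner g) Z' k = Z' d"
      by (rule regradeE[OF a k])
    have kd: "k = cj g d" using d by simp
    have "bij_betw (vec_scale (\<nu> d) \<circ> act P g) (Z' d) (Z' (cj g d))"
      by (rule bij_betw_trans[OF act_bij[OF P g d(1), folded Z'_def] bij_betw_vec_scale[OF Z \<nu>[OF d(1)]]])
    moreover have "bij_betw (ap ?f) (Z' d) (Z' k) \<longleftrightarrow> bij_betw (vec_scale (\<nu> d) \<circ> act P g) (Z' d) (Z' k)"
      by (rule bij_betw_cong) (simp only: fe[OF d(1)] comp_apply)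
    ultimately show "bij_betw (ap ?f) (shift (inner g) Z' k) (Z' k)"
      unfolding d(3) by (simp only: kd)
  qed
  then show ?thesis
    using f fe unfolding Z'_def by blast
qed

text \<open>The rescaled operators commute with the actions by \<open>kappa_theta_conj\<close>, are
  natural because arrows of the center commute with all operators, and respect tensor products
  because \<open>kappa g\<close> cancels against the denominator of \<mu>.\<close>

lemma ind_trivial:
  assumes g: "g \<in> \<G>" and \<nu>: "\<And>x. x \<in> \<G> \<Longrightarrow> \<nu> x \<noteq> 0"
    and \<mu>: "\<And>x y. x \<in> \<G> \<Longrightarrow> y \<in> \<G> \<Longrightarrow> \<mu> x y = \<nu> x * \<nu> y / (\<nu> (x \<otimes> y) * kappa g x y)"
    and p: "pair (inner g) \<mu>"
  shows "tensor_functor_iso D D (ind C (FF (inner g) \<mu>)) (id_tensor_functor D)"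
proof -
  let ?F = "FF (inner g) \<mu>"
  note a = inner_auto[OF g]
  define f where "f P = (SOME f. f \<in> Hom C (shift (inner g) (fst P)) (fst P) \<and> is_iso C f \<and>
    (\<forall>d\<in>\<G>. \<forall>z\<in>fst P d. ap f z = vec_scale (\<nu> d) (act P g z)))" for P :: "('a, 'k) grspace \<times> (('a, 'k) grspace \<Rightarrow> ('a, 'k) grmap)"
  have f: "f P \<in> Hom C (shift (inner g) (fst P)) (fst P)" "is_iso C (f P)"
    "\<And>d z. d \<in> \<G> \<Longrightarrow> z \<in> fst P d \<Longrightarrow> ap (f P) z = vec_scale (\<nu> d) (act P g z)"
    if P: "P \<in> CO" for P
  proof -
    have *: "f P \<in> Hom C (shift (inner g) (fst P)) (fst P) \<and> is_iso C (f P) \<and>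
        (\<forall>d\<in>\<G>. \<forall>z\<in>fst P d. ap (f P) z = vec_scale (\<nu> d) (act P g z))"
      unfolding f_def by (rule someI_ex) (rule conj_hom_exists[OF P g \<nu>, unfolded Bex_def])
    show "f P \<in> Hom C (shift (inner g) (fst P)) (fst P)" "is_iso C (f P)"
      using * by (simp_all only:)
    fix d z assume "d \<in> \<G>" "z \<in> fst P d"
    then show "ap (f P) z = vec_scale (\<nu> d) (act P g z)"
      using *[THEN conjunct2, THEN conjunct2] by (simp only:)
  qed
  have arr: "(indo ?F P, f P, P) \<in> CA" if P: "P \<in> CO" for P
    unfolding center_arrs_iff[OF ind_obj_closed[OF p P] P]
  proof (intro conjI ballI)
    have o: "fst (indo ?F P) = shift (inner g) (fst P)"
      by (simp add: C.ind_obj_fst)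
    note Z = center_GS(1)[OF P]
    show "f P \<in> Hom C (fst (indo ?F P)) (fst P)"
      unfolding o by (rule f(1)[OF P])
    fix h' k z assume h': "h' \<in> \<G>" and k: "k \<in> \<G>" and z: "z \<in> fst (indo ?F P) k"
    obtain h where h: "h \<in> \<G>" "h' = inner g h" "shift (inner g) (fst P) h' = fst P h"
      by (rule regradeE[OF a h'])
    obtain d where d: "d \<in> \<G>" "k = inner g d" "shift (inner g) (fst P) k = fst P d"
      by (rule regradeE[OF a k])
    have z: "z \<in> fst P d" using z d(3) o by simp
    note hz = act_mem[OF P h(1) d(1) z]
    have cl: "cj h d \<in> \<G>" "cj g h \<in> \<G>" "g \<otimes> h \<in> \<G>" using g h(1) d(1) by simp_all
    note zt = hom_total[OF Z d(1) z] and hzt = hom_total[OF Z cl(1) hz]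
    have t: "tot (shift (inner g) (fst P)) = tot (fst P)" by (rule regrade_total[OF a])
    have nz: "\<nu> d \<noteq> 0" "\<nu> (cj h d) \<noteq> 0" "\<nu> h \<noteq> 0" "\<nu> (h \<otimes> d) \<noteq> 0" "kappa g h d \<noteq> 0" "kappa g (cj h d) h \<noteq> 0"
        "theta d g h \<noteq> 0" "theta d (cj g h) g \<noteq> 0"
      using \<nu> g h(1) d(1) by simp_all
    \<comment> \<open>Factoring \<open>g \<otimes> h\<close> as \<open>g\<close> times
      \<open>h\<close> and as \<open>cj g h\<close> times \<open>g\<close> compares the two orders
      in which the operators are applied.\<close>
    have 1: "act P (g \<otimes> h) z = vec_scale (theta d g h) (act P g (act P h z))"
      by (rule act_act[OF P g h(1) d(1) z])
    have 2: "act P (g \<otimes> h) z = vec_scale (theta d (cj g h) g) (act P (cj g h) (act P g z))"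
      using act_act[OF P cl(2) g d(1) z] by (simp add: cj_swap g h(1))
    have e1: "act P g (act P h z) = vec_scale (1 / theta d g h) (act P (g \<otimes> h) z)"
      using nz by (simp add: 1)
    have e2: "act P (cj g h) (act P g z) = vec_scale (1 / theta d (cj g h) g) (act P (g \<otimes> h) z)"
      using nz by (simp add: 2)
    have "ap (f P) (act (indo ?F P) h' z) =
        vec_scale (\<mu> h d / \<mu> (cj h d) h * \<nu> (cj h d) / theta d g h) (act P (g \<otimes> h) z)"
      unfolding h(2) act_ind[OF p P h(1) d(1) z] ap_scale[OF f(1)[OF P], unfolded t, OF hzt] f(3)[OF P cl(1) hz] e1
      by simp
    moreover have "act P h' (ap (f P) z) = vec_scale (\<nu> d / theta d (cj g h) g) (act P (g \<otimes> h) z)"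
      unfolding h(2) inner_apply[OF h(1)] f(3)[OF P d(1) z]
        linear_onD(2)[OF act_linear[OF P cl(2)] act_total[OF P g zt]] e2 by simp
    \<comment> \<open>Since \<open>cj h d \<otimes> h = h \<otimes> d\<close>, the values of \<nu>
      cancel except for \<open>\<nu> d\<close>; the quotient of values of \<open>kappa\<close> that
      remains is the one in \<open>kappa_theta_conj\<close>.\<close>
    moreover have "\<mu> h d / \<mu> (cj h d) h * \<nu> (cj h d) / theta d g h = \<nu> d / theta d (cj g h) g"
      using kappa_theta_conj[OF d(1) g h(1)] nz cj_swap[OF h(1) d(1)]
      by (simp add: \<mu>[OF h(1) d(1)] \<mu>[OF cl(1) h(1)] divide_simps)
    ultimately show "ap (f P) (act (indo ?F P) h' z) = act P h' (ap (f P) z)"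
      by simp
  qed
  let ?\<eta> = "\<lambda>P. (indo ?F P, f P, P)"
  have nat: "f Q \<bullet> FA ?F \<phi> = \<phi> \<bullet> f P" if \<phi>: "(P, \<phi>, Q) \<in> CA" for P Q \<phi>
  proof -
    note P = C.center_arrsD(1)[OF \<phi>] and Q = C.center_arrsD(2)[OF \<phi>] and h = C.center_arrsD(3)[OF \<phi>]
    note Fh = FA_hom[OF a h, of \<mu>]
    note \<phi>' = \<phi>[unfolded center_arrs_iff[OF P Q]]
    show ?thesis
    proof (rule hom_eqI[OF hom_comp[OF Fh(1) f(1)[OF Q]] hom_comp[OF f(1)[OF P] h]])
      fix k z assume k: "k \<in> \<G>" and z: "z \<in> shift (inner g) (fst P) k"
      obtain d where d: "d \<in> \<G>" "k = inner g d" "shift (inner g) (fst P) k = fst P d"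
        by (rule regradeE[OF a k])
      have z: "z \<in> fst P d" using z d(3) by simp
      note zt = hom_total[OF center_GS(1)[OF P] d(1) z]
      have zt': "z \<in> tot (shift (inner g) (fst P))" using zt by (simp add: regrade_total[OF a])
      have e: "ap \<phi> (act P g z) = act Q g (ap \<phi> z)"
        using \<phi>' g d(1) z by blast
      show "ap (f Q \<bullet> FA ?F \<phi>) z = ap (\<phi> \<bullet> f P) z"
        unfolding ap_comp[OF Fh(1) f(1)[OF Q] zt'] ap_comp[OF f(1)[OF P] h zt'] Fh(2) f(3)[OF P d(1) z]
          f(3)[OF Q d(1) homD(6)[OF h d(1) z]] ap_scale[OF h act_total[OF P g zt]] e ..
    qed
  qed
  have ten: "f (cten P Q) \<bullet> FJ ?F (fst P) (fst Q) = f P \<odot> f Q"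
    if P: "P \<in> CO" and Q: "Q \<in> CO" for P Q
  proof -
    note Z = center_GS(1)[OF P] and W = center_GS(1)[OF Q]
    note PQ = center_ten_closed[OF P Q] and J = FJ_props[OF p Z W]
    note fPQ = f(1)[OF PQ, unfolded center_ten_fst]
    show ?thesis
    proof (rule hom_regrade_ten_eqI[OF a Z W hom_comp[OF J(1) fPQ] ten_in_hom[OF f(1)[OF P] f(1)[OF Q]]])
      fix x y v w assume *: "x \<in> \<G>" "y \<in> \<G>" "v \<in> fst P x" "w \<in> fst Q y"
      have vt: "v \<in> tot (shift (inner g) (fst P))" and wt: "w \<in> tot (shift (inner g) (fst Q))"
        using hom_total[OF Z *(1,3)] hom_total[OF W *(2,4)] by (simp_all add: regrade_total[OF a])
      note t = total_ten[OF regrade_closed[OF a Z] regrade_closed[OF a W] vt wt]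
      have t2: "vec_ten v w \<in> tot (shift (inner g) (gten (fst P) (fst Q)))"
        using t by (simp add: regrade_ten[OF a])
      have xy: "x \<otimes> y \<in> \<G>" using * by simp
      note vw = gr_ten_mem[of x y v "fst P" w "fst Q", OF *]
      have nz: "\<nu> x \<noteq> 0" "\<nu> y \<noteq> 0" "\<nu> (x \<otimes> y) \<noteq> 0" "kappa g x y \<noteq> 0" using \<nu> g * by simp_all
      show "ap (f (cten P Q) \<bullet> FJ ?F (fst P) (fst Q)) (vec_ten v w) = ap (f P \<odot> f Q) (vec_ten v w)"
        unfolding ap_comp[OF J(1) fPQ t] J(2)[OF *] ap_scale[OF fPQ t2] f(3)[OF PQ xy, unfolded center_ten_fst, OF vw]
          ap_ten[OF f(1)[OF P] f(1)[OF Q] vt wt] f(3)[OF P *(1,3)] f(3)[OF Q *(2,4)]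
          act_center_ten[OF P Q g *]
        using nz by (simp add: \<mu>[OF *(1,2)] ac_simps)
    qed
  qed
  show ?thesis
    unfolding tensor_functor_iso_def is_nat_iso_def
  proof (rule exI[of _ ?\<eta>], intro conjI ballI)
    fix P assume "P \<in> Obj D"
    then have P: "P \<in> CO" by simp
    show "?\<eta> P \<in> Hom D (FO (ind C ?F) P) (FO (id_tensor_functor D) P)"
      using arr[OF P] by (simp add: ind_simps id_tensor_functor_def D_hom_iff)
    show "is_iso D (?\<eta> P)"
      by (rule C.center_Inv(2)[OF arr[OF P] f(2)[OF P]])
    fix Q assume "Q \<in> Obj D"
    then have Q: "Q \<in> CO" by simp
    have fPQ: "f P \<odot> f Q \<in> Hom C (gten (shift (inner g) (fst P)) (shift (inner g) (fst Q))) (gten (fst P) (fst Q))"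
      by (rule ten_in_hom[OF f(1)[OF P] f(1)[OF Q]])
    then have id: "Id C (gten (fst P) (fst Q)) \<bullet> (f P \<odot> f Q) = f P \<odot> f Q"
      by (rule C.id_left)
    show "?\<eta> (P \<boxtimes>\<^bsub>D\<^esub> Q) \<cdot>\<^bsub>D\<^esub> FJ (ind C ?F) P Q = FJ (id_tensor_functor D) P Q \<cdot>\<^bsub>D\<^esub> (?\<eta> P \<boxdot>\<^bsub>D\<^esub> ?\<eta> Q)"
      by (simp add: ind_simps id_tensor_functor_def ten[OF P Q] id)
    fix \<phi> assume "\<phi> \<in> Hom D P Q"
    then obtain \<phi>' where "\<phi> = (P, \<phi>', Q)" "(P, \<phi>', Q) \<in> CA"
      unfolding D_hom_iff by blast
    then show "?\<eta> Q \<cdot>\<^bsub>D\<^esub> FA (ind C ?F) \<phi> = FA (id_tensor_functor D) \<phi> \<cdot>\<^bsub>D\<^esub> ?\<eta> P"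
      using nat by (simp add: ind_simps id_tensor_functor_def)
  qed
qed

end

section \<open>Graded spaces with a basis indexed by the group\<close>

context finite_group
begin

lemma sum_vec_apply: "(\<Sum>a\<in>A. u a) n = (\<Sum>a\<in>A. u a n)" for u :: "'i \<Rightarrow> 'k::field vec"
  by (induction A rule: infinite_finite_induct) auto

text \<open>Group elements are numbered because all spaces live inside the space of sequences; the
  numbering itself is irrelevant.\<close>

definition index :: "'a \<Rightarrow> nat" where
  "index = (SOME i. inj_on i \<G>)"

lemma index_inj: "inj_on index \<G>"
proof -
  obtain f :: "'a \<Rightarrow> nat" and n :: nat where "f ` \<G> = {i. i < n} \<and> inj_on f \<G>"
    using finite_imp_inj_to_nat_seg[OF finite_carrier] by (elim exE)
  then have "\<exists>i :: 'a \<Rightarrow> nat. inj_on i \<G>"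
    by (intro exI[of _ f]) (rule conjunct2)
  then show ?thesis
    unfolding index_def by (rule someI_ex)
qed

lemma index_eq [simp]: "h \<in> \<G> \<Longrightarrow> k \<in> \<G> \<Longrightarrow> index h = index k \<longleftrightarrow> h = k"
  by (rule inj_on_eq_iff[OF index_inj])

definition coords :: "('a \<Rightarrow> 'k::field) \<Rightarrow> 'k vec" where
  "coords c = (\<lambda>n. if n \<in> index ` \<G> then c (inv_into \<G> index n) else 0)"

lemma coords_index [simp]: "k \<in> \<G> \<Longrightarrow> coords c (index k) = c k"
  by (simp add: coords_def inv_into_f_f[OF index_inj])

lemma coords_other: "n \<notin> index ` \<G> \<Longrightarrow> coords c n = 0"
  by (simp add: coords_def)

lemma coords_cong: "(\<And>k. k \<in> \<G> \<Longrightarrow> c k = c' k) \<Longrightarrow> coords c = coords c'"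
  by (rule ext) (simp add: coords_def inv_into_into)

lemma coords_scale: "vec_scale r (coords c) = coords (\<lambda>k. r * c k)"
  by (rule ext) (simp add: coords_def)

text \<open>The hypothesis says that each coordinate of the result is a fixed multiple of one
  coordinate of the argument; the actions on the induced objects and their products all have this
  form.\<close>

lemma coords_linear:
  assumes "\<And>k. k \<in> \<G> \<Longrightarrow> \<exists>n r. \<forall>v. c v k = v n * r"
  shows "linear_on UNIV (\<lambda>v. coords (c v))"
proof -
  have "c (u + v) k = c u k + c v k" "c (vec_scale r v) k = r * c v k" if "k \<in> \<G>" for u v r k
    using assms[OF that] by (auto simp: algebra_simps)
  then have "coords (c (u + v)) n = coords (c u) n + coords (c v) n" "coords (c (vec_scale r v)) n = r * coords (c v) n" for u v r n
    by (cases "n \<in> index ` \<G>"; auto simp: coords_other)+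
  then show ?thesis
    unfolding linear_on_def by (simp add: fun_eq_iff)
qed

text \<open>The degrees that occur form the conjugacy class of \<open>x\<close>, while the total
  dimension is the order of the group. The support condition also removes the coordinates that do
  not number a group element.\<close>

definition orbit_space :: "'a \<Rightarrow> ('a, 'k::field) grspace" where
  "orbit_space x = (\<lambda>d. {v. \<forall>n. v n \<noteq> 0 \<longrightarrow> (\<exists>h\<in>\<G>. n = index h \<and> cj h x = d)})"

lemma orbit_space_eqI:
  assumes v: "v \<in> orbit_space x d" and w: "w \<in> orbit_space x d'" and "\<And>k. k \<in> \<G> \<Longrightarrow> v (index k) = w (index k)"
  shows "v = w"
proof (rule ext)
  fix n
  show "v n = w n"
  proof (cases "n \<in> index ` \<G>")
    case True
    then show ?thesis using assms(3) by blast
  next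
    case False
    then have "v n = 0" "w n = 0"
      using v w unfolding orbit_space_def by blast+
    then show ?thesis by simp
  qed
qed

lemma orbit_spaceD: "\<lbrakk>v \<in> orbit_space x d; k \<in> \<G>; v (index k) \<noteq> 0\<rbrakk> \<Longrightarrow> cj k x = d"
  by (fastforce simp: orbit_space_def)

lemma coords_mem:
  assumes "\<And>k. k \<in> \<G> \<Longrightarrow> c k \<noteq> 0 \<Longrightarrow> cj k x = d"
  shows "coords c \<in> orbit_space x d"
  using assms unfolding orbit_space_def by (auto simp: coords_def inv_into_f_f[OF index_inj])

lemma orbit_space_coords: "v \<in> orbit_space x d \<Longrightarrow> coords (\<lambda>k. v (index k)) = v"
  by (rule orbit_space_eqI[where x = x and d = d and d' = d, OF coords_mem]) (auto dest: orbit_spaceD)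

lemma orbit_space_closed:
  assumes x: "x \<in> \<G>"
  shows "orbit_space x \<in> (graded_spaces G :: ('a, 'k::field) grspace set)"
  unfolding graded_spaces_def
proof (rule CollectI, intro conjI ballI allI impI)
  fix d
  show sub: "seqvec.subspace (orbit_space x d :: 'k vec set)"
    unfolding seqvec.subspace_def orbit_space_def by (auto, metis add.right_neutral)
  let ?e = "\<lambda>h. coords (\<lambda>k. if k = h then 1 else 0) :: 'k vec"
  define B where "B = ?e ` {h \<in> \<G>. cj h x = d}"
  have "finite B"
    using finite_carrier by (simp add: B_def)
  moreover have "(orbit_space x d :: 'k vec set) = seqvec.span B"
  proof
    show "seqvec.span B \<subseteq> orbit_space x d"
      by (rule seqvec.span_minimal[OF _ sub]) (auto simp: B_def intro!: coords_mem split: if_splits)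
    show "orbit_space x d \<subseteq> seqvec.span B"
    proof
      fix v :: "'k vec" assume v: "v \<in> orbit_space x d"
      let ?S = "{h \<in> \<G>. cj h x = d}"
      have "v = (\<Sum>h\<in>?S. vec_scale (v (index h)) (?e h))"
      proof (rule ext)
        fix n
        have "(\<Sum>h\<in>?S. vec_scale (v (index h)) (?e h)) n = (\<Sum>h\<in>?S. v (index h) * ?e h n)"
          by (simp add: sum_vec_apply)
        also have "\<dots> = v n"
        proof (cases "v n = 0")
          case True
          have "v (index h) * ?e h n = 0" if "h \<in> ?S" for h
            using True that by (cases "n \<in> index ` \<G>") (auto simp: coords_other split: if_splits)
          then show ?thesis
            using True by (simp add: sum.neutral)
        next
          case False
          then obtain k where k: "k \<in> \<G>" "n = index k" "cj k x = d"
            using v unfolding orbit_space_def by blast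
          have "(\<Sum>h\<in>?S. v (index h) * ?e h n) = v (index k) * ?e k n"
            by (rule sum_if_eq) (use k finite_carrier in auto)
          then show ?thesis
            using k by simp
        qed
        finally show "v n = (\<Sum>h\<in>?S. vec_scale (v (index h)) (?e h)) n"
          by simp
      qed
      moreover have "(\<Sum>h\<in>?S. vec_scale (v (index h)) (?e h)) \<in> seqvec.span B"
        by (intro seqvec.span_sum seqvec.span_scale seqvec.span_base) (auto simp: B_def)
      ultimately show "v \<in> seqvec.span B"
        by simp
    qed
  qed
  ultimately show "\<exists>B. finite B \<and> (orbit_space x d :: 'k vec set) = seqvec.span B"
    by blast
next
  fix u :: "'a \<Rightarrow> 'k vec" and d assume u: "(\<forall>g\<in>\<G>. u g \<in> orbit_space x g) \<and> (\<Sum>g\<in>\<G>. u g) = 0" and d: "d \<in> \<G>"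
  show "u d = 0"
  proof (rule ext, rule ccontr)
    fix n assume "u d n \<noteq> (0 :: 'k vec) n"
    then have n: "u d n \<noteq> 0" by simp
    then obtain h where h: "h \<in> \<G>" "n = index h" "cj h x = d"
      using u d unfolding orbit_space_def by blast
    have "u g n = 0" if "g \<in> \<G>" "g \<noteq> d" for g
      using u that h orbit_spaceD[of "u g" x g h] by auto
    then have "(\<Sum>g\<in>\<G>. u g n) = u d n"
      by (intro sum_if_eq finite_carrier d)
    then show False
      using u n by (simp add: sum_vec_apply[symmetric])
  qed
next
  fix d assume "d \<notin> \<G>"
  then have "cj h x \<noteq> d" if "h \<in> \<G>" for h
    using x that cj_closed[OF that x] by blast
  then show "(orbit_space x d :: 'k vec set) = {0}"
    by (auto simp: orbit_space_def fun_eq_iff)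
qed

end

section \<open>Induced objects of the center and their products\<close>

context graded_setup
begin

text \<open>Converse to the passage from half-braidings to operators. The inverses
  \<open>\<rho>'\<close> are supplied as data, since they give the inverse of the half-braiding at
  every object directly.\<close>

lemma center_obj_exists:
  assumes Z: "Z \<in> GS"
    and lin: "\<And>g. g \<in> \<G> \<Longrightarrow> linear_on UNIV (\<rho> g)" "\<And>g. g \<in> \<G> \<Longrightarrow> linear_on UNIV (\<rho>' g)"
    and mem: "\<And>g d z. \<lbrakk>g \<in> \<G>; d \<in> \<G>; z \<in> Z d\<rbrakk> \<Longrightarrow> \<rho> g z \<in> Z (cj g d)"
      "\<And>g d z. \<lbrakk>g \<in> \<G>; d \<in> \<G>; z \<in> Z d\<rbrakk> \<Longrightarrow> \<rho>' g z \<in> Z (cj (inv g) d)"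
    and inv: "\<And>g d z. \<lbrakk>g \<in> \<G>; d \<in> \<G>; z \<in> Z d\<rbrakk> \<Longrightarrow> \<rho>' g (\<rho> g z) = z"
      "\<And>g d z. \<lbrakk>g \<in> \<G>; d \<in> \<G>; z \<in> Z d\<rbrakk> \<Longrightarrow> \<rho> g (\<rho>' g z) = z"
    and hex: "\<And>g h d z. \<lbrakk>g \<in> \<G>; h \<in> \<G>; d \<in> \<G>; z \<in> Z d\<rbrakk> \<Longrightarrow>
      \<rho> (g \<otimes> h) z = vec_scale (theta d g h) (\<rho> g (\<rho> h z))"
  shows "\<exists>P\<in>CO. fst P = Z \<and> (\<forall>g\<in>\<G>. \<forall>d\<in>\<G>. \<forall>z\<in>Z d. act P g z = \<rho> g z)"
proof -
  have id: "linear_on UNIV (\<lambda>v :: 'k vec. v)" by (simp add: linear_on_def)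
  have ex: "\<exists>f. f \<in> Hom C (gten X Z) (gten Z X) \<and> is_iso C f \<and>
      (\<forall>g\<in>\<G>. \<forall>d\<in>\<G>. \<forall>x\<in>X g. \<forall>z\<in>Z d. ap f (vec_ten x z) = vec_ten (\<rho> g z) x)"
    if X: "X \<in> GS" for X
  proof -
    \<comment> \<open>The half-braiding applies \<open>\<rho> g\<close> to the second factor and
      swaps; the new degrees \<open>cj g d\<close> and \<open>g\<close> again have product
      \<open>g \<otimes> d\<close>.\<close>
    have mf: "vswap (tens (\<lambda>v. v) (\<rho> g) (vec_ten x z)) \<in> gten Z X (g \<otimes> d)"
      if *: "g \<in> \<G>" "d \<in> \<G>" "x \<in> X g" "z \<in> Z d" for g d x z
      using gr_ten_mem[of _ _ "\<rho> g z" Z x X, OF cj_closed[OF *(1,2)] *(1) mem(1)[OF *(1,2,4)] *(3)]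
      by (simp add: tens_vec_ten[OF id lin(1)[OF *(1)]] cj_swap[OF *(1,2)])
    obtain f where f: "f \<in> Hom C (gten X Z) (gten Z X)"
      "\<forall>g\<in>\<G>. \<forall>d\<in>\<G>. \<forall>x\<in>X g. \<forall>z\<in>Z d. ap f (vec_ten x z) = vswap (tens (\<lambda>v. v) (\<rho> g) (vec_ten x z))"
      using ten_hom_exists[OF X Z ten_closed[OF Z X] linear_on_compose[OF maps_linear(1) tens_linear[OF id lin(1)]] mf] by blast
    have fe: "ap f (vec_ten x z) = vec_ten (\<rho> g z) x" if "g \<in> \<G>" "d \<in> \<G>" "x \<in> X g" "z \<in> Z d" for g d x z
      using f(2) that by (simp add: tens_vec_ten[OF id lin(1)[OF that(1)]])
    have mh: "vswap (tens (\<rho>' g) (\<lambda>v. v) (vec_ten z x)) \<in> gten X Z (d \<otimes> g)"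
      if *: "d \<in> \<G>" "g \<in> \<G>" "z \<in> Z d" "x \<in> X g" for d g z x
    proof -
      have i: "inv g \<in> \<G>" "g \<otimes> cj (inv g) d = d \<otimes> g" using * by (simp_all add: cj_def m_assoc)
      show ?thesis
        using gr_ten_mem[of _ _ x X "\<rho>' g z" Z, OF *(2) cj_closed[OF i(1) *(1)] *(4) mem(2)[OF *(2,1,3)]]
        by (simp add: tens_vec_ten[OF lin(2)[OF *(2)] id] i(2))
    qed
    obtain h where h: "h \<in> Hom C (gten Z X) (gten X Z)"
      "\<forall>d\<in>\<G>. \<forall>g\<in>\<G>. \<forall>z\<in>Z d. \<forall>x\<in>X g. ap h (vec_ten z x) = vswap (tens (\<rho>' g) (\<lambda>v. v) (vec_ten z x))"
      using ten_hom_exists[OF Z X ten_closed[OF X Z] linear_on_compose[OF maps_linear(1) tens_linear[OF lin(2) id]] mh] by blast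
    have he: "ap h (vec_ten z x) = vec_ten x (\<rho>' g z)" if "d \<in> \<G>" "g \<in> \<G>" "z \<in> Z d" "x \<in> X g" for d g z x
      using h(2) that by (simp add: tens_vec_ten[OF lin(2)[OF that(2)] id])
    have "is_inverse C f h"
    proof (rule C.is_inverseI[OF f(1) h(1)])
      show "h \<bullet> f = Id C (gten X Z)"
      proof (rule hom_ten_eqI[OF hom_comp[OF f(1) h(1)] id_hom'[OF ten_closed[OF X Z]] X Z])
        fix g d x z assume *: "g \<in> \<G>" "d \<in> \<G>" "x \<in> X g" "z \<in> Z d"
        note t = total_ten[OF X Z hom_total[OF X *(1,3)] hom_total[OF Z *(2,4)]]
        show "ap (h \<bullet> f) (vec_ten x z) = ap (Id C (gten X Z)) (vec_ten x z)"
          unfolding ap_comp[OF f(1) h(1) t] ap_Id[OF t] fe[OF *]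
            he[OF cj_closed[OF *(1,2)] *(1) mem(1)[OF *(1,2,4)] *(3)] inv(1)[OF *(1,2,4)] ..
      qed
      show "f \<bullet> h = Id C (gten Z X)"
      proof (rule hom_ten_eqI[OF hom_comp[OF h(1) f(1)] id_hom'[OF ten_closed[OF Z X]] Z X])
        fix d g z x assume *: "d \<in> \<G>" "g \<in> \<G>" "z \<in> Z d" "x \<in> X g"
        note t = total_ten[OF Z X hom_total[OF Z *(1,3)] hom_total[OF X *(2,4)]]
        have i: "inv g \<in> \<G>" using * by simp
        show "ap (f \<bullet> h) (vec_ten z x) = ap (Id C (gten Z X)) (vec_ten z x)"
          unfolding ap_comp[OF h(1) f(1) t] ap_Id[OF t] he[OF *]
            fe[OF *(2) cj_closed[OF i *(1)] *(4) mem(2)[OF *(2,1,3)]] inv(2)[OF *(2,1,3)] ..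
      qed
    qed
    then have "is_iso C f" by (rule C.is_isoI)
    then show ?thesis
      using f(1) fe by blast
  qed
  define \<gamma> where "\<gamma> = (\<lambda>X\<in>GS. SOME f. f \<in> Hom C (gten X Z) (gten Z X) \<and> is_iso C f \<and>
      (\<forall>g\<in>\<G>. \<forall>d\<in>\<G>. \<forall>x\<in>X g. \<forall>z\<in>Z d. ap f (vec_ten x z) = vec_ten (\<rho> g z) x))"
  have \<gamma>: "\<gamma> X \<in> Hom C (gten X Z) (gten Z X) \<and> is_iso C (\<gamma> X) \<and>
      (\<forall>g\<in>\<G>. \<forall>d\<in>\<G>. \<forall>x\<in>X g. \<forall>z\<in>Z d. ap (\<gamma> X) (vec_ten x z) = vec_ten (\<rho> g z) x)"
    if X: "X \<in> GS" for X
    unfolding \<gamma>_def restrict_apply'[OF X] by (rule someI_ex) (rule ex[OF X])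
  have act: "act (Z, \<gamma>) g z = \<rho> g z" if *: "g \<in> \<G>" "d \<in> \<G>" "z \<in> Z d" for g d z
    by (rule actI) (use \<gamma>[OF delta_closed[OF *(1)]] * vec_unit_delta[of g] in blast)
  have "(Z, \<gamma>) \<in> CO"
  proof (rule center_objsI[OF Z])
    show "\<gamma> \<in> extensional GS" by (simp add: \<gamma>_def)
    show "\<gamma> X \<in> Hom C (gten X Z) (gten Z X)" "is_iso C (\<gamma> X)" if "X \<in> GS" for X
      using \<gamma>[OF that] by (simp_all only:)
    show "ap (\<gamma> X) (vec_ten x z) = vec_ten (act (Z, \<gamma>) g z) x"
      if "X \<in> GS" "g \<in> \<G>" "d \<in> \<G>" "x \<in> X g" "z \<in> Z d" for X g d x z
      unfolding act[OF that(2,3,5)] using \<gamma>[OF that(1)] that(2-) by blast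
    fix g h d z assume *: "g \<in> \<G>" "h \<in> \<G>" "d \<in> \<G>" "z \<in> Z d"
    show "act (Z, \<gamma>) (g \<otimes> h) z = vec_scale (theta d g h) (act (Z, \<gamma>) g (act (Z, \<gamma>) h z))"
      unfolding act[OF *(2-4)] act[OF *(1) cj_closed[OF *(2,3)] mem(1)[OF *(2-4)]] act[OF m_closed[OF *(1,2)] *(3,4)]
      by (rule hex[OF *])
  qed
  then show ?thesis
    using act by (intro bexI[of _ "(Z, \<gamma>)"]) auto
qed

text \<open>The underlying space of \<open>I(x)\<close> has a basis \<open>e\<^sub>h\<close> with \<open>e\<^sub>h\<close> of degree \<open>h x h\<^sup>-\<^sup>1\<close>, and
  \<open>y\<close> sends \<open>e\<^sub>h\<close> to a multiple of \<open>e\<^sub>y\<^sub>h\<close>. The \<open>I(x)\<close> form an algebra graded by \<open>x\<close>, which is used to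
  read off \<open>\<mu>\<close> from a tensor isomorphism of \<open>ind F\<^sub>a\<^sub>,\<^sub>\<mu>\<close> with the identity.\<close>

lemma orbit_obj_exists:
  assumes x: "x \<in> \<G>"
  shows "\<exists>P\<in>CO. fst P = orbit_space x \<and> (\<forall>g\<in>\<G>. \<forall>d\<in>\<G>. \<forall>z\<in>orbit_space x d.
    act P g z = coords (\<lambda>k. z (index (inv g \<otimes> k)) / theta x g (inv g \<otimes> k)))"
proof (rule center_obj_exists[OF orbit_space_closed[OF x],
      where \<rho>' = "\<lambda>g z. coords (\<lambda>k. z (index (g \<otimes> k)) * theta x g k)"])
  let ?\<rho> = "\<lambda>g z. coords (\<lambda>k. z (index (inv g \<otimes> k)) / theta x g (inv g \<otimes> k)) :: 'k vec"
  let ?\<rho>' = "\<lambda>g z. coords (\<lambda>k. z (index (g \<otimes> k)) * theta x g k)"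
  fix g assume g: "g \<in> \<G>"
  show "linear_on UNIV (?\<rho> g)"
    by (rule coords_linear) (metis divide_inverse)
  show "linear_on UNIV (?\<rho>' g)"
    by (rule coords_linear) blast
  fix d and z :: "'k vec" assume d: "d \<in> \<G>" and z: "z \<in> orbit_space x d"
  have 1: "cj k x = cj g d" if "k \<in> \<G>" "z (index (inv g \<otimes> k)) \<noteq> 0" for k
    using orbit_spaceD[OF z _ that(2)] that(1) g x cj_inv(2)[OF g, of "cj k x"] by (simp add: cj_cj)
  then show m: "?\<rho> g z \<in> orbit_space x (cj g d)"
    by (intro coords_mem) auto
  have 2: "cj k x = cj (inv g) d" if "k \<in> \<G>" "z (index (g \<otimes> k)) \<noteq> 0" for k
    using orbit_spaceD[OF z _ that(2)] that(1) g x cj_inv(1)[OF g, of "cj k x"] by (simp add: cj_cj)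
  then show m': "?\<rho>' g z \<in> orbit_space x (cj (inv g) d)"
    by (intro coords_mem) auto
  have "?\<rho>' g (?\<rho> g z) = coords (\<lambda>k. z (index k))"
    by (rule coords_cong) (use g x in simp)
  then show "?\<rho>' g (?\<rho> g z) = z"
    by (simp only: orbit_space_coords[OF z])
  have "?\<rho> g (?\<rho>' g z) = coords (\<lambda>k. z (index k))"
    by (rule coords_cong) (use g x in simp)
  then show "?\<rho> g (?\<rho>' g z) = z"
    by (simp only: orbit_space_coords[OF z])
  fix h assume h: "h \<in> \<G>"
  show "?\<rho> (g \<otimes> h) z = vec_scale (theta d g h) (?\<rho> g (?\<rho> h z))"
    unfolding coords_scale
  proof (rule coords_cong)
    fix k assume k: "k \<in> \<G>"
    define l where "l = inv (g \<otimes> h) \<otimes> k"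
    have l: "l \<in> \<G>" "inv h \<otimes> (inv g \<otimes> k) = l" "inv g \<otimes> k = h \<otimes> l"
      using g h k by (simp_all add: l_def inv_mult_group m_assoc)
    have "z (index l) / theta x (g \<otimes> h) l = theta d g h * (z (index l) / theta x h l / theta x g (h \<otimes> l))"
    \<comment> \<open>Only on the support of \<open>z\<close> is \<open>d\<close> the conjugate of
      \<open>x\<close> by \<open>l\<close>, as \<open>theta_cocycle\<close> requires.\<close>
    proof (cases "z (index l) = 0")
      case False
      have "theta d g h * theta x (g \<otimes> h) l = theta x h l * theta x g (h \<otimes> l)"
        using theta_cocycle[OF x g h l(1)] orbit_spaceD[OF z l(1) False] by (simp add: mult.commute)
      moreover have "theta x (g \<otimes> h) l \<noteq> 0" "theta x h l \<noteq> 0" "theta x g (h \<otimes> l) \<noteq> 0"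
        using x g h l(1) by simp_all
      ultimately show ?thesis
        using False by (simp add: field_simps)
    qed simp
    then show "z (index (inv (g \<otimes> h) \<otimes> k)) / theta x (g \<otimes> h) (inv (g \<otimes> h) \<otimes> k) =
        theta d g h * (coords (\<lambda>k. z (index (inv h \<otimes> k)) / theta x h (inv h \<otimes> k)) (index (inv g \<otimes> k)) / theta x g (inv g \<otimes> k))"
      using g h k l by (simp add: l_def[symmetric])
  qed
qed

definition orbit_obj :: "'a \<Rightarrow> ('a, 'k) grspace \<times> (('a, 'k) grspace \<Rightarrow> ('a, 'k) grmap)" where
  "orbit_obj x = (SOME P. P \<in> CO \<and> fst P = orbit_space x \<and> (\<forall>g\<in>\<G>. \<forall>d\<in>\<G>. \<forall>z\<in>orbit_space x d.
    act P g z = coords (\<lambda>k. z (index (inv g \<otimes> k)) / theta x g (inv g \<otimes> k))))"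

lemma orbit_obj:
  assumes x: "x \<in> \<G>"
  shows "orbit_obj x \<in> CO" "fst (orbit_obj x) = orbit_space x"
    and "\<lbrakk>g \<in> \<G>; d \<in> \<G>; z \<in> orbit_space x d\<rbrakk> \<Longrightarrow>
      act (orbit_obj x) g z = coords (\<lambda>k. z (index (inv g \<otimes> k)) / theta x g (inv g \<otimes> k))"
proof -
  have *: "orbit_obj x \<in> CO \<and> fst (orbit_obj x) = orbit_space x \<and> (\<forall>g\<in>\<G>. \<forall>d\<in>\<G>. \<forall>z\<in>orbit_space x d.
    act (orbit_obj x) g z = coords (\<lambda>k. z (index (inv g \<otimes> k)) / theta x g (inv g \<otimes> k)))"
    unfolding orbit_obj_def by (rule someI_ex) (rule orbit_obj_exists[OF x, unfolded Bex_def])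
  show "orbit_obj x \<in> CO" "fst (orbit_obj x) = orbit_space x"
    using * by (simp_all only:)
  assume "g \<in> \<G>" "d \<in> \<G>" "z \<in> orbit_space x d"
  then show "act (orbit_obj x) g z = coords (\<lambda>k. z (index (inv g \<otimes> k)) / theta x g (inv g \<otimes> k))"
    using *[THEN conjunct2, THEN conjunct2] by blast
qed

text \<open>Pointwise multiplication of functions on the group, weighted at \<open>k\<close> by the
  inverse of \<open>kappa k x y\<close>. Degrees multiply because conjugation by \<open>k\<close> is
  a homomorphism, and \<open>kappa_theta\<close> makes the map an arrow of the center.\<close>

lemma orbit_mult_exists:
  assumes x: "x \<in> \<G>" and y: "y \<in> \<G>"
  shows "\<exists>m. (cten (orbit_obj x) (orbit_obj y), m, orbit_obj (x \<otimes> y)) \<in> CA \<and>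
    (\<forall>a\<in>\<G>. \<forall>b\<in>\<G>. \<forall>v\<in>orbit_space x a. \<forall>w\<in>orbit_space y b.
      ap m (vec_ten v w) = coords (\<lambda>k. v (index k) * w (index k) / kappa k x y))"
proof -
  have xy: "x \<otimes> y \<in> \<G>" using x y by simp
  note X = orbit_space_closed[OF x, where 'k = 'k] and Y = orbit_space_closed[OF y, where 'k = 'k]
    and XY = orbit_space_closed[OF xy, where 'k = 'k]
  \<comment> \<open>Only diagonal entries are read, which on pure tensors are the pointwise
    products.\<close>
  let ?F = "\<lambda>t. coords (\<lambda>k. t (prod_encode (index k, index k)) / kappa k x y) :: 'k vec"
  have "\<exists>m\<in>Hom C (gten (orbit_space x) (orbit_space y)) (orbit_space (x \<otimes> y)).
      \<forall>a\<in>\<G>. \<forall>b\<in>\<G>. \<forall>v\<in>orbit_space x a. \<forall>w\<in>orbit_space y b. ap m (vec_ten v w) = ?F (vec_ten v w)"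
  proof (rule ten_hom_exists[OF X Y XY])
    show "linear_on UNIV ?F"
      by (rule coords_linear) (metis divide_inverse)
    fix a b and v w :: "'k vec" assume *: "a \<in> \<G>" "b \<in> \<G>" "v \<in> orbit_space x a" "w \<in> orbit_space y b"
    show "?F (vec_ten v w) \<in> orbit_space (x \<otimes> y) (a \<otimes> b)"
    proof (rule coords_mem)
      fix k assume k: "k \<in> \<G>" and "vec_ten v w (prod_encode (index k, index k)) / kappa k x y \<noteq> 0"
      then have "v (index k) \<noteq> 0" "w (index k) \<noteq> 0" by simp_all
      then show "cj k (x \<otimes> y) = a \<otimes> b"
        using orbit_spaceD[OF *(3) k] orbit_spaceD[OF *(4) k] x y k by (simp add: cj_mult)
    qed
  qed
  then obtain m where m: "m \<in> Hom C (gten (orbit_space x) (orbit_space y)) (orbit_space (x \<otimes> y))"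
    "\<And>a b v w. \<lbrakk>a \<in> \<G>; b \<in> \<G>; v \<in> orbit_space x a; w \<in> orbit_space y b\<rbrakk> \<Longrightarrow>
      ap m (vec_ten v w) = coords (\<lambda>k. v (index k) * w (index k) / kappa k x y)"
    by auto
  have "(cten (orbit_obj x) (orbit_obj y), m, orbit_obj (x \<otimes> y)) \<in> CA"
  proof (rule center_arrs_tenI[OF orbit_obj(1)[OF x] orbit_obj(1)[OF y] orbit_obj(1)[OF xy]])
    show "m \<in> Hom C (gten (fst (orbit_obj x)) (fst (orbit_obj y))) (fst (orbit_obj (x \<otimes> y)))"
      using m(1) by (simp add: orbit_obj(2) x y)
    fix g a b v w assume *: "g \<in> \<G>" "a \<in> \<G>" "b \<in> \<G>" "v \<in> fst (orbit_obj x) a" "w \<in> fst (orbit_obj y) b"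
    note v = *(4)[unfolded orbit_obj(2)[OF x]] and w = *(5)[unfolded orbit_obj(2)[OF y]]
    note gv = act_mem[OF orbit_obj(1)[OF x] *(1,2,4), unfolded orbit_obj(2)[OF x]]
      and gw = act_mem[OF orbit_obj(1)[OF y] *(1,3,5), unfolded orbit_obj(2)[OF y]]
    have c: "cj g a \<in> \<G>" "cj g b \<in> \<G>" "a \<otimes> b \<in> \<G>" using * by simp_all
    have mvw: "ap m (vec_ten v w) \<in> orbit_space (x \<otimes> y) (a \<otimes> b)"
      by (rule homD(6)[OF m(1) c(3)]) (rule gr_ten_mem[of a b v "orbit_space x" w "orbit_space y", OF *(2,3) v w])
    show "vec_scale (kappa g a b) (ap m (vec_ten (act (orbit_obj x) g v) (act (orbit_obj y) g w))) =
        act (orbit_obj (x \<otimes> y)) g (ap m (vec_ten v w))"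
      unfolding m(2)[OF c(1,2) gv gw] orbit_obj(3)[OF xy *(1) c(3) mvw]
      unfolding m(2)[OF *(2,3) v w] orbit_obj(3)[OF x *(1,2) v] orbit_obj(3)[OF y *(1,3) w] coords_scale
    proof (rule coords_cong)
      fix k assume k: "k \<in> \<G>"
      define l where "l = inv g \<otimes> k"
      have l: "l \<in> \<G>" "k = g \<otimes> l" using *(1) k by (simp_all add: l_def)
      have "kappa g a b * (v (index l) / theta x g l * (w (index l) / theta y g l) / kappa k x y) =
          v (index l) * w (index l) / kappa l x y / theta (x \<otimes> y) g l"
      proof (cases "v (index l) = 0 \<or> w (index l) = 0")
        case False
        then have "a = cj l x" "b = cj l y"
          using orbit_spaceD[OF v l(1)] orbit_spaceD[OF w l(1)] by simp_all
        then have "kappa g a b * kappa l x y * theta (x \<otimes> y) g l = kappa k x y * theta x g l * theta y g l"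
          using kappa_theta[OF x y *(1) l(1)] by (simp add: l(2))
        moreover have "kappa l x y \<noteq> 0" "theta (x \<otimes> y) g l \<noteq> 0" "kappa k x y \<noteq> 0" "theta x g l \<noteq> 0" "theta y g l \<noteq> 0"
          using x y *(1) l(1) k by simp_all
        ultimately show ?thesis
          by (simp add: field_simps)
      qed auto
      then show "kappa g a b * (coords (\<lambda>k. v (index (inv g \<otimes> k)) / theta x g (inv g \<otimes> k)) (index k) *
          coords (\<lambda>k. w (index (inv g \<otimes> k)) / theta y g (inv g \<otimes> k)) (index k) / kappa k x y) =
        coords (\<lambda>k. v (index k) * w (index k) / kappa k x y) (index (inv g \<otimes> k)) / theta (x \<otimes> y) g (inv g \<otimes> k)"
        using k l(1) by (simp add: l_def[symmetric])
    qed
  qed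
  then show ?thesis
    using m(2) by blast
qed

text \<open>The group element \<open>x\<close> acts on the unit object of the center by the inverse
  of this scalar, which is 1 when \<omega> is normalised.\<close>

definition unit_scalar :: "'a \<Rightarrow> 'k" where
  "unit_scalar x = \<omega> x \<one> \<one> * \<omega> \<one> \<one> x"

lemma unit_scalar_nonzero: "x \<in> \<G> \<Longrightarrow> unit_scalar x \<noteq> 0"
  by (simp add: unit_scalar_def)

text \<open>The unit of the group contributes only a coboundary, so its factor can be moved into the
  cochain \<nu> when the isomorphism is evaluated at basis vectors belonging to the unit.\<close>

lemma kappa_one:
  assumes "x \<in> \<G>" "y \<in> \<G>"
  shows "kappa \<one> x y = unit_scalar (x \<otimes> y) / (unit_scalar x * unit_scalar y)"
  unfolding kappa_def unit_scalar_def cj_one(1)[OF assms(1)] cj_one(1)[OF assms(2)] omega_unit(1)[OF assms]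
    omega_unit(2)[OF assms] omega_unit(3)[OF assms]
  using assms by (simp add: field_simps)

text \<open>The isomorphism at \<open>I(x)\<close> is tested on the basis vector at the unit. The
  degree of its image determines \<open>a\<close>, and naturality with respect to the products
  determines \<mu>.\<close>

lemma trivial_ind_imp_inner:
  assumes p: "pair a \<mu>" and iso: "tensor_functor_iso D D (ind C (FF a \<mu>)) (id_tensor_functor D)"
  shows "\<exists>s \<nu>. s \<in> \<G> \<and> a = inner s \<and> (\<forall>x\<in>\<G>. \<nu> x \<noteq> 0) \<and>
    (\<forall>x\<in>\<G>. \<forall>y\<in>\<G>. \<mu> x y = \<nu> x * \<nu> y / (\<nu> (x \<otimes> y) * kappa s x y))"
proof -
  let ?F = "FF a \<mu>"
  note a = pairD(1)[OF p]
  obtain \<eta> where \<eta>: "\<And>P. P \<in> CO \<Longrightarrow> \<eta> P \<in> Hom D (indo ?F P) P \<and> is_iso D (\<eta> P)"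
    "\<And>P Q f. f \<in> Hom D P Q \<Longrightarrow> \<eta> Q \<cdot>\<^bsub>D\<^esub> FA (ind C ?F) f = f \<cdot>\<^bsub>D\<^esub> \<eta> P"
    "\<And>P Q. P \<in> CO \<Longrightarrow> Q \<in> CO \<Longrightarrow>
      \<eta> (cten P Q) \<cdot>\<^bsub>D\<^esub> FJ (ind C ?F) P Q = Id D (cten P Q) \<cdot>\<^bsub>D\<^esub> (\<eta> P \<boxdot>\<^bsub>D\<^esub> \<eta> Q)"
  proof -
    obtain \<eta> where n: "is_nat_iso D D (ind C ?F) (id_tensor_functor D) \<eta>"
      "\<forall>P\<in>Obj D. \<forall>Q\<in>Obj D. \<eta> (P \<boxtimes>\<^bsub>D\<^esub> Q) \<cdot>\<^bsub>D\<^esub> FJ (ind C ?F) P Q = FJ (id_tensor_functor D) P Q \<cdot>\<^bsub>D\<^esub> (\<eta> P \<boxdot>\<^bsub>D\<^esub> \<eta> Q)"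
      using iso unfolding tensor_functor_iso_def by (elim exE conjE)
    show ?thesis
    proof (rule that)
      show "\<eta> P \<in> Hom D (indo ?F P) P \<and> is_iso D (\<eta> P)" if "P \<in> CO" for P
        using n(1) that unfolding is_nat_iso_def by (simp add: ind_simps id_tensor_functor_def)
      show "\<eta> (cten P Q) \<cdot>\<^bsub>D\<^esub> FJ (ind C ?F) P Q = Id D (cten P Q) \<cdot>\<^bsub>D\<^esub> (\<eta> P \<boxdot>\<^bsub>D\<^esub> \<eta> Q)"
        if "P \<in> CO" "Q \<in> CO" for P Q
        using bspec[OF bspec[OF n(2)], of P Q] that by (simp add: id_tensor_functor_def)
      show "\<eta> Q \<cdot>\<^bsub>D\<^esub> FA (ind C ?F) f = f \<cdot>\<^bsub>D\<^esub> \<eta> P" if f: "f \<in> Hom D P Q" for P Q f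
      proof -
        have "P \<in> Obj D" "Q \<in> Obj D" using D.hom_obj[OF f] by simp_all
        then show ?thesis
          using n(1) f unfolding is_nat_iso_def by (simp add: id_tensor_functor_def)
      qed
    qed
  qed
  define f where "f P = fst (snd (\<eta> P))" for P
  have ee: "\<eta> P = (indo ?F P, f P, P)" and arr: "(indo ?F P, f P, P) \<in> CA" if "P \<in> CO" for P
    using \<eta>(1)[OF that] unfolding D_hom_iff f_def by auto
  have fh: "f P \<in> Hom C (shift a (fst P)) (fst P)" if "P \<in> CO" for P
    using C.center_arrsD(3)[OF arr[OF that]] by (simp add: C.ind_obj_fst)
  have nat: "f Q \<bullet> FA ?F m = m \<bullet> f P" if "(P, m, Q) \<in> CA" for P Q m
  proof -
    have "(P, m, Q) \<in> Hom D P Q"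
      using that by (simp add: D_hom_iff)
    from \<eta>(2)[OF this] show ?thesis
      by (simp add: ind_simps ee C.center_arrsD(1,2)[OF that])
  qed
  have ten: "f (cten P Q) \<bullet> FJ ?F (fst P) (fst Q) = f P \<odot> f Q" if P: "P \<in> CO" and Q: "Q \<in> CO" for P Q
  proof -
    have id: "Id C (gten (fst P) (fst Q)) \<bullet> (f P \<odot> f Q) = f P \<odot> f Q"
      by (rule C.id_left[OF ten_in_hom[OF fh[OF P] fh[OF Q]]])
    show ?thesis
      using \<eta>(3)[OF P Q] by (simp add: ind_simps ee P Q center_ten_closed id)
  qed
  \<comment> \<open>The same sequence has degree \<open>x\<close> in every \<open>I(x)\<close>, and
    the product of two copies of it is a multiple of it.\<close>
  define e where "e = (coords (\<lambda>k. if k = \<one> then 1 else 0) :: 'k vec)"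
  have e: "e \<in> orbit_space x x" if "x \<in> \<G>" for x
    unfolding e_def by (rule coords_mem) (use that in \<open>auto split: if_splits\<close>)
  have e1: "e (index k) = (if k = \<one> then 1 else 0)" if "k \<in> \<G>" for k
    using that by (simp add: e_def)
  note O = orbit_space_closed[where 'k = 'k]
  note fo = fh[OF orbit_obj(1), unfolded orbit_obj(2)]
  define c where "c x k = ap (f (orbit_obj x)) e (index k)" for x k
  have re: "e \<in> shift a (orbit_space x) (a x)" if "x \<in> \<G>" for x
    by (rule regrade_mem[of a x e "orbit_space x", OF a that e[OF that]])
  have fmem: "ap (f (orbit_obj x)) e \<in> orbit_space x (a x)" if x: "x \<in> \<G>" for x
    by (rule homD(6)[OF fh[OF orbit_obj(1)[OF x], unfolded orbit_obj(2)[OF x]] autoD(1)[OF a x] re[OF x]])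
  \<comment> \<open>The image of \<open>e\<close> has degree \<open>a x\<close>, so the basis vector
    at \<open>k\<close> can occur in it only if its own degree \<open>cj k x\<close> is
    \<open>a x\<close>.\<close>
  have deg: "cj k x = a x" if "x \<in> \<G>" "k \<in> \<G>" "c x k \<noteq> 0" for x k
    using orbit_spaceD[OF fmem[OF that(1)] that(2)] that(3) by (simp add: c_def)
  \<comment> \<open>Two ways to map a product of generators: multiply and then apply the isomorphism
    on the left, apply it to both and then multiply on the right. The factor \<mu> comes from the
    tensor structure of the induced functor, the values of \<open>kappa\<close> from the
    products.\<close>
  have rel: "\<mu> x y / kappa \<one> x y * c (x \<otimes> y) k = c x k * c y k / kappa k x y"
    if x: "x \<in> \<G>" and y: "y \<in> \<G>" and k: "k \<in> \<G>" for x y k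
  proof -
    have xy: "x \<otimes> y \<in> \<G>" using x y by simp
    let ?P = "orbit_obj x" and ?Q = "orbit_obj y" and ?R = "orbit_obj (x \<otimes> y)"
    let ?T = "gten (orbit_space x) (orbit_space y)"
    note P = orbit_obj(1)[OF x] and Q = orbit_obj(1)[OF y] and R = orbit_obj(1)[OF xy]
    note fP = orbit_obj(2)[OF x] and fQ = orbit_obj(2)[OF y] and fR = orbit_obj(2)[OF xy]
    obtain m where m: "(cten ?P ?Q, m, ?R) \<in> CA"
      "\<forall>a\<in>\<G>. \<forall>b\<in>\<G>. \<forall>v\<in>orbit_space x a. \<forall>w\<in>orbit_space y b.
        ap m (vec_ten v w) = coords (\<lambda>k. v (index k) * w (index k) / kappa k x y)"
      using orbit_mult_exists[OF x y] by blast
    have mh: "m \<in> Hom C ?T (orbit_space (x \<otimes> y))"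
      using C.center_arrsD(3)[OF m(1)] by (simp add: fP fQ fR)
    note Fm = FA_hom[OF a mh, of \<mu>]
    note J = FJ_props[OF p O[OF x] O[OF y]]
    note hP = fh[OF P, unfolded fP] and hQ = fh[OF Q, unfolded fQ] and hR = fh[OF R, unfolded fR]
    have hT: "f (cten ?P ?Q) \<in> Hom C (shift a ?T) ?T"
      using fh[OF center_ten_closed[OF P Q]] by (simp add: fP fQ)
    note t = hom_total[OF O[OF x] x e[OF x]] hom_total[OF O[OF y] y e[OF y]]
    have rt: "e \<in> tot (shift a (orbit_space x))" "e \<in> tot (shift a (orbit_space y))"
      using t by (simp_all add: regrade_total[OF a])
    note eT = total_ten[OF regrade_closed[OF a O[OF x]] regrade_closed[OF a O[OF y]] rt]
    have eT': "vec_ten e e \<in> tot (shift a ?T)"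
      using eT by (simp add: regrade_ten[OF a])
    have me: "ap m (vec_ten e e) = vec_scale (1 / kappa \<one> x y) e"
    proof -
      have "ap m (vec_ten e e) = coords (\<lambda>k. e (index k) * e (index k) / kappa k x y)"
        using m(2) x y e[OF x] e[OF y] by blast
      also have "\<dots> = coords (\<lambda>k. 1 / kappa \<one> x y * (if k = \<one> then 1 else 0))"
        by (rule coords_cong) (simp add: e1)
      finally show ?thesis
        by (simp only: e_def coords_scale)
    qed
    have eR: "e \<in> tot (shift a (orbit_space (x \<otimes> y)))"
      using hom_total[OF O[OF xy] xy e[OF xy]] by (simp add: regrade_total[OF a])
    have "ap (m \<bullet> f (cten ?P ?Q)) (ap (FJ ?F (orbit_space x) (orbit_space y)) (vec_ten e e)) =
        ap m (ap (f (cten ?P ?Q)) (ap (FJ ?F (orbit_space x) (orbit_space y)) (vec_ten e e)))"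
      by (rule ap_comp[OF hT mh ap_total[OF J(1) eT]])
    also have "\<dots> = ap m (ap (f (cten ?P ?Q) \<bullet> FJ ?F (orbit_space x) (orbit_space y)) (vec_ten e e))"
      by (simp only: ap_comp[OF J(1) hT eT])
    also have "f (cten ?P ?Q) \<bullet> FJ ?F (orbit_space x) (orbit_space y) = f ?P \<odot> f ?Q"
      using ten[OF P Q] by (simp only: fP fQ)
    also have "ap (f ?P \<odot> f ?Q) (vec_ten e e) = vec_ten (ap (f ?P) e) (ap (f ?Q) e)"
      by (rule ap_ten[OF hP hQ rt])
    also have "ap m (vec_ten (ap (f ?P) e) (ap (f ?Q) e)) = coords (\<lambda>k. ap (f ?P) e (index k) * ap (f ?Q) e (index k) / kappa k x y)"
      using m(2) autoD(1)[OF a x] autoD(1)[OF a y] fmem[OF x] fmem[OF y] by blast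
    finally have A: "ap (m \<bullet> f (cten ?P ?Q)) (ap (FJ ?F (orbit_space x) (orbit_space y)) (vec_ten e e)) =
        coords (\<lambda>k. c x k * c y k / kappa k x y)"
      by (simp only: c_def)
    have "ap (f ?R \<bullet> FA ?F m) (ap (FJ ?F (orbit_space x) (orbit_space y)) (vec_ten e e)) =
        ap (f ?R) (vec_scale (\<mu> x y) (vec_scale (1 / kappa \<one> x y) e))"
      by (simp only: J(2)[OF x y e[OF x] e[OF y]] ap_scale[OF hom_comp[OF Fm(1) hR] eT'] ap_comp[OF Fm(1) hR eT'] Fm(2) me
          ap_scale[OF hR eR] vec_scale_vec_scale)
    also have "\<dots> = vec_scale (\<mu> x y / kappa \<one> x y) (ap (f ?R) e)"
      by (simp add: ap_scale[OF hR eR])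
    finally have "vec_scale (\<mu> x y / kappa \<one> x y) (ap (f ?R) e) = coords (\<lambda>k. c x k * c y k / kappa k x y)"
      using A nat[OF m(1)] by simp
    then have "vec_scale (\<mu> x y / kappa \<one> x y) (ap (f ?R) e) (index k) = coords (\<lambda>k. c x k * c y k / kappa k x y) (index k)"
      by simp
    then show ?thesis
      using k by (simp add: c_def)
  qed
  \<comment> \<open>Otherwise the isomorphism at \<open>I(\<one>)\<close> would send the nonzero
    vector \<open>e\<close> to zero.\<close>
  have "\<exists>s\<in>\<G>. c \<one> s \<noteq> 0"
  proof (rule ccontr)
    assume "\<not> ?thesis"
    then have z: "ap (f (orbit_obj \<one>)) e (index k) = 0 (index k)" if "k \<in> \<G>" for k
      using that by (simp add: c_def)
    note P = orbit_obj(1)[OF one_closed]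
    note h = fh[OF P, unfolded orbit_obj(2)[OF one_closed]]
    have "ap (f (orbit_obj \<one>)) e = 0"
      by (rule orbit_space_eqI[OF fmem[OF one_closed] gradedD(5)[OF O[OF one_closed], of \<one>] z])
    moreover obtain h' where h': "(orbit_obj \<one>, h', indo ?F (orbit_obj \<one>)) \<in> CA"
      "h' \<bullet> f (orbit_obj \<one>) = Id C (shift a (orbit_space \<one>))"
    proof -
      obtain g where "is_inverse D (indo ?F (orbit_obj \<one>), f (orbit_obj \<one>), orbit_obj \<one>) g"
        using \<eta>(1)[OF P] unfolding is_iso_def ee[OF P] by blast
      then have g: "g \<in> Hom D (orbit_obj \<one>) (indo ?F (orbit_obj \<one>))"
        "g \<cdot>\<^bsub>D\<^esub> (indo ?F (orbit_obj \<one>), f (orbit_obj \<one>), orbit_obj \<one>) = Id D (indo ?F (orbit_obj \<one>))"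
        unfolding is_inverse_def by simp_all
      obtain h' where "g = (orbit_obj \<one>, h', indo ?F (orbit_obj \<one>))" "(orbit_obj \<one>, h', indo ?F (orbit_obj \<one>)) \<in> CA"
        using g(1) unfolding D_hom_iff by blast
      then show ?thesis
        using that[of h'] g(2) by (simp add: C.ind_obj_fst orbit_obj(2))
    qed
    have hh: "h' \<in> Hom C (orbit_space \<one>) (shift a (orbit_space \<one>))"
      using C.center_arrsD(3)[OF h'(1)] by (simp add: C.ind_obj_fst orbit_obj(2))
    have et: "e \<in> tot (shift a (orbit_space \<one>))"
      using hom_total[OF O[OF one_closed] one_closed e[OF one_closed]] by (simp add: regrade_total[OF a])
    have "ap h' (ap (f (orbit_obj \<one>)) e) = e"
      using arg_cong[OF h'(2), of "\<lambda>q. ap q e"] by (simp only: ap_comp[OF h hh et] ap_Id[OF et])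
    moreover have "ap h' 0 = 0"
      by (rule linear_on_zero[OF homD(5)[OF hh] total_subspace[OF O[OF one_closed]]])
    ultimately have "e = 0"
      by simp
    then show False
      using e1[of \<one>] by simp
  qed
  then obtain s where s: "s \<in> \<G>" "c \<one> s \<noteq> 0" by blast
  \<comment> \<open>For \<open>y\<close> the inverse of \<open>x\<close> the left side of
    \<open>rel\<close> is a nonzero multiple of \<open>c \<one> s\<close>, so neither factor on the
    right vanishes.\<close>
  have cs: "c x s \<noteq> 0" if x: "x \<in> \<G>" for x
  proof -
    have "\<mu> x (inv x) / kappa \<one> x (inv x) * c \<one> s = c x s * c (inv x) s / kappa s x (inv x)"
      using rel[OF x inv_closed[OF x] s(1)] x by simp
    moreover have "\<mu> x (inv x) \<noteq> 0" "kappa \<one> x (inv x) \<noteq> 0"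
      using pairD(2)[OF p x inv_closed[OF x]] x by simp_all
    ultimately show ?thesis
      using s(2) by auto
  qed
  have as: "a = inner s"
    unfolding auto_eq_iff[OF a inner_auto[OF s(1)]] using deg[OF _ s(1) cs] by simp
  let ?u = unit_scalar
  note u = unit_scalar_nonzero
  \<comment> \<open>Expressing \<open>kappa \<one>\<close> in \<open>rel\<close> through
    \<open>unit_scalar\<close> and distributing it over the three coefficients yields the cochain
    \<nu>.\<close>
  have "\<mu> x y = c x s / ?u x * (c y s / ?u y) / (c (x \<otimes> y) s / ?u (x \<otimes> y) * kappa s x y)"
    if x: "x \<in> \<G>" and y: "y \<in> \<G>" for x y
  proof -
    note k1 = kappa_one[OF x y]
    have nz: "?u x \<noteq> 0" "?u y \<noteq> 0" "?u (x \<otimes> y) \<noteq> 0" "kappa s x y \<noteq> 0" "c (x \<otimes> y) s \<noteq> 0"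
      using x y s(1) u cs by simp_all
    show ?thesis
      using rel[OF x y s(1)] nz unfolding k1 by (simp add: field_simps)
  qed
  then show ?thesis
    by (intro exI[of _ s] exI[of _ "\<lambda>x. c x s / ?u x"]) (use s(1) as cs u in simp)
qed

end

section \<open>The exact sequence\<close>

context graded_setup
begin

abbreviation "\<I> \<equiv> I_group G \<omega>"

abbreviation "\<S> \<equiv> Stab G \<omega>"

abbreviation "\<O> \<equiv> OutStab G \<omega>"

definition cls where
  "cls a \<mu> = braided_iso_rel D `` {ind C (FF a \<mu>)}"

lemma cls_mult:
  assumes p: "pair a \<mu>" and q: "pair b \<nu>"
  shows "cls a \<mu> \<otimes>\<^bsub>Aut_braided D\<^esub> cls b \<nu> = cls (compose \<G> a b) (pmul b \<mu> \<nu>)"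
proof -
  note i = ind_autoeq[OF pair_mult[OF p q]] and A = ind_comp_agree[OF p q]
  show ?thesis
    unfolding cls_def D.Aut_braided_mult[OF ind_autoeq[OF p] ind_autoeq[OF q] D.agree_braided_autoeqs[OF A i]]
    by (rule D.agree_braided_class[OF A i])
qed

lemma cls_one: "\<one>\<^bsub>Aut_braided D\<^esub> = cls (\<lambda>x\<in>\<G>. x) (\<lambda>x y. 1)"
  unfolding cls_def Aut_braided_def quotient_group_def
  using D.agree_braided_class[OF ind_id_agree ind_autoeq[OF pair_one]] by simp

lemma ind_class_F_class:
  assumes p: "pair a \<mu>"
  shows "ind_class C (F_class G \<omega> a \<mu>) = cls a \<mu>"
proof -
  let ?F = "FF a \<mu>"
  let ?R = "braided_iso_rel D"
  note eq = D.equiv_braided_iso_rel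
  have F: "is_tensor_functor C C ?F" "is_equivalence C C ?F"
    by (rule FF_tensor_functor[OF p], rule FF_equivalence[OF pairD(1)[OF p]])
  have "?F \<in> F_class G \<omega> a \<mu>"
    unfolding F_class_def tensor_iso_rel_def using FF_autoeq[OF p] C.tensor_functor_iso_refl[OF F(1)] by simp
  then have "cls a \<mu> \<subseteq> ind_class C (F_class G \<omega> a \<mu>)"
    unfolding cls_def ind_class_def by blast
  moreover have "K \<in> cls a \<mu>" if K0: "K \<in> ind_class C (F_class G \<omega> a \<mu>)" for K
  proof -
    obtain H where H: "(?F, H) \<in> tensor_iso_rel C" and K: "(ind C H, K) \<in> ?R"
      using K0 unfolding ind_class_def F_class_def by auto
    have H': "is_tensor_functor C C H" "is_equivalence C C H" "tensor_functor_iso C C ?F H"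
      using H unfolding tensor_iso_rel_def tensor_autoeqs_def by simp_all
    have iH: "ind C H \<in> braided_autoeqs D"
      using K unfolding braided_iso_rel_def by simp
    \<comment> \<open>For an arbitrary representative \<open>H\<close> this is drawn from membership
      in \<open>braided_iso_rel\<close>, which contains that \<open>ind C H\<close> is a braided
      autoequivalence; other representatives contribute nothing to the class.\<close>
    have "indo H P \<in> CO" if "P \<in> CO" for P
      using D.tensor_functorD(2)[OF D.braided_autoeqs_tensor[OF iH], of P] that by (simp add: ind_simps)
    from C.tensor_functor_iso_ind[OF F H' ind_obj_closed[OF p] this center_ten_closed]
    have "(ind C ?F, ind C H) \<in> ?R"
      unfolding braided_iso_rel_def using ind_autoeq[OF p] iH by simp
    then show ?thesis
      unfolding cls_def using K eq by (meson Image_singleton_iff equivE transE)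
  qed
  ultimately show ?thesis
    by blast
qed

text \<open>By the classification of tensor autoequivalences every class has a representative
  \<open>F\<^sub>a\<^sub>,\<^sub>\<mu>\<close>.\<close>

lemma carrier_I_group: "carrier \<I> = {cls a \<mu> | a \<mu>. pair a \<mu>}"
proof -
  have F: "F_class G \<omega> a \<mu> \<in> tensor_autoeqs C // tensor_iso_rel C" if "pair a \<mu>" for a \<mu>
    unfolding F_class_def by (rule quotientI[OF FF_autoeq[OF that]])
  moreover have "\<exists>a \<mu>. pair a \<mu> \<and> tensor_iso_rel C `` {\<alpha>} = F_class G \<omega> a \<mu>" if \<alpha>: "\<alpha> \<in> tensor_autoeqs C" for \<alpha>
  proof -
    obtain a \<mu> where p: "pair a \<mu>" and i: "tensor_functor_iso C C (FF a \<mu>) \<alpha>"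
      using tensor_autoeq_classification[OF \<alpha>] by blast
    note T = FF_tensor_functor[OF p]
    have T': "is_tensor_functor C C H" if "H \<in> tensor_autoeqs C" for H
      using that by (simp add: tensor_autoeqs_def)
    note j = C.tensor_functor_iso_sym[OF T T'[OF \<alpha>] i]
    have "tensor_functor_iso C C \<alpha> H \<longleftrightarrow> tensor_functor_iso C C (FF a \<mu>) H" if "H \<in> tensor_autoeqs C" for H
      using C.tensor_functor_iso_trans[OF T T'[OF \<alpha>] T'[OF that] i] C.tensor_functor_iso_trans[OF T'[OF \<alpha>] T T'[OF that] j] by iprover
    then have "tensor_iso_rel C `` {\<alpha>} = F_class G \<omega> a \<mu>"
      unfolding F_class_def tensor_iso_rel_def using FF_autoeq[OF p] \<alpha> by auto
    then show ?thesis
      using p by blast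
  qed
  ultimately have "tensor_autoeqs C // tensor_iso_rel C = {F_class G \<omega> a \<mu> | a \<mu>. pair a \<mu>}"
    unfolding quotient_def by blast
  then have carrier: "carrier \<I> = ind_class C ` {F_class G \<omega> a \<mu> | a \<mu>. pair a \<mu>}"
    unfolding ind_image_def Aut_tensor_def quotient_group_def by simp
  show ?thesis
    unfolding carrier
  proof (intro equalityI subsetI)
    fix \<xi> assume "\<xi> \<in> ind_class C ` {F_class G \<omega> a \<mu> | a \<mu>. pair a \<mu>}"
    then obtain a \<mu> where p: "pair a \<mu>" and "\<xi> = ind_class C (F_class G \<omega> a \<mu>)"
      by (elim imageE CollectE exE conjE) simp
    then have "\<xi> = cls a \<mu>"
      by (simp only: ind_class_F_class)
    then show "\<xi> \<in> {cls a \<mu> | a \<mu>. pair a \<mu>}"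
      using p by (intro CollectI exI conjI)
  next
    fix \<xi> assume "\<xi> \<in> {cls a \<mu> | a \<mu>. pair a \<mu>}"
    then obtain a \<mu> where p: "pair a \<mu>" and \<xi>: "\<xi> = cls a \<mu>"
      by (elim CollectE exE conjE) simp
    show "\<xi> \<in> ind_class C ` {F_class G \<omega> a \<mu> | a \<mu>. pair a \<mu>}"
    proof (rule image_eqI)
      show "\<xi> = ind_class C (F_class G \<omega> a \<mu>)"
        by (simp only: \<xi> ind_class_F_class[OF p])
      show "F_class G \<omega> a \<mu> \<in> {F_class G \<omega> a \<mu> | a \<mu>. pair a \<mu>}"
        using p by (intro CollectI exI conjI) (rule refl)
    qed
  qed
qed

lemma cls_closed: "pair a \<mu> \<Longrightarrow> cls a \<mu> \<in> carrier \<I>"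
  unfolding carrier_I_group by blast

lemma I_group_mult:
  assumes "pair a \<mu>" "pair b \<nu>"
  shows "cls a \<mu> \<otimes>\<^bsub>\<I>\<^esub> cls b \<nu> = cls (compose \<G> a b) (pmul b \<mu> \<nu>)"
  using cls_mult[OF assms] by (simp add: ind_image_def)

lemma I_group_one: "\<one>\<^bsub>\<I>\<^esub> = cls (\<lambda>x\<in>\<G>. x) (\<lambda>x y. 1)"
  using cls_one by (simp add: ind_image_def)

lemma compose_id_auto:
  assumes "a \<in> auto G"
  shows "compose \<G> (\<lambda>x\<in>\<G>. x) a = a" "compose \<G> a (\<lambda>x\<in>\<G>. x) = a"
  using autoD[OF assms] by (auto simp: compose_def restrict_def extensional_def)

lemma pmul_one:
  assumes "pair a \<mu>"
  shows "pmul a (\<lambda>x y. 1) \<mu> = \<mu>" "pmul (\<lambda>x\<in>\<G>. x) \<mu> (\<lambda>x y. 1) = \<mu>"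
  using pairD(4)[OF assms] by (auto simp: pmul_def fun_eq_iff)

lemma I_group_inv:
  assumes p: "pair a \<mu>"
  shows "cls (inv_auto a) (pinv a \<mu>) \<otimes>\<^bsub>\<I>\<^esub> cls a \<mu> = \<one>\<^bsub>\<I>\<^esub>"
  by (simp add: I_group_mult[OF pair_inv[OF p] p] I_group_one compose_inv_auto[OF pairD(1)[OF p]] pmul_pinv[OF p])

text \<open>The axioms are checked on pairs \<open>(a, \<mu>)\<close>, where composition is explicit
  and associative, and inverses are given by \<open>inv_auto\<close> and \<open>pinv\<close>, before
  passing to classes.\<close>

lemma group_I_group: "group \<I>"
proof (rule groupI)
  show "\<one>\<^bsub>\<I>\<^esub> \<in> carrier \<I>"
    unfolding I_group_one by (rule cls_closed[OF pair_one])
next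
  fix x assume "x \<in> carrier \<I>"
  then obtain a \<mu> where p: "pair a \<mu>" and x: "x = cls a \<mu>"
    unfolding carrier_I_group by blast
  show "\<one>\<^bsub>\<I>\<^esub> \<otimes>\<^bsub>\<I>\<^esub> x = x"
    unfolding x I_group_one I_group_mult[OF pair_one p] compose_id_auto[OF pairD(1)[OF p]] pmul_one[OF p] ..
  show "\<exists>y\<in>carrier \<I>. y \<otimes>\<^bsub>\<I>\<^esub> x = \<one>\<^bsub>\<I>\<^esub>"
    unfolding x using I_group_inv[OF p] cls_closed[OF pair_inv[OF p]] by blast
  fix y assume "y \<in> carrier \<I>"
  then obtain b \<nu> where q: "pair b \<nu>" and y: "y = cls b \<nu>"
    unfolding carrier_I_group by blast
  show "x \<otimes>\<^bsub>\<I>\<^esub> y \<in> carrier \<I>"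
    unfolding x y I_group_mult[OF p q] by (rule cls_closed[OF pair_mult[OF p q]])
  fix z assume "z \<in> carrier \<I>"
  then obtain c \<xi> where r: "pair c \<xi>" and z: "z = cls c \<xi>"
    unfolding carrier_I_group by blast
  note cG = autoD(1)[OF pairD(1)[OF r]]
  have "compose \<G> (compose \<G> a b) c = compose \<G> a (compose \<G> b c)"
    using cG by (auto simp: compose_def fun_eq_iff)
  moreover have "pmul c (pmul b \<mu> \<nu>) \<xi> = pmul (compose \<G> b c) \<mu> (pmul c \<nu> \<xi>)"
    using cG by (auto simp: pmul_def fun_eq_iff compose_def)
  ultimately show "x \<otimes>\<^bsub>\<I>\<^esub> y \<otimes>\<^bsub>\<I>\<^esub> z = x \<otimes>\<^bsub>\<I>\<^esub> (y \<otimes>\<^bsub>\<I>\<^esub> z)"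
    unfolding x y z I_group_mult[OF p q] I_group_mult[OF q r] I_group_mult[OF pair_mult[OF p q] r] I_group_mult[OF p pair_mult[OF q r]]
    by simp
qed

text \<open>Combines both directions of the kernel computation; the later arguments on
  well-definedness and exactness rest on this description.\<close>

lemma cls_eq_one_iff:
  assumes p: "pair a \<mu>"
  shows "cls a \<mu> = \<one>\<^bsub>\<I>\<^esub> \<longleftrightarrow> (\<exists>s \<nu>. s \<in> \<G> \<and> a = inner s \<and> (\<forall>x\<in>\<G>. \<nu> x \<noteq> 0) \<and>
    (\<forall>x\<in>\<G>. \<forall>y\<in>\<G>. \<mu> x y = \<nu> x * \<nu> y / (\<nu> (x \<otimes> y) * kappa s x y)))" (is "_ \<longleftrightarrow> ?R")
proof -
  have id: "id_tensor_functor D \<in> braided_autoeqs D"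
    by (rule D.agree_braided_autoeqs[OF ind_id_agree ind_autoeq[OF pair_one]])
  have "\<one>\<^bsub>\<I>\<^esub> = braided_iso_rel D `` {id_tensor_functor D}"
    by (simp add: ind_image_def Aut_braided_def quotient_group_def)
  then have "cls a \<mu> = \<one>\<^bsub>\<I>\<^esub> \<longleftrightarrow> tensor_functor_iso D D (ind C (FF a \<mu>)) (id_tensor_functor D)"
    using D.braided_class_eq_iff[OF ind_autoeq[OF p] id] by (simp add: cls_def)
  also have "\<dots> \<longleftrightarrow> ?R"
  proof
    assume "tensor_functor_iso D D (ind C (FF a \<mu>)) (id_tensor_functor D)"
    then show ?R
      by (rule trivial_ind_imp_inner[OF p])
  next
    assume ?R
    then obtain s \<nu> where *: "s \<in> \<G>" "a = inner s" "\<forall>x\<in>\<G>. \<nu> x \<noteq> 0"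
      "\<forall>x\<in>\<G>. \<forall>y\<in>\<G>. \<mu> x y = \<nu> x * \<nu> y / (\<nu> (x \<otimes> y) * kappa s x y)"
      by (elim exE conjE)
    show "tensor_functor_iso D D (ind C (FF a \<mu>)) (id_tensor_functor D)"
      unfolding *(2) by (rule ind_trivial[OF *(1) _ _ p[unfolded *(2)], of \<nu>]) (use *(3,4) in simp_all)
  qed
  finally show ?thesis .
qed

end

section \<open>The center of the group and its inner automorphisms\<close>

context finite_group
begin

lemma group_center_carrier: "z \<in> carrier (group_center G) \<longleftrightarrow> z \<in> \<G> \<and> (\<forall>x\<in>\<G>. z \<otimes> x = x \<otimes> z)"
  by (simp add: group_center_def)

lemma group_group_center: "group (group_center G)"
proof -
  have "subgroup {z \<in> \<G>. \<forall>x\<in>\<G>. z \<otimes> x = x \<otimes> z} G"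
  proof (rule subgroupI)
    fix z assume z: "z \<in> {z \<in> \<G>. \<forall>x\<in>\<G>. z \<otimes> x = x \<otimes> z}"
    then have zG: "z \<in> \<G>" and zc: "\<And>x. x \<in> \<G> \<Longrightarrow> x \<otimes> z = z \<otimes> x"
      by simp_all
    have "inv z \<otimes> x = x \<otimes> inv z" if x: "x \<in> \<G>" for x
    proof -
      have "inv z \<otimes> x = inv z \<otimes> (x \<otimes> z) \<otimes> inv z"
        using zG x by (simp add: m_assoc)
      also have "x \<otimes> z = z \<otimes> x"
        by (rule zc[OF x])
      finally show ?thesis
        using zG x by simp
    qed
    then show "inv z \<in> {z \<in> \<G>. \<forall>x\<in>\<G>. z \<otimes> x = x \<otimes> z}"
      using zG by simp
    fix w assume w: "w \<in> {z \<in> \<G>. \<forall>x\<in>\<G>. z \<otimes> x = x \<otimes> z}"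
    have "z \<otimes> w \<otimes> x = x \<otimes> (z \<otimes> w)" if x: "x \<in> \<G>" for x
    proof -
      have c: "z \<otimes> x = x \<otimes> z" "w \<otimes> x = x \<otimes> w" "w \<in> \<G>"
        using z w x by blast+
      have "z \<otimes> w \<otimes> x = z \<otimes> (w \<otimes> x)"
        using zG c(3) x by (simp only: m_assoc)
      also have "\<dots> = z \<otimes> x \<otimes> w"
        using zG c(3) x by (simp only: c(2) m_assoc)
      finally show ?thesis
        using zG c(3) x by (simp only: c(1) m_assoc)
    qed
    then show "z \<otimes> w \<in> {z \<in> \<G>. \<forall>x\<in>\<G>. z \<otimes> x = x \<otimes> z}"
      using zG w by blast
  qed (auto intro: exI[of _ \<one>])
  then show ?thesis
    unfolding group_center_def by (rule subgroup_imp_group)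
qed

lemma central_cj:
  assumes "z \<in> carrier (group_center G)" "x \<in> \<G>"
  shows "cj z x = x"
proof -
  have z: "z \<in> \<G>" "z \<otimes> x = x \<otimes> z"
    using assms unfolding group_center_carrier by blast+
  show ?thesis
    unfolding cj_def z(2) using z(1) assms(2) by (simp add: m_assoc)
qed

lemma inner_eq_id_iff:
  assumes "s \<in> \<G>"
  shows "(\<lambda>x\<in>\<G>. x) = inner s \<longleftrightarrow> s \<in> carrier (group_center G)"
proof
  assume eq: "(\<lambda>x\<in>\<G>. x) = inner s"
  have "s \<otimes> x = x \<otimes> s" if x: "x \<in> \<G>" for x
    using fun_cong[OF eq, of x] cj_swap[OF assms x] x by simp
  then show "s \<in> carrier (group_center G)"
    using assms by (simp add: group_center_carrier)
next
  assume "s \<in> carrier (group_center G)"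
  then show "(\<lambda>x\<in>\<G>. x) = inner s"
    using central_cj by (auto simp: inner_def cj_def)
qed

lemma compose_inner:
  assumes "g \<in> \<G>" "h \<in> \<G>"
  shows "compose \<G> (inner g) (inner h) = inner (g \<otimes> h)"
  using assms by (auto simp: compose_def inner_def fun_eq_iff m_assoc inv_mult_group)

lemma conj_inner:
  assumes a: "a \<in> auto G" and g: "g \<in> \<G>"
  shows "compose \<G> (compose \<G> a (inner g)) (inv_auto a) = inner (a g)"
  unfolding auto_eq_iff[OF compose_auto[OF compose_auto[OF a inner_auto[OF g]] inv_auto_closed[OF a]] inner_auto[OF autoD(1)[OF a g]]]
  using g inv_into_auto[OF a] by (simp add: compose_def inv_auto_def auto_cj[OF a])

end

section \<open>Second cohomology and the map \<beta>\<close>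

context graded_setup
begin

abbreviation "Z \<equiv> Z2 G :: ('a \<Rightarrow> 'a \<Rightarrow> 'k) monoid"
abbreviation "B \<equiv> B2 G :: ('a \<Rightarrow> 'a \<Rightarrow> 'k) set"
abbreviation "ident \<equiv> (\<lambda>x\<in>\<G>. x)"

text \<open>For the identity automorphism the two values of \<omega> cancel, so cocycles are the
  pairs over it; the closure properties of pairs give the group structure on cocycles.\<close>

lemma Z2_iff_pair: "\<mu> \<in> carrier Z \<longleftrightarrow> pair ident \<mu>"
  using id_in_auto by (auto simp: Z2_def pair_def stab_cochains_def)

lemma Z2_simps [simp]: "\<mu> \<otimes>\<^bsub>Z\<^esub> \<nu> = (\<lambda>x y. \<mu> x y * \<nu> x y)" "\<one>\<^bsub>Z\<^esub> = (\<lambda>x y. 1)"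
  by (simp_all add: Z2_def)

lemma pmul_ident: "pair ident \<mu> \<Longrightarrow> pair ident \<nu> \<Longrightarrow> pmul ident \<mu> \<nu> = (\<lambda>x y. \<mu> x y * \<nu> x y)"
  by (intro ext) (auto simp: pmul_def pairD(4))

lemma Z2_mult_closed: "\<mu> \<in> carrier Z \<Longrightarrow> \<nu> \<in> carrier Z \<Longrightarrow> (\<lambda>x y. \<mu> x y * \<nu> x y) \<in> carrier Z"
  unfolding Z2_iff_pair using pair_mult[of ident \<mu> ident \<nu>] compose_id_auto(1)[OF id_in_auto] by (simp add: pmul_ident)

lemma inv_auto_ident: "inv_auto ident = ident"
  using compose_inv_auto(1)[OF id_in_auto] compose_id_auto(1)[OF inv_auto_closed[OF id_in_auto]] by simp

lemma Z2_inv_closed: "\<mu> \<in> carrier Z \<Longrightarrow> (\<lambda>x y. 1 / \<mu> x y) \<in> carrier Z"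
proof -
  assume \<mu>: "\<mu> \<in> carrier Z"
  then have p: "pair ident \<mu>" by (simp only: Z2_iff_pair)
  have "pinv ident \<mu> = (\<lambda>x y. 1 / \<mu> x y)"
    using pairD(4)[OF p] by (auto simp: pinv_def inv_auto_ident fun_eq_iff)
  then show ?thesis
    using pair_inv[OF p] by (simp add: Z2_iff_pair inv_auto_ident)
qed

lemma Z2_cancel: "\<mu> \<in> carrier Z \<Longrightarrow> 1 / \<mu> x y * \<mu> x y = 1"
  unfolding Z2_iff_pair using pairD(2,4)[of ident \<mu>] by (cases "x \<in> \<G> \<and> y \<in> \<G>") auto

lemma comm_group_Z2: "comm_group Z"
proof (rule comm_groupI)
  show "\<one>\<^bsub>Z\<^esub> \<in> carrier Z"
    using pair_one by (simp add: Z2_iff_pair)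
  show "\<exists>\<nu> \<in> carrier Z. \<nu> \<otimes>\<^bsub>Z\<^esub> \<mu> = \<one>\<^bsub>Z\<^esub>" if "\<mu> \<in> carrier Z" for \<mu>
    by (rule bexI[OF _ Z2_inv_closed[OF that]]) (simp add: Z2_cancel[OF that] del: times_divide_eq_left)
qed (auto simp: Z2_mult_closed mult_ac)

lemma Z2_inv: "\<mu> \<in> carrier Z \<Longrightarrow> inv\<^bsub>Z\<^esub> \<mu> = (\<lambda>x y. 1 / \<mu> x y)"
  by (rule group.inv_equality[OF comm_group.axioms(2)[OF comm_group_Z2] _ _ Z2_inv_closed])
    (simp_all add: Z2_cancel del: times_divide_eq_left)

lemma B2_iff: "\<mu> \<in> B \<longleftrightarrow> (\<exists>\<nu>. (\<forall>x\<in>\<G>. \<nu> x \<noteq> 0) \<and>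
    (\<forall>x\<in>\<G>. \<forall>y\<in>\<G>. \<mu> x y = \<nu> x * \<nu> y / \<nu> (x \<otimes> y))) \<and>
    (\<forall>x y. \<not> (x \<in> \<G> \<and> y \<in> \<G>) \<longrightarrow> \<mu> x y = 1)"
  unfolding B2_def cochains2_def coboundary1_def by (auto simp: mult.commute)

lemma B2_memI:
  assumes "\<And>x. x \<in> \<G> \<Longrightarrow> \<nu> x \<noteq> 0"
    and "\<And>x y. x \<in> \<G> \<Longrightarrow> y \<in> \<G> \<Longrightarrow> \<mu> x y = \<nu> x * \<nu> y / \<nu> (x \<otimes> y)"
    and "\<And>x y. \<not> (x \<in> \<G> \<and> y \<in> \<G>) \<Longrightarrow> \<mu> x y = 1"
  shows "\<mu> \<in> B"
  unfolding B2_iff using assms by (intro conjI exI[of _ \<nu>]) simp_all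

lemma B2_subset: "B \<subseteq> carrier Z"
proof
  fix \<mu> assume "\<mu> \<in> B"
  then obtain \<nu> where *: "\<forall>x\<in>\<G>. \<nu> x \<noteq> 0"
    "\<forall>x\<in>\<G>. \<forall>y\<in>\<G>. \<mu> x y = \<nu> x * \<nu> y / \<nu> (x \<otimes> y)"
    "\<forall>x y. \<not> (x \<in> \<G> \<and> y \<in> \<G>) \<longrightarrow> \<mu> x y = 1"
    unfolding B2_iff by (elim exE conjE)
  note * = *[rule_format]
  have "pair ident \<mu>"
  proof (rule pairI[OF id_in_auto _ _ *(3)])
    show "\<mu> x y \<noteq> 0" if "x \<in> \<G>" "y \<in> \<G>" for x y
      using *(1,2) that by simp
    fix x y z assume g: "x \<in> \<G>" "y \<in> \<G>" "z \<in> \<G>"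
    then show "\<omega> (ident x) (ident y) (ident z) * (\<mu> (x \<otimes> y) z * \<mu> x y) = \<omega> x y z * \<mu> y z * \<mu> x (y \<otimes> z)"
      using *(1)[of "x \<otimes> y"] *(1)[of "y \<otimes> z"] *(1)[of "x \<otimes> y \<otimes> z"] by (simp add: *(2) m_assoc)
  qed
  then show "\<mu> \<in> carrier Z" by (simp only: Z2_iff_pair)
qed

lemma normal_B2: "normal B Z"
proof (rule comm_group.subgroup_imp_normal[OF comm_group_Z2], rule group.subgroupI[OF comm_group.axioms(2)[OF comm_group_Z2] B2_subset])
  have "(\<lambda>x y. 1) \<in> B"
    by (rule B2_memI[of "\<lambda>x. 1"]) simp_all
  then show "B \<noteq> {}" by blast
  fix \<mu> assume \<mu>: "\<mu> \<in> B"
  then obtain u where u: "\<forall>x\<in>\<G>. u x \<noteq> 0"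
    "\<forall>x\<in>\<G>. \<forall>y\<in>\<G>. \<mu> x y = u x * u y / u (x \<otimes> y)"
    "\<forall>x y. \<not> (x \<in> \<G> \<and> y \<in> \<G>) \<longrightarrow> \<mu> x y = 1"
    unfolding B2_iff by (elim exE conjE)
  note u = u[rule_format]
  have "(\<lambda>x y. 1 / \<mu> x y) \<in> B"
    by (rule B2_memI[of "\<lambda>x. 1 / u x"]) (simp_all add: u)
  then show "inv\<^bsub>Z\<^esub> \<mu> \<in> B"
    using \<mu> B2_subset by (simp add: Z2_inv subset_iff)
  fix \<nu> assume "\<nu> \<in> B"
  then obtain w where w: "\<forall>x\<in>\<G>. w x \<noteq> 0"
    "\<forall>x\<in>\<G>. \<forall>y\<in>\<G>. \<nu> x y = w x * w y / w (x \<otimes> y)"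
    "\<forall>x y. \<not> (x \<in> \<G> \<and> y \<in> \<G>) \<longrightarrow> \<nu> x y = 1"
    unfolding B2_iff by (elim exE conjE)
  note w = w[rule_format]
  have "(\<lambda>x y. \<mu> x y * \<nu> x y) \<in> B"
    by (rule B2_memI[of "\<lambda>x. u x * w x"]) (auto simp: u w)
  then show "\<mu> \<otimes>\<^bsub>Z\<^esub> \<nu> \<in> B" by simp
qed

lemma group_H2: "group (H2 G :: ('a \<Rightarrow> 'a \<Rightarrow> 'k) set monoid)"
  unfolding H2_def by (rule normal.factorgroup_is_group[OF normal_B2])

lemma H2_carrier: "M \<in> carrier (H2 G) \<longleftrightarrow> (\<exists>\<mu> \<in> carrier Z. M = B #>\<^bsub>Z\<^esub> \<mu>)"
  by (simp add: H2_def FactGroup_def RCOSETS_def)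

lemma H2_mult: "\<mu> \<in> carrier Z \<Longrightarrow> \<nu> \<in> carrier Z \<Longrightarrow>
    (B #>\<^bsub>Z\<^esub> \<mu>) \<otimes>\<^bsub>H2 G\<^esub> (B #>\<^bsub>Z\<^esub> \<nu>) = B #>\<^bsub>Z\<^esub> (\<lambda>x y. \<mu> x y * \<nu> x y)"
  using normal.rcos_sum[OF normal_B2] by (simp add: H2_def FactGroup_def)

lemma H2_eqI:
  assumes "\<mu> \<in> carrier Z" "\<beta> \<in> B" "\<mu>' = (\<lambda>x y. \<beta> x y * \<mu> x y)"
  shows "B #>\<^bsub>Z\<^esub> \<mu>' = B #>\<^bsub>Z\<^esub> \<mu>"
proof -
  have "\<mu>' \<in> B #>\<^bsub>Z\<^esub> \<mu>"
    using assms unfolding r_coset_def by auto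
  from group.repr_independence[OF comm_group.axioms(2)[OF comm_group_Z2] this assms(1) normal_imp_subgroup[OF normal_B2]]
  show ?thesis by simp
qed

text \<open>Conjugation by a central element is trivial, so \<open>kappa z\<close> becomes the
  cocycle of \<open>z\<close>, and \<open>kappa_coboundary\<close> becomes the cocycle
  condition.\<close>

lemma beta_cocycle_central:
  assumes z: "z \<in> carrier (group_center G)"
  shows "x \<in> \<G> \<Longrightarrow> y \<in> \<G> \<Longrightarrow> beta_cocycle G \<omega> z x y = kappa z x y"
    and "beta_cocycle G \<omega> z \<in> carrier Z"
proof -
  show e: "beta_cocycle G \<omega> z x y = kappa z x y" if "x \<in> \<G>" "y \<in> \<G>" for x y
    using that by (simp add: beta_cocycle_def kappa_def central_cj[OF z])
  have zG: "z \<in> \<G>" using z by (simp add: group_center_carrier)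
  have "pair ident (beta_cocycle G \<omega> z)"
  proof (rule pairI[OF id_in_auto])
    show "beta_cocycle G \<omega> z x y \<noteq> 0" if "x \<in> \<G>" "y \<in> \<G>" for x y
      using that zG by (simp add: e)
    show "beta_cocycle G \<omega> z x y = 1" if "\<not> (x \<in> \<G> \<and> y \<in> \<G>)" for x y
      using that unfolding beta_cocycle_def by (rule if_not_P)
    fix x y w assume g: "x \<in> \<G>" "y \<in> \<G>" "w \<in> \<G>"
    then show "\<omega> (ident x) (ident y) (ident w) * (beta_cocycle G \<omega> z (x \<otimes> y) w * beta_cocycle G \<omega> z x y) =
        \<omega> x y w * beta_cocycle G \<omega> z y w * beta_cocycle G \<omega> z x (y \<otimes> w)"
      using kappa_coboundary[OF g zG] by (simp add: e central_cj[OF z] mult_ac)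
  qed
  then show "beta_cocycle G \<omega> z \<in> carrier Z" by (simp only: Z2_iff_pair)
qed

lemma beta_hom: "group_hom (group_center G) (H2 G) (beta G \<omega>)"
  unfolding group_hom_def group_hom_axioms_def
proof (intro conjI group_group_center group_H2 Group.homI)
  fix z assume z: "z \<in> carrier (group_center G)"
  note bz = beta_cocycle_central[OF z]
  have zG: "z \<in> \<G>" using z by (simp add: group_center_carrier)
  show "beta G \<omega> z \<in> carrier (H2 G)"
    unfolding beta_def H2_carrier using bz(2) by blast
  fix w assume w: "w \<in> carrier (group_center G)"
  note bw = beta_cocycle_central[OF w]
  have wG: "w \<in> \<G>" using w by (simp add: group_center_carrier)
  have zw: "z \<otimes> w \<in> carrier (group_center G)"
    using monoid.m_closed[OF group.is_monoid[OF group_group_center] z w] by (simp add: group_center_def)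
  note bzw = beta_cocycle_central[OF zw]
  \<comment> \<open>For central elements \<open>kappa_theta\<close> says that the cocycles multiply
    up to this factor, the coboundary of the inverse of \<open>theta\<close> as a function of its
    first argument.\<close>
  let ?\<beta> = "\<lambda>x y. if x \<in> \<G> \<and> y \<in> \<G> then theta (x \<otimes> y) z w / (theta x z w * theta y z w) else 1"
  have "B #>\<^bsub>Z\<^esub> beta_cocycle G \<omega> (z \<otimes> w) = B #>\<^bsub>Z\<^esub> (\<lambda>x y. beta_cocycle G \<omega> z x y * beta_cocycle G \<omega> w x y)"
  proof (rule H2_eqI[OF Z2_mult_closed[OF bz(2) bw(2)]])
    show "?\<beta> \<in> B"
      by (rule B2_memI[of "\<lambda>x. 1 / theta x z w"]) (use zG wG in auto)
    show "beta_cocycle G \<omega> (z \<otimes> w) = (\<lambda>x y. ?\<beta> x y * (beta_cocycle G \<omega> z x y * beta_cocycle G \<omega> w x y))"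
    proof (intro ext)
      fix x y
      show "beta_cocycle G \<omega> (z \<otimes> w) x y = ?\<beta> x y * (beta_cocycle G \<omega> z x y * beta_cocycle G \<omega> w x y)"
      proof (cases "x \<in> \<G> \<and> y \<in> \<G>")
        case True
        then have "theta x z w \<noteq> 0" "theta y z w \<noteq> 0" using zG wG by simp_all
        then show ?thesis
          using kappa_theta[of x y z w] True zG wG
          by (simp add: bz(1) bw(1) bzw(1) central_cj[OF w] field_simps)
      next
        case False
        then show ?thesis by (auto simp: beta_cocycle_def)
      qed
    qed
  qed
  then show "beta G \<omega> (z \<otimes>\<^bsub>group_center G\<^esub> w) = beta G \<omega> z \<otimes>\<^bsub>H2 G\<^esub> beta G \<omega> w"
    unfolding beta_def H2_mult[OF bz(2) bw(2)] by (simp add: group_center_def)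
qed

section \<open>The stabiliser of \<omega> and its quotient by inner automorphisms\<close>

lemma Stab_carrier: "a \<in> carrier \<S> \<longleftrightarrow> (\<exists>\<mu>. pair a \<mu>)"
  by (auto simp: Stab_def pair_def)

lemma Stab_auto: "a \<in> carrier \<S> \<Longrightarrow> a \<in> auto G"
  by (simp add: Stab_def)

lemma Stab_mult: "a \<in> carrier \<S> \<Longrightarrow> b \<in> carrier \<S> \<Longrightarrow> a \<otimes>\<^bsub>\<S>\<^esub> b = compose \<G> a b"
  by (simp add: Stab_def AutoGroup_def BijGroup_def auto_def)

lemma Stab_one: "\<one>\<^bsub>\<S>\<^esub> = ident"
  by (simp add: Stab_def AutoGroup_def BijGroup_def)

lemma Stab_closed:
  assumes "a \<in> carrier \<S>" "b \<in> carrier \<S>"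
  shows "compose \<G> a b \<in> carrier \<S>" "inv_auto a \<in> carrier \<S>" "ident \<in> carrier \<S>"
  using assms pair_mult pair_inv pair_one unfolding Stab_carrier by blast+

lemma group_Stab: "group \<S>"
proof (rule groupI)
  fix a assume a: "a \<in> carrier \<S>"
  note au = Stab_auto[OF a]
  show "\<one>\<^bsub>\<S>\<^esub> \<otimes>\<^bsub>\<S>\<^esub> a = a"
    unfolding Stab_one Stab_mult[OF Stab_closed(3)[OF a a] a] by (rule compose_id_auto[OF au])
  show "\<exists>b\<in>carrier \<S>. b \<otimes>\<^bsub>\<S>\<^esub> a = \<one>\<^bsub>\<S>\<^esub>"
    by (rule bexI[OF _ Stab_closed(2)[OF a a]]) (simp only: Stab_mult[OF Stab_closed(2)[OF a a] a] Stab_one compose_inv_auto[OF au])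
  fix b assume b: "b \<in> carrier \<S>"
  show "a \<otimes>\<^bsub>\<S>\<^esub> b \<in> carrier \<S>"
    unfolding Stab_mult[OF a b] by (rule Stab_closed(1)[OF a b])
  fix c assume c: "c \<in> carrier \<S>"
  show "a \<otimes>\<^bsub>\<S>\<^esub> b \<otimes>\<^bsub>\<S>\<^esub> c = a \<otimes>\<^bsub>\<S>\<^esub> (b \<otimes>\<^bsub>\<S>\<^esub> c)"
    unfolding Stab_mult[OF a b] Stab_mult[OF b c] Stab_mult[OF Stab_closed(1)[OF a b] c] Stab_mult[OF a Stab_closed(1)[OF b c]]
    using autoD(1)[OF Stab_auto[OF c]] by (auto simp: compose_def fun_eq_iff)
next
  show "\<one>\<^bsub>\<S>\<^esub> \<in> carrier \<S>"
    unfolding Stab_one Stab_carrier using pair_one by blast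
qed

lemma Stab_inv: "a \<in> carrier \<S> \<Longrightarrow> inv\<^bsub>\<S>\<^esub> a = inv_auto a"
  by (rule group.inv_equality[OF group_Stab])
    (simp_all add: Stab_mult Stab_closed Stab_one compose_inv_auto Stab_auto)

lemma Inn_eq: "Inn G = inner ` \<G>"
  by (auto simp: Inn_def inner_def)

text \<open>The case \<open>\<nu> = 1\<close> of the cochains that make conjugation by
  \<open>g\<close> induce the trivial class.\<close>

definition inner_cochain :: "'a \<Rightarrow> 'a \<Rightarrow> 'a \<Rightarrow> 'k" where
  "inner_cochain g x y = (if x \<in> \<G> \<and> y \<in> \<G> then 1 / kappa g x y else 1)"

lemma pair_inner_cochain:
  assumes g: "g \<in> \<G>"
  shows "pair (inner g) (inner_cochain g)" "cls (inner g) (inner_cochain g) = \<one>\<^bsub>\<I>\<^esub>"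
proof -
  show p: "pair (inner g) (inner_cochain g)"
    by (rule pair_inner_iff[OF g, of "\<lambda>x. 1"]) (use g in \<open>auto simp: inner_cochain_def\<close>)
  show "cls (inner g) (inner_cochain g) = \<one>\<^bsub>\<I>\<^esub>"
    unfolding cls_eq_one_iff[OF p]
    by (intro exI[of _ g] exI[of _ "\<lambda>x. 1"] conjI ballI) (simp_all add: g inner_cochain_def)
qed

lemma inner_Stab: "g \<in> \<G> \<Longrightarrow> inner g \<in> carrier \<S>"
  unfolding Stab_carrier using pair_inner_cochain(1) by blast

lemma inner_one: "inner \<one> = ident"
  by (auto simp: inner_def)

lemma inv_auto_inner:
  assumes g: "g \<in> \<G>"
  shows "inv_auto (inner g) = inner (inv g)"
proof -
  have i: "inv g \<in> \<G>" using g by simp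
  have "inv\<^bsub>\<S>\<^esub> inner g = inner (inv g)"
    by (rule group.inv_equality[OF group_Stab])
      (simp_all add: Stab_mult inner_Stab g compose_inner Stab_one inner_one)
  then show ?thesis
    by (simp only: Stab_inv[OF inner_Stab[OF g]])
qed

lemma normal_Inn: "normal (Inn G) \<S>"
  unfolding group.normal_inv_iff[OF group_Stab]
proof (intro conjI ballI group.subgroupI[OF group_Stab])
  show "Inn G \<subseteq> carrier \<S>" "Inn G \<noteq> {}"
    using inner_Stab by (auto simp: Inn_eq)
  fix a assume "a \<in> Inn G"
  then obtain g where g: "g \<in> \<G>" "a = inner g" by (auto simp: Inn_eq)
  show "inv\<^bsub>\<S>\<^esub> a \<in> Inn G"
    unfolding g(2) Stab_inv[OF inner_Stab[OF g(1)]] inv_auto_inner[OF g(1)] Inn_eq by (rule imageI[OF inv_closed[OF g(1)]])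
  fix b assume "b \<in> Inn G"
  then obtain h where h: "h \<in> \<G>" "b = inner h" by (auto simp: Inn_eq)
  show "a \<otimes>\<^bsub>\<S>\<^esub> b \<in> Inn G"
    unfolding g(2) h(2) Stab_mult[OF inner_Stab[OF g(1)] inner_Stab[OF h(1)]] compose_inner[OF g(1) h(1)] Inn_eq
    by (rule imageI[OF m_closed[OF g(1) h(1)]])
next
  fix a b assume a: "a \<in> carrier \<S>" and "b \<in> Inn G"
  then obtain g where g: "g \<in> \<G>" "b = inner g" by (auto simp: Inn_eq)
  note b = inner_Stab[OF g(1)]
  show "a \<otimes>\<^bsub>\<S>\<^esub> b \<otimes>\<^bsub>\<S>\<^esub> inv\<^bsub>\<S>\<^esub> a \<in> Inn G"
    unfolding g(2) Stab_inv[OF a] Stab_mult[OF a b] Stab_mult[OF Stab_closed(1)[OF a b] Stab_closed(2)[OF a a]]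
      conj_inner[OF Stab_auto[OF a] g(1)] Inn_eq
    by (rule imageI[OF autoD(1)[OF Stab_auto[OF a] g(1)]])
qed

abbreviation outer where "outer a \<equiv> Inn G #>\<^bsub>\<S>\<^esub> a"

lemma group_OutStab: "group \<O>"
  unfolding OutStab_def by (rule normal.factorgroup_is_group[OF normal_Inn])

lemma OutStab_carrier: "A \<in> carrier \<O> \<longleftrightarrow> (\<exists>a\<in>carrier \<S>. A = outer a)"
  by (simp add: OutStab_def FactGroup_def RCOSETS_def)

lemma OutStab_mult: "a \<in> carrier \<S> \<Longrightarrow> b \<in> carrier \<S> \<Longrightarrow>
    outer a \<otimes>\<^bsub>\<O>\<^esub> outer b = outer (compose \<G> a b)"
  using normal.rcos_sum[OF normal_Inn] by (simp add: OutStab_def FactGroup_def Stab_mult)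

lemma OutStab_one: "\<one>\<^bsub>\<O>\<^esub> = Inn G"
  by (simp add: OutStab_def FactGroup_def)

lemma outer_eq_Inn_iff:
  assumes a: "a \<in> carrier \<S>"
  shows "outer a = Inn G \<longleftrightarrow> a \<in> Inn G"
  using group.rcos_self[OF group_Stab a normal_imp_subgroup[OF normal_Inn]]
    group.coset_join2[OF group_Stab a normal_imp_subgroup[OF normal_Inn]] by auto

lemma outer_eqI:
  assumes a: "a \<in> carrier \<S>" and g: "g \<in> \<G>"
  shows "outer (compose \<G> (inner g) a) = outer a"
proof -
  have "compose \<G> (inner g) a \<in> outer a"
    unfolding r_coset_def Stab_mult[OF inner_Stab[OF g] a, symmetric] Inn_eq using g by blast
  from group.repr_independence[OF group_Stab this a normal_imp_subgroup[OF normal_Inn]] show ?thesis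
    by simp
qed

text \<open>Two pairs with the same class differ by a pair of trivial class, whose automorphism is
  inner; hence the union in the definition runs over a single coset.\<close>

lemma I_to_OutStab_cls:
  assumes p: "pair a \<mu>"
  shows "I_to_OutStab G \<omega> (cls a \<mu>) = outer a"
proof -
  have a: "a \<in> carrier \<S>" using p Stab_carrier by blast
  have eq: "outer b = outer a" if q: "pair b \<nu>" and e: "cls b \<nu> = cls a \<mu>" for b \<nu>
  proof -
    note r = pair_inv[OF p] and au = pairD(1)[OF p] and bu = pairD(1)[OF q]
    have "cls (compose \<G> b (inv_auto a)) (pmul (inv_auto a) \<nu> (pinv a \<mu>)) = cls a \<mu> \<otimes>\<^bsub>\<I>\<^esub> cls (inv_auto a) (pinv a \<mu>)"
      by (simp only: I_group_mult[OF q r, symmetric] e)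
    also have "\<dots> = \<one>\<^bsub>\<I>\<^esub>"
      by (simp only: I_group_mult[OF p r] compose_inv_auto(1)[OF au] pmul_pinv(1)[OF p] I_group_one)
    finally obtain s where s: "s \<in> \<G>" "compose \<G> b (inv_auto a) = inner s"
      unfolding cls_eq_one_iff[OF pair_mult[OF q r]] by (elim exE conjE)
    have "b x = compose \<G> (inner s) a x" if x: "x \<in> \<G>" for x
      using fun_cong[OF s(2), of "a x"] x autoD(1)[OF au x] inv_into_auto[OF au]
      by (simp add: compose_def inv_auto_def)
    then have "b = compose \<G> (inner s) a"
      unfolding auto_eq_iff[OF bu compose_auto[OF inner_auto[OF s(1)] au]] by blast
    then show ?thesis
      by (simp only: outer_eqI[OF a s(1)])
  qed
  have "{outer b | b \<nu>. b \<in> carrier \<S> \<and> \<nu> \<in> stab_cochains G \<omega> b \<and> ind_class C (F_class G \<omega> b \<nu>) = cls a \<mu>} = {outer a}" (is "?S = _")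
  proof (intro equalityI subsetI)
    fix A assume "A \<in> ?S"
    then obtain b \<nu> where b: "A = outer b" "b \<in> carrier \<S>" "\<nu> \<in> stab_cochains G \<omega> b"
      "ind_class C (F_class G \<omega> b \<nu>) = cls a \<mu>"
      by (elim CollectE exE conjE) simp
    have q: "pair b \<nu>"
      unfolding pair_def using Stab_auto[OF b(2)] b(3) by simp
    show "A \<in> {outer a}"
      using eq[OF q b(4)[unfolded ind_class_F_class[OF q]]] b(1) by simp
  next
    fix A assume "A \<in> {outer a}"
    then have "A = outer a" by simp
    then show "A \<in> ?S"
      using a p[unfolded pair_def] ind_class_F_class[OF p] by (intro CollectI exI[of _ a] exI[of _ \<mu>]) simp
  qed
  then show ?thesis
    unfolding I_to_OutStab_def by simp
qed

lemma I_to_OutStab_hom: "group_hom \<I> \<O> (I_to_OutStab G \<omega>)"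
  unfolding group_hom_def group_hom_axioms_def
proof (intro conjI group_I_group group_OutStab Group.homI)
  fix x assume "x \<in> carrier \<I>"
  then obtain a \<mu> where p: "pair a \<mu>" and x: "x = cls a \<mu>"
    unfolding carrier_I_group by (elim CollectE exE conjE)
  have a: "a \<in> carrier \<S>" using p Stab_carrier by blast
  show "I_to_OutStab G \<omega> x \<in> carrier \<O>"
    unfolding x I_to_OutStab_cls[OF p] OutStab_carrier using a by blast
  fix y assume "y \<in> carrier \<I>"
  then obtain b \<nu> where q: "pair b \<nu>" and y: "y = cls b \<nu>"
    unfolding carrier_I_group by (elim CollectE exE conjE)
  have b: "b \<in> carrier \<S>" using q Stab_carrier by blast
  show "I_to_OutStab G \<omega> (x \<otimes>\<^bsub>\<I>\<^esub> y) = I_to_OutStab G \<omega> x \<otimes>\<^bsub>\<O>\<^esub> I_to_OutStab G \<omega> y"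
    unfolding x y I_group_mult[OF p q] I_to_OutStab_cls[OF p] I_to_OutStab_cls[OF q] I_to_OutStab_cls[OF pair_mult[OF p q]]
      OutStab_mult[OF a b] ..
qed

lemma I_to_OutStab_surj: "I_to_OutStab G \<omega> ` carrier \<I> = carrier \<O>"
proof (intro equalityI subsetI)
  fix A assume "A \<in> I_to_OutStab G \<omega> ` carrier \<I>"
  then obtain \<xi> where "\<xi> \<in> carrier \<I>" "A = I_to_OutStab G \<omega> \<xi>"
    by (elim imageE)
  then show "A \<in> carrier \<O>"
    using group_hom.hom_closed[OF I_to_OutStab_hom] by simp
next
  fix A assume "A \<in> carrier \<O>"
  then obtain a where a: "a \<in> carrier \<S>" "A = outer a"
    unfolding OutStab_carrier by (elim bexE)
  obtain \<mu> where p: "pair a \<mu>"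
    using a(1) unfolding Stab_carrier by (elim exE)
  show "A \<in> I_to_OutStab G \<omega> ` carrier \<I>"
    unfolding a(2) I_to_OutStab_cls[OF p, symmetric] by (rule imageI[OF cls_closed[OF p]])
qed

section \<open>The map from second cohomology, and exactness\<close>

lemma cls_ident_mult:
  assumes m: "\<mu> \<in> carrier Z" and n: "\<nu> \<in> carrier Z"
  shows "cls ident (\<lambda>x y. \<mu> x y * \<nu> x y) = cls ident \<mu> \<otimes>\<^bsub>\<I>\<^esub> cls ident \<nu>"
proof -
  note p = m[unfolded Z2_iff_pair] and q = n[unfolded Z2_iff_pair]
  show ?thesis
    by (simp only: I_group_mult[OF p q] pmul_ident[OF p q] compose_id_auto[OF id_in_auto])
qed

text \<open>The element \<open>s\<close> is the unit here. Its factor \<open>kappa \<one>\<close>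
  has to be compensated in the cochain, hence the division by \<open>unit_scalar\<close>.\<close>

lemma cls_B2:
  assumes b: "\<mu> \<in> B"
  shows "cls ident \<mu> = \<one>\<^bsub>\<I>\<^esub>"
proof -
  have p: "pair ident \<mu>" using b B2_subset Z2_iff_pair by blast
  obtain \<nu> where \<nu>: "\<forall>x\<in>\<G>. \<nu> x \<noteq> 0" "\<forall>x\<in>\<G>. \<forall>y\<in>\<G>. \<mu> x y = \<nu> x * \<nu> y / \<nu> (x \<otimes> y)"
    using b unfolding B2_iff by (elim exE conjE)
  let ?u = unit_scalar
  note u = unit_scalar_nonzero
  have "\<mu> x y = (\<nu> x / ?u x) * (\<nu> y / ?u y) / (\<nu> (x \<otimes> y) / ?u (x \<otimes> y) * kappa \<one> x y)"
    if x: "x \<in> \<G>" and y: "y \<in> \<G>" for x y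
  proof -
    note k1 = kappa_one[OF x y]
    show ?thesis
      using \<nu> u[OF x] u[OF y] u[OF m_closed[OF x y]] x y unfolding k1 by simp
  qed
  then show ?thesis
    unfolding cls_eq_one_iff[OF p]
    by (intro exI[of _ \<one>] exI[of _ "\<lambda>x. \<nu> x / ?u x"] conjI ballI) (simp_all add: inner_one \<nu>(1) u)
qed

text \<open>Cocycles in one coset differ by a coboundary, whose class is trivial, so all of them
  contribute the same class to the union.\<close>

lemma H2_to_I_coset:
  assumes m: "\<mu> \<in> carrier Z"
  shows "H2_to_I G \<omega> (B #>\<^bsub>Z\<^esub> \<mu>) = cls ident \<mu>"
proof -
  note grp = comm_group.axioms(2)[OF comm_group_Z2]
  have "ind_class C (F_class G \<omega> ident \<mu>') = cls ident \<mu>" if c: "\<mu>' \<in> B #>\<^bsub>Z\<^esub> \<mu>" for \<mu>'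
  proof -
    obtain b where b: "b \<in> B" "\<mu>' = (\<lambda>x y. b x y * \<mu> x y)"
      using c unfolding r_coset_def Z2_simps by blast
    have bZ: "b \<in> carrier Z" using b(1) B2_subset by blast
    have p': "pair ident \<mu>'"
      using Z2_mult_closed[OF bZ m] unfolding b(2) Z2_iff_pair .
    have "cls ident \<mu>' = \<one>\<^bsub>\<I>\<^esub> \<otimes>\<^bsub>\<I>\<^esub> cls ident \<mu>"
      unfolding b(2) cls_ident_mult[OF bZ m] cls_B2[OF b(1)] ..
    then show ?thesis
      using monoid.l_one[OF group.is_monoid[OF group_I_group] cls_closed[OF m[unfolded Z2_iff_pair]]]
      by (simp only: ind_class_F_class[OF p'])
  qed
  moreover have "B #>\<^bsub>Z\<^esub> \<mu> \<noteq> {}"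
    using group.rcos_self[OF grp m normal_imp_subgroup[OF normal_B2]] by blast
  ultimately show ?thesis
    unfolding H2_to_I_def by simp
qed

lemma H2_to_I_hom: "group_hom (H2 G) \<I> (H2_to_I G \<omega>)"
  unfolding group_hom_def group_hom_axioms_def
proof (intro conjI group_I_group group_H2 Group.homI)
  fix M :: "('a \<Rightarrow> 'a \<Rightarrow> 'k) set" assume "M \<in> carrier (H2 G)"
  then obtain \<mu> where m: "\<mu> \<in> carrier Z" "M = B #>\<^bsub>Z\<^esub> \<mu>"
    unfolding H2_carrier by (elim bexE)
  show "H2_to_I G \<omega> M \<in> carrier \<I>"
    unfolding m(2) H2_to_I_coset[OF m(1)] by (rule cls_closed[OF m(1)[unfolded Z2_iff_pair]])
  fix N :: "('a \<Rightarrow> 'a \<Rightarrow> 'k) set" assume "N \<in> carrier (H2 G)"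
  then obtain \<nu> where n: "\<nu> \<in> carrier Z" "N = B #>\<^bsub>Z\<^esub> \<nu>"
    unfolding H2_carrier by (elim bexE)
  show "H2_to_I G \<omega> (M \<otimes>\<^bsub>H2 G\<^esub> N) = H2_to_I G \<omega> M \<otimes>\<^bsub>\<I>\<^esub> H2_to_I G \<omega> N"
    unfolding m(2) n(2) H2_mult[OF m(1) n(1)] H2_to_I_coset[OF m(1)] H2_to_I_coset[OF n(1)]
      H2_to_I_coset[OF Z2_mult_closed[OF m(1) n(1)]] by (rule cls_ident_mult[OF m(1) n(1)])
qed

text \<open>Over the identity automorphism a trivial class forces \<open>s\<close> to be central,
  and for central \<open>s\<close> the scalar \<open>kappa s\<close> is the cocycle of
  \<open>s\<close>.\<close>

lemma exact_at_H2: "beta G \<omega> ` carrier (group_center G) = kernel (H2 G) \<I> (H2_to_I G \<omega>)"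
proof (intro equalityI subsetI)
  fix M assume "M \<in> beta G \<omega> ` carrier (group_center G)"
  then obtain z where z: "z \<in> carrier (group_center G)" and M: "M = beta G \<omega> z"
    by (elim imageE)
  have zG: "z \<in> \<G>" using z by (simp add: group_center_carrier)
  note bz = beta_cocycle_central[OF z]
  have i: "inner z = ident" using inner_eq_id_iff[OF zG] z by simp
  note p = pair_inner_cochain[OF zG, unfolded i]
  have c: "inner_cochain z \<in> carrier Z"
    using p(1) by (simp only: Z2_iff_pair)
  \<comment> \<open>The inverse of the cocycle of \<open>z\<close> is the cochain already known to
    have trivial class.\<close>
  have "beta_cocycle G \<omega> z x y * inner_cochain z x y = 1" for x y
    using zG by (cases "x \<in> \<G> \<and> y \<in> \<G>") (auto simp: bz(1) inner_cochain_def, auto simp: beta_cocycle_def)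
  then have "cls ident (\<lambda>x y. 1) = cls ident (beta_cocycle G \<omega> z) \<otimes>\<^bsub>\<I>\<^esub> cls ident (inner_cochain z)"
    by (simp only: cls_ident_mult[OF bz(2) c, symmetric])
  also have "\<dots> = cls ident (beta_cocycle G \<omega> z)"
    unfolding p(2) by (rule monoid.r_one[OF group.is_monoid[OF group_I_group] cls_closed[OF bz(2)[unfolded Z2_iff_pair]]])
  finally have "H2_to_I G \<omega> M = \<one>\<^bsub>\<I>\<^esub>"
    unfolding M beta_def H2_to_I_coset[OF bz(2)] I_group_one by (rule sym)
  then show "M \<in> kernel (H2 G) \<I> (H2_to_I G \<omega>)"
    unfolding kernel_def using group_hom.hom_closed[OF beta_hom z] M by simp
next
  fix M assume "M \<in> kernel (H2 G) \<I> (H2_to_I G \<omega>)"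
  then have M: "M \<in> carrier (H2 G)" "H2_to_I G \<omega> M = \<one>\<^bsub>\<I>\<^esub>"
    unfolding kernel_def by simp_all
  obtain \<mu> where m: "\<mu> \<in> carrier Z" "M = B #>\<^bsub>Z\<^esub> \<mu>"
    using M(1) unfolding H2_carrier by (elim bexE)
  have "cls ident \<mu> = \<one>\<^bsub>\<I>\<^esub>"
    using M(2) unfolding m(2) H2_to_I_coset[OF m(1)] .
  then obtain s \<nu> where s: "s \<in> \<G>" "ident = inner s" and \<nu>: "\<forall>x\<in>\<G>. \<nu> x \<noteq> 0"
    "\<forall>x\<in>\<G>. \<forall>y\<in>\<G>. \<mu> x y = \<nu> x * \<nu> y / (\<nu> (x \<otimes> y) * kappa s x y)"
    unfolding cls_eq_one_iff[OF m(1)[unfolded Z2_iff_pair]] by (elim exE conjE)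
  have z: "s \<in> carrier (group_center G)"
    using inner_eq_id_iff[OF s(1)] s(2) by simp
  note bz = beta_cocycle_central[OF z]
  \<comment> \<open>As \<open>kappa\<close> occurs in the denominator of \<mu>, the class of \<mu>
    is inverse to that of \<open>s\<close>; the preimage is therefore the inverse of
    \<open>s\<close>.\<close>
  have "(\<lambda>x y. \<mu> x y * beta_cocycle G \<omega> s x y) \<in> B"
  proof (rule B2_memI[of \<nu>])
    show "\<mu> x y * beta_cocycle G \<omega> s x y = 1" if "\<not> (x \<in> \<G> \<and> y \<in> \<G>)" for x y
      using pairD(4)[OF m(1)[unfolded Z2_iff_pair] that] pairD(4)[OF bz(2)[unfolded Z2_iff_pair] that] by simp
  qed (simp_all add: \<nu> bz(1) s(1))
  from H2_eqI[OF monoid.one_closed[OF group.is_monoid[OF comm_group.axioms(2)[OF comm_group_Z2]]] this, of "\<lambda>x y. \<mu> x y * beta_cocycle G \<omega> s x y"]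
  have "M \<otimes>\<^bsub>H2 G\<^esub> beta G \<omega> s = B #>\<^bsub>Z\<^esub> \<one>\<^bsub>Z\<^esub>"
    unfolding m(2) beta_def H2_mult[OF m(1) bz(2)] by simp
  also have "\<dots> = \<one>\<^bsub>H2 G\<^esub>"
    unfolding H2_def using group.coset_join2[OF comm_group.axioms(2)[OF comm_group_Z2] monoid.one_closed[OF group.is_monoid[OF comm_group.axioms(2)[OF comm_group_Z2]]] normal_imp_subgroup[OF normal_B2]
        subgroup.one_closed[OF normal_imp_subgroup[OF normal_B2]]] by (simp add: FactGroup_def)
  finally have "inv\<^bsub>H2 G\<^esub> (beta G \<omega> s) = M"
    by (rule group.inv_equality[OF group_H2 _ group_hom.hom_closed[OF beta_hom z] M(1)])
  then have "M = beta G \<omega> (inv\<^bsub>group_center G\<^esub> s)"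
    by (simp only: group_hom.hom_inv[OF beta_hom z])
  then show "M \<in> beta G \<omega> ` carrier (group_center G)"
    by (rule image_eqI[OF _ group.inv_closed[OF group_group_center z]])
qed

lemma exact_at_I: "H2_to_I G \<omega> ` carrier (H2 G) = kernel \<I> \<O> (I_to_OutStab G \<omega>)"
proof (intro equalityI subsetI)
  fix \<xi> assume "\<xi> \<in> H2_to_I G \<omega> ` carrier (H2 G)"
  then obtain M where M: "M \<in> carrier (H2 G)" "\<xi> = H2_to_I G \<omega> M"
    by (elim imageE)
  obtain \<mu> where m: "\<mu> \<in> carrier Z" "M = B #>\<^bsub>Z\<^esub> \<mu>"
    using M(1) unfolding H2_carrier by (elim bexE)
  note p = m(1)[unfolded Z2_iff_pair]
  have i: "ident \<in> carrier \<S>" "ident \<in> Inn G"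
    using p Stab_carrier imageI[OF one_closed, of inner] unfolding Inn_eq inner_one by blast+
  have "I_to_OutStab G \<omega> (cls ident \<mu>) = \<one>\<^bsub>\<O>\<^esub>"
    unfolding I_to_OutStab_cls[OF p] OutStab_one outer_eq_Inn_iff[OF i(1)] by (rule i(2))
  then show "\<xi> \<in> kernel \<I> \<O> (I_to_OutStab G \<omega>)"
    unfolding kernel_def M(2) m(2) H2_to_I_coset[OF m(1)] using cls_closed[OF p] by simp
next
  fix \<xi> assume "\<xi> \<in> kernel \<I> \<O> (I_to_OutStab G \<omega>)"
  then have \<xi>: "\<xi> \<in> carrier \<I>" "I_to_OutStab G \<omega> \<xi> = \<one>\<^bsub>\<O>\<^esub>"
    unfolding kernel_def by simp_all
  obtain a \<mu> where p: "pair a \<mu>" and x: "\<xi> = cls a \<mu>"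
    using \<xi>(1) unfolding carrier_I_group by (elim CollectE exE conjE)
  have a: "a \<in> carrier \<S>" using p Stab_carrier by blast
  have "a \<in> Inn G"
    using \<xi>(2) unfolding x I_to_OutStab_cls[OF p] OutStab_one outer_eq_Inn_iff[OF a] .
  then obtain g where g: "g \<in> \<G>" "a = inner g"
    unfolding Inn_eq by (elim imageE)
  \<comment> \<open>Multiplication by the trivial class of conjugation by \<open>inv g\<close> moves
    the pair over the identity automorphism without changing its class.\<close>
  note q = pair_inner_cochain[OF inv_closed[OF g(1)]]
  define \<mu>' where "\<mu>' = pmul a (inner_cochain (inv g)) \<mu>"
  have e: "compose \<G> (inner (inv g)) a = ident"
    unfolding g(2) compose_inner[OF inv_closed[OF g(1)] g(1)] l_inv[OF g(1)] by (rule inner_one)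
  have m: "\<mu>' \<in> carrier Z"
    using pair_mult[OF q(1) p] unfolding e Z2_iff_pair \<mu>'_def .
  have "cls a \<mu> = cls (inner (inv g)) (inner_cochain (inv g)) \<otimes>\<^bsub>\<I>\<^esub> cls a \<mu>"
    unfolding q(2) by (rule sym, rule monoid.l_one[OF group.is_monoid[OF group_I_group] cls_closed[OF p]])
  also have "\<dots> = H2_to_I G \<omega> (B #>\<^bsub>Z\<^esub> \<mu>')"
    unfolding I_group_mult[OF q(1) p] e H2_to_I_coset[OF m] by (simp only: \<mu>'_def)
  finally show "\<xi> \<in> H2_to_I G \<omega> ` carrier (H2 G)"
    unfolding x by (rule image_eqI) (use m in \<open>auto simp: H2_carrier\<close>)
qed

end

theorem proposition4p5:
  fixes G :: "('g, 'b) monoid_scheme"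
    and \<omega> :: "'g \<Rightarrow> 'g \<Rightarrow> 'g \<Rightarrow> 'k :: {alg_closed_field, field_char_0}"
  assumes "group G" and "finite (carrier G)"
    and "is_cocycle3 G \<omega>"
  shows "group_hom (group_center G) (H2 G) (beta G \<omega>)
    \<and> group_hom (H2 G) (I_group G \<omega>) (H2_to_I G \<omega>)
    \<and> group_hom (I_group G \<omega>) (OutStab G \<omega>) (I_to_OutStab G \<omega>)
    \<and> beta G \<omega> ` carrier (group_center G) = kernel (H2 G) (I_group G \<omega>) (H2_to_I G \<omega>)
    \<and> H2_to_I G \<omega> ` carrier (H2 G) = kernel (I_group G \<omega>) (OutStab G \<omega>) (I_to_OutStab G \<omega>)
    \<and> I_to_OutStab G \<omega> ` carrier (I_group G \<omega>) = carrier (OutStab G \<omega>)"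
proof -
  interpret graded_setup G \<omega>
    using assms by (simp add: graded_setup_def finite_group_def graded_setup_axioms_def finite_group_axioms_def)
  show ?thesis
    using beta_hom H2_to_I_hom I_to_OutStab_hom exact_at_H2 exact_at_I I_to_OutStab_surj by (intro conjI)
qed

end
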